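(* Let $\Bbbk$ be a field of characteristic $0$, let $Q$ be any finite quiver, let $I\subset\Bbbk Q$ be any two-sided ideal, let $A=\Bbbk Q/I$, and let $R$ be any reduction system satisfying $(\diamond)$ for $I$. Then there is an equivalence of formal deformation problems (i.e. an isomorphism of the corresponding deformation functors, sending a complete local Noetherian $\Bbbk$-algebra $(B,\mathfrak m)$ to the set of equivalence classes of formal deformations over $(B,\mathfrak m)$) between (i) deformations of the associative algebra $A$; (ii) deformations of the reduction system $R$; (iii) deformations of the relations (ideal) $I$.
   Context: Paths and algebras: $Q_n$ is the set of paths of length $n$ in $Q$, $Q_\bullet=\bigcup_{n\ge 0}Q_n$, $e_i$ is the length-$0$ path at the vertex $i\in Q_0$; in $\Bbbk Q$ the product $pq$ is the concatenation if the target of $p$ is the source of $q$, and $0$ otherwise. $\otimes=\otimes_{\Bbbk Q_0}$ and $\mathrm{Hom}=\mathrm{Hom}_{\Bbbk Q_0^{e}}$ ($\Bbbk Q_0$-bimodule maps) unless indicated otherwise. $\pi:\Bbbk Q\to A$ is the projection. Reduction systems: a reduction system is a set $R=\{(s,\varphi_s)\mid s\in S\}$ with $S\subset Q_{\ge 2}$ such that $s$ is not a subpath of $s'$ for $s\neq s'\in S$, and each $\varphi_s\in\Bbbk Q$ is a linear combination of irreducible paths parallel to $s$ (same source and target). A path is irreducible if no subpath of it lies in $S$; $\mathrm{Irr}_S$ is the set of irreducible paths. A basic reduction is a linear map $\Bbbk Q\to\Bbbk Q$ sending one path $qsr$ ($s\in S$) to $q\varphi_s r$ and fixing all other paths; a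 reduction is a finite composition of basic reductions. A path $p$ is reduction-finite if for every infinite sequence of reductions $(\mathfrak r_i)$ the sequence $\mathfrak r_n\cdots\mathfrak r_1(p)$ is eventually constant; it is reduction-unique if moreover $\mathfrak r(p)=\mathfrak r'(p)$ for all reductions $\mathfrak r,\mathfrak r'$ with $\mathfrak r(p),\mathfrak r'(p)$ both irreducible. $R$ satisfies $(\diamond)$ for $I$ if $I=\langle s-\varphi_s\rangle_{s\in S}$ and every path is reduction-unique. Then (Diamond Lemma) $\pi$ restricts to an isomorphism $\Bbbk\mathrm{Irr}_S\to A$ with inverse $\sigma$; identify $\mathrm{Hom}(\Bbbk S,A)=\mathrm{Hom}(\Bbbk S,\Bbbk\mathrm{Irr}_S)$, so $R$ is given by $\varphi\in \mathrm{Hom}(\Bbbk S,A)$ with $\varphi_s=\sigma\varphi(s)$; similarly $\widetilde\varphi_s=\sigma\widetilde\varphi(s)$. Formal deformations over a complete local Noetherian commutative $\Bbbk$-algebra $(B,\mathfrak m)$ with residue field $\Bbbk$ ($\widehat\otimes$ is the $\mathfrak m$-adically completed tensor product): (i) A formal deformation of $A$ is a $B$-bilinear associative product $\star$ on $A\widehat\otimes B$ reducing modulo $\mathfrak m$ to the product of $A$. Two such, $\star,\star'$, are (gauge) equivalent if there is a $B$-module automorphism $T$ of $A\widehat\otimes B$ with $T\otimes_B\Bbbk=\mathrm{id}_A$ and $T(a\star b)=T(a)\star'T(b)$. (ii) A formal deformation of $R$ is $\widehat R_{\varphi+\widetilde\varphi}=\{(s,\varphi_s+\widetilde\varphi_s)\}_{s\in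 S}$ with $\widetilde\varphi\in\mathrm{Hom}(\Bbbk S,A)\widehat\otimes\mathfrak m$ such that for every $n\ge1$ every path in $Q$ is reduction-unique with respect to $\{(s,\varphi_s+\widetilde\varphi^{(n)}_s)\}$ over $\Bbbk Q\otimes_{\Bbbk} B/\mathfrak m^{n+1}$, where $\widetilde\varphi^{(n)}$ is the image of $\widetilde\varphi$ modulo $\mathfrak m^{n+1}$. Let $\mathrm{red}^{(\infty)}_{\varphi+\widetilde\varphi}$ be the $B$-linear map to $\Bbbk\mathrm{Irr}_S\widehat\otimes B$ obtained by iterating rightmost reductions until everything is irreducible (modulo each power of $\mathfrak m$), a rightmost reduction replacing a reducible path $p=qsr$, $s$ the rightmost subpath of $p$ lying in $S$, by $q(\varphi_s+\widetilde\varphi_s)r$. $\widehat R_{\varphi+\widetilde\varphi}$ and $\widehat R_{\varphi+\widetilde\varphi'}$ are equivalent if there is a $B$-linear $\Bbbk Q_0$-bimodule automorphism $T$ of $\Bbbk\mathrm{Irr}_S\widehat\otimes B$ with $T\otimes_B\Bbbk=\mathrm{id}$, $T(e_i)=e_i$ for all $i\in Q_0$, and $T(\mathrm{red}^{(\infty)}_{\varphi+\widetilde\varphi'}(p))=\mathrm{red}^{(\infty)}_{\varphi+\widetilde\varphi}(T(p_1)\cdots T(p_m))$ for every path $p=p_1\cdots p_m$ with $p_i\in Q_1$. (iii) A formal deformation of $I$ is a two-sided ideal $\widehat I$ of $\Bbbk Q\widehat\otimes B$ which is complete as a $\Bbbk Q\widehat\otimes B$-bimodule, satisfies $\widehat I\otimes_B\Bbbk=I$,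 and for which there is a $B$-module isomorphism $\Phi:A\widehat\otimes B\to(\Bbbk Q\widehat\otimes B)/\widehat I$ with $\Phi\otimes_B\Bbbk=\mathrm{id}_A$. Two such $\widehat I,\widehat I'$ (with isomorphisms $\Phi,\Phi'$) are equivalent if there is a $B$-module automorphism $T$ of $A\widehat\otimes B$ with $T\otimes_B\Bbbk=\mathrm{id}_A$ such that $\Phi'T\Phi^{-1}$ is an isomorphism of $B$-algebras. *)

theory Defs
  imports
    "Graph_Theory.Digraph"
    "Graph_Theory.Arc_Walk"
    "HOL-Algebra.QuotRing"
    "HOL-Algebra.Ideal_Product"
    "HOL-Algebra.Ring_Divisibility"
    "HOL-Algebra.Module"
begin

section \<open>Paths\<close>

text \<open>A finite quiver is a \<^locale>\<open>fin_digraph\<close>: loops and parallel arcs are allowed there.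
  A path is a pair of its source and its list of arrows, so that \<open>(i, [])\<close> is \<open>e_i\<close>.\<close>

type_synonym ('v, 'a) path = "'v \<times> 'a list"

definition paths :: "('v, 'a) pre_digraph \<Rightarrow> ('v, 'a) path set" where
  "paths Q = {p. \<exists>v. pre_digraph.awalk Q (fst p) (snd p) v}"

definition source :: "('v, 'a) path \<Rightarrow> 'v" where
  "source p = fst p"

definition target :: "('v, 'a) pre_digraph \<Rightarrow> ('v, 'a) path \<Rightarrow> 'v" where
  "target Q p = pre_digraph.awlast Q (fst p) (snd p)"

definition parallel :: "('v, 'a) pre_digraph \<Rightarrow> ('v, 'a) path \<Rightarrow> ('v, 'a) path \<Rightarrow> bool" where
  "parallel Q p q \<longleftrightarrow> source p = source q \<and> target Q p = target Q q"

definition path_cat :: "('v, 'a) path \<Rightarrow> ('v, 'a) path \<Rightarrow> ('v, 'a) path" where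
  "path_cat p q = (fst p, snd p @ snd q)"

definition splittings :: "('v, 'a) pre_digraph \<Rightarrow> ('v, 'a) path \<Rightarrow> (('v, 'a) path \<times> ('v, 'a) path) set"
  where "splittings Q p =
    {(q, r). q \<in> paths Q \<and> r \<in> paths Q \<and> target Q q = source r \<and> path_cat q r = p}"

text \<open>All ways \<open>p = q s r\<close> of finding a member of \<open>S\<close> as a subpath of \<open>p\<close>.\<close>

definition occurrences :: "('v, 'a) pre_digraph \<Rightarrow> ('v, 'a) path set \<Rightarrow> ('v, 'a) path \<Rightarrow>
    (('v, 'a) path \<times> ('v, 'a) path \<times> ('v, 'a) path) set" where
  "occurrences Q S p = {(q, s, r). q \<in> paths Q \<and> s \<in> S \<and> s \<in> paths Q \<and> r \<in> paths Q \<and>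
     target Q q = source s \<and> target Q s = source r \<and> path_cat q (path_cat s r) = p}"

definition Irr :: "('v, 'a) pre_digraph \<Rightarrow> ('v, 'a) path set \<Rightarrow> ('v, 'a) path set" where
  "Irr Q S = {p \<in> paths Q. occurrences Q S p = {}}"


section \<open>Path algebras and their completions\<close>

text \<open>\<open>\<Bbbk>Q \<otimes> R\<close>: finitely supported functions from paths to \<open>R\<close> with the convolution product.
  With \<open>R = \<Bbbk>\<close> this is \<open>\<Bbbk>Q\<close> itself.\<close>

definition path_algebra :: "('r, 'm) ring_scheme \<Rightarrow> ('v, 'a) pre_digraph \<Rightarrow>
    ('r, ('v, 'a) path \<Rightarrow> 'r) module" where
  "path_algebra R Q =
    \<lparr>carrier = {x. (\<forall>p\<in>paths Q. x p \<in> carrier R) \<and> (\<forall>p. p \<notin> paths Q \<longrightarrow> x p = \<zero>\<^bsub>R\<^esub>) \<and>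
                   finite {p. x p \<noteq> \<zero>\<^bsub>R\<^esub>}},
     monoid.mult = (\<lambda>x y p. finsum R (\<lambda>(q, r). x q \<otimes>\<^bsub>R\<^esub> y r) (splittings Q p)),
     one = (\<lambda>p. if p \<in> paths Q \<and> snd p = [] then \<one>\<^bsub>R\<^esub> else \<zero>\<^bsub>R\<^esub>),
     zero = (\<lambda>p. \<zero>\<^bsub>R\<^esub>),
     add = (\<lambda>x y p. x p \<oplus>\<^bsub>R\<^esub> y p),
     smult = (\<lambda>c x p. c \<otimes>\<^bsub>R\<^esub> x p)\<rparr>"

definition path_elem :: "('r, 'm) ring_scheme \<Rightarrow> ('v, 'a) path \<Rightarrow> ('v, 'a) path \<Rightarrow> 'r" where
  "path_elem R p = (\<lambda>p'. if p' = p then \<one>\<^bsub>R\<^esub> else \<zero>\<^bsub>R\<^esub>)"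

abbreviation ideal_power :: "('b, 'm) ring_scheme \<Rightarrow> 'b set \<Rightarrow> nat \<Rightarrow> 'b set" where
  "ideal_power B m n \<equiv> m [^]\<^bsub>ideals_set B\<^esub> n"

text \<open>The \<open>m\<close>-adic completion of the free \<open>B\<close>-module \<open>\<Bbbk>Q \<otimes> B\<close>, i.e. the limit over \<open>n\<close> of
  \<open>\<Bbbk>Q \<otimes> B/m^n\<close>: as \<open>B\<close> is complete, its elements are the families of coefficients that, modulo
  each \<open>m^n\<close>, are finitely supported. The convolution sums remain finite.\<close>

definition completed_path_algebra :: "('b, 'm) ring_scheme \<Rightarrow> 'b set \<Rightarrow> ('v, 'a) pre_digraph \<Rightarrow>
    ('b, ('v, 'a) path \<Rightarrow> 'b) module" where
  "completed_path_algebra B m Q = (path_algebra B Q)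
    \<lparr>carrier := {x. (\<forall>p\<in>paths Q. x p \<in> carrier B) \<and> (\<forall>p. p \<notin> paths Q \<longrightarrow> x p = \<zero>\<^bsub>B\<^esub>) \<and>
                    (\<forall>n. finite {p \<in> paths Q. x p \<notin> ideal_power B m n})}\<rparr>"

text \<open>\<open>\<Bbbk>Irr_S\<close> completed over \<open>B\<close>. Only the \<open>B\<close>-module structure and the left and right
  multiplication by the \<open>e_i\<close> are meaningful; the inherited product leaves the carrier.\<close>

definition completed_Irr :: "('b, 'm) ring_scheme \<Rightarrow> 'b set \<Rightarrow> ('v, 'a) pre_digraph \<Rightarrow>
    ('v, 'a) path set \<Rightarrow> ('b, ('v, 'a) path \<Rightarrow> 'b) module" where
  "completed_Irr B m Q S = (completed_path_algebra B m Q)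
    \<lparr>carrier := {x \<in> carrier (completed_path_algebra B m Q). \<forall>p. x p \<noteq> \<zero>\<^bsub>B\<^esub> \<longrightarrow> p \<in> Irr Q S}\<rparr>"


section \<open>Modules\<close>

definition module_span :: "('b, 'm) ring_scheme \<Rightarrow> ('b, 'x, 'n) module_scheme \<Rightarrow> 'x set \<Rightarrow> 'x set" where
  "module_span B M X = (\<lambda>N. submodule N B M) hull X"

definition ideal_smult :: "('b, 'm) ring_scheme \<Rightarrow> ('b, 'x, 'n) module_scheme \<Rightarrow> 'b set \<Rightarrow> 'x set \<Rightarrow> 'x set"
  where "ideal_smult B M J N = module_span B M {b \<odot>\<^bsub>M\<^esub> x | b x. b \<in> J \<and> x \<in> N}"

definition module_iso :: "('b, 'm) ring_scheme \<Rightarrow> ('b, 'x, 'n) module_scheme \<Rightarrow>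
    ('b, 'y, 'l) module_scheme \<Rightarrow> ('x \<Rightarrow> 'y) set" where
  "module_iso B M N = {T \<in> iso (add_monoid M) (add_monoid N).
     \<forall>b\<in>carrier B. \<forall>x\<in>carrier M. T (b \<odot>\<^bsub>M\<^esub> x) = b \<odot>\<^bsub>N\<^esub> T x}"

text \<open>Completeness (including separatedness) of \<open>F 0\<close> for a descending filtration \<open>F\<close> by subgroups.\<close>

definition complete_filtration :: "('x, 'n) ring_scheme \<Rightarrow> (nat \<Rightarrow> 'x set) \<Rightarrow> bool" where
  "complete_filtration M F \<longleftrightarrow>
    (\<forall>x. (\<forall>n. x n \<in> F 0 \<and> x (Suc n) \<ominus>\<^bsub>M\<^esub> x n \<in> F n) \<longrightarrow>
         (\<exists>!y. y \<in> F 0 \<and> (\<forall>n. y \<ominus>\<^bsub>M\<^esub> x n \<in> F n)))"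

definition quotient_algebra :: "('b, 'x) module \<Rightarrow> 'x set \<Rightarrow> ('b, 'x set) module" where
  "quotient_algebra M J = ring.extend (M Quot J)
     (module.fields (\<lambda>b X. \<Union>x\<in>X. J +>\<^bsub>M\<^esub> (b \<odot>\<^bsub>M\<^esub> x)))"


section \<open>Coefficient algebras\<close>

type_synonym ('k, 'b) coeff = "('k, 'b) module \<times> 'b set"

definition structure_map :: "('k, 'b) module \<Rightarrow> 'k \<Rightarrow> 'b" where
  "structure_map B c = c \<odot>\<^bsub>B\<^esub> \<one>\<^bsub>B\<^esub>"

text \<open>Complete local Noetherian commutative \<open>\<Bbbk>\<close>-algebras \<open>(B, m)\<close> with residue field \<open>\<Bbbk>\<close>,
  having their elements in the (arbitrary) type \<open>'b\<close>.\<close>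

definition coeff_algebras :: "'k ring \<Rightarrow> ('k, 'b) coeff set" where
  "coeff_algebras K = {(B, m).
     algebra K B \<and> noetherian_ring B \<and>
     maximalideal m B \<and> (\<forall>m'. maximalideal m' B \<longrightarrow> m' = m) \<and>
     complete_filtration B (ideal_power B m) \<and>
     bij_betw (\<lambda>c. m +>\<^bsub>B\<^esub> structure_map B c) (carrier K) (carrier (B Quot m))}"

definition coeff_homs :: "'k ring \<Rightarrow> ('k, 'b) coeff \<Rightarrow> ('k, 'b) coeff \<Rightarrow> ('b \<Rightarrow> 'b) set" where
  "coeff_homs K = (\<lambda>(B, m) (B', m'). {f \<in> ring_hom B B'.
     (\<forall>c\<in>carrier K. \<forall>b\<in>carrier B. f (c \<odot>\<^bsub>B\<^esub> b) = c \<odot>\<^bsub>B'\<^esub> f b) \<and> f ` m \<subseteq> m'})"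

definition residue :: "'k ring \<Rightarrow> ('k, 'b) module \<Rightarrow> 'b set \<Rightarrow> 'b \<Rightarrow> 'k" where
  "residue K B m b = (THE c. c \<in> carrier K \<and> b \<ominus>\<^bsub>B\<^esub> structure_map B c \<in> m)"

text \<open>A map \<open>f\<close> of coefficients acts on (completed) path algebras by \<open>x \<mapsto> f \<circ> x\<close>. For an ideal \<open>J\<close>
  upstairs, its completed base change is the closure of the \<open>B\<close>-span of the image of \<open>J\<close>. For the
  structure map \<open>\<Bbbk> \<rightarrow> B\<close> and \<open>J = I\<close> this is the completed tensor product of \<open>I\<close> and \<open>B\<close>.\<close>

definition base_change_ideal :: "('b, 'm) ring_scheme \<Rightarrow> 'b set \<Rightarrow> ('v, 'a) pre_digraph \<Rightarrow> ('c \<Rightarrow> 'b) \<Rightarrow>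
    (('v, 'a) path \<Rightarrow> 'c) set \<Rightarrow> (('v, 'a) path \<Rightarrow> 'b) set" where
  "base_change_ideal B m Q f J = {y \<in> carrier (completed_path_algebra B m Q).
     \<forall>n. \<exists>x \<in> module_span B (completed_path_algebra B m Q) ((\<lambda>x. f \<circ> x) ` J).
       \<forall>p. y p \<ominus>\<^bsub>B\<^esub> x p \<in> ideal_power B m n}"

definition quotient_map :: "('c, ('v, 'a) path \<Rightarrow> 'c) module \<Rightarrow> (('v, 'a) path \<Rightarrow> 'c) set \<Rightarrow>
    ('b \<Rightarrow> 'c) \<Rightarrow> (('v, 'a) path \<Rightarrow> 'b) set \<Rightarrow> (('v, 'a) path \<Rightarrow> 'c) set" where
  "quotient_map P' J' f X = (\<Union>x\<in>X. J' +>\<^bsub>P'\<^esub> (f \<circ> x))"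

text \<open>For \<open>A = \<Bbbk>Q/I\<close>, the completed tensor product of \<open>A\<close> and \<open>B\<close>. The completed tensor product over
  a field is exact, so it is the quotient of that of \<open>\<Bbbk>Q\<close> by that of \<open>I\<close>. Only its \<open>B\<close>-module structure
  and the reduction to \<open>A\<close> are used below.\<close>

definition completed_quotient :: "('k, 'b) module \<Rightarrow> 'b set \<Rightarrow> ('v, 'a) pre_digraph \<Rightarrow>
    (('v, 'a) path \<Rightarrow> 'k) set \<Rightarrow> ('b, (('v, 'a) path \<Rightarrow> 'b) set) module" where
  "completed_quotient B m Q I =
     quotient_algebra (completed_path_algebra B m Q) (base_change_ideal B m Q (structure_map B) I)"

definition reduce_mod :: "'k ring \<Rightarrow> ('k, 'b) module \<Rightarrow> 'b set \<Rightarrow> ('v, 'a) pre_digraph \<Rightarrow>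
    (('v, 'a) path \<Rightarrow> 'k) set \<Rightarrow> (('v, 'a) path \<Rightarrow> 'b) set \<Rightarrow> (('v, 'a) path \<Rightarrow> 'k) set" where
  "reduce_mod K B m Q I = quotient_map (path_algebra K Q) I (residue K B m)"


section \<open>Reduction systems\<close>

definition reduction_system :: "'k ring \<Rightarrow> ('v, 'a) pre_digraph \<Rightarrow> ('v, 'a) path set \<Rightarrow>
    (('v, 'a) path \<Rightarrow> ('v, 'a) path \<Rightarrow> 'k) \<Rightarrow> bool" where
  "reduction_system K Q S \<phi> \<longleftrightarrow>
     S \<subseteq> {p \<in> paths Q. length (snd p) \<ge> 2} \<and>
     (\<forall>s\<in>S. \<forall>s'\<in>S. s \<noteq> s' \<longrightarrow> occurrences Q {s} s' = {}) \<and>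
     (\<forall>s\<in>S. \<phi> s \<in> carrier (path_algebra K Q) \<and>
        (\<forall>p. \<phi> s p \<noteq> \<zero>\<^bsub>K\<^esub> \<longrightarrow> p \<in> Irr Q S \<and> parallel Q p s))"

text \<open>From here on the coefficient ring \<open>R\<close> is arbitrary, since
  reductions are needed over \<open>\<Bbbk>\<close> and over all \<open>B/m^n\<close>.\<close>

definition replacement :: "('r, 'm) ring_scheme \<Rightarrow> ('v, 'a) pre_digraph \<Rightarrow>
    (('v, 'a) path \<Rightarrow> ('v, 'a) path \<Rightarrow> 'r) \<Rightarrow>
    ('v, 'a) path \<times> ('v, 'a) path \<times> ('v, 'a) path \<Rightarrow> ('v, 'a) path \<Rightarrow> 'r" where
  "replacement R Q \<phi> = (\<lambda>(q, s, r). path_elem R q \<otimes>\<^bsub>path_algebra R Q\<^esub> \<phi> s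
     \<otimes>\<^bsub>path_algebra R Q\<^esub> path_elem R r)"

definition basic_reduction :: "('r, 'm) ring_scheme \<Rightarrow> ('v, 'a) pre_digraph \<Rightarrow>
    (('v, 'a) path \<Rightarrow> ('v, 'a) path \<Rightarrow> 'r) \<Rightarrow>
    ('v, 'a) path \<times> ('v, 'a) path \<times> ('v, 'a) path \<Rightarrow>
    (('v, 'a) path \<Rightarrow> 'r) \<Rightarrow> ('v, 'a) path \<Rightarrow> 'r" where
  "basic_reduction R Q \<phi> = (\<lambda>(q, s, r) x. let p = path_cat q (path_cat s r) in
     x(p := \<zero>\<^bsub>R\<^esub>) \<oplus>\<^bsub>path_algebra R Q\<^esub> x p \<odot>\<^bsub>path_algebra R Q\<^esub> replacement R Q \<phi> (q, s, r))"

inductive_set reductions :: "('r, 'm) ring_scheme \<Rightarrow> ('v, 'a) pre_digraph \<Rightarrow> ('v, 'a) path set \<Rightarrow>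
    (('v, 'a) path \<Rightarrow> ('v, 'a) path \<Rightarrow> 'r) \<Rightarrow> ((('v, 'a) path \<Rightarrow> 'r) \<Rightarrow> ('v, 'a) path \<Rightarrow> 'r) set"
  for R Q S \<phi> where
    "id \<in> reductions R Q S \<phi>"
  | "\<rho> \<in> reductions R Q S \<phi> \<Longrightarrow> qsr \<in> occurrences Q S p \<Longrightarrow>
       basic_reduction R Q \<phi> qsr \<circ> \<rho> \<in> reductions R Q S \<phi>"

definition reduction_finite :: "('r, 'm) ring_scheme \<Rightarrow> ('v, 'a) pre_digraph \<Rightarrow> ('v, 'a) path set \<Rightarrow>
    (('v, 'a) path \<Rightarrow> ('v, 'a) path \<Rightarrow> 'r) \<Rightarrow> ('v, 'a) path \<Rightarrow> bool" where
  "reduction_finite R Q S \<phi> p \<longleftrightarrow>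
     (\<forall>\<rho>. (\<forall>i. \<rho> i \<in> reductions R Q S \<phi>) \<longrightarrow>
       (\<exists>N. \<forall>n\<ge>N. rec_nat (path_elem R p) \<rho> n = rec_nat (path_elem R p) \<rho> N))"

definition irreducible_elem :: "('r, 'm) ring_scheme \<Rightarrow> ('v, 'a) pre_digraph \<Rightarrow> ('v, 'a) path set \<Rightarrow>
    (('v, 'a) path \<Rightarrow> 'r) \<Rightarrow> bool" where
  "irreducible_elem R Q S x \<longleftrightarrow> (\<forall>p. x p \<noteq> \<zero>\<^bsub>R\<^esub> \<longrightarrow> p \<in> Irr Q S)"

definition reduction_unique :: "('r, 'm) ring_scheme \<Rightarrow> ('v, 'a) pre_digraph \<Rightarrow> ('v, 'a) path set \<Rightarrow>
    (('v, 'a) path \<Rightarrow> ('v, 'a) path \<Rightarrow> 'r) \<Rightarrow> ('v, 'a) path \<Rightarrow> bool" where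
  "reduction_unique R Q S \<phi> p \<longleftrightarrow> reduction_finite R Q S \<phi> p \<and>
     (\<forall>\<rho>\<in>reductions R Q S \<phi>. \<forall>\<rho>'\<in>reductions R Q S \<phi>.
        irreducible_elem R Q S (\<rho> (path_elem R p)) \<and> irreducible_elem R Q S (\<rho>' (path_elem R p)) \<longrightarrow>
        \<rho> (path_elem R p) = \<rho>' (path_elem R p))"

definition satisfies_diamond :: "'k ring \<Rightarrow> ('v, 'a) pre_digraph \<Rightarrow> ('v, 'a) path set \<Rightarrow>
    (('v, 'a) path \<Rightarrow> ('v, 'a) path \<Rightarrow> 'k) \<Rightarrow> (('v, 'a) path \<Rightarrow> 'k) set \<Rightarrow> bool" where
  "satisfies_diamond K Q S \<phi> I \<longleftrightarrow>
     I = Idl\<^bsub>path_algebra K Q\<^esub> ((\<lambda>s. path_elem K s \<ominus>\<^bsub>path_algebra K Q\<^esub> \<phi> s) ` S) \<and>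
     (\<forall>p\<in>paths Q. reduction_unique K Q S \<phi> p)"

text \<open>A rightmost occurrence is one that is followed by the shortest path; it is unique
  since no element of \<open>S\<close> is a proper subpath of another. The map below applies rightmost
  reduction linearly to all paths in the support.\<close>

definition rightmost_occurrence :: "('v, 'a) pre_digraph \<Rightarrow> ('v, 'a) path set \<Rightarrow> ('v, 'a) path \<Rightarrow>
    ('v, 'a) path \<times> ('v, 'a) path \<times> ('v, 'a) path" where
  "rightmost_occurrence Q S p = (THE qsr. qsr \<in> occurrences Q S p \<and>
     (\<forall>qsr'\<in>occurrences Q S p. length (snd (snd (snd qsr))) \<le> length (snd (snd (snd qsr')))))"

definition rightmost_reduction :: "('r, 'm) ring_scheme \<Rightarrow> ('v, 'a) pre_digraph \<Rightarrow> ('v, 'a) path set \<Rightarrow>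
    (('v, 'a) path \<Rightarrow> ('v, 'a) path \<Rightarrow> 'r) \<Rightarrow> (('v, 'a) path \<Rightarrow> 'r) \<Rightarrow> ('v, 'a) path \<Rightarrow> 'r" where
  "rightmost_reduction R Q S \<phi> x = (\<lambda>p'. finsum R
     (\<lambda>p. x p \<otimes>\<^bsub>R\<^esub> (if p \<in> Irr Q S then path_elem R p
                      else replacement R Q \<phi> (rightmost_occurrence Q S p)) p')
     {p. x p \<noteq> \<zero>\<^bsub>R\<^esub>})"


section \<open>Deformations of the associative algebra\<close>

definition alg_deformations :: "'k ring \<Rightarrow> ('v, 'a) pre_digraph \<Rightarrow> (('v, 'a) path \<Rightarrow> 'k) set \<Rightarrow>
    ('k, 'b) coeff \<Rightarrow>
    ((('v, 'a) path \<Rightarrow> 'b) set \<Rightarrow> (('v, 'a) path \<Rightarrow> 'b) set \<Rightarrow> (('v, 'a) path \<Rightarrow> 'b) set) set" where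
  "alg_deformations K Q I = (\<lambda>(B, m).
     let A = path_algebra K Q Quot I; M = completed_quotient B m Q I; red = reduce_mod K B m Q I in
     {star \<in> carrier M \<rightarrow>\<^sub>E carrier M \<rightarrow>\<^sub>E carrier M.
       (\<forall>x\<in>carrier M. \<forall>y\<in>carrier M. \<forall>z\<in>carrier M.
          star (x \<oplus>\<^bsub>M\<^esub> y) z = star x z \<oplus>\<^bsub>M\<^esub> star y z \<and>
          star x (y \<oplus>\<^bsub>M\<^esub> z) = star x y \<oplus>\<^bsub>M\<^esub> star x z \<and>
          star (star x y) z = star x (star y z)) \<and>
       (\<forall>b\<in>carrier B. \<forall>x\<in>carrier M. \<forall>y\<in>carrier M.
          star (b \<odot>\<^bsub>M\<^esub> x) y = b \<odot>\<^bsub>M\<^esub> star x y \<and> star x (b \<odot>\<^bsub>M\<^esub> y) = b \<odot>\<^bsub>M\<^esub> star x y) \<and>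
       (\<forall>x\<in>carrier M. \<forall>y\<in>carrier M. red (star x y) = red x \<otimes>\<^bsub>A\<^esub> red y)})"

definition alg_equiv :: "'k ring \<Rightarrow> ('v, 'a) pre_digraph \<Rightarrow> (('v, 'a) path \<Rightarrow> 'k) set \<Rightarrow>
    ('k, 'b) coeff \<Rightarrow>
    ((('v, 'a) path \<Rightarrow> 'b) set \<Rightarrow> (('v, 'a) path \<Rightarrow> 'b) set \<Rightarrow> (('v, 'a) path \<Rightarrow> 'b) set) rel" where
  "alg_equiv K Q I = (\<lambda>(B, m).
     let M = completed_quotient B m Q I; red = reduce_mod K B m Q I in
     {(star, star'). star \<in> alg_deformations K Q I (B, m) \<and> star' \<in> alg_deformations K Q I (B, m) \<and>
       (\<exists>T \<in> module_iso B M M. (\<forall>x\<in>carrier M. red (T x) = red x) \<and>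
          (\<forall>x\<in>carrier M. \<forall>y\<in>carrier M. T (star x y) = star' (T x) (T y)))})"

definition alg_functor :: "'k ring \<Rightarrow> ('v, 'a) pre_digraph \<Rightarrow> (('v, 'a) path \<Rightarrow> 'k) set \<Rightarrow>
    ('k, 'b) coeff \<Rightarrow>
    ((('v, 'a) path \<Rightarrow> 'b) set \<Rightarrow> (('v, 'a) path \<Rightarrow> 'b) set \<Rightarrow> (('v, 'a) path \<Rightarrow> 'b) set) set set" where
  "alg_functor K Q I X = alg_deformations K Q I X // alg_equiv K Q I X"

text \<open>The base change of a product along \<open>f\<close> is the (unique) \<open>B'\<close>-bilinear product making the
  base change map multiplicative.\<close>

definition alg_base_change :: "'k ring \<Rightarrow> ('v, 'a) pre_digraph \<Rightarrow> (('v, 'a) path \<Rightarrow> 'k) set \<Rightarrow>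
    ('k, 'b) coeff \<Rightarrow> ('k, 'b) coeff \<Rightarrow> ('b \<Rightarrow> 'b) \<Rightarrow>
    ((('v, 'a) path \<Rightarrow> 'b) set \<Rightarrow> (('v, 'a) path \<Rightarrow> 'b) set \<Rightarrow> (('v, 'a) path \<Rightarrow> 'b) set) rel" where
  "alg_base_change K Q I = (\<lambda>(B, m) (B', m') f.
     let M = completed_quotient B m Q I;
         g = quotient_map (completed_path_algebra B' m' Q)
               (base_change_ideal B' m' Q (structure_map B') I) f in
     {(star, star'). star \<in> alg_deformations K Q I (B, m) \<and> star' \<in> alg_deformations K Q I (B', m') \<and>
       (\<forall>x\<in>carrier M. \<forall>y\<in>carrier M. g (star x y) = star' (g x) (g y))})"

definition alg_functor_map :: "'k ring \<Rightarrow> ('v, 'a) pre_digraph \<Rightarrow> (('v, 'a) path \<Rightarrow> 'k) set \<Rightarrow>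
    ('k, 'b) coeff \<Rightarrow> ('k, 'b) coeff \<Rightarrow> ('b \<Rightarrow> 'b) \<Rightarrow>
    ((('v, 'a) path \<Rightarrow> 'b) set \<Rightarrow> (('v, 'a) path \<Rightarrow> 'b) set \<Rightarrow> (('v, 'a) path \<Rightarrow> 'b) set) set \<Rightarrow>
    ((('v, 'a) path \<Rightarrow> 'b) set \<Rightarrow> (('v, 'a) path \<Rightarrow> 'b) set \<Rightarrow> (('v, 'a) path \<Rightarrow> 'b) set) set" where
  "alg_functor_map K Q I X Y f C = alg_equiv K Q I Y `` (alg_base_change K Q I X Y f `` C)"


section \<open>Deformations of the reduction system\<close>

definition deformed_rule :: "('k, 'b) module \<Rightarrow> (('v, 'a) path \<Rightarrow> ('v, 'a) path \<Rightarrow> 'k) \<Rightarrow>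
    (('v, 'a) path \<Rightarrow> ('v, 'a) path \<Rightarrow> 'b) \<Rightarrow> ('v, 'a) path \<Rightarrow> ('v, 'a) path \<Rightarrow> 'b" where
  "deformed_rule B \<phi> \<psi> s = (\<lambda>p. structure_map B (\<phi> s p) \<oplus>\<^bsub>B\<^esub> \<psi> s p)"

definition truncation :: "('k, 'b) module \<Rightarrow> 'b set \<Rightarrow> nat \<Rightarrow> (('v, 'a) path \<Rightarrow> 'b) \<Rightarrow>
    ('v, 'a) path \<Rightarrow> 'b set" where
  "truncation B m n x = (\<lambda>p. ideal_power B m (Suc n) +>\<^bsub>B\<^esub> x p)"

text \<open>Since \<open>B\<close> is Noetherian, the \<open>m/m^n\<close> are finite-dimensional, so the completed tensor
  product of \<open>Hom(\<Bbbk>S, \<Bbbk>Irr_S)\<close> and \<open>m\<close> consists of all families, indexed by \<open>s \<in> S\<close>, of elements of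
  \<open>\<Bbbk>Irr_S\<close> completed over \<open>m\<close> and parallel to \<open>s\<close>.\<close>

definition red_deformations :: "('v, 'a) pre_digraph \<Rightarrow> ('v, 'a) path set \<Rightarrow>
    (('v, 'a) path \<Rightarrow> ('v, 'a) path \<Rightarrow> 'k) \<Rightarrow> ('k, 'b) coeff \<Rightarrow>
    (('v, 'a) path \<Rightarrow> ('v, 'a) path \<Rightarrow> 'b) set" where
  "red_deformations Q S \<phi> = (\<lambda>(B, m).
     {\<psi> \<in> (\<Pi>\<^sub>E s\<in>S. {x \<in> carrier (completed_Irr B m Q S).
                       \<forall>p. x p \<in> m \<and> (x p \<noteq> \<zero>\<^bsub>B\<^esub> \<longrightarrow> parallel Q p s)}).
       \<forall>n\<ge>1. \<forall>p\<in>paths Q. reduction_unique (B Quot ideal_power B m (Suc n)) Q S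
         (\<lambda>s. truncation B m n (deformed_rule B \<phi> \<psi> s)) p})"

definition red_inf :: "('v, 'a) pre_digraph \<Rightarrow> ('v, 'a) path set \<Rightarrow>
    (('v, 'a) path \<Rightarrow> ('v, 'a) path \<Rightarrow> 'k) \<Rightarrow> ('k, 'b) coeff \<Rightarrow>
    (('v, 'a) path \<Rightarrow> ('v, 'a) path \<Rightarrow> 'b) \<Rightarrow> (('v, 'a) path \<Rightarrow> 'b) \<Rightarrow> ('v, 'a) path \<Rightarrow> 'b" where
  "red_inf Q S \<phi> = (\<lambda>(B, m) \<psi> x. THE y. y \<in> carrier (completed_Irr B m Q S) \<and>
     (\<forall>n. \<exists>N. \<forall>k\<ge>N.
        (rightmost_reduction (B Quot ideal_power B m (Suc n)) Q S
           (\<lambda>s. truncation B m n (deformed_rule B \<phi> \<psi> s)) ^^ k) (truncation B m n x)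
        = truncation B m n y))"

definition red_equiv :: "'k ring \<Rightarrow> ('v, 'a) pre_digraph \<Rightarrow> ('v, 'a) path set \<Rightarrow>
    (('v, 'a) path \<Rightarrow> ('v, 'a) path \<Rightarrow> 'k) \<Rightarrow> ('k, 'b) coeff \<Rightarrow>
    (('v, 'a) path \<Rightarrow> ('v, 'a) path \<Rightarrow> 'b) rel" where
  "red_equiv K Q S \<phi> = (\<lambda>(B, m).
     let P = completed_path_algebra B m Q; M = completed_Irr B m Q S;
         e = (\<lambda>i. path_elem B (i, [])); arrow = (\<lambda>a. path_elem B (tail Q a, [a])) in
     {(\<psi>, \<psi>'). \<psi> \<in> red_deformations Q S \<phi> (B, m) \<and> \<psi>' \<in> red_deformations Q S \<phi> (B, m) \<and>
       (\<exists>T \<in> module_iso B M M.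
          (\<forall>i\<in>verts Q. \<forall>x\<in>carrier M.
             T (e i \<otimes>\<^bsub>P\<^esub> x) = e i \<otimes>\<^bsub>P\<^esub> T x \<and> T (x \<otimes>\<^bsub>P\<^esub> e i) = T x \<otimes>\<^bsub>P\<^esub> e i) \<and>
          (\<forall>x\<in>carrier M. residue K B m \<circ> T x = residue K B m \<circ> x) \<and>
          (\<forall>i\<in>verts Q. T (e i) = e i) \<and>
          (\<forall>(u, as) \<in> paths Q. as \<noteq> [] \<longrightarrow>
             T (red_inf Q S \<phi> (B, m) \<psi>' (path_elem B (u, as))) =
             red_inf Q S \<phi> (B, m) \<psi> (foldr (\<lambda>a y. T (arrow a) \<otimes>\<^bsub>P\<^esub> y) as \<one>\<^bsub>P\<^esub>)))})"

definition red_functor :: "'k ring \<Rightarrow> ('v, 'a) pre_digraph \<Rightarrow> ('v, 'a) path set \<Rightarrow>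
    (('v, 'a) path \<Rightarrow> ('v, 'a) path \<Rightarrow> 'k) \<Rightarrow> ('k, 'b) coeff \<Rightarrow>
    (('v, 'a) path \<Rightarrow> ('v, 'a) path \<Rightarrow> 'b) set set" where
  "red_functor K Q S \<phi> X = red_deformations Q S \<phi> X // red_equiv K Q S \<phi> X"

definition red_functor_map :: "'k ring \<Rightarrow> ('v, 'a) pre_digraph \<Rightarrow> ('v, 'a) path set \<Rightarrow>
    (('v, 'a) path \<Rightarrow> ('v, 'a) path \<Rightarrow> 'k) \<Rightarrow> ('k, 'b) coeff \<Rightarrow> ('k, 'b) coeff \<Rightarrow> ('b \<Rightarrow> 'b) \<Rightarrow>
    (('v, 'a) path \<Rightarrow> ('v, 'a) path \<Rightarrow> 'b) set \<Rightarrow> (('v, 'a) path \<Rightarrow> ('v, 'a) path \<Rightarrow> 'b) set" where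
  "red_functor_map K Q S \<phi> X Y f C =
     red_equiv K Q S \<phi> Y `` ((\<lambda>\<psi>. restrict (\<lambda>s. f \<circ> \<psi> s) S) ` C)"


section \<open>Deformations of the ideal\<close>

text \<open>The isomorphisms \<open>\<Phi>\<close> that reduce to the identity of \<open>A\<close>.\<close>

definition trivializations :: "'k ring \<Rightarrow> ('v, 'a) pre_digraph \<Rightarrow> (('v, 'a) path \<Rightarrow> 'k) set \<Rightarrow>
    ('k, 'b) coeff \<Rightarrow> (('v, 'a) path \<Rightarrow> 'b) set \<Rightarrow>
    ((('v, 'a) path \<Rightarrow> 'b) set \<Rightarrow> (('v, 'a) path \<Rightarrow> 'b) set) set" where
  "trivializations K Q I = (\<lambda>(B, m) J.
     let M = completed_quotient B m Q I; red = reduce_mod K B m Q I in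
     {\<Phi> \<in> module_iso B M (quotient_algebra (completed_path_algebra B m Q) J).
       \<forall>x\<in>carrier M. red (\<Phi> x) = red x})"

text \<open>The third and fourth conditions express that reduction modulo \<open>m\<close> induces an isomorphism from
  \<open>J/mJ\<close>, the tensor product of \<open>J\<close> with \<open>\<Bbbk>\<close> over \<open>B\<close>, onto \<open>I\<close>.\<close>

definition ideal_deformations :: "'k ring \<Rightarrow> ('v, 'a) pre_digraph \<Rightarrow> (('v, 'a) path \<Rightarrow> 'k) set \<Rightarrow>
    ('k, 'b) coeff \<Rightarrow> (('v, 'a) path \<Rightarrow> 'b) set set" where
  "ideal_deformations K Q I = (\<lambda>(B, m). let P = completed_path_algebra B m Q in
     {J. ideal J P \<and>
         complete_filtration P (\<lambda>n. ideal_smult B P (ideal_power B m n) J) \<and>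
         (\<lambda>x. residue K B m \<circ> x) ` J = I \<and>
         (\<forall>x\<in>J. residue K B m \<circ> x = \<zero>\<^bsub>path_algebra K Q\<^esub> \<longrightarrow> x \<in> ideal_smult B P m J) \<and>
         trivializations K Q I (B, m) J \<noteq> {}})"

definition ideal_equiv :: "'k ring \<Rightarrow> ('v, 'a) pre_digraph \<Rightarrow> (('v, 'a) path \<Rightarrow> 'k) set \<Rightarrow>
    ('k, 'b) coeff \<Rightarrow> (('v, 'a) path \<Rightarrow> 'b) set rel" where
  "ideal_equiv K Q I = (\<lambda>(B, m).
     let P = completed_path_algebra B m Q; M = completed_quotient B m Q I; red = reduce_mod K B m Q I in
     {(J, J'). J \<in> ideal_deformations K Q I (B, m) \<and> J' \<in> ideal_deformations K Q I (B, m) \<and>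
       (\<exists>\<Phi> \<in> trivializations K Q I (B, m) J. \<exists>\<Phi>' \<in> trivializations K Q I (B, m) J'.
        \<exists>T \<in> module_iso B M M. (\<forall>x\<in>carrier M. red (T x) = red x) \<and>
          \<Phi>' \<circ> T \<circ> inv_into (carrier M) \<Phi> \<in>
            module_iso B (quotient_algebra P J) (quotient_algebra P J') \<inter>
            ring_iso (quotient_algebra P J) (quotient_algebra P J'))})"

definition ideal_functor :: "'k ring \<Rightarrow> ('v, 'a) pre_digraph \<Rightarrow> (('v, 'a) path \<Rightarrow> 'k) set \<Rightarrow>
    ('k, 'b) coeff \<Rightarrow> (('v, 'a) path \<Rightarrow> 'b) set set set" where
  "ideal_functor K Q I X = ideal_deformations K Q I X // ideal_equiv K Q I X"

definition ideal_functor_map :: "'k ring \<Rightarrow> ('v, 'a) pre_digraph \<Rightarrow> (('v, 'a) path \<Rightarrow> 'k) set \<Rightarrow>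
    ('k, 'b) coeff \<Rightarrow> ('k, 'b) coeff \<Rightarrow> ('b \<Rightarrow> 'b) \<Rightarrow>
    (('v, 'a) path \<Rightarrow> 'b) set set \<Rightarrow> (('v, 'a) path \<Rightarrow> 'b) set set" where
  "ideal_functor_map K Q I X Y f C =
     ideal_equiv K Q I Y `` (base_change_ideal (fst Y) (snd Y) Q f ` C)"


section \<open>Set-valued functors\<close>

definition set_functor :: "'o set \<Rightarrow> ('o \<Rightarrow> 'o \<Rightarrow> ('b \<Rightarrow> 'b) set) \<Rightarrow> ('o \<Rightarrow> 'x set) \<Rightarrow>
    ('o \<Rightarrow> 'o \<Rightarrow> ('b \<Rightarrow> 'b) \<Rightarrow> 'x \<Rightarrow> 'x) \<Rightarrow> bool" where
  "set_functor Ob Hom D Dmap \<longleftrightarrow>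
     (\<forall>X\<in>Ob. \<forall>Y\<in>Ob. \<forall>f\<in>Hom X Y. Dmap X Y f \<in> D X \<rightarrow> D Y) \<and>
     (\<forall>X\<in>Ob. \<forall>x\<in>D X. Dmap X X id x = x) \<and>
     (\<forall>X\<in>Ob. \<forall>Y\<in>Ob. \<forall>Z\<in>Ob. \<forall>f\<in>Hom X Y. \<forall>g\<in>Hom Y Z. \<forall>x\<in>D X.
        Dmap X Z (g \<circ> f) x = Dmap Y Z g (Dmap X Y f x))"

definition natural_iso :: "'o set \<Rightarrow> ('o \<Rightarrow> 'o \<Rightarrow> ('b \<Rightarrow> 'b) set) \<Rightarrow>
    ('o \<Rightarrow> 'x set) \<Rightarrow> ('o \<Rightarrow> 'o \<Rightarrow> ('b \<Rightarrow> 'b) \<Rightarrow> 'x \<Rightarrow> 'x) \<Rightarrow>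
    ('o \<Rightarrow> 'y set) \<Rightarrow> ('o \<Rightarrow> 'o \<Rightarrow> ('b \<Rightarrow> 'b) \<Rightarrow> 'y \<Rightarrow> 'y) \<Rightarrow> ('o \<Rightarrow> 'x \<Rightarrow> 'y) \<Rightarrow> bool" where
  "natural_iso Ob Hom D Dmap E Emap \<eta> \<longleftrightarrow>
     (\<forall>X\<in>Ob. bij_betw (\<eta> X) (D X) (E X)) \<and>
     (\<forall>X\<in>Ob. \<forall>Y\<in>Ob. \<forall>f\<in>Hom X Y. \<forall>x\<in>D X. \<eta> Y (Dmap X Y f x) = Emap X Y f (\<eta> X x))"

definition isomorphic_functors :: "'o set \<Rightarrow> ('o \<Rightarrow> 'o \<Rightarrow> ('b \<Rightarrow> 'b) set) \<Rightarrow>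
    ('o \<Rightarrow> 'x set) \<Rightarrow> ('o \<Rightarrow> 'o \<Rightarrow> ('b \<Rightarrow> 'b) \<Rightarrow> 'x \<Rightarrow> 'x) \<Rightarrow>
    ('o \<Rightarrow> 'y set) \<Rightarrow> ('o \<Rightarrow> 'o \<Rightarrow> ('b \<Rightarrow> 'b) \<Rightarrow> 'y \<Rightarrow> 'y) \<Rightarrow> bool" where
  "isomorphic_functors Ob Hom D Dmap E Emap \<longleftrightarrow>
     set_functor Ob Hom D Dmap \<and> set_functor Ob Hom E Emap \<and>
     (\<exists>\<eta>. natural_iso Ob Hom D Dmap E Emap \<eta>)"

end

theory Submission
  imports Defs
begin

text \<open>A deformation in each of the three senses is, up to equivalence, a product on one and the same module,
and equivalence is the same relation on these products.

Write \<open>P\<close> for the completion of \<open>\<Bbbk>Q \<otimes> B\<close> and \<open>N\<close> for the completed free module on the irreducible paths.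
The Diamond Lemma says that \<open>\<Bbbk>Irr\<^sub>S\<close> is a complement of \<open>I\<close> in \<open>\<Bbbk>Q\<close>. Call an ideal \<open>J\<close> of \<open>P\<close> good if \<open>N\<close> is a
complement of \<open>J\<close> and \<open>J\<close> reduces into \<open>I\<close> modulo \<open>m\<close>. For good \<open>J\<close> the projection \<open>proj J\<close> onto \<open>N\<close> along \<open>J\<close>
turns multiplication of paths into the product \<open>proj J (u v)\<close> on \<open>N\<close> (\<open>nprod J\<close>). Two bilinear products
on \<open>N\<close> are gauge equivalent if a \<open>B\<close>-linear automorphism of \<open>N\<close> that is the identity modulo \<open>m\<close> carries
one to the other. The claim is that each of the three functors sends \<open>B\<close> to the set of good ideals up to
gauge equivalence of their products, compatibly with base change.

Ideals: the deformations of \<open>I\<close> are exactly the good ideals (\<open>ideal_deformations_eq\<close>). A trivialization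
\<open>\<Phi>\<close> compares \<open>N\<close> with the quotient by \<open>J\<close>; being the identity modulo \<open>m\<close> it is bijective in coordinates by
a geometric series, which makes \<open>N\<close> a complement. Conversely all flatness and completeness conditions
follow from the splitting of \<open>P\<close> into \<open>N\<close> and \<open>J\<close>.

Reduction systems: as no reduction over \<open>\<Bbbk>\<close> continues forever, the relation "\<open>p'\<close> occurs in a replacement
of \<open>p\<close>" is well-founded (\<open>wf_if_reduction_finite\<close>, by a compactness argument). Over \<open>B\<close> this holds up to
terms in \<open>m\<close>, so that reductions converge \<open>m\<close>-adically to a linear normal form map \<open>nf\<close>. Uniqueness of
the irreducible results modulo all powers of \<open>m\<close> says that \<open>nf\<close> does not see reductions inside a longer
path, hence that its kernel is an ideal, with complement \<open>N\<close> (\<open>confluent_complement\<close>). In the other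
direction a good ideal \<open>J\<close> contains \<open>s - proj J s\<close>, and these elements are a deformed reduction system
whose reductions do not change the class modulo \<open>J\<close>; so its normal form map is \<open>proj J\<close>. This is a
bijection between deformations of \<open>R\<close> and good ideals. The equivalences of reduction systems are the
gauge equivalences that fix the vertices, and any gauge equivalence can be conjugated to such a one
(\<open>gauge_fixing_vertices\<close>).

Algebras: in the coordinates \<open>N\<close> a product on the completion of \<open>A \<otimes> B\<close> is any associative bilinear
product on \<open>N\<close> with the right reduction. It is isomorphic to the product of a good ideal, since
the vertices lift to orthogonal idempotents by Newton iteration and the arrows can be put into the
corners that these cut out; the resulting multiplicative map from \<open>P\<close> is the identity on \<open>N\<close>
modulo \<open>m\<close>, and its kernel is the good ideal (\<open>product_from_ideal\<close>).

Linear maps are handled throughout by the universal property of completed free modules: they exist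
with prescribed values on paths, and are determined by these values (\<open>linear_extension\<close>,
\<open>semilinear_eq\<close>). Here finite generation of the powers of \<open>m\<close> makes every linear map continuous.
The undeformed situation is the same theory over the ring \<open>\<Bbbk>\<close> with the zero ideal, so that passing from
\<open>\<Bbbk>\<close> to \<open>B\<close>, from \<open>B\<close> to its residue field and along homomorphisms of coefficients are all instances of
one base change theorem (\<open>base_change_complement\<close>).\<close>

section \<open>Paths\<close>

lemma target_Nil [simp]: "target Q (u, []) = u"
 by (simp add: target_def pre_digraph.awalk_verts.simps)

lemma target_Cons [simp]: "target Q (u, a # as) = target Q (head Q a, as)"
 by (simp add: target_def pre_digraph.awalk_verts.simps pre_digraph.awalk_verts_non_Nil)

lemma target_append: "target Q (u, as @ bs) = target Q (target Q (u, as), bs)"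
 by (induction as arbitrary: u) auto

lemma (in wf_digraph) paths_Nil [simp]: "(u, []) : paths G \<longleftrightarrow> u : verts G"
 by (auto simp: paths_def awalk_def)

lemma (in wf_digraph) paths_Cons:
 "(u, a # as) : paths G \<longleftrightarrow> a : arcs G \<and> tail G a = u \<and> (head G a, as) : paths G"
 by (auto simp: paths_def awalk_def)

lemma (in wf_digraph) paths_append:
 "(u, as @ bs) : paths G \<longleftrightarrow> (u, as) : paths G \<and> (target G (u, as), bs) : paths G"
proof (induction as arbitrary: u)
 case Nil
 then show ?case by (auto simp: paths_def awalk_def)
qed (auto simp: paths_Cons)

lemma (in wf_digraph) source_in_verts: "p : paths G ==> fst p : verts G"
 by (auto simp: paths_def awalk_def)

lemma (in wf_digraph) target_in_verts: "p : paths G ==> target G p : verts G"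
 using paths_append[of "fst p" "snd p" "[]"] by auto

lemma (in wf_digraph) splittings_eq:
 "splittings G (u, as) = (if (u, as) : paths G
  then (\<lambda>k. ((u, take k as), (target G (u, take k as), drop k as))) ` {..length as} else {})"
proof (cases "(u, as) : paths G")
 case True
 have "(q, r) : splittings G (u, as) \<longleftrightarrow>
  (q, r) : (\<lambda>k. ((u, take k as), (target G (u, take k as), drop k as))) ` {..length as}" for q r
 proof
  assume "(q, r) : splittings G (u, as)"
  then show "(q, r) : (\<lambda>k. ((u, take k as), (target G (u, take k as), drop k as))) ` {..length as}"
   by (auto simp: splittings_def path_cat_def source_def image_iff intro!: bexI[of _ "length (snd q)"])
 next
  assume "(q, r) : (\<lambda>k. ((u, take k as), (target G (u, take k as), drop k as))) ` {..length as}"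
  then obtain k where k: "q = (u, take k as)" "r = (target G (u, take k as), drop k as)" by auto
  show "(q, r) : splittings G (u, as)"
   using True paths_append[of u "take k as" "drop k as"]
   by (simp add: splittings_def k path_cat_def source_def)
 qed
 then show ?thesis using True by auto
next
 case False
 then show ?thesis
  using paths_append by (fastforce simp: splittings_def path_cat_def source_def)
qed

lemma (in wf_digraph) finite_splittings [simp]: "finite (splittings G p)"
 by (cases p) (simp add: splittings_eq)

lemma (in wf_digraph) splittings_not_path [simp]: "p \<notin> paths G ==> splittings G p = {}"
 by (cases p) (simp only: splittings_eq if_False)

lemma (in wf_digraph) splittings_Nil [simp]:
 "u : verts G ==> splittings G (u, []) = {((u, []), (u, []))}"
 by (simp add: splittings_eq)

lemma (in wf_digraph) splittings_Cons:
 assumes "(u, a # as) : paths G"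
 shows "splittings G (u, a # as) = insert ((u, []), (u, a # as))
  ((\<lambda>(q, r). ((u, a # snd q), r)) ` splittings G (head G a, as))"
proof -
 have "{..length (a # as)} = insert 0 (Suc ` {..length as})"
  by (simp add: atMost_Suc_eq_insert_0)
 then show ?thesis using assms
  by (simp add: splittings_eq paths_Cons image_image)
qed

lemma (in wf_digraph) splittings_paths:
 assumes "(q, r) : splittings G p"
 shows "q : paths G \<and> r : paths G \<and> p : paths G"
proof -
 have "p : paths G"
 proof (rule ccontr)
  assume "p \<notin> paths G"
  then show False using assms by (subst (asm) splittings_not_path) auto
 qed
 then show ?thesis using assms by (simp add: splittings_def)
qed

section \<open>The convolution product\<close>

lemma path_algebra_simps [simp]:
 "\<zero>\<^bsub>path_algebra R Q\<^esub> = (\<lambda>p. \<zero>\<^bsub>R\<^esub>)"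
 "x \<oplus>\<^bsub>path_algebra R Q\<^esub> y = (\<lambda>p. x p \<oplus>\<^bsub>R\<^esub> y p)"
 "c \<odot>\<^bsub>path_algebra R Q\<^esub> x = (\<lambda>p. c \<otimes>\<^bsub>R\<^esub> x p)"
 by (simp_all add: path_algebra_def)

definition families :: "('r, 'm) ring_scheme => ('v, 'a) pre_digraph => (('v, 'a) path => 'r) set" where
 "families R Q = {x. (\<forall>p\<in>paths Q. x p : carrier R) \<and> (\<forall>p. p \<notin> paths Q \<longrightarrow> x p = \<zero>\<^bsub>R\<^esub>)}"

abbreviation conv :: "('r, 'm) ring_scheme => ('v, 'a) pre_digraph => (('v, 'a) path => 'r) =>
  (('v, 'a) path => 'r) => (('v, 'a) path => 'r)" where
 "conv R Q x y \<equiv> x \<otimes>\<^bsub>path_algebra R Q\<^esub> y"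

text \<open>Deleting a first arrow \<open>a\<close>. Splitting off the first arrow of a path turns identities between
 convolution products into inductions on the length of the path.\<close>

definition chop :: "('r, 'm) ring_scheme => ('v, 'a) pre_digraph => 'a =>
  (('v, 'a) path => 'r) => ('v, 'a) path => 'r" where
 "chop R Q a x = (\<lambda>(w, bs). if w = head Q a then x (tail Q a, a # bs) else \<zero>\<^bsub>R\<^esub>)"

locale coeff_quiver = cring R + wf_digraph Q for R (structure) and Q :: "('v, 'w) pre_digraph"
begin

lemma families_carrier [simp]: "x : families R Q ==> x p : carrier R"
 by (cases "p : paths Q") (auto simp: families_def simp del: split_paired_All)

lemma families_not_path: "x : families R Q ==> p \<notin> paths Q ==> x p = \<zero>"
 by (auto simp: families_def simp del: families_carrier split_paired_All)

lemma chop_families [simp]: "a : arcs Q ==> x : families R Q ==> chop R Q a x : families R Q"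
 by (auto simp: families_def chop_def paths_Cons simp del: families_carrier split_paired_All)

lemma conv_eq: "conv R Q x y p = (finsum R (\<lambda>(q, r). x q \<otimes> y r) (splittings Q p))"
 by (simp add: path_algebra_def)

lemma conv_not_path: "p \<notin> paths Q ==> conv R Q x y p = \<zero>"
 by (simp add: conv_eq)

lemma conv_families [simp]:
 "x : families R Q ==> y : families R Q ==> conv R Q x y : families R Q"
 unfolding families_def[of R Q] mem_Collect_eq
 by (auto simp: conv_eq intro!: finsum_closed) (auto simp: families_def simp del: families_carrier split_paired_All dest: splittings_paths)

lemma conv_Nil:
 "x : families R Q ==> y : families R Q ==> u : verts Q ==>
 conv R Q x y (u, []) = x (u, []) \<otimes> y (u, [])"
 by (simp add: conv_eq)

lemma conv_Cons:
 assumes "x : families R Q" "y : families R Q" "(u, a # as) : paths Q"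
 shows "conv R Q x y (u, a # as) =
  x (u, []) \<otimes> y (u, a # as) \<oplus> conv R Q (chop R Q a x) y (head Q a, as)"
proof -
 let ?g = "\<lambda>(q, r). ((u, a # snd q), r)"
 have inj: "inj_on ?g (splittings Q (head Q a, as))"
  by (auto simp: inj_on_def splittings_def path_cat_def)
 have "conv R Q x y (u, a # as) = x (u, []) \<otimes> y (u, a # as) \<oplus>
   (finsum R (\<lambda>(q, r). x q \<otimes> y r) (?g ` splittings Q (head Q a, as)))"
  unfolding conv_eq splittings_Cons[OF assms(3)]
  using assms by (subst finsum_insert) (auto simp: paths_Cons)
 also have "(finsum R (\<lambda>(q, r). x q \<otimes> y r) (?g ` splittings Q (head Q a, as))) =
   (finsum R (\<lambda>(q, r). chop R Q a x q \<otimes> y r) (splittings Q (head Q a, as)))"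
  using assms inj
  by (subst finsum_reindex)
   (auto intro!: finsum_cong simp: Pi_def chop_def splittings_def path_cat_def paths_Cons
    simp del: splittings_not_path)
 finally show ?thesis by (simp add: conv_eq)
qed

lemma conv_add_left:
 assumes "x : families R Q" "y : families R Q" "z : families R Q"
 shows "conv R Q (\<lambda>p. x p \<oplus> y p) z p = conv R Q x z p \<oplus> conv R Q y z p"
 unfolding conv_eq using assms
 by (subst finsum_addf[symmetric]) (auto simp: l_distr intro!: finsum_cong)

lemma conv_add_right:
 assumes "x : families R Q" "y : families R Q" "z : families R Q"
 shows "conv R Q z (\<lambda>p. x p \<oplus> y p) p = conv R Q z x p \<oplus> conv R Q z y p"
 unfolding conv_eq using assms
 by (subst finsum_addf[symmetric]) (auto simp: r_distr intro!: finsum_cong)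

lemma conv_smult_left:
 assumes "x : families R Q" "y : families R Q" "c : carrier R"
 shows "conv R Q (\<lambda>p. c \<otimes> x p) y p = c \<otimes> conv R Q x y p"
 unfolding conv_eq using assms
 by (subst finsum_rdistr) (auto simp: m_assoc intro!: finsum_cong)

lemma conv_smult_right:
 assumes "x : families R Q" "y : families R Q" "c : carrier R"
 shows "conv R Q x (\<lambda>p. c \<otimes> y p) p = c \<otimes> conv R Q x y p"
 unfolding conv_eq using assms
 by (subst finsum_rdistr) (auto simp: m_ac intro!: finsum_cong)

lemma conv_zero_left [simp]: "y : families R Q ==> conv R Q (\<lambda>p. \<zero>) y p = \<zero>"
 unfolding conv_eq by (auto intro!: add.finprod_one_eqI)

lemma conv_zero_right [simp]: "y : families R Q ==> conv R Q y (\<lambda>p. \<zero>) p = \<zero>"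
 unfolding conv_eq by (auto intro!: add.finprod_one_eqI)

lemma families_add [simp]:
 "x : families R Q ==> y : families R Q ==> (\<lambda>p. x p \<oplus> y p) : families R Q"
 by (auto simp: families_def simp del: families_carrier split_paired_All)

lemma families_smult [simp]:
 "x : families R Q ==> c : carrier R ==> (\<lambda>p. c \<otimes> x p) : families R Q"
 by (auto simp: families_def simp del: families_carrier split_paired_All)

lemma families_uminus [simp]: "x : families R Q ==> (\<lambda>p. \<ominus> x p) : families R Q"
 by (auto simp: families_def simp del: families_carrier split_paired_All)

lemma chop_conv:
 assumes "x : families R Q" "y : families R Q" "a : arcs Q"
 shows "chop R Q a (conv R Q x y) =
  (\<lambda>p. x (tail Q a, []) \<otimes> chop R Q a y p \<oplus> conv R Q (chop R Q a x) y p)"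
proof
 fix p :: "('v, 'w) path"
 obtain w bs where p: "p = (w, bs)" by (cases p)
 consider "p \<notin> paths Q" | "p : paths Q" "w = head Q a" | "p : paths Q" "w \<noteq> head Q a" by auto
 then show "chop R Q a (conv R Q x y) p =
  x (tail Q a, []) \<otimes> chop R Q a y p \<oplus> conv R Q (chop R Q a x) y p"
 proof cases
  case 1
  moreover have "w = head Q a ==> (tail Q a, a # bs) \<notin> paths Q"
   using 1 by (simp add: p paths_Cons)
  ultimately show ?thesis using assms
   by (auto simp: conv_not_path p chop_def families_not_path)
 next
  case 2
  then show ?thesis using assms by (simp add: p chop_def conv_Cons paths_Cons)
 next
  case 3
  have "conv R Q (chop R Q a x) y p = \<zero>"
   unfolding conv_eq using 3 assms
   by (intro add.finprod_one_eqI)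
    (auto simp: p chop_def splittings_def path_cat_def simp del: splittings_not_path)
  then show ?thesis using 3 assms by (simp add: p chop_def)
 qed
qed

lemma conv_assoc_at:
 assumes "x : families R Q" "y : families R Q" "z : families R Q" "(u, as) : paths Q"
 shows "conv R Q (conv R Q x y) z (u, as) = conv R Q x (conv R Q y z) (u, as)"
 using assms(1,4)
proof (induction as arbitrary: u x)
 case Nil
 then show ?case using assms by (simp add: conv_Nil m_assoc)
next
 case (Cons a as)
 then have a: "a : arcs Q" "tail Q a = u" "(head Q a, as) : paths Q" by (auto simp: paths_Cons)
 note F = assms(2,3) Cons.prems
 have u: "u : verts Q" using F(4) source_in_verts by fastforce
 have "conv R Q (conv R Q x y) z (u, a # as) =
   (x (u, []) \<otimes> y (u, [])) \<otimes> z (u, a # as) \<oplus>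
   (x (u, []) \<otimes> conv R Q (chop R Q a y) z (head Q a, as) \<oplus>
   conv R Q (conv R Q (chop R Q a x) y) z (head Q a, as))"
  using F a u by (simp add: conv_Cons conv_Nil chop_conv conv_add_left conv_smult_left)
 also have "\<dots> = (x (u, []) \<otimes> y (u, [])) \<otimes> z (u, a # as) \<oplus>
   (x (u, []) \<otimes> conv R Q (chop R Q a y) z (head Q a, as) \<oplus>
   conv R Q (chop R Q a x) (conv R Q y z) (head Q a, as))"
  using F a by (simp add: Cons.IH)
 also have "\<dots> = conv R Q x (conv R Q y z) (u, a # as)"
  using F a u by (simp add: conv_Cons r_distr m_assoc a_assoc)
 finally show ?case .
qed

lemma conv_assoc:
 assumes "x : families R Q" "y : families R Q" "z : families R Q"
 shows "conv R Q (conv R Q x y) z = conv R Q x (conv R Q y z)"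
proof
 fix p :: "('v, 'w) path"
 show "conv R Q (conv R Q x y) z p = conv R Q x (conv R Q y z) p"
  using conv_assoc_at[OF assms, of "fst p" "snd p"] by (cases "p : paths Q") (auto simp: conv_not_path)
qed

lemma one_families [simp]: "\<one>\<^bsub>path_algebra R Q\<^esub> : families R Q"
 by (auto simp: families_def path_algebra_def simp del: families_carrier split_paired_All)

lemma conv_one_left:
 assumes "x : families R Q"
 shows "conv R Q \<one>\<^bsub>path_algebra R Q\<^esub> x = x"
proof
 fix p :: "('v, 'w) path"
 have 1: "\<one>\<^bsub>path_algebra R Q\<^esub> = (\<lambda>p. if p : paths Q \<and> snd p = [] then \<one> else \<zero>)"
  by (simp add: path_algebra_def)
 have chop: "chop R Q a \<one>\<^bsub>path_algebra R Q\<^esub> = (\<lambda>p. \<zero>)" for a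
  by (auto simp: chop_def 1)
 obtain u as where p: "p = (u, as)" by (cases p)
 show "conv R Q \<one>\<^bsub>path_algebra R Q\<^esub> x p = x p"
 proof (cases "p : paths Q")
  case True
  then have "u : verts Q" using source_in_verts p by fastforce
  with True assms show ?thesis
   by (cases as) (simp_all add: p conv_Nil conv_Cons chop, simp_all add: 1)
 qed (use assms in \<open>simp add: conv_not_path families_not_path\<close>)
qed

lemma conv_one_right:
 assumes "x : families R Q"
 shows "conv R Q x \<one>\<^bsub>path_algebra R Q\<^esub> = x"
proof
 fix p :: "('v, 'w) path"
 have 1: "\<one>\<^bsub>path_algebra R Q\<^esub> = (\<lambda>p. if p : paths Q \<and> snd p = [] then \<one> else \<zero>)"
  by (simp add: path_algebra_def)
 have *: "(u, as) : paths Q ==> x : families R Q ==> conv R Q x \<one>\<^bsub>path_algebra R Q\<^esub> (u, as) = x (u, as)" for u as x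
 proof (induction as arbitrary: u x)
  case Nil
  then show ?case by (simp add: conv_Nil, simp add: 1)
 next
  case (Cons a as)
  then have a: "a : arcs Q" "tail Q a = u" "(head Q a, as) : paths Q" by (auto simp: paths_Cons)
  have "conv R Q x \<one>\<^bsub>path_algebra R Q\<^esub> (u, a # as) = chop R Q a x (head Q a, as)"
   using Cons a by (simp add: conv_Cons, simp add: 1)
  then show ?case using a by (simp add: chop_def)
 qed
 show "conv R Q x \<one>\<^bsub>path_algebra R Q\<^esub> p = x p"
  using *[of "fst p" "snd p"] assms
  by (cases "p : paths Q") (auto simp: conv_not_path families_not_path)
qed

text \<open>Every set of families closed under the operations is a ring and an \<open>R\<close>-module. This covers
 the path algebra and its completions at once.\<close>

lemma subalgebra_of_families:
 assumes "C \<subseteq> families R Q" "(\<lambda>p. \<zero>) : C" "\<one>\<^bsub>path_algebra R Q\<^esub> : C"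
  and add: "!!x y. x : C ==> y : C ==> (\<lambda>p. x p \<oplus> y p) : C"
  and smult: "!!c x. c : carrier R ==> x : C ==> (\<lambda>p. c \<otimes> x p) : C"
  and conv: "!!x y. x : C ==> y : C ==> conv R Q x y : C"
 shows "ring ((path_algebra R Q)\<lparr>carrier := C\<rparr>)" "module R ((path_algebra R Q)\<lparr>carrier := C\<rparr>)"
proof -
 let ?C = "(path_algebra R Q)\<lparr>carrier := C\<rparr>"
 have sel: "\<zero>\<^bsub>?C\<^esub> = (\<lambda>p. \<zero>)" "\<one>\<^bsub>?C\<^esub> = \<one>\<^bsub>path_algebra R Q\<^esub>"
  "x \<oplus>\<^bsub>?C\<^esub> y = (\<lambda>p. x p \<oplus> y p)" "c \<odot>\<^bsub>?C\<^esub> x = (\<lambda>p. c \<otimes> x p)"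
  "x \<otimes>\<^bsub>?C\<^esub> y = conv R Q x y" "carrier ?C = C" for x y c
  by (simp_all add: path_algebra_def)
 have C: "x : C ==> x p : carrier R" for x p
  using assms(1) by (auto intro: families_carrier[OF subsetD])
 have C': "x : C ==> x : families R Q" for x using assms(1) by blast
 have ab: "abelian_group ?C"
 proof (rule abelian_groupI, unfold sel)
  fix x assume x: "x : C"
  show "\<exists>y\<in>C. (\<lambda>p. y p \<oplus> x p) = (\<lambda>p. \<zero>)"
  proof (rule bexI)
   show "(\<lambda>p. \<ominus> \<one> \<otimes> x p) : C" using smult x by simp
   show "(\<lambda>p. (\<ominus> \<one> \<otimes> x p) \<oplus> x p) = (\<lambda>p. \<zero>)"
    using x C by (simp add: l_minus l_neg)
  qed
 qed (auto simp: assms C a_ac)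
 show "ring ?C"
 proof (rule ringI[OF ab])
  show "monoid ?C"
   by (rule monoidI; unfold sel)
    (use assms(3) in \<open>auto simp: conv C' conv_assoc conv_one_left conv_one_right\<close>)
 qed (auto simp: sel C' conv_add_left conv_add_right)
 show "module R ?C"
  by (rule moduleI[OF is_cring ab]) (auto simp: sel smult C l_distr r_distr m_assoc)
qed

end

lemma ring_hom_finsum:
 assumes "f : ring_hom R R'" "ring R" "ring R'" "finite A" "!!i. i : A ==> h i : carrier R"
 shows "f (finsum R h A) = finsum R' (\<lambda>i. f (h i)) A"
proof -
 interpret R: ring R by fact
 interpret R': ring R' by fact
 show ?thesis using assms(4,5)
  by (induction A rule: finite_induct)
   (auto simp: ring_hom_zero[OF assms(1-3)] ring_hom_add[OF assms(1)] ring_hom_closed[OF assms(1)]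
    R.finsum_insert R'.finsum_insert Pi_def)
qed

lemma ring_hom_conv:
 assumes f: "f : ring_hom R R'" and "coeff_quiver R Q" "coeff_quiver R' Q"
  and xy: "x : families R Q" "y : families R Q"
 shows "f \<circ> conv R Q x y = conv R' Q (f \<circ> x) (f \<circ> y)"
proof
 fix p
 interpret R: coeff_quiver R Q by fact
 interpret R': coeff_quiver R' Q by fact
 show "(f \<circ> conv R Q x y) p = conv R' Q (f \<circ> x) (f \<circ> y) p"
  unfolding R.conv_eq R'.conv_eq comp_def
  using xy by (subst ring_hom_finsum[OF f R.ring_axioms R'.ring_axioms])
   (auto intro!: R'.finsum_cong simp: ring_hom_mult[OF f] ring_hom_closed[OF f])
qed

lemma ring_hom_families:
 assumes "f : ring_hom R R'" "ring R" "ring R'" "x : families R Q"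
 shows "f \<circ> x : families R' Q"
 using assms by (auto simp: families_def ring_hom_closed[OF assms(1)] ring_hom_zero[OF assms(1-3)])

section \<open>Paths as elements of path algebras\<close>

lemma ring_hom_path_elem:
 assumes "f : ring_hom R R'" "ring R" "ring R'"
 shows "f \<circ> path_elem R p = path_elem R' p"
 by (auto simp: path_elem_def ring_hom_one[OF assms(1)] ring_hom_zero[OF assms])

context coeff_quiver
begin

lemma path_elem_families [simp]: "p : paths Q ==> path_elem R p : families R Q"
 by (auto simp: families_def path_elem_def simp del: families_carrier split_paired_All)

lemma path_elem_carrier [simp]: "path_elem R p q : carrier R"
 by (simp add: path_elem_def)

lemma conv_path_elem_left:
 assumes "y : families R Q" "(u, as @ bs) : paths Q"
 shows "conv R Q (path_elem R (u, as)) y (u, as @ bs) = y (target Q (u, as), bs)"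
proof -
 let ?r = "((u, as), (target Q (u, as), bs))"
 have r: "?r : splittings Q (u, as @ bs)"
  using assms(2) by (auto simp: splittings_def paths_append path_cat_def source_def)
 have "conv R Q (path_elem R (u, as)) y (u, as @ bs) =
   (\<Oplus>j\<in>splittings Q (u, as @ bs). if ?r = j then (\<lambda>j. y (snd j)) j else \<zero>)"
  unfolding conv_eq
 proof (rule finsum_cong'[OF refl])
  show "(\<lambda>j. if ?r = j then (\<lambda>j. y (snd j)) j else \<zero>) : splittings Q (u, as @ bs) \<rightarrow> carrier R"
   using assms by simp
  fix j assume j: "j : splittings Q (u, as @ bs)"
  have *: "j = ?r" if "fst j = (u, as)"
  proof -
   obtain a b c d where "j = ((a, b), (c, d))" by (metis surj_pair)
   with j that show ?thesis
    by (clarsimp simp: splittings_def path_cat_def source_def)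
  qed
  show "(case j of (q, r) => path_elem R (u, as) q \<otimes> y r) = (if ?r = j then (\<lambda>j. y (snd j)) j else \<zero>)"
  proof (cases "j = ?r")
   case True
   then show ?thesis using families_carrier[OF assms(1), of "(target Q (u, as), bs)"] by (simp add: path_elem_def)
  next
   case False
   obtain q r where qr: "j = (q, r)" by (cases j)
   have "path_elem R (u, as) q = \<zero>" using * False by (auto simp: path_elem_def qr)
   then show ?thesis using False families_carrier[OF assms(1), of r] by (auto simp: qr)
  qed
 qed
 also have "\<dots> = y (target Q (u, as), bs)"
  using assms r by (subst finsum_singleton) auto
 finally show ?thesis .
qed

lemma conv_path_elem_left_nonzero:
 assumes "y : families R Q" "conv R Q (path_elem R q) y p \<noteq> \<zero>"
 obtains r where "(q, r) : splittings Q p" "y r \<noteq> \<zero>"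
proof -
 have "\<exists>(q', r)\<in>splittings Q p. path_elem R q q' \<otimes> y r \<noteq> \<zero>"
 proof (rule ccontr)
  assume "\<not> ?thesis"
  then have "conv R Q (path_elem R q) y p = \<zero>"
   unfolding conv_eq by (intro add.finprod_one_eqI) auto
  with assms(2) show False by simp
 qed
 then obtain q' r where "(q', r) : splittings Q p" "path_elem R q q' \<otimes> y r \<noteq> \<zero>" by blast
 moreover from this have "q' = q" "y r \<noteq> \<zero>"
  using families_carrier[OF assms(1), of r] by (auto simp: path_elem_def split: if_splits)
 ultimately show thesis using that by blast
qed

lemma conv_path_elem_right:
 assumes "x : families R Q" "(u, as @ bs) : paths Q"
 shows "conv R Q x (path_elem R (target Q (u, as), bs)) (u, as @ bs) = x (u, as)"
proof -
 let ?r = "((u, as), (target Q (u, as), bs))"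
 have r: "?r : splittings Q (u, as @ bs)"
  using assms(2) by (auto simp: splittings_def paths_append path_cat_def source_def)
 have "conv R Q x (path_elem R (target Q (u, as), bs)) (u, as @ bs) =
   (\<Oplus>j\<in>splittings Q (u, as @ bs). if ?r = j then (\<lambda>j. x (fst j)) j else \<zero>)"
  unfolding conv_eq
 proof (rule finsum_cong'[OF refl])
  show "(\<lambda>j. if ?r = j then (\<lambda>j. x (fst j)) j else \<zero>) : splittings Q (u, as @ bs) \<rightarrow> carrier R"
   using assms by simp
  fix j assume j: "j : splittings Q (u, as @ bs)"
  have *: "j = ?r" if "snd j = (target Q (u, as), bs)"
  proof -
   obtain a b c d where "j = ((a, b), (c, d))" by (metis surj_pair)
   with j that show ?thesis
    by (clarsimp simp: splittings_def path_cat_def source_def)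
  qed
  show "(case j of (q, r) => x q \<otimes> path_elem R (target Q (u, as), bs) r) = (if ?r = j then (\<lambda>j. x (fst j)) j else \<zero>)"
  proof (cases "j = ?r")
   case True
   then show ?thesis using families_carrier[OF assms(1), of "(u, as)"] by (simp add: path_elem_def)
  next
   case False
   obtain q r where qr: "j = (q, r)" by (cases j)
   have "path_elem R (target Q (u, as), bs) r = \<zero>" using * False by (auto simp: path_elem_def qr)
   then show ?thesis using False families_carrier[OF assms(1), of q] by (auto simp: qr)
  qed
 qed
 also have "\<dots> = x (u, as)"
  using assms r by (subst finsum_singleton) auto
 finally show ?thesis .
qed

lemma conv_path_elem_right_nonzero:
 assumes "x : families R Q" "conv R Q x (path_elem R r) p \<noteq> \<zero>"
 obtains q where "(q, r) : splittings Q p" "x q \<noteq> \<zero>"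
proof -
 have "\<exists>(q, r')\<in>splittings Q p. x q \<otimes> path_elem R r r' \<noteq> \<zero>"
 proof (rule ccontr)
  assume "\<not> ?thesis"
  then have "conv R Q x (path_elem R r) p = \<zero>"
   unfolding conv_eq by (intro add.finprod_one_eqI) auto
  with assms(2) show False by simp
 qed
 then obtain q r' where "(q, r') : splittings Q p" "x q \<otimes> path_elem R r r' \<noteq> \<zero>" by blast
 moreover from this have "r' = r" "x q \<noteq> \<zero>"
  using families_carrier[OF assms(1), of q] by (auto simp: path_elem_def split: if_splits)
 ultimately show thesis using that by blast
qed

lemma conv_path_elems:
 assumes "p : paths Q" "q : paths Q"
 shows "conv R Q (path_elem R p) (path_elem R q) =
  (if target Q p = source q then path_elem R (path_cat p q) else (\<lambda>_. \<zero>))"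
proof
 fix p' :: "('v, 'w) path"
 note q = path_elem_families[OF assms(2)]
 show "conv R Q (path_elem R p) (path_elem R q) p' =
  (if target Q p = source q then path_elem R (path_cat p q) else (\<lambda>_. \<zero>)) p'"
 proof (cases "target Q p = source q \<and> p' = path_cat p q")
  case True
  have "(fst p, snd p @ snd q) : paths Q" "target Q (fst p, snd p) = fst q"
   using assms True by (auto simp: paths_append source_def)
  then show ?thesis using True conv_path_elem_left[OF q, of "fst p" "snd p" "snd q"]
   by (simp add: path_cat_def path_elem_def source_def)
 next
  case False
  have "conv R Q (path_elem R p) (path_elem R q) p' = \<zero>"
  proof (rule ccontr)
   assume "conv R Q (path_elem R p) (path_elem R q) p' \<noteq> \<zero>"
   then obtain r where "(p, r) : splittings Q p'" "path_elem R q r \<noteq> \<zero>"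
    using conv_path_elem_left_nonzero[OF q] by blast
   then show False using False by (auto simp: splittings_def path_elem_def split: if_splits)
  qed
  then show ?thesis using False by (auto simp: path_elem_def)
 qed
qed

end

declare split_paired_All [simp del] split_paired_Ex [simp del]

section \<open>Adic coefficient rings\<close>

lemma one_ideals_set [simp]: "\<one>\<^bsub>ideals_set R\<^esub> = carrier R"
 by (simp add: ideals_set_def)

locale adic_ring = cring B for B (structure) +
 fixes m
 assumes m_ideal: "ideal m B"
  and complete: "complete_filtration B (ideal_power B m)"
  and powers_fg: "\<exists>G. finite G \<and> G \<subseteq> carrier B \<and> ideal_power B m n = Idl G"
begin

abbreviation F :: "nat => 'a set" where "F n \<equiv> ideal_power B m n"

lemma m_ideals_set: "m : carrier (ideals_set B)"
 using m_ideal by (simp add: ideals_set_def)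

lemma F_ideal: "ideal (F n) B"
proof -
 interpret M: comm_monoid "ideals_set B" by (rule ideals_set_is_comm_monoid)
 have "F n : carrier (ideals_set B)" using m_ideals_set by (rule M.nat_pow_closed)
 then show ?thesis by (simp add: ideals_set_def)
qed

lemma F_0 [simp]: "F 0 = carrier B"
 by (simp add: ideals_set_def nat_pow_def)

lemma F_plus: "F (n + k) = F n \<cdot> F k"
proof -
 interpret M: comm_monoid "ideals_set B" by (rule ideals_set_is_comm_monoid)
 show ?thesis using M.nat_pow_mult[OF m_ideals_set, of n k] by (simp add: ideals_set_def)
qed

lemma F_1 [simp]: "F (Suc 0) = m"
proof -
 interpret M: comm_monoid "ideals_set B" by (rule ideals_set_is_comm_monoid)
 show ?thesis using M.nat_pow_eone[OF m_ideals_set] by simp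
qed

lemma F_mult: "a : F n ==> b : F k ==> a \<otimes> b : F (n + k)"
 unfolding F_plus by (rule ideal_prod.prod)

lemma F_antimono: "n \<le> k ==> F k \<subseteq> F n"
 using ideal_prod_inter[OF F_ideal F_ideal, of n "k - n"] F_plus[of n "k - n"] by auto

lemma F_carrier: "a : F n ==> a : carrier B"
 using ideal.Icarr[OF F_ideal] .

lemma F_zero [simp]: "\<zero> : F n"
 by (rule additive_subgroup.zero_closed[OF ideal.axioms(1)[OF F_ideal]])

lemma F_add: "a : F n ==> b : F n ==> a \<oplus> b : F n"
 by (rule additive_subgroup.a_closed[OF ideal.axioms(1)[OF F_ideal]])

lemma F_uminus: "a : F n ==> \<ominus> a : F n"
 by (rule additive_subgroup.a_inv_closed[OF ideal.axioms(1)[OF F_ideal]])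

lemma F_minus: "a : F n ==> b : F n ==> a \<ominus> b : F n"
 by (simp add: a_minus_def F_add F_uminus)

lemma F_smult: "c : carrier B ==> a : F n ==> c \<otimes> a : F n"
 by (rule ideal.I_l_closed[OF F_ideal])

lemma F_finsum: "(!!i. i : A ==> h i : F n) ==> finsum B h A : F n"
proof (induction A rule: infinite_finite_induct)
 case (insert x A)
 then show ?case by (subst finsum_insert) (auto intro: F_carrier F_add)
qed (simp_all add: finsum_infinite)

lemma F_separated:
 assumes "b : carrier B" "!!n. b : F n"
 shows "b = \<zero>"
proof -
 have "\<exists>!y. y : F 0 \<and> (\<forall>n. y \<ominus> \<zero> : F n)"
  using complete[unfolded complete_filtration_def, rule_format, of "\<lambda>n. \<zero>"] by (simp add: a_minus_def)
 moreover have "b : F 0 \<and> (\<forall>n. b \<ominus> \<zero> : F n)" using assms by (simp add: a_minus_def)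
 moreover have "\<zero> : F 0 \<and> (\<forall>n. \<zero> \<ominus> \<zero> : F n)" by (simp add: a_minus_def)
 ultimately show ?thesis by blast
qed

lemma F_limit:
 assumes "!!n. x n : carrier B" "!!n. x (Suc n) \<ominus> x n : F n"
 obtains y where "y : carrier B" "!!n. y \<ominus> x n : F n"
 using complete[unfolded complete_filtration_def, rule_format, of x] assms by (auto simp del: One_nat_def)

text \<open>Finite generation of the powers of \<open>m\<close>, in a form that respects the filtration: one finite
 set of generators of \<open>F n\<close> expresses all elements of the deeper \<open>F (n + k)\<close> with coefficients
 in \<open>F k\<close>.\<close>

lemma F_generators:
 obtains G where "finite G" "G \<subseteq> F n"
  "!!k c. c : F (n + k) ==> \<exists>d. d : G \<rightarrow> F k \<and> c = (\<Oplus>g\<in>G. g \<otimes> d g)"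
proof -
 obtain G where G: "finite G" "G \<subseteq> carrier B" "F n = Idl G"
  using powers_fg by blast
 define L where "L k = {(\<Oplus>g\<in>G. g \<otimes> d g) | d. d : G \<rightarrow> F k}" for k
 have dc: "d g : carrier B" if "d : G \<rightarrow> F k" "g : G" for d k g
  using that F_carrier[of "d g" k] by auto
 have Gc: "g : carrier B" if "g : G" for g using that G by auto
 have L_carrier: "L k \<subseteq> carrier B" for k
  unfolding L_def using dc Gc by (auto intro!: finsum_closed)
 have L_add: "x \<oplus> y : L k" if "x : L k" "y : L k" for x y k
 proof -
  from that obtain d d' where d: "d : G \<rightarrow> F k" "d' : G \<rightarrow> F k"
   and x: "x = (\<Oplus>g\<in>G. g \<otimes> d g)" and y: "y = (\<Oplus>g\<in>G. g \<otimes> d' g)" unfolding L_def by blast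
  have "x \<oplus> y = (\<Oplus>g\<in>G. g \<otimes> d g \<oplus> g \<otimes> d' g)"
   unfolding x y by (subst finsum_addf) (auto intro: dc[OF d(1)] dc[OF d(2)] Gc)
  also have "\<dots> = (\<Oplus>g\<in>G. g \<otimes> (d g \<oplus> d' g))"
   using dc[OF d(1)] dc[OF d(2)] Gc by (intro finsum_cong'[OF refl]) (auto simp: r_distr)
  finally show ?thesis
   unfolding L_def using d by (auto intro!: exI[of _ "\<lambda>g. d g \<oplus> d' g"] F_add)
 qed
 have L_mult: "x \<otimes> r : L k" if "x : L j" "r : F k" for x r j k
 proof -
  from that obtain d where d: "d : G \<rightarrow> F j" and x: "x = (\<Oplus>g\<in>G. g \<otimes> d g)" unfolding L_def by blast
  have r: "r : carrier B" using that F_carrier by blast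
  have "x \<otimes> r = (\<Oplus>g\<in>G. g \<otimes> d g \<otimes> r)"
   unfolding x by (subst finsum_ldistr[OF G(1) r]) (auto intro: dc[OF d] Gc)
  also have "\<dots> = (\<Oplus>g\<in>G. g \<otimes> (d g \<otimes> r))"
   using dc[OF d] Gc r by (intro finsum_cong'[OF refl]) (auto simp: m_assoc)
  finally show ?thesis
   unfolding L_def using dc[OF d] that by (auto intro!: exI[of _ "\<lambda>g. d g \<otimes> r"] F_smult)
 qed
 have L_ideal: "ideal (L 0) B"
 proof (rule idealI[OF ring_axioms])
  show "subgroup (L 0) (add_monoid B)"
  proof (rule add.subgroupI)
   have "(\<Oplus>g\<in>G. g \<otimes> \<one>) : L 0" unfolding L_def by (auto intro!: exI[of _ "\<lambda>g. \<one>"])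
   then show "L 0 \<noteq> {}" by blast
   show "\<ominus> a : L 0" if "a : L 0" for a
   proof -
    have "a \<otimes> \<ominus> \<one> : L 0" by (rule L_mult[OF that]) simp
    then show ?thesis using that L_carrier[of 0] by (auto simp: r_minus)
   qed
  qed (use L_carrier L_add in \<open>auto\<close>)
  show "a \<otimes> x : L 0" if "a : L 0" "x : carrier B" for a x
   using L_mult[OF that(1), of x 0] that by simp
  then show "x \<otimes> a : L 0" if "a : L 0" "x : carrier B" for a x
   using that L_carrier[of 0] by (auto simp: m_comm[of x a])
 qed
 have "G \<subseteq> L 0"
 proof
  fix g assume g: "g : G"
  have "(\<Oplus>j\<in>G. j \<otimes> (if g = j then \<one> else \<zero>)) = (\<Oplus>j\<in>G. if g = j then j else \<zero>)"
   by (rule finsum_cong') (auto simp: Gc)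
  also have "\<dots> = g" using finsum_singleton[OF g G(1), of "\<lambda>j. j"] G(2) by auto
  finally show "g : L 0" unfolding L_def by (force intro!: exI[of _ "\<lambda>j. if g = j then \<one> else \<zero>"])
 qed
 then have FL: "F n \<subseteq> L 0" unfolding G(3) by (rule genideal_minimal[OF L_ideal])
 have "c : L k" if "c : F (n + k)" for c k
  using that unfolding F_plus
 proof (induction rule: ideal_prod.induct)
  case (prod i j)
  then show ?case using FL L_mult by blast
 next
  case (sum s1 s2)
  then show ?case using L_add by blast
 qed
 then have "\<exists>d. d : G \<rightarrow> F k \<and> c = (\<Oplus>g\<in>G. g \<otimes> d g)" if "c : F (n + k)" for c k
  using that unfolding L_def by blast
 moreover have "G \<subseteq> F n" using genideal_self[OF G(2)] G(3) by simp
 ultimately show thesis using that G(1) by blast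
qed

end

section \<open>Completed path algebras\<close>

text \<open>The completed free module on a set \<open>X\<close> of paths, together with its \<open>m\<close>-adic filtration.\<close>

definition fspan :: "('b, 'm) ring_scheme => 'b set => ('v, 'w) pre_digraph =>
  ('v, 'w) path set => nat => (('v, 'w) path => 'b) set" where
 "fspan B m Q X n = {x : carrier (completed_path_algebra B m Q).
  (\<forall>p. p \<notin> X \<longrightarrow> x p = \<zero>\<^bsub>B\<^esub>) \<and> (\<forall>p. x p : ideal_power B m n)}"

locale adic_quiver = adic_ring B m + fin_digraph Q
 for B (structure) and m and Q :: "('v, 'w) pre_digraph"

sublocale adic_quiver \<subseteq> coeff_quiver B Q ..

context adic_quiver
begin

abbreviation P where "P \<equiv> completed_path_algebra B m Q"
abbreviation T where "T X n \<equiv> fspan B m Q X n"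
abbreviation plus_P (infixl "\<boxplus>" 65) where "plus_P \<equiv> add P"
abbreviation minus_P (infixl "\<boxminus>" 65) where "minus_P \<equiv> a_minus P"
abbreviation uminus_P ("\<boxminus> _" [81] 80) where "uminus_P \<equiv> a_inv P"
abbreviation times_P (infixl "\<boxtimes>" 70) where "times_P \<equiv> monoid.mult P"
abbreviation smult_P (infixl "\<bullet>" 70) where "smult_P \<equiv> smult P"
abbreviation zero_P ("\<zero>\<^sub>P") where "zero_P \<equiv> zero P"
abbreviation one_P ("\<one>\<^sub>P") where "one_P \<equiv> one P"
abbreviation coset_P (infixl "+>\<^sub>P" 60) where "coset_P \<equiv> a_r_coset P"
abbreviation pe where "pe \<equiv> path_elem B"

lemma P_record: "(path_algebra B Q)\<lparr>carrier := carrier P\<rparr> = P"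
 by (simp add: completed_path_algebra_def del: families_carrier)

lemma P_apply [simp]:
 "\<zero>\<^sub>P p = \<zero>" "(x \<boxplus> y) p = x p \<oplus> y p" "(c \<bullet> x) p = c \<otimes> x p"
 by (simp_all add: completed_path_algebra_def path_algebra_def del: families_carrier)

lemma P_zero: "\<zero>\<^sub>P = (\<lambda>p. \<zero>)" by (rule ext) simp
lemma P_smult: "c \<bullet> x = (\<lambda>p. c \<otimes> x p)" by (rule ext) simp
lemma P_mult: "x \<boxtimes> y = conv B Q x y"
 by (simp add: completed_path_algebra_def del: families_carrier)
lemma P_one: "\<one>\<^sub>P = \<one>\<^bsub>path_algebra B Q\<^esub>"
 by (simp add: completed_path_algebra_def del: families_carrier)

lemma families_I:
 "(!!p. x p : carrier B) ==> (!!p. p \<notin> paths Q ==> x p = \<zero>) ==> x : families B Q"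
 by (simp add: families_def del: families_carrier)

lemma P_iff: "x : carrier P \<longleftrightarrow> x : families B Q \<and> (\<forall>n. finite {p. x p \<notin> F n})"
proof -
 have "{p. x p \<notin> F n} = {p : paths Q. x p \<notin> F n}" if "x : families B Q" for n
  using families_not_path[OF that] by (metis (lifting) F_zero)
 moreover have "x : carrier P \<longleftrightarrow> x : families B Q \<and> (\<forall>n. finite {p : paths Q. x p \<notin> F n})"
  by (simp add: completed_path_algebra_def families_def del: split_paired_All families_carrier)
 ultimately show ?thesis by (cases "x : families B Q") simp_all
qed

lemma P_I: "x : families B Q ==> (!!n. finite {p. x p \<notin> F n}) ==> x : carrier P"
 unfolding P_iff by blast

lemma P_finite: "x : carrier P ==> finite {p. x p \<notin> F n}"
 unfolding P_iff by blast

lemma P_families [simp]: "x : carrier P ==> x : families B Q"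
 unfolding P_iff by blast

lemma P_coeff [simp]: "x : carrier P ==> x p : carrier B"
 by (rule families_carrier[OF P_families])

lemma P_conv_closed:
 assumes "x : carrier P" "y : carrier P"
 shows "conv B Q x y : carrier P"
 unfolding P_iff
proof (intro conjI allI)
 show "conv B Q x y : families B Q" using assms by simp
 fix n
 let ?A = "{p. x p \<notin> F n}" and ?A' = "{p. y p \<notin> F n}"
 have "{p. conv B Q x y p \<notin> F n} \<subseteq> (\<lambda>(q, r). path_cat q r) ` (?A \<times> ?A')"
 proof
  fix p assume "p : {p. conv B Q x y p \<notin> F n}"
  then have "\<exists>i\<in>splittings Q p. (case i of (q, r) => x q \<otimes> y r) \<notin> F n"
   unfolding conv_eq using F_finsum by (metis (no_types, lifting) mem_Collect_eq)
  then obtain q r where qr: "(q, r) : splittings Q p" "x q \<otimes> y r \<notin> F n" by auto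
  have "x q \<notin> F n" "y r \<notin> F n"
   using qr(2) F_smult[of "x q" "y r" n] F_smult[of "y r" "x q" n] assms
   by (auto simp: m_comm[of "x q" "y r"])
  moreover have "p = path_cat q r" using qr(1) by (simp add: splittings_def)
  ultimately show "p : (\<lambda>(q, r). path_cat q r) ` (?A \<times> ?A')" by auto
 qed
 then show "finite {p. conv B Q x y p \<notin> F n}"
  by (rule finite_subset) (use assms P_finite in auto)
qed

lemma finite_trivial_paths: "finite {p. p : paths Q \<and> snd p = []}"
proof -
 have "{p. p : paths Q \<and> snd p = []} \<subseteq> (\<lambda>u. (u, [])) ` verts Q" by auto
 then show ?thesis by (rule finite_subset) simp
qed

lemma P_one_closed: "\<one>\<^bsub>path_algebra B Q\<^esub> : carrier P"
proof -
 have "{p. \<one>\<^bsub>path_algebra B Q\<^esub> p \<notin> F n} \<subseteq> {p. p : paths Q \<and> snd p = []}" for n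
  by (auto simp: path_algebra_def)
 then show ?thesis unfolding P_iff using finite_trivial_paths finite_subset one_families by blast
qed

lemma P_add_closed:
 assumes "x : carrier P" "y : carrier P"
 shows "(\<lambda>p. x p \<oplus> y p) : carrier P"
proof -
 have "{p. x p \<oplus> y p \<notin> F n} \<subseteq> {p. x p \<notin> F n} \<union> {p. y p \<notin> F n}" for n
  using F_add by auto
 then have "finite {p. x p \<oplus> y p \<notin> F n}" for n
  by (rule finite_subset) (intro finite_UnI P_finite assms)
 then show ?thesis using assms by (intro P_I) simp_all
qed

lemma P_smult_closed:
 assumes "x : carrier P" "c : carrier B"
 shows "(\<lambda>p. c \<otimes> x p) : carrier P"
proof -
 have "{p. c \<otimes> x p \<notin> F n} \<subseteq> {p. x p \<notin> F n}" for n
  using F_smult assms by auto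
 then have "finite {p. c \<otimes> x p \<notin> F n}" for n
  by (rule finite_subset) (intro P_finite assms)
 then show ?thesis using assms by (intro P_I) simp_all
qed

lemma P_ring: "ring P" and P_module: "module B P"
proof -
 have "(\<lambda>p. \<zero>) : carrier P" by (rule P_I) (simp_all add: families_def del: families_carrier)
 note * = subalgebra_of_families[of "carrier P", unfolded P_record, OF _ this P_one_closed
   P_add_closed P_smult_closed P_conv_closed]
 show "ring P" by (rule *(1)) auto
 show "module B P" by (rule *(2)) auto
qed

end

sublocale adic_quiver \<subseteq> P: ring "completed_path_algebra B m Q" by (rule P_ring)
sublocale adic_quiver \<subseteq> PM: module B "completed_path_algebra B m Q" by (rule P_module)

context adic_quiver
begin

lemma P_uminus_apply [simp]: "x : carrier P ==> (\<boxminus> x) p = \<ominus> x p"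
proof -
 assume x: "x : carrier P"
 have "(x \<boxplus> \<boxminus> x) p = \<zero>" using x by (simp only: P.r_neg P_apply)
 then show ?thesis using x by (metis P.a_inv_closed P_apply(2) P_coeff a_comm minus_equality)
qed

lemma P_minus_apply [simp]:
 "x : carrier P ==> y : carrier P ==> (x \<boxminus> y) p = x p \<ominus> y p"
 by (simp add: a_minus_def)

lemma path_elem_P [simp]: "p : paths Q ==> path_elem B p : carrier P"
proof -
 assume "p : paths Q"
 moreover have "{q. path_elem B p q \<notin> F n} \<subseteq> {p}" for n by (auto simp: path_elem_def)
 ultimately show ?thesis unfolding P_iff by (meson finite.emptyI finite_insert finite_subset path_elem_families)
qed

lemma T_P: "x : T X n ==> x : carrier P" by (simp add: fspan_def)
lemma T_F: "x : T X n ==> x p : F n" by (simp add: fspan_def)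
lemma T_supp: "x : T X n ==> p \<notin> X ==> x p = \<zero>" by (simp add: fspan_def)
lemma T_I: "x : carrier P ==> (!!p. p \<notin> X ==> x p = \<zero>) ==> (!!p. x p : F n) ==> x : T X n"
 by (simp add: fspan_def del: split_paired_All)
lemma T_UNIV_0 [simp]: "T UNIV 0 = carrier P" by (auto simp: fspan_def)
lemma T_mono: "X \<subseteq> Y ==> k \<le> n ==> x : T X n ==> x : T Y k"
 using F_antimono[of k n] by (auto simp: fspan_def)
lemma T_zero [simp]: "\<zero>\<^sub>P : T X n" by (simp add: fspan_def)
lemma T_add: "x : T X n ==> y : T X n ==> x \<boxplus> y : T X n"
 by (rule T_I) (auto simp: T_P T_supp T_F F_add)
lemma T_uminus: "x : T X n ==> \<boxminus> x : T X n"
 by (rule T_I) (auto simp: T_P T_supp T_F F_uminus)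
lemma T_minus: "x : T X n ==> y : T X n ==> x \<boxminus> y : T X n"
 by (simp add: a_minus_def T_add T_uminus)
lemma T_smult: "x : T X n ==> c : carrier B ==> c \<bullet> x : T X n"
 by (rule T_I) (auto simp: T_P T_supp T_F F_smult)
lemma T_smult_F: "x : T X k ==> c : F n ==> c \<bullet> x : T X (n + k)"
 by (rule T_I) (auto simp: T_P T_supp T_F F_mult F_carrier)
lemma T_finsum: "(!!i. i : A ==> h i : T X n) ==> finsum P h A : T X n"
proof (induction A rule: infinite_finite_induct)
 case (insert x A)
 then show ?case by (subst P.finsum_insert) (auto intro: T_P T_add)
qed (simp_all add: P.finsum_infinite)
lemma T_path_elem: "p : paths Q ==> p : X ==> path_elem B p : T X 0"
 by (rule T_I) (simp, auto simp: path_elem_def)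
lemma T_mult:
 assumes "x : T UNIV n" "y : T UNIV k"
 shows "x \<boxtimes> y : T UNIV (n + k)"
proof (rule T_I)
 show "x \<boxtimes> y : carrier P" using assms by (simp add: T_P)
 show "(x \<boxtimes> y) p : F (n + k)" for p
  unfolding P_mult conv_eq by (rule F_finsum) (use assms in \<open>auto simp: T_F F_mult\<close>)
qed simp

lemma P_separated:
 assumes "x : carrier P" "!!n. x : T UNIV n"
 shows "x = \<zero>\<^sub>P"
proof
 fix p
 have "x p : F n" for n using T_F[OF assms(2)] .
 then show "x p = \<zero>\<^sub>P p" using F_separated[of "x p"] assms(1) by simp
qed

lemma P_eqI:
 assumes "x : carrier P" "y : carrier P" "!!n. x \<boxminus> y : T UNIV n"
 shows "x = y"
 using P_separated[of "x \<boxminus> y"] assms by simp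

text \<open>Limits exist coefficientwise; the limit is again finitely supported modulo each power
 of \<open>m\<close> because it agrees there with a member of the sequence.\<close>

lemma T_limit:
 assumes x: "!!n. x n : T X 0" "!!n. x (Suc n) \<boxminus> x n : T X n"
 obtains y where "y : T X 0" "!!n. y \<boxminus> x n : T X n"
proof -
 note xP = T_P[OF x(1)]
 have "\<exists>b. b : carrier B \<and> (\<forall>n. b \<ominus> x n p : F n)" for p
 proof (rule F_limit[of "\<lambda>n. x n p"])
  show "x (Suc n) p \<ominus> x n p : F n" for n
   using T_F[OF x(2), of n p] xP by simp
 qed (use xP in auto)
 then obtain y where y: "!!p. y p : carrier B" "!!p n. y p \<ominus> x n p : F n" by metis
 have y0: "y p = \<zero>" if "!!n. x n p = \<zero>" for p
  by (rule F_separated) (use y(1,2)[of p] that in \<open>auto simp: a_minus_def\<close>)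
 have yF: "y p : F n" if "x n p : F n" for p n
 proof -
  have "y p = (y p \<ominus> x n p) \<oplus> x n p" using y xP by (simp add: a_minus_def a_assoc l_neg)
  then show ?thesis using F_add[OF y(2)[of p n] that] by simp
 qed
 have "y : families B Q"
  using y0 y(1) families_not_path[OF P_families[OF xP]] unfolding families_def by (simp del: split_paired_All families_carrier)
 moreover have "{p. y p \<notin> F n} \<subseteq> {p. x n p \<notin> F n}" for n using yF by auto
 ultimately have yP: "y : carrier P" unfolding P_iff using P_finite[OF xP] finite_subset by blast
 show thesis
 proof
  show "y : T X 0"
  proof (rule T_I[OF yP])
   show "y p = \<zero>" if "p \<notin> X" for p using y0[OF T_supp[OF x(1) that]] .
  qed (simp add: y)
  show "y \<boxminus> x n : T X n" for n
  proof (rule T_I)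
   show "(y \<boxminus> x n) p = \<zero>" if "p \<notin> X" for p
    using that yP xP y0 T_supp[OF x(1)] by (simp add: a_minus_def)
  qed (use yP xP y(2) in auto)
 qed
qed

lemma restrict_T:
 assumes "x : T X n"
 shows "(\<lambda>p. if p : Y then x p else \<zero>) : T (X \<inter> Y) n"
proof (rule T_I)
 have x: "x : carrier P" using assms by (rule T_P)
 have "{p. (if p : Y then x p else \<zero>) \<notin> F k} \<subseteq> {p. x p \<notin> F k}" for k by auto
 then have "finite {p. (if p : Y then x p else \<zero>) \<notin> F k}" for k
  using P_finite[OF x] finite_subset by blast
 moreover have "(\<lambda>p. if p : Y then x p else \<zero>) : families B Q"
  using P_families[OF x] by (auto simp: families_def simp del: split_paired_All families_carrier P_families)
 ultimately show "(\<lambda>p. if p : Y then x p else \<zero>) : carrier P" by (intro P_I)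
qed (use assms in \<open>auto simp: T_supp T_F\<close>)

lemma split_T:
 assumes "x : T X n"
 shows "x = (\<lambda>p. if p : Y then x p else \<zero>) \<boxplus> (\<lambda>p. if p : - Y then x p else \<zero>)"
 using T_P[OF assms] by (intro ext) auto

text \<open>An element is a finite combination of paths up to any given power of \<open>m\<close>; inducting on the
 number of its coefficients outside that power avoids all sums.\<close>

lemma approx_induct [consumes 1, case_names add path small]:
 assumes x: "x : T X j"
  and add: "!!x y. x : T X j ==> y : T X j ==> Z x ==> Z y ==> Z (x \<boxplus> y)"
  and path: "!!c p. c : F j ==> p : X ==> p : paths Q ==> Z (c \<bullet> path_elem B p)"
  and small: "!!z. z : T X j ==> z : T X n ==> Z z"
 shows "Z x"
 using x
proof (induction "card {p. x p \<notin> F n}" arbitrary: x)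
 case 0
 then have "{p. x p \<notin> F n} = {}" using P_finite[OF T_P[OF 0(2)]] by simp
 then have "x p : F n" for p by blast
 then have "x : T X n" using T_P[OF 0(2)] T_supp[OF 0(2)] by (intro T_I)
 then show ?case using 0(2) by (intro small)
next
 case (Suc k)
 have fin: "finite {p. x p \<notin> F n}" using P_finite[OF T_P[OF Suc.prems]] .
 have "{p. x p \<notin> F n} \<noteq> {}" using Suc.hyps(2) by (metis card.empty nat.distinct(1))
 then obtain p where p: "x p \<notin> F n" by blast
 have pX: "p : X" using p T_supp[OF Suc.prems, of p] F_zero[of n] by metis
 have pQ: "p : paths Q"
  using p families_not_path[OF P_families[OF T_P[OF Suc.prems]], of p] F_zero[of n] by metis
 define x' where "x' = (\<lambda>q. if q : - {p} then x q else \<zero>)"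
 have x': "x' : T X j" unfolding x'_def
  using restrict_T[OF Suc.prems, of "- {p}"] T_mono[of "X \<inter> - {p}" X j j] by blast
 have "{q. x' q \<notin> F n} = {q. x q \<notin> F n} - {p}" by (auto simp: x'_def)
 then have "card {q. x' q \<notin> F n} = k" using Suc.hyps(2) p fin by simp
 then have "Z x'" using Suc.hyps(1)[OF _ x'] by simp
 moreover have xp: "x p : F j" using T_F[OF Suc.prems] .
 moreover have "x p \<bullet> path_elem B p : T X j"
  using T_smult_F[OF T_path_elem[OF pQ pX] xp] by simp
 ultimately have "Z (x p \<bullet> path_elem B p \<boxplus> x')" using add x' path[OF _ pX pQ] by blast
 also have "x p \<bullet> path_elem B p \<boxplus> x' = x"
  using T_P[OF Suc.prems] by (intro ext) (auto simp: x'_def path_elem_def)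
 finally show ?case .
qed

text \<open>This is where finite generation of \<open>m^n\<close> enters: an element with coefficients in \<open>m^n\<close> is a
 finite sum of multiples \<open>b \<odot> y\<close> with \<open>b : m^n\<close>, the elements \<open>y\<close> being again finitely supported
 modulo each power. Consequently every linear map is continuous.\<close>

lemma T_induct [consumes 1, case_names smult add]:
 assumes x: "x : T X n"
  and smult: "!!b y. b : F n ==> y : T X 0 ==> Z (b \<bullet> y)"
  and add: "!!y z. y : T X n ==> z : T X n ==> Z y ==> Z z ==> Z (y \<boxplus> z)"
 shows "Z x"
proof -
 obtain G where G: "finite G" "G \<subseteq> F n"
  "!!k c. c : F (n + k) ==> \<exists>d. d : G \<rightarrow> F k \<and> c = (\<Oplus>g\<in>G. g \<otimes> d g)"
  using F_generators by blast
 have Gc: "g : carrier B" if "g : G" for g using that G(2) F_carrier by blast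
 have "\<exists>d. d : G \<rightarrow> carrier B \<and> x p = (\<Oplus>g\<in>G. g \<otimes> d g) \<and> (x p = \<zero> \<longrightarrow> d = (\<lambda>g. \<zero>)) \<and>
   (\<forall>k. x p : F (n + k) \<longrightarrow> d : G \<rightarrow> F k)" for p
 proof (cases "x p = \<zero>")
  case True
  have "(\<Oplus>g\<in>G. g \<otimes> \<zero>) = \<zero>" using Gc by (intro add.finprod_one_eqI) auto
  then show ?thesis using True by (intro exI[of _ "\<lambda>g. \<zero>"]) auto
 next
  case False
  have "\<exists>k. x p \<notin> F k" using F_separated[of "x p"] False T_P[OF x] by auto
  then obtain k where k: "x p \<notin> F k" by blast
  define M where "M = {k. x p : F (n + k)}"
  have "0 : M" using T_F[OF x] by (simp add: M_def)
  moreover have "j < k" if "j : M" for j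
  proof (rule ccontr)
   assume "\<not> j < k"
   then have "F (n + j) \<subseteq> F k" by (intro F_antimono) simp
   then show False using that k by (auto simp: M_def)
  qed
  then have "finite M" by (meson bounded_nat_set_is_finite)
  ultimately have Max: "Max M : M" by (intro Max_in) auto
  then have "x p : F (n + Max M)" unfolding M_def by blast
  then obtain d where d: "d : G \<rightarrow> F (Max M)" "x p = (\<Oplus>g\<in>G. g \<otimes> d g)"
   using G(3)[of "x p" "Max M"] by blast
  have "d : G \<rightarrow> F j" if "x p : F (n + j)" for j
  proof -
   have "j \<le> Max M" using that \<open>finite M\<close> by (intro Max_ge) (auto simp: M_def)
   then show ?thesis using d(1) F_antimono[of j "Max M"] by auto
  qed
  moreover have "d : G \<rightarrow> carrier B" using d(1) F_carrier by blast
  ultimately show ?thesis using d False by blast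
 qed
 then have "\<forall>p. \<exists>d. d : G \<rightarrow> carrier B \<and> x p = (\<Oplus>g\<in>G. g \<otimes> d g) \<and> (x p = \<zero> \<longrightarrow> d = (\<lambda>g. \<zero>)) \<and>
   (\<forall>k. x p : F (n + k) \<longrightarrow> d : G \<rightarrow> F k)" by (intro allI)
 from choice[OF this] obtain d where *: "\<forall>p. d p : G \<rightarrow> carrier B \<and> x p = (\<Oplus>g\<in>G. g \<otimes> d p g) \<and>
   (x p = \<zero> \<longrightarrow> d p = (\<lambda>g. \<zero>)) \<and> (\<forall>k. x p : F (n + k) \<longrightarrow> d p : G \<rightarrow> F k)" ..
 then have d: "d p : G \<rightarrow> carrier B" "x p = (\<Oplus>g\<in>G. g \<otimes> d p g)"
  "x p = \<zero> ==> d p = (\<lambda>g. \<zero>)" "x p : F (n + k) ==> d p : G \<rightarrow> F k" for p k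
  using spec[OF *, of p] by blast+
 have y: "(\<lambda>p. d p g) : T X 0" if g: "g : G" for g
 proof (rule T_I)
  have dc: "d p g : carrier B" for p using funcset_mem[OF d(1) g] .
  have d0: "d p g = \<zero>" if "x p = \<zero>" for p using d(3)[OF that] by simp
  show "(\<lambda>p. d p g) : carrier P"
  proof (rule P_I)
   show "(\<lambda>p. d p g) : families B Q"
    using dc d0[OF families_not_path[OF P_families[OF T_P[OF x]]]] by (rule families_I)
   have "d p g : F k" if "x p : F (n + k)" for p k using funcset_mem[OF d(4)[OF that] g] .
   then have "{p. d p g \<notin> F k} \<subseteq> {p. x p \<notin> F (n + k)}" for k by blast
   then show "finite {p. d p g \<notin> F k}" for k using P_finite[OF T_P[OF x]] by (rule finite_subset)
  qed
  show "d p g : F 0" for p using funcset_mem[OF d(1) g] by simp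
  show "d p g = \<zero>" if "p \<notin> X" for p using d(3) T_supp[OF x that] by simp
 qed
 have "finite H ==> H \<subseteq> G ==> (\<lambda>p. \<Oplus>g\<in>H. g \<otimes> d p g) : T X n \<and> Z (\<lambda>p. \<Oplus>g\<in>H. g \<otimes> d p g)" for H
 proof (induction H rule: finite_induct)
  case empty
  have "(\<lambda>p. \<Oplus>g\<in>{}. g \<otimes> d p g) = \<zero> \<bullet> \<zero>\<^sub>P" by (rule ext) simp
  moreover have "Z (\<zero> \<bullet> \<zero>\<^sub>P)" by (rule smult) auto
  ultimately show ?case by (simp add: T_smult)
 next
  case (insert g H)
  then have g: "g : G" "g : F n" using G(2) by auto
  have "(\<lambda>p. \<Oplus>g\<in>insert g H. g \<otimes> d p g) = g \<bullet> (\<lambda>p. d p g) \<boxplus> (\<lambda>p. \<Oplus>g\<in>H. g \<otimes> d p g)"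
  proof
   fix p
   have "d p h : carrier B" "h : carrier B" if "h : insert g H" for h
    using that insert(4) d(1)[of p] Gc by auto
   then show "(\<Oplus>g\<in>insert g H. g \<otimes> d p g) = (g \<bullet> (\<lambda>p. d p g) \<boxplus> (\<lambda>p. \<Oplus>g\<in>H. g \<otimes> d p g)) p"
    using insert(1,2) by (simp add: finsum_insert Pi_def)
  qed
  moreover have "g \<bullet> (\<lambda>p. d p g) : T X n" using T_smult_F[OF y[OF g(1)] g(2)] by simp
  ultimately show ?case using insert smult[OF g(2) y[OF g(1)]] by (auto intro: T_add add)
 qed
 from this[OF G(1)] have "Z (\<lambda>p. \<Oplus>g\<in>G. g \<otimes> d p g)" by simp
 also have "(\<lambda>p. \<Oplus>g\<in>G. g \<otimes> d p g) = x" using d(2) by (intro ext) simp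
 finally show ?thesis .
qed

end

lemma (in abelian_group) minus_add_add:
 "[|x : carrier G; y : carrier G; z : carrier G; w : carrier G|] ==>
 (x \<oplus> y) \<ominus> (z \<oplus> w) = (x \<ominus> z) \<oplus> (y \<ominus> w)"
 by (simp add: a_minus_def minus_add a_ac)

lemma (in abelian_group) minus_minus_minus:
 "[|x : carrier G; y : carrier G; z : carrier G; w : carrier G|] ==>
 (x \<ominus> y) \<ominus> (z \<ominus> w) = (x \<ominus> z) \<ominus> (y \<ominus> w)"
 by (simp add: a_minus_def minus_add a_ac)

lemma (in abelian_group) minus_telescope:
 "[|x : carrier G; y : carrier G; z : carrier G|] ==> (x \<ominus> y) \<oplus> (y \<ominus> z) = x \<ominus> z"
proof -
 assume *: "x : carrier G" "y : carrier G" "z : carrier G"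
 then have "(x \<ominus> y) \<oplus> (y \<ominus> z) = x \<oplus> ((\<ominus> y \<oplus> y) \<oplus> \<ominus> z)" by (simp add: a_minus_def a_assoc)
 then show ?thesis using * by (simp add: l_neg a_minus_def)
qed

lemma (in abelian_group) minus_add_cancel:
 "[|x : carrier G; y : carrier G|] ==> (x \<ominus> y) \<oplus> y = x"
 by (simp add: a_minus_def a_assoc l_neg)

declare (in adic_quiver) P_apply [simp del] P_minus_apply [simp del] P_uminus_apply [simp del]
lemmas (in adic_quiver) P_pointwise = P_apply P_minus_apply P_uminus_apply

lemma (in abelian_group) add_minus_cancel:
 "[|x : carrier G; y : carrier G|] ==> (x \<oplus> y) \<ominus> x = y"
 by (simp add: a_minus_def a_comm[of x y] a_assoc r_neg)

section \<open>Linear maps between completed free modules\<close>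

definition semilinear :: "('b => 'c) => ('b, 'm) ring_scheme => ('b, 'x, 'n) module_scheme =>
  ('c, 'y, 'l) module_scheme => 'x set => ('x => 'y) => bool" where
 "semilinear f B M N D g \<longleftrightarrow> (\<forall>x\<in>D. g x : carrier N) \<and>
  (\<forall>x\<in>D. \<forall>y\<in>D. g (x \<oplus>\<^bsub>M\<^esub> y) = g x \<oplus>\<^bsub>N\<^esub> g y) \<and>
  (\<forall>b\<in>carrier B. \<forall>x\<in>D. g (b \<odot>\<^bsub>M\<^esub> x) = f b \<odot>\<^bsub>N\<^esub> g x)"

lemma semilinearI:
 assumes "!!x. x : D ==> g x : carrier N"
  "!!x y. x : D ==> y : D ==> g (x \<oplus>\<^bsub>M\<^esub> y) = g x \<oplus>\<^bsub>N\<^esub> g y"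
  "!!b x. b : carrier B ==> x : D ==> g (b \<odot>\<^bsub>M\<^esub> x) = f b \<odot>\<^bsub>N\<^esub> g x"
 shows "semilinear f B M N D g"
 using assms by (simp add: semilinear_def)

lemma semilinearD:
 assumes "semilinear f B M N D g"
 shows "x : D ==> g x : carrier N"
  "x : D ==> y : D ==> g (x \<oplus>\<^bsub>M\<^esub> y) = g x \<oplus>\<^bsub>N\<^esub> g y"
  "b : carrier B ==> x : D ==> g (b \<odot>\<^bsub>M\<^esub> x) = f b \<odot>\<^bsub>N\<^esub> g x"
 using assms by (simp_all add: semilinear_def)

lemma semilinear_subset:
 assumes "semilinear f B M N D g" "E \<subseteq> D"
 shows "semilinear f B M N E g"
proof (rule semilinearI)
 fix x y assume "x : E" "y : E"
 then have "x : D" "y : D" using assms(2) by auto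
 then show "g (x \<oplus>\<^bsub>M\<^esub> y) = g x \<oplus>\<^bsub>N\<^esub> g y" by (rule semilinearD(2)[OF assms(1)])
next
 fix x assume "x : E"
 then have "x : D" using assms(2) by auto
 then show "g x : carrier N" "!!b. b : carrier B ==> g (b \<odot>\<^bsub>M\<^esub> x) = f b \<odot>\<^bsub>N\<^esub> g x"
  using semilinearD(1,3)[OF assms(1)] by auto
qed

locale adic_hom = src: adic_quiver B m Q + tgt: adic_quiver B' m' Q
 for B (structure) and m and Q :: "('v, 'w) pre_digraph" and B' (structure) and m' and f +
 assumes f_hom: "f : ring_hom B B'" and f_m: "f ` m \<subseteq> m'"
begin

lemma f_simps [simp]:
 "x : carrier B ==> f x : carrier B'" "f \<zero> = \<zero>\<^bsub>B'\<^esub>" "f \<one> = \<one>\<^bsub>B'\<^esub>"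
 "x : carrier B ==> y : carrier B ==> f (x \<oplus> y) = f x \<oplus>\<^bsub>B'\<^esub> f y"
 "x : carrier B ==> y : carrier B ==> f (x \<otimes> y) = f x \<otimes>\<^bsub>B'\<^esub> f y"
 using ring_hom_closed[OF f_hom] ring_hom_zero[OF f_hom src.ring_axioms tgt.ring_axioms]
  ring_hom_one[OF f_hom] ring_hom_add[OF f_hom] ring_hom_mult[OF f_hom] by auto

lemma f_uminus: "x : carrier B ==> f (\<ominus> x) = \<ominus>\<^bsub>B'\<^esub> f x"
proof -
 assume x: "x : carrier B"
 have "f (\<ominus> x) \<oplus>\<^bsub>B'\<^esub> f x = f (\<ominus> x \<oplus> x)" using x by (subst f_simps(4)) auto
 also have "\<dots> = \<zero>\<^bsub>B'\<^esub>" using x by (simp add: src.l_neg)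
 finally show ?thesis using x tgt.minus_equality[of "f (\<ominus> x)" "f x"] by simp
qed

lemma f_minus: "x : carrier B ==> y : carrier B ==> f (x \<ominus> y) = f x \<ominus>\<^bsub>B'\<^esub> f y"
 by (simp add: a_minus_def f_uminus)

lemma f_F: "b : src.F n ==> f b : tgt.F n"
proof (induction n arbitrary: b)
 case (Suc n)
 have "b : ideal_prod B (src.F n) m" using Suc.prems src.F_plus[of n "Suc 0"] by (simp only: src.F_1 add_Suc_right add_0_right)
 then have "b : carrier B \<and> f b : ideal_prod B' (tgt.F n) m'"
 proof (induction rule: ideal_prod.induct)
  case (prod i j)
  then have "i : carrier B" "j : carrier B"
   using src.F_carrier src.m_ideal ideal.Icarr by metis+
  then show ?case using prod Suc.IH f_m by (auto intro: ideal_prod.prod)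
 next
  case (sum s1 s2)
  then show ?case by (auto intro: ideal_prod.sum)
 qed
 then show ?case using tgt.F_plus[of n "Suc 0"] by (simp only: tgt.F_1 add_Suc_right add_0_right)
qed simp

lemma f_T:
 assumes "x : src.T X n"
 shows "f \<circ> x : tgt.T X n"
proof (rule tgt.T_I)
 have x: "x : carrier src.P" using assms by (rule src.T_P)
 have F: "(f \<circ> x) p : tgt.F k" if "x p : src.F k" for k p using f_F[OF that] by simp
 show "(f \<circ> x) p : tgt.F n" for p using F src.T_F[OF assms] .
 show "(f \<circ> x) p = \<zero>\<^bsub>B'\<^esub>" if "p \<notin> X" for p using src.T_supp[OF assms that] by simp
 show "f \<circ> x : carrier tgt.P"
 proof (rule tgt.P_I)
  show "f \<circ> x : families B' Q"
   using ring_hom_families[OF f_hom src.ring_axioms tgt.ring_axioms src.P_families[OF x]] .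
  have "{p. (f \<circ> x) p \<notin> tgt.F k} \<subseteq> {p. x p \<notin> src.F k}" for k using F by blast
  then show "finite {p. (f \<circ> x) p \<notin> tgt.F k}" for k using src.P_finite[OF x] by (rule finite_subset)
 qed
qed

lemma f_P [simp]: "x : carrier src.P ==> f \<circ> x : carrier tgt.P"
 using f_T[of x UNIV 0] by simp

lemma f_P_add: "x : carrier src.P ==> y : carrier src.P ==>
  f \<circ> (x \<oplus>\<^bsub>src.P\<^esub> y) = (f \<circ> x) \<oplus>\<^bsub>tgt.P\<^esub> (f \<circ> y)"
 by (rule ext) (simp add: src.P_pointwise tgt.P_pointwise)

lemma f_P_minus: "x : carrier src.P ==> y : carrier src.P ==>
  f \<circ> (x \<ominus>\<^bsub>src.P\<^esub> y) = (f \<circ> x) \<ominus>\<^bsub>tgt.P\<^esub> (f \<circ> y)"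
 by (rule ext) (simp add: src.P_pointwise tgt.P_pointwise f_minus)

lemma f_P_zero: "f \<circ> \<zero>\<^bsub>src.P\<^esub> = \<zero>\<^bsub>tgt.P\<^esub>"
 by (rule ext) (simp add: src.P_pointwise tgt.P_pointwise)

lemma f_P_smult: "x : carrier src.P ==> c : carrier B ==>
  f \<circ> (c \<odot>\<^bsub>src.P\<^esub> x) = f c \<odot>\<^bsub>tgt.P\<^esub> (f \<circ> x)"
 by (rule ext) (simp add: src.P_pointwise tgt.P_pointwise)

lemma f_P_mult: "x : carrier src.P ==> y : carrier src.P ==>
  f \<circ> (x \<otimes>\<^bsub>src.P\<^esub> y) = (f \<circ> x) \<otimes>\<^bsub>tgt.P\<^esub> (f \<circ> y)"
 unfolding src.P_mult tgt.P_mult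
 by (rule ring_hom_conv[OF f_hom]) (simp_all add: src.coeff_quiver_axioms tgt.coeff_quiver_axioms)

lemma f_path_elem: "f \<circ> path_elem B p = path_elem B' p"
 by (rule ring_hom_path_elem[OF f_hom src.ring_axioms tgt.ring_axioms])

text \<open>Continuity is automatic: multiples by elements of \<open>m^n\<close> go to multiples by elements
 of \<open>m'^n\<close>.\<close>

lemma semilinear_T:
 assumes g: "semilinear f B src.P tgt.P (src.T X 0) g"
  and Y: "!!x. x : src.T X 0 ==> g x : tgt.T Y k" and x: "x : src.T X n"
 shows "g x : tgt.T Y (n + k)"
proof -
 have T0: "y : src.T X 0" if "y : src.T X n" for y using src.T_mono[of X X 0 n] that by blast
 show ?thesis using x
 proof (induction rule: src.T_induct)
  case (smult b y)
  then have "g (b \<odot>\<^bsub>src.P\<^esub> y) = f b \<odot>\<^bsub>tgt.P\<^esub> g y"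
   using semilinearD(3)[OF g] src.F_carrier by blast
  then show ?case using tgt.T_smult_F[OF Y f_F] smult by simp
 next
  case (add y z)
  then show ?case using semilinearD(2)[OF g T0 T0] tgt.T_add by simp
 qed
qed

lemma semilinear_eq:
 assumes g: "semilinear f B src.P tgt.P (src.T X 0) g" and h: "semilinear f B src.P tgt.P (src.T X 0) h"
  and eq: "!!p. p : X ==> p : paths Q ==> g (path_elem B p) = h (path_elem B p)"
  and x: "x : src.T X 0"
 shows "g x = h x"
proof (rule tgt.P_eqI)
 note gP = semilinearD(1)[OF g] and hP = semilinearD(1)[OF h]
 show "g x : carrier tgt.P" "h x : carrier tgt.P" using gP hP x by auto
 fix n
 show "g x \<ominus>\<^bsub>tgt.P\<^esub> h x : tgt.T UNIV n" using x
 proof (induction rule: src.approx_induct[where n = n])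
  case (add x y)
  then show ?case
   using gP hP tgt.P.minus_add_add[of "g x" "g y" "h x" "h y"]
   by (simp add: semilinearD(2)[OF g] semilinearD(2)[OF h] tgt.T_add)
 next
  case (path c p)
  then have "g (c \<odot>\<^bsub>src.P\<^esub> path_elem B p) = h (c \<odot>\<^bsub>src.P\<^esub> path_elem B p)"
   using semilinearD(3)[OF g _ src.T_path_elem] semilinearD(3)[OF h _ src.T_path_elem] eq by simp
  moreover have "c \<odot>\<^bsub>src.P\<^esub> path_elem B p : src.T X 0"
   using path by (intro src.T_smult src.T_path_elem) auto
  ultimately show ?case using hP by (simp add: a_minus_def tgt.P.r_neg)
 next
  case (small z)
  have "g z : tgt.T UNIV (n + 0)"
   by (rule semilinear_T[OF g _ small(2)]) (simp add: gP)
  moreover have "h z : tgt.T UNIV (n + 0)"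
   by (rule semilinear_T[OF h _ small(2)]) (simp add: hP)
  ultimately show ?case by (simp add: tgt.T_minus)
 qed
qed

end

context adic_quiver
begin

abbreviation lin where "lin D g \<equiv> semilinear (\<lambda>b. b) B P P D g"

lemma adic_hom_ident: "adic_hom B m Q B m (\<lambda>b. b)"
 by unfold_locales (auto simp: ring_hom_def)

lemmas lin_T = adic_hom.semilinear_T[OF adic_hom_ident]
lemmas lin_eq = adic_hom.semilinear_eq[OF adic_hom_ident]

lemma lin_minus:
 assumes "lin (T X n) g" "x : T X n" "y : T X n"
 shows "g (x \<boxminus> y) = g x \<boxminus> g y"
proof -
 have "g ((x \<boxminus> y) \<boxplus> y) = g (x \<boxminus> y) \<boxplus> g y"
  using assms by (intro semilinearD(2)[OF assms(1)] T_minus)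
 also have "(x \<boxminus> y) \<boxplus> y = x" using assms T_P by (intro P.minus_add_cancel)
 finally show ?thesis
  using assms semilinearD(1)[OF assms(1)] P.r_neg
  by (simp add: a_minus_def P.a_assoc T_add T_uminus)
qed

lemma lin_zero: "lin (T X n) g ==> g \<zero>\<^sub>P = \<zero>\<^sub>P"
 using semilinearD(3)[of "\<lambda>b. b" B P P "T X n" g \<zero> "\<zero>\<^sub>P"] semilinearD(1)[of "\<lambda>b. b" B P P "T X n" g "\<zero>\<^sub>P"]
 by (simp add: PM.smult_l_null)

lemma lin_comp: "lin D g ==> (!!x. x : D ==> g x : E) ==> lin E h ==> lin D (\<lambda>x. h (g x))"
 by (simp add: semilinear_def)

lemma lin_mult_left: "c : carrier P ==> lin (carrier P) (\<lambda>x. c \<boxtimes> x)"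
 by (rule semilinearI)
  (simp_all add: P.r_distr, simp add: P_mult P_smult, rule ext, simp add: conv_smult_right)

lemma lin_mult_right: "c : carrier P ==> lin (carrier P) (\<lambda>x. x \<boxtimes> c)"
 by (rule semilinearI)
  (simp_all add: P.l_distr, simp add: P_mult P_smult, rule ext, simp add: conv_smult_left)

lemma smult_mult:
 assumes "b : carrier B" "x : carrier P" "y : carrier P"
 shows "(b \<bullet> x) \<boxtimes> y = b \<bullet> (x \<boxtimes> y)" "x \<boxtimes> (b \<bullet> y) = b \<bullet> (x \<boxtimes> y)"
 using semilinearD(3)[OF lin_mult_right] semilinearD(3)[OF lin_mult_left] assms by auto

text \<open>A completed free module has the universal property of a free module: prescribed images of the
 basis extend by convergent sums.\<close>

lemma linear_extension:
 assumes u: "!!p. p : X ==> p : paths Q ==> u p : T Y 0"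
 obtains g where "lin (T X 0) g" "!!x. x : T X 0 ==> g x : T Y 0"
  "!!p. p : X ==> p : paths Q ==> g (path_elem B p) = u p"
proof -
 define D where "D = X \<inter> paths Q"
 define S where "S n x = {p. x p \<notin> F n}" for n and x :: "('v, 'w) path => 'a"
 define s where "s x A = (\<Oplus>\<^bsub>P\<^esub>p\<in>A. x p \<bullet> u p)" for x A
 have uT: "u p : T Y 0" if "p : D" for p using u that by (auto simp: D_def)
 have uP: "u p : carrier P" if "p : D" for p using T_P[OF uT[OF that]] .
 have S: "finite (S n x)" "S n x \<subseteq> D" if "x : T X 0" for n x
 proof -
  show "finite (S n x)" using P_finite[OF T_P[OF that]] by (simp add: S_def)
  show "S n x \<subseteq> D"
  proof
   fix p assume p: "p : S n x"
   have "p : X" using p T_supp[OF that, of p] F_zero[of n] by (cases "p : X") (auto simp: S_def)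
   moreover have "p : paths Q"
    using p families_not_path[OF P_families[OF T_P[OF that]], of p] F_zero[of n]
    by (cases "p : paths Q") (auto simp: S_def)
   ultimately show "p : D" by (simp add: D_def)
  qed
 qed
 have trm: "(\<lambda>p. x p \<bullet> u p) : A \<rightarrow> carrier P" if "x : T X 0" "A \<subseteq> D" for x A
  using that T_P[OF that(1)] uP by auto
 have sT: "s x A : T Y 0" if "x : T X 0" "A \<subseteq> D" for x A
  unfolding s_def using that T_P[OF that(1)] by (intro T_finsum T_smult uT) auto
 have sP: "s x A : carrier P" if "x : T X 0" "A \<subseteq> D" for x A
  using T_P[OF sT[OF that]] .
 have more: "s x A \<boxminus> s x (S n x) : T Y n"
  if x: "x : T X 0" and A: "finite A" "A \<subseteq> D" "S n x \<subseteq> A" for x A n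
 proof -
  have AA: "A = S n x \<union> (A - S n x)" using A by auto
  have "s x (S n x \<union> (A - S n x)) = s x (S n x) \<boxplus> s x (A - S n x)"
   unfolding s_def
   using A S[OF x] by (intro P.finsum_Un_disjoint trm[OF x]) auto
  then have sA: "s x A = s x (S n x) \<boxplus> s x (A - S n x)" using AA by simp
  have sub: "A - S n x \<subseteq> D" using A by auto
  have "s x (A - S n x) : T Y n"
   unfolding s_def
  proof (rule T_finsum)
   fix p assume p: "p : A - S n x"
   show "x p \<bullet> u p : T Y n"
    using T_smult_F[OF uT[of p], of "x p" n] p sub by (auto simp: S_def)
  qed
  moreover have "s x A \<boxminus> s x (S n x) = s x (A - S n x)"
   unfolding sA using sP[OF x sub] sP[OF x S(2)[OF x]] by (intro P.add_minus_cancel)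
  ultimately show ?thesis by simp
 qed
 have "\<exists>y. y : T Y 0 \<and> (\<forall>n. y \<boxminus> s x (S n x) : T Y n)" if x: "x : T X 0" for x
 proof -
  have "S n x \<subseteq> S (Suc n) x" for n using F_antimono[of n "Suc n"] by (auto simp: S_def)
  then have "s x (S (Suc n) x) \<boxminus> s x (S n x) : T Y n" for n
   using S[OF x] by (intro more[OF x])
  then show ?thesis using T_limit[of "\<lambda>n. s x (S n x)" Y] sT[OF x S(2)[OF x]] by metis
 qed
 then obtain g where g: "!!x. x : T X 0 ==> g x : T Y 0"
  "!!x n. x : T X 0 ==> g x \<boxminus> s x (S n x) : T Y n" by metis
 note gP = T_P[OF g(1)]
 have close: "g x \<boxminus> s x A : T UNIV n"
  if x: "x : T X 0" and A: "finite A" "A \<subseteq> D" "S n x \<subseteq> A" for x A n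
 proof -
  have sub: "S n x \<subseteq> D" using S[OF x] by simp
  have "(g x \<boxminus> s x (S n x)) \<boxminus> (s x A \<boxminus> s x (S n x)) : T Y n"
   using g(2)[OF x] more[OF x A] by (rule T_minus)
  also have "(g x \<boxminus> s x (S n x)) \<boxminus> (s x A \<boxminus> s x (S n x)) =
    (g x \<boxminus> s x A) \<boxminus> (s x (S n x) \<boxminus> s x (S n x))"
   using gP[OF x] sP[OF x sub] sP[OF x A(2)] by (intro P.minus_minus_minus) auto
  also have "\<dots> = g x \<boxminus> s x A"
   using gP[OF x] sP[OF x sub] sP[OF x A(2)] by (simp add: a_minus_def P.r_neg)
  finally show ?thesis using T_mono[of Y UNIV n n] by blast
 qed
 have unique: "y = g x" if x: "x : T X 0" and y: "y : carrier P"
  "!!n. \<exists>A. finite A \<and> A \<subseteq> D \<and> S n x \<subseteq> A \<and> y \<boxminus> s x A : T UNIV n" for x y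
 proof (rule P_eqI[OF y(1) gP[OF x]])
  fix n
  obtain A where A: "finite A" "A \<subseteq> D" "S n x \<subseteq> A" "y \<boxminus> s x A : T UNIV n" using y(2) by blast
  have "(y \<boxminus> s x A) \<boxminus> (g x \<boxminus> s x A) : T UNIV n"
   using A(4) close[OF x A(1-3)] by (rule T_minus)
  also have "(y \<boxminus> s x A) \<boxminus> (g x \<boxminus> s x A) = (y \<boxminus> g x) \<boxminus> (s x A \<boxminus> s x A)"
   using gP[OF x] sP[OF x A(2)] y(1) by (intro P.minus_minus_minus) auto
  also have "\<dots> = y \<boxminus> g x"
   using gP[OF x] sP[OF x A(2)] y(1) by (simp add: a_minus_def P.r_neg)
  finally show "y \<boxminus> g x : T UNIV n" .
 qed
 show thesis
 proof (rule that)
  show "lin (T X 0) g"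
  proof (rule semilinearI)
   show "g (x \<boxplus> y) = g x \<boxplus> g y" if x: "x : T X 0" and y: "y : T X 0" for x y
   proof (rule unique[symmetric])
    show xy: "x \<boxplus> y : T X 0" using x y by (rule T_add)
    show "g x \<boxplus> g y : carrier P" using gP x y by auto
    fix n
    let ?A = "S n x \<union> S n y \<union> S n (x \<boxplus> y)"
    have A: "finite ?A" "?A \<subseteq> D" using S[OF x] S[OF y] S[OF xy] by auto
    have "s (x \<boxplus> y) ?A = s x ?A \<boxplus> s y ?A"
     unfolding s_def using T_P[OF x] T_P[OF y] uP A(2)
     by (subst P.finsum_addf[symmetric])
      (auto intro!: P.finsum_cong' simp: PM.smult_l_distr P_pointwise subsetD Pi_def)
    then have "(g x \<boxplus> g y) \<boxminus> s (x \<boxplus> y) ?A =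
      (g x \<boxminus> s x ?A) \<boxplus> (g y \<boxminus> s y ?A)"
     using gP x y sP[OF x A(2)] sP[OF y A(2)] P.minus_add_add by simp
    also have "\<dots> : T UNIV n" using close[OF x A] close[OF y A] by (intro T_add) auto
    finally have *: "(g x \<boxplus> g y) \<boxminus> s (x \<boxplus> y) ?A : T UNIV n" .
    show "\<exists>A. finite A \<and> A \<subseteq> D \<and> S n (x \<boxplus> y) \<subseteq> A \<and>
      (g x \<boxplus> g y) \<boxminus> s (x \<boxplus> y) A : T UNIV n"
     by (rule exI[of _ ?A], intro conjI A *) simp
   qed
   show "g (b \<bullet> x) = b \<bullet> g x" if b: "b : carrier B" and x: "x : T X 0" for b x
   proof (rule unique[symmetric])
    show bx: "b \<bullet> x : T X 0" using x b by (rule T_smult)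
    show "b \<bullet> g x : carrier P" using gP x b by auto
    fix n
    let ?A = "S n x \<union> S n (b \<bullet> x)"
    have A: "finite ?A" "?A \<subseteq> D" using S[OF x] S[OF bx] by auto
    have "s (b \<bullet> x) ?A = b \<bullet> s x ?A"
     unfolding s_def using T_P[OF x] b uP A
     by (subst PM.finsum_smult_ldistr)
      (auto intro!: P.finsum_cong' simp: PM.smult_assoc1 P_pointwise subsetD Pi_def)
    then have "b \<bullet> g x \<boxminus> s (b \<bullet> x) ?A = b \<bullet> (g x \<boxminus> s x ?A)"
     using gP[OF x] b sP[OF x A(2)] by (simp add: a_minus_def PM.smult_r_distr PM.smult_r_minus)
    also have "\<dots> : T UNIV n" using close[OF x A] b by (intro T_smult) auto
    finally have *: "b \<bullet> g x \<boxminus> s (b \<bullet> x) ?A : T UNIV n" .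
    show "\<exists>A. finite A \<and> A \<subseteq> D \<and> S n (b \<bullet> x) \<subseteq> A \<and>
      b \<bullet> g x \<boxminus> s (b \<bullet> x) A : T UNIV n"
     by (rule exI[of _ ?A], intro conjI A *) simp
   qed
  qed (rule gP)
  show "g x : T Y 0" if "x : T X 0" for x using g(1)[OF that] .
  fix p assume p: "p : X" "p : paths Q"
  then have pD: "{p} \<subseteq> D" by (simp add: D_def)
  show "g (path_elem B p) = u p"
  proof (rule unique[symmetric])
   show "path_elem B p : T X 0" using p by (intro T_path_elem)
   show up: "u p : carrier P" using pD uP by auto
   fix n
   have "S n (path_elem B p) \<subseteq> {p}" by (auto simp: S_def path_elem_def)
   moreover have "s (path_elem B p) {p} = u p"
    unfolding s_def using up by (simp add: P.finsum_insert) (simp add: path_elem_def PM.smult_one)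
   then have "u p \<boxminus> s (path_elem B p) {p} : T UNIV n" using up by (simp add: a_minus_def P.r_neg)
   ultimately show "\<exists>A. finite A \<and> A \<subseteq> D \<and> S n (path_elem B p) \<subseteq> A \<and>
     u p \<boxminus> s (path_elem B p) A : T UNIV n" using pD by (intro exI[of _ "{p}"]) auto
  qed
 qed
qed

text \<open>Inversion by the geometric series: if \<open>g\<close> is the identity modulo \<open>m\<close>, then \<open>h = id - g\<close> raises
 the filtration, so \<open>x \<mapsto> y + h x\<close> is a contraction.\<close>

lemma near_identity_bij:
 assumes g: "lin (T X 0) g" and gT: "!!x. x : T X 0 ==> g x : T X 0"
  and near: "!!x. x : T X 0 ==> g x \<boxminus> x : T X 1"
 shows "bij_betw g (T X 0) (T X 0)"
proof -
 define h where "h x = x \<boxminus> g x" for x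
 have gP: "g x : carrier P" if "x : T X 0" for x using T_P[OF gT[OF that]] .
 have h1: "h x : T X 1" if "x : T X 0" for x
 proof -
  have "h x = \<boxminus> (g x \<boxminus> x)"
   using gP[OF that] T_P[OF that] by (simp add: h_def a_minus_def P.minus_add P.a_comm)
  then show ?thesis using near[OF that] by (simp add: T_uminus)
 qed
 have h: "lin (T X 0) h"
 proof (rule semilinearI)
  show "h x : carrier P" if "x : T X 0" for x using h1[OF that] by (rule T_P)
  show "h (x \<boxplus> y) = h x \<boxplus> h y" if "x : T X 0" "y : T X 0" for x y
   unfolding h_def using that gP T_P by (simp add: semilinearD(2)[OF g] P.minus_add_add)
  show "h (b \<bullet> x) = b \<bullet> h x" if "b : carrier B" "x : T X 0" for b x
   unfolding h_def using that gP T_P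
   by (simp add: semilinearD(3)[OF g] a_minus_def PM.smult_r_distr PM.smult_r_minus)
 qed
 have hn: "h x : T X (Suc n)" if "x : T X n" for x n
  using lin_T[OF h h1 that] by simp
 have T0: "x : T X 0" if "x : T X n" for x n using T_mono[of X X 0 n] that by blast
 have "inj_on g (T X 0)"
 proof (rule inj_onI)
  fix x y assume xy: "x : T X 0" "y : T X 0" "g x = g y"
  define d where "d = x \<boxminus> y"
  have d: "d : T X 0" unfolding d_def using xy by (intro T_minus)
  have "g d = \<zero>\<^sub>P" unfolding d_def lin_minus[OF g xy(1,2)] using xy gP by (simp add: a_minus_def P.r_neg)
  then have hd: "h d = d" using T_P[OF d] by (simp add: h_def a_minus_def)
  have "d : T X n" for n by (induction n) (use d hn[of d] hd in auto)
  then have "d : T UNIV n" for n using T_mono[of X UNIV n n] by blast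
  then have "d = \<zero>\<^sub>P" using P_separated T_P[OF d] by blast
  then show "x = y" using xy T_P unfolding d_def by (metis P.minus_add_cancel P.l_zero)
 qed
 moreover have "g ` T X 0 = T X 0"
 proof
  show "g ` T X 0 \<subseteq> T X 0" using gT by auto
  show "T X 0 \<subseteq> g ` T X 0"
  proof
   fix y assume y: "y : T X 0"
   define x where "x n = ((\<lambda>z. y \<boxplus> h z) ^^ n) y" for n
   have xS: "x (Suc n) = y \<boxplus> h (x n)" for n by (simp add: x_def)
   have xT: "x n : T X 0" for n
    by (induction n) (use y T_add T0[OF h1] in \<open>auto simp: x_def\<close>)
   note xP = T_P[OF xT]
   have diff: "x (Suc n) \<boxminus> x n : T X n" for n
   proof (induction n)
    case 0
    show ?case using xT by (intro T_minus)
   next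
    case (Suc n)
    have "x (Suc (Suc n)) \<boxminus> x (Suc n) =
      (y \<boxplus> h (x (Suc n))) \<boxminus> (y \<boxplus> h (x n))"
     by (simp only: xS)
    also have "\<dots> = h (x (Suc n)) \<boxminus> h (x n)"
     using T_P[OF y] semilinearD(1)[OF h xT] P.minus_add_add[of y "h (x (Suc n))" y "h (x n)"] 
     by (simp add: a_minus_def P.r_neg del: funpow.simps)
    also have "\<dots> = h (x (Suc n) \<boxminus> x n)" using lin_minus[OF h xT xT] by simp
    also have "\<dots> : T X (Suc n)" using hn[OF Suc] .
    finally show ?case .
   qed
   obtain z where z: "z : T X 0" "!!n. z \<boxminus> x n : T X n" using T_limit[of x X] xT diff by blast
   have "y = g z"
   proof (rule P_eqI[OF T_P[OF y] gP[OF z(1)]])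
    fix n
    have hz: "h z : carrier P" "h (x n) : carrier P" using semilinearD(1)[OF h] z xT by auto
    have "(z \<boxminus> x n) : T X n" by (rule z(2))
    then have "h (z \<boxminus> x n) : T X (Suc n)" by (rule hn)
    then have "h z \<boxminus> h (x n) : T X n"
     using lin_minus[OF h z(1) xT] T_mono[of X X n "Suc n"] by auto
    moreover have "z \<boxminus> x (Suc n) : T X n" using z(2)[of "Suc n"] T_mono[of X X n "Suc n"] by auto
    ultimately have "(h z \<boxminus> h (x n)) \<boxminus> (z \<boxminus> x (Suc n)) : T X n" by (rule T_minus)
    also have "(h z \<boxminus> h (x n)) \<boxminus> (z \<boxminus> x (Suc n)) = y \<boxminus> g z"
    proof
     fix p
     note c = P_coeff[OF T_P[OF z(1)], of p] P_coeff[OF gP[OF z(1)], of p]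
      P_coeff[OF T_P[OF y], of p] P_coeff[OF hz(2), of p]
     show "((h z \<boxminus> h (x n)) \<boxminus> (z \<boxminus> x (Suc n))) p = (y \<boxminus> g z) p"
      unfolding xS h_def[of z] using c hz(2) T_P[OF z(1)] gP[OF z(1)] T_P[OF y]
      by (simp add: P_pointwise, algebra)
    qed
    finally show "y \<boxminus> g z : T UNIV n" using T_mono[of X UNIV n n] by blast
   qed
   then show "y : g ` T X 0" using z(1) by blast
  qed
 qed
 ultimately show ?thesis by (simp add: bij_betw_def)
qed

lemma lin_inv:
 assumes g: "lin (T X 0) g" and bij: "bij_betw g (T X 0) (T Y 0)"
 shows "lin (T Y 0) (inv_into (T X 0) g)"
proof (rule semilinearI)
 let ?i = "inv_into (T X 0) g"
 have i: "?i y : T X 0" "g (?i y) = y" if "y : T Y 0" for y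
  using that bij by (auto simp: bij_betw_def inv_into_into f_inv_into_f)
 have eq: "?i (g x) = x" if "x : T X 0" for x using bij that by (simp add: bij_betw_def)
 show "?i y : carrier P" if "y : T Y 0" for y using T_P i that by blast
 show "?i (x \<boxplus> y) = ?i x \<boxplus> ?i y" if "x : T Y 0" "y : T Y 0" for x y
  using eq[of "?i x \<boxplus> ?i y"] semilinearD(2)[OF g] that i by (simp add: T_add)
 show "?i (b \<bullet> x) = b \<bullet> ?i x" if "b : carrier B" "x : T Y 0" for b x
  using eq[of "b \<bullet> ?i x"] semilinearD(3)[OF g] that i by (simp add: T_smult)
qed

text \<open>Bilinear maps are determined by their values on pairs of paths.\<close>

lemma lin_eq2:
 assumes 1: "!!v. v : T Y 0 ==> lin (T X 0) (\<lambda>u. g u v)" "!!v. v : T Y 0 ==> lin (T X 0) (\<lambda>u. h u v)"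
  and 2: "!!u. u : T X 0 ==> lin (T Y 0) (g u)" "!!u. u : T X 0 ==> lin (T Y 0) (h u)"
  and eq: "!!p q. p : X ==> p : paths Q ==> q : Y ==> q : paths Q ==>
   g (path_elem B p) (path_elem B q) = h (path_elem B p) (path_elem B q)"
  and u: "u : T X 0" and v: "v : T Y 0"
 shows "g u v = h u v"
proof (rule lin_eq[OF 1(1) 1(2) _ u, OF v v])
 fix p assume p: "p : X" "p : paths Q"
 have pX: "path_elem B p : T X 0" using p by (intro T_path_elem)
 show "g (path_elem B p) v = h (path_elem B p) v"
  by (rule lin_eq[OF 2(1) 2(2) _ v, OF pX pX]) (rule eq[OF p])
qed

end

section \<open>Complements of the irreducible paths\<close>

locale quiver_tips = adic_quiver B m Q
 for B (structure) and m and Q :: "('v, 'w) pre_digraph" and S :: "('v, 'w) path set" +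
 assumes S_paths: "S \<subseteq> paths Q"
  and S_length: "s : S ==> length (snd s) \<ge> 2"
  and S_minimal: "s : S ==> s' : S ==> s \<noteq> s' ==> occurrences Q {s} s' = {}"
begin

abbreviation Ir where "Ir \<equiv> Irr Q S"

text \<open>The ideals whose quotient has the irreducible paths as a topological basis.\<close>

definition complement :: "(('v, 'w) path => 'a) set => bool" where
 "complement J \<longleftrightarrow> ideal J P \<and> (\<forall>x\<in>carrier P. \<exists>!u. u : T Ir 0 \<and> x \<boxminus> u : J)"

definition proj :: "(('v, 'w) path => 'a) set => (('v, 'w) path => 'a) => ('v, 'w) path => 'a" where
 "proj J x = (THE u. u : T Ir 0 \<and> x \<boxminus> u : J)"

lemma complement_ideal: "complement J ==> ideal J P"
 by (simp add: complement_def)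

lemma complement_sub: "complement J ==> x : J ==> x : carrier P"
 by (rule ideal.Icarr[OF complement_ideal])

lemma complement_closed:
 assumes "complement J"
 shows "x : J ==> y : J ==> x \<boxplus> y : J" "x : J ==> y : J ==> x \<boxminus> y : J" "\<zero>\<^sub>P : J"
  "x : J ==> \<boxminus> x : J"
  "x : J ==> y : carrier P ==> x \<boxtimes> y : J" "x : J ==> y : carrier P ==> y \<boxtimes> x : J"
  "x : J ==> b : carrier B ==> b \<bullet> x : J"
proof -
 interpret J: ideal J P using assms by (rule complement_ideal)
 show "x : J ==> y : J ==> x \<boxplus> y : J" "x : J ==> y : J ==> x \<boxminus> y : J" "\<zero>\<^sub>P : J"
  "x : J ==> \<boxminus> x : J"
  "x : J ==> y : carrier P ==> x \<boxtimes> y : J" "x : J ==> y : carrier P ==> y \<boxtimes> x : J"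
  by (auto simp: a_minus_def J.I_l_closed J.I_r_closed)
 show "b \<bullet> x : J" if "x : J" "b : carrier B"
 proof -
  have "(b \<bullet> \<one>\<^sub>P) \<boxtimes> x = b \<bullet> x" using that J.Icarr by (simp add: smult_mult)
  then show ?thesis using that J.I_l_closed[of x "b \<bullet> \<one>\<^sub>P"] by simp
 qed
qed

lemma proj:
 assumes "complement J" "x : carrier P"
 shows "proj J x : T Ir 0" "x \<boxminus> proj J x : J"
 using theI'[of "\<lambda>u. u : T Ir 0 \<and> x \<boxminus> u : J"] assms unfolding complement_def proj_def by blast+

lemma proj_P: "complement J ==> x : carrier P ==> proj J x : carrier P"
 using proj(1) T_P by blast

lemma proj_unique:
 assumes "complement J" "x : carrier P" "u : T Ir 0" "x \<boxminus> u : J"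
 shows "proj J x = u"
 using assms proj[OF assms(1,2)] unfolding complement_def by blast

lemma proj_Irr: "complement J ==> u : T Ir 0 ==> proj J u = u"
 using T_P complement_closed(3) by (intro proj_unique) (auto simp: a_minus_def P.r_neg)

lemma proj_lin:
 assumes J: "complement J"
 shows "lin (carrier P) (proj J)"
proof (rule semilinearI)
 show "proj J x : carrier P" if "x : carrier P" for x using proj_P[OF J that] .
 show "proj J (x \<boxplus> y) = proj J x \<boxplus> proj J y" if "x : carrier P" "y : carrier P" for x y
  using that proj[OF J] proj_P[OF J] J
  by (intro proj_unique T_add) (simp_all add: P.minus_add_add complement_closed)
 show "proj J (b \<bullet> x) = b \<bullet> proj J x" if "b : carrier B" "x : carrier P" for b x
 proof (rule proj_unique[OF J])
  have "b \<bullet> x \<boxminus> b \<bullet> proj J x = b \<bullet> (x \<boxminus> proj J x)"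
   using that proj_P[OF J] by (simp add: a_minus_def PM.smult_r_distr PM.smult_r_minus)
  also have "\<dots> : J" using complement_closed(7)[OF J] proj(2)[OF J] that by blast
  finally show "b \<bullet> x \<boxminus> b \<bullet> proj J x : J" .
  show "b \<bullet> proj J x : T Ir 0" using proj(1)[OF J] that by (intro T_smult)
 qed (use that in simp)
qed

lemma lin_UNIV: "lin (carrier P) g \<longleftrightarrow> lin (T UNIV 0) g" by simp

lemma proj_T: "complement J ==> x : T UNIV n ==> proj J x : T Ir n"
 using lin_T[of UNIV "proj J" Ir 0 x n] proj_lin proj(1) by simp

lemma proj_eq_zero: "complement J ==> x : carrier P ==> proj J x = \<zero>\<^sub>P \<longleftrightarrow> x : J"
 using proj(2)[of J x] proj_unique[of J x "\<zero>\<^sub>P"] by (auto simp: a_minus_def)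

lemma proj_minus: "complement J ==> x : carrier P ==> y : carrier P ==>
  proj J (x \<boxminus> y) = proj J x \<boxminus> proj J y"
 using lin_minus[of UNIV 0 "proj J"] proj_lin by simp

lemma proj_eq_iff:
 assumes "complement J" "x : carrier P" "y : carrier P"
 shows "proj J x = proj J y \<longleftrightarrow> x \<boxminus> y : J"
 using proj_eq_zero[OF assms(1), of "x \<boxminus> y"] proj_minus[OF assms] assms
 by (metis P.minus_closed P.r_right_minus_eq proj_P)

text \<open>Factors of a product may be replaced by their projections, as \<open>J\<close> is an ideal. All computations in
the quotient by \<open>J\<close> are done with this rule.\<close>

lemma proj_mult:
 assumes J: "complement J" and x: "x : carrier P" and y: "y : carrier P"
 shows "proj J (proj J x \<boxtimes> y) = proj J (x \<boxtimes> y)" "proj J (x \<boxtimes> proj J y) = proj J (x \<boxtimes> y)"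
proof -
 note px = proj_P[OF J x] and py = proj_P[OF J y]
 have "(x \<boxtimes> y) \<boxminus> (proj J x \<boxtimes> y) = (x \<boxminus> proj J x) \<boxtimes> y"
  using x y px by (simp add: a_minus_def P.l_distr P.l_minus)
 then have "(x \<boxtimes> y) \<boxminus> (proj J x \<boxtimes> y) : J"
  using complement_closed(5)[OF J proj(2)[OF J x] y] by simp
 then show "proj J (proj J x \<boxtimes> y) = proj J (x \<boxtimes> y)"
  using proj_eq_iff[OF J, of "x \<boxtimes> y" "proj J x \<boxtimes> y"] x y px by simp
 have "(x \<boxtimes> y) \<boxminus> (x \<boxtimes> proj J y) = x \<boxtimes> (y \<boxminus> proj J y)"
  using x y py by (simp add: a_minus_def P.r_distr P.r_minus)
 then have "(x \<boxtimes> y) \<boxminus> (x \<boxtimes> proj J y) : J"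
  using complement_closed(6)[OF J proj(2)[OF J y] x] by simp
 then show "proj J (x \<boxtimes> proj J y) = proj J (x \<boxtimes> y)"
  using proj_eq_iff[OF J, of "x \<boxtimes> y" "x \<boxtimes> proj J y"] x y py by simp
qed

text \<open>A complement is the kernel of a projection onto \<open>N\<close> whose kernel is closed under multiplication.\<close>

lemma complementI:
 assumes g: "lin (carrier P) g" and gT: "!!x. x : carrier P ==> g x : T Ir 0"
  and gI: "!!u. u : T Ir 0 ==> g u = u" and J: "J = {x : carrier P. g x = \<zero>\<^sub>P}"
  and mult: "!!x y. x : J ==> y : carrier P ==> g (x \<boxtimes> y) = \<zero>\<^sub>P \<and> g (y \<boxtimes> x) = \<zero>\<^sub>P"
 shows "complement J" "x : carrier P ==> proj J x = g x"
proof -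
 have gminus: "g (x \<boxminus> y) = g x \<boxminus> g y" if "x : carrier P" "y : carrier P" for x y
  using lin_minus[of UNIV 0 g x y] g that by simp
 have g0: "g \<zero>\<^sub>P = \<zero>\<^sub>P" using lin_zero[of UNIV 0 g] g by simp
 have gu: "g x = u \<longleftrightarrow> x \<boxminus> u : J" if "x : carrier P" "u : T Ir 0" for x u
 proof -
  have "g (x \<boxminus> u) = g x \<boxminus> u" using gminus that T_P gI by simp
  then have "x \<boxminus> u : J \<longleftrightarrow> g x \<boxminus> u = \<zero>\<^sub>P" using that T_P[OF that(2)] unfolding J by simp
  then show ?thesis using T_P[OF gT[OF that(1)]] T_P[OF that(2)] by simp
 qed
 have "ideal J P"
 proof (rule idealI[OF P_ring])
  show "subgroup J (add_monoid P)"
  proof (rule P.add.subgroupI)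
   show "J \<noteq> {}" unfolding J using g0 by blast
   show "\<boxminus> a : J" if "a : J" for a
    using that gminus[of "\<zero>\<^sub>P" a] g0 unfolding J by (simp add: a_minus_def)
   show "a \<boxplus> b : J" if "a : J" "b : J" for a b
    using that semilinearD(2)[OF g] unfolding J by simp
  qed (auto simp: J)
  show "x \<boxtimes> a : J" if "a : J" "x : carrier P" for a x using mult that unfolding J by simp
  show "a \<boxtimes> x : J" if "a : J" "x : carrier P" for a x using mult that unfolding J by simp
 qed
 moreover have "\<exists>!u. u : T Ir 0 \<and> x \<boxminus> u : J" if "x : carrier P" for x
  using gu[OF that] gT[OF that] by blast
 ultimately show c: "complement J" by (simp add: complement_def)
 show "proj J x = g x" if "x : carrier P"
  using gu[OF that gT[OF that]] gT[OF that] by (intro proj_unique[OF c that]) simp_all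
qed

lemma occurrences_refl: "s : S ==> occurrences Q S s \<noteq> {}"
proof -
 assume s: "s : S"
 then have p: "s : paths Q" using S_paths by auto
 have "((fst s, []), s, (target Q s, [])) : occurrences Q S s"
  using s p source_in_verts[OF p] target_in_verts[OF p] by (simp add: occurrences_def source_def path_cat_def)
 then show ?thesis by blast
qed

lemma S_not_Irr: "s : S ==> s \<notin> Ir"
 using occurrences_refl by (simp add: Irr_def)

lemma occurrences_length:
 assumes "(q, s, r) : occurrences Q S p"
 shows "length (snd p) \<ge> 2"
proof -
 have "s : S" "p = path_cat q (path_cat s r)" using assms by (auto simp: occurrences_def)
 then show ?thesis using S_length[of s] by (simp add: path_cat_def)
qed

lemma short_Irr: "p : paths Q ==> length (snd p) < 2 ==> p : Ir"
 using occurrences_length[of _ _ _ p] by (fastforce simp: Irr_def)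

lemma occurrencesD:
 assumes "(q, s, r) : occurrences Q S p"
 shows "q : paths Q" "s : S" "s : paths Q" "r : paths Q" "p : paths Q" "target Q q = source s"
  "target Q s = source r" "p = (fst q, snd q @ snd s @ snd r)"
  "pe p = pe q \<boxtimes> (pe s \<boxtimes> pe r)"
proof -
 show *: "q : paths Q" "s : S" "s : paths Q" "r : paths Q" "target Q q = source s"
  "target Q s = source r" "p = (fst q, snd q @ snd s @ snd r)"
  using assms by (auto simp: occurrences_def path_cat_def)
 have sr: "path_cat s r : paths Q" "source (path_cat s r) = source s"
  using * paths_append[of "fst s" "snd s" "snd r"] by (auto simp: path_cat_def source_def)
 have p: "p = path_cat q (path_cat s r)" using * by (simp add: path_cat_def)
 show "p : paths Q"
  using * sr paths_append[of "fst q" "snd q" "snd s @ snd r"] by (auto simp: path_cat_def source_def)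
 show "pe p = pe q \<boxtimes> (pe s \<boxtimes> pe r)"
  using * sr by (simp add: P_mult conv_path_elems p)
qed

text \<open>An occurrence with the shortest remainder exists, and is unique: two occurrences ending at the same
place would be nested, so that one element of \<open>S\<close> would contain the other.\<close>

lemma rightmost_occurrence:
 assumes p: "p : paths Q" "p \<notin> Ir"
 shows "rightmost_occurrence Q S p : occurrences Q S p"
proof -
 let ?len = "\<lambda>o'. length (snd (snd (snd o')))"
 have ne: "occurrences Q S p \<noteq> {}" using p by (simp add: Irr_def)
 then obtain o1 where o1: "o1 : occurrences Q S p" "!!o'. o' : occurrences Q S p ==> ?len o1 \<le> ?len o'"
  using ex_has_least_nat[of "\<lambda>o'. o' : occurrences Q S p" _ ?len] by blast
 have key: "s = s' \<and> q = q' \<and> r = r'"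
  if o: "(q, s, r) : occurrences Q S p" "(q', s', r') : occurrences Q S p"
   and len: "length (snd r) = length (snd r')" "length (snd s) \<le> length (snd s')" for q s r q' s' r'
 proof -
  note a = occurrencesD[OF o(1)] and b = occurrencesD[OF o(2)]
  have eq: "snd q @ snd s @ snd r = snd q' @ snd s' @ snd r'" "fst q = fst q'" using a(8) b(8) by auto
  then have sr: "snd r = snd r'" and qs: "snd q @ snd s = snd q' @ snd s'"
   using len(1) append_eq_append_conv[of "snd q @ snd s" "snd q' @ snd s'" "snd r" "snd r'"] by simp_all
  obtain t where t: "snd q = snd q' @ t \<and> t @ snd s = snd s' \<or> snd q @ t = snd q' \<and> snd s = t @ snd s'"
   using qs append_eq_append_conv2[of "snd q" "snd s" "snd q'" "snd s'"] by blast
  have "snd q @ t = snd q' \<and> snd s = t @ snd s' ==> t = []" using len(2) by simp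
  with t have s': "snd s' = t @ snd s" and q: "snd q = snd q' @ t" by fastforce+
  have t: "(fst s', t) : paths Q" "target Q (fst s', t) = fst s"
  proof -
   show "(fst s', t) : paths Q" using b(3) s' paths_append[of "fst s'" t "snd s"] by (metis prod.collapse)
   have "target Q q = target Q (target Q q', t)"
    using q eq(2) target_append[of Q "fst q'" "snd q'" t] by (metis prod.collapse)
   then show "target Q (fst s', t) = fst s" using a(6) b(6) by (simp add: source_def)
  qed
  have "((fst s', t), s, (target Q s, [])) : occurrences Q {s} s'"
   using t a(3) s' target_in_verts[OF a(3)] by (simp add: occurrences_def source_def path_cat_def prod_eq_iff)
  then have ss: "s = s'" using S_minimal[OF a(2) b(2)] by blast
  moreover have "q = q'" using q s' ss eq(2) by (simp add: prod_eq_iff)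
  moreover have "fst r = fst r'" using ss a(7) b(7) by (simp add: source_def)
  with sr have "r = r'" by (rule prod_eqI[rotated])
  ultimately show ?thesis by blast
 qed
 have "o' = o1" if "o' : occurrences Q S p" "\<forall>o''\<in>occurrences Q S p. ?len o' \<le> ?len o''" for o'
 proof -
  have len: "?len o' = ?len o1" using that o1 by (simp add: le_antisym)
  obtain q s r q' s' r' where qsr: "o' = (q, s, r)" "o1 = (q', s', r')" by (metis prod_cases3)
  show ?thesis
   using key[of q s r q' s' r'] key[of q' s' r' q s r] that(1) o1(1) len qsr
   by (cases "length (snd s) \<le> length (snd s')") auto
 qed
 then have "\<exists>!o'. o' : occurrences Q S p \<and> (\<forall>o''\<in>occurrences Q S p. ?len o' \<le> ?len o'')"
  using o1 by blast
 from theI'[OF this] show ?thesis unfolding rightmost_occurrence_def by blast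
qed

end

section \<open>Reductions over adic coefficient rings\<close>

locale rules = quiver_tips B m Q S
 for B (structure) and m and Q :: "('v, 'w) pre_digraph" and S +
 fixes \<chi>
 assumes rule_T: "s : S ==> \<chi> s : T Ir 0"
  and rule_parallel: "s : S ==> \<chi> s p \<noteq> \<zero> ==> parallel Q p s"
begin

abbreviation repl where "repl \<equiv> replacement B Q \<chi>"
abbreviation reds where "reds \<equiv> reductions B Q S \<chi>"
abbreviation breds where "breds \<equiv> basic_reduction B Q \<chi>"

lemma rule_P: "s : S ==> \<chi> s : carrier P"
 using rule_T T_P by blast

lemma repl_eq: "repl (q, s, r) = pe q \<boxtimes> \<chi> s \<boxtimes> pe r"
 by (simp add: replacement_def P_mult)

lemma repl_P [simp]:
 assumes "oc : occurrences Q S p"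
 shows "repl oc : carrier P"
proof -
 obtain q s r where oc: "oc = (q, s, r)" by (metis prod_cases3)
 show ?thesis using occurrencesD[OF assms[unfolded oc]] rule_P unfolding oc repl_eq by simp
qed

lemma repl_self:
 assumes "oc : occurrences Q S p"
 shows "repl oc p = \<zero>"
proof -
 obtain q s r where oc: "oc = (q, s, r)" by (metis prod_cases3)
 note o = occurrencesD[OF assms[unfolded oc]]
 have chi: "\<chi> s : carrier P" using rule_P o by blast
 have "repl oc p = conv B Q (pe q) (conv B Q (\<chi> s) (pe r)) p"
  using o chi unfolding oc repl_eq P_mult by (simp add: conv_assoc)
 also have "\<dots> = conv B Q (\<chi> s) (pe r) (target Q q, snd s @ snd r)"
  using conv_path_elem_left[of "conv B Q (\<chi> s) (pe r)" "fst q" "snd q" "snd s @ snd r"] o chi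
  by simp
 also have "\<dots> = \<chi> s s"
 proof -
  have "(fst s, snd s @ snd r) : paths Q" using o paths_append by (simp add: source_def)
  then show ?thesis
   using conv_path_elem_right[of "\<chi> s" "fst s" "snd s" "snd r"] o chi by (simp add: source_def)
 qed
 also have "\<dots> = \<zero>" using T_supp[OF rule_T[OF o(2)]] S_not_Irr[OF o(2)] by blast
 finally show ?thesis .
qed

lemma breds_eq:
 assumes "oc : occurrences Q S p" "x : carrier P"
 shows "breds oc x = x \<boxplus> x p \<bullet> (repl oc \<boxminus> pe p)"
proof
 fix p'
 obtain q s r where oc: "oc = (q, s, r)" by (metis prod_cases3)
 have p: "path_cat q (path_cat s r) = p" using assms(1) by (auto simp: occurrences_def oc)
 have pQ: "p : paths Q" using occurrencesD[OF assms(1)[unfolded oc]] by blast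
 note c = P_coeff[OF repl_P[OF assms(1)], of p'] P_coeff[OF assms(2), of p] P_coeff[OF assms(2), of p']
 have r: "x p \<oplus> x p \<otimes> (repl (q, s, r) p \<ominus> \<one>) = x p \<otimes> repl (q, s, r) p"
  if "repl (q, s, r) p : carrier B" using that c(2) by algebra
 show "breds oc x p' = (x \<boxplus> x p \<bullet> (repl oc \<boxminus> pe p)) p'"
  using c repl_P[OF assms(1)] pQ unfolding oc basic_reduction_def
  by (cases "p' = p") (simp_all add: Let_def p P_pointwise r, simp_all add: path_elem_def a_minus_def r[unfolded a_minus_def])
qed

lemma breds_path_elem:
 assumes "oc : occurrences Q S p" "c : carrier B"
 shows "breds oc (c \<bullet> pe p) = c \<bullet> repl oc"
proof -
 obtain q s r where oc: "oc = (q, s, r)" by (metis prod_cases3)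
 have pQ: "p : paths Q" using occurrencesD[OF assms(1)[unfolded oc]] by blast
 have "(c \<bullet> pe p) p = c" using assms by (simp add: P_pointwise path_elem_def)
 then have "breds oc (c \<bullet> pe p) =
   c \<bullet> pe p \<boxplus> c \<bullet> (repl oc \<boxminus> pe p)"
  using assms pQ by (subst breds_eq[OF assms(1)]) simp_all
 also have "\<dots> = c \<bullet> (pe p \<boxplus> (repl oc \<boxminus> pe p))"
  using assms pQ repl_P[OF assms(1)] by (simp add: PM.smult_r_distr)
 also have "pe p \<boxplus> (repl oc \<boxminus> pe p) = repl oc"
  using pQ repl_P[OF assms(1)] P.minus_add_cancel P.a_comm by simp
 finally show ?thesis .
qed

lemma breds_other:
 assumes "oc : occurrences Q S p" "x : carrier P" "x p = \<zero>"
 shows "breds oc x = x"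
proof -
 obtain q s r where oc: "oc = (q, s, r)" by (metis prod_cases3)
 have "p : paths Q" using occurrencesD[OF assms(1)[unfolded oc]] by blast
 then show ?thesis using assms repl_P[OF assms(1)] by (simp add: breds_eq PM.smult_l_null)
qed

lemma breds_lin:
 assumes oc: "oc : occurrences Q S p"
 shows "lin (carrier P) (breds oc)"
proof (rule semilinearI)
 obtain q s r where oc': "oc = (q, s, r)" by (metis prod_cases3)
 have pQ: "p : paths Q" using occurrencesD[OF oc[unfolded oc']] by blast
 define w where "w = repl oc \<boxminus> pe p"
 have w: "w : carrier P" using repl_P[OF oc] pQ by (simp add: w_def)
 have eq: "breds oc x = x \<boxplus> x p \<bullet> w" if "x : carrier P" for x
  using breds_eq[OF oc that] by (simp add: w_def)
 show "breds oc x : carrier P" if "x : carrier P" for x using that w by (simp add: eq)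
 show "breds oc (x \<boxplus> y) = breds oc x \<boxplus> breds oc y" if "x : carrier P" "y : carrier P" for x y
  using that w by (simp add: eq P_pointwise(2) PM.smult_l_distr P.a_ac)
 show "breds oc (b \<bullet> x) = b \<bullet> breds oc x" if "b : carrier B" "x : carrier P" for b x
  using that w by (simp add: eq P_pointwise(3) PM.smult_r_distr PM.smult_assoc1)
qed

lemma breds_reds: "oc : occurrences Q S p ==> breds oc : reds"
 using reductions.intros(2)[OF reductions.intros(1), of oc Q S p] by simp

end

text \<open>Termination is only required modulo \<open>m\<close>: terms of a replacement with coefficients in \<open>m\<close> may be
arbitrarily large, but gain a power of \<open>m\<close>.\<close>

locale rewriting = rules B m Q S \<chi>
 for B (structure) and m and Q :: "('v, 'w) pre_digraph" and S and \<chi> +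
 assumes terminating: "wf {(p', p). \<exists>oc\<in>occurrences Q S p. replacement B Q \<chi> oc p' \<notin> m}"
begin

text \<open>Termination over \<open>B/m^n\<close>: a reduction replaces \<open>c \<odot> p\<close> by terms that are smaller for the
 well-founded order on paths, or whose coefficient lies one step deeper in the filtration.\<close>

lemma filtered_wf_induct:
 assumes small: "!!x. x : T UNIV n ==> Z x"
  and add: "!!x y. x : carrier P ==> y : carrier P ==> Z x ==> Z y ==> Z (x \<boxplus> y)"
  and step: "!!c p. c : carrier B ==> p : paths Q ==>
   (!!oc. oc : occurrences Q S p ==> Z (c \<bullet> repl oc)) ==> Z (c \<bullet> pe p)"
  and x: "x : carrier P"
 shows "Z x"
proof -
 have "\<forall>x\<in>T UNIV (n - d). Z x" for d
 proof (induction d)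
  case 0
  then show ?case using small by simp
 next
  case (Suc d)
  show ?case
  proof (cases "Suc d \<le> n")
   case False
   then have "n - Suc d = n - d" by simp
   then show ?thesis using Suc by simp
  next
   case True
   define j where "j = n - Suc d"
   have j: "n - d = Suc j" using True by (simp add: j_def)
   have deep: "Z y" if "y : T UNIV (Suc j)" for y using Suc that j by simp
   have path: "Z (c \<bullet> pe p)" if c: "c : F j" and p: "p : paths Q" for c p
    using terminating c p
   proof (induction p arbitrary: c rule: wf_induct_rule)
    case (less p)
    have cB: "c : carrier B" using less F_carrier by blast
    show ?case
    proof (rule step[OF cB less.prems(2)])
     fix oc assume oc: "oc : occurrences Q S p"
     define X where "X = {p'. repl oc p' \<notin> m}"
     define w1 where "w1 = (\<lambda>p'. if p' : X then repl oc p' else \<zero>)"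
     define w2 where "w2 = (\<lambda>p'. if p' : - X then repl oc p' else \<zero>)"
     have w: "repl oc : T UNIV 0" using repl_P[OF oc] by simp
     have w1: "w1 : T X 0" using restrict_T[OF w, of X] by (simp add: w1_def)
     have w2P: "w2 : carrier P" using T_P[OF restrict_T[OF w, of "- X"]] by (simp add: w2_def)
     have "w2 p' : m" for p' using F_zero[of "Suc 0", unfolded F_1] by (auto simp: w2_def X_def)
     then have w2: "w2 : T UNIV (Suc 0)" using w2P by (intro T_I) (simp_all only: F_1 UNIV_I not_True_eq_False)
     have cw1: "c \<bullet> w1 : T X j" using T_smult_F[OF w1 less.prems(1)] by simp
     have "Z (c \<bullet> w1)" using cw1
     proof (induction rule: approx_induct[where n = "Suc j"])
      case (add x y)
      then show ?case using assms(2) T_P by blast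
     next
      case (path c' p')
      then show ?case using less.IH[of p' c'] oc by (auto simp: X_def)
     next
      case (small z)
      then show ?case using deep T_mono[of X UNIV "Suc j" "Suc j"] by blast
     qed
     moreover have "Z (c \<bullet> w2)" using deep T_smult_F[OF w2 less.prems(1)] by simp
     moreover have "repl oc = w1 \<boxplus> w2" unfolding w1_def w2_def by (rule split_T[OF w])
     then have "c \<bullet> repl oc = c \<bullet> w1 \<boxplus> c \<bullet> w2"
      using PM.smult_r_distr[OF cB T_P[OF w1] w2P] by simp
     ultimately show "Z (c \<bullet> repl oc)"
      using assms(2)[of "c \<bullet> w1" "c \<bullet> w2"] w2P T_P[OF w1] cB by simp
    qed
   qed
   show ?thesis unfolding j_def[symmetric]
   proof
    fix x assume "x : T UNIV j"
    then show "Z x"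
    proof (induction rule: approx_induct[where n = "Suc j"])
     case (add x y)
     then show ?case using assms(2) T_P by blast
    next
     case (path c p)
     then show ?case using \<open>!!c p. c : F j ==> p : paths Q ==> Z (c \<bullet> pe p)\<close> by blast
    next
     case (small z)
     then show ?case using deep by blast
    qed
   qed
  qed
 qed
 from this[of n] x show ?thesis by simp
qed

end

lemma funpow_in: "x : D ==> (!!x. x : D ==> g x : D) ==> (g ^^ k) x : D"
 by (induction k) auto

context rewriting
begin

text \<open>One rightmost reduction applied to all paths of an element at once.\<close>

definition rho :: "(('v, 'w) path => 'a) => ('v, 'w) path => 'a" where
 "rho = (SOME g. lin (carrier P) g \<and> (\<forall>p\<in>paths Q. g (pe p) =
  (if p : Ir then pe p else repl (rightmost_occurrence Q S p))))"

lemma rho: "lin (carrier P) rho \<and> (\<forall>p\<in>paths Q. rho (pe p) =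
  (if p : Ir then pe p else repl (rightmost_occurrence Q S p)))"
proof -
 define u where "u p = (if p : Ir then pe p else repl (rightmost_occurrence Q S p))" for p
 have u: "u p : T UNIV 0" if "p : UNIV" "p : paths Q" for p
  using that repl_P[OF rightmost_occurrence] by (simp add: u_def)
 obtain g where "lin (T UNIV 0) g" "!!x. x : T UNIV 0 ==> g x : T UNIV 0"
  "!!p. p : UNIV ==> p : paths Q ==> g (pe p) = u p"
  by (rule linear_extension[of UNIV u UNIV, OF u]) (assumption | rule that)+
 then have "\<exists>g. lin (carrier P) g \<and> (\<forall>p\<in>paths Q. g (pe p) =
  (if p : Ir then pe p else repl (rightmost_occurrence Q S p)))" by (auto simp: u_def)
 then show ?thesis unfolding rho_def by (rule someI_ex)
qed

lemma rho_lin: "lin (carrier P) rho" using rho by blast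
lemma rho_P: "x : carrier P ==> rho x : carrier P" using semilinearD(1)[OF rho_lin] .
lemma rho_Irr_path: "p : Ir ==> rho (pe p) = pe p"
 using rho by (auto simp: Irr_def)
lemma rho_path: "p : paths Q ==> p \<notin> Ir ==> rho (pe p) = repl (rightmost_occurrence Q S p)"
 using rho by auto

lemma rho_Irr: "u : T Ir 0 ==> rho u = u"
proof (rule lin_eq)
 show "lin (T Ir 0) rho" using rho_lin T_P by (auto intro: semilinear_subset)
 show "lin (T Ir 0) (\<lambda>u. u)" by (rule semilinearI) (auto simp: T_P)
qed (auto simp: rho_Irr_path)

lemma rho_T: "x : T UNIV n ==> rho x : T UNIV n"
 using lin_T[of UNIV rho UNIV 0 x n] rho_lin rho_P by simp

lemma rho_pow_P: "x : carrier P ==> (rho ^^ k) x : carrier P"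
 by (rule funpow_in) (auto simp: rho_P)

lemma rho_pow_lin: "lin (carrier P) (rho ^^ k)"
proof (induction k)
 case 0
 show ?case by (rule semilinearI) auto
next
 case (Suc k)
 have "lin (carrier P) (\<lambda>x. rho ((rho ^^ k) x))"
  by (rule lin_comp[OF Suc _ rho_lin]) (rule rho_pow_P)
 then show ?case by (simp add: comp_def)
qed

text \<open>Iterated rightmost reduction becomes irreducible modulo a given power of \<open>m\<close>, and then stays constant
modulo that power.\<close>

definition settles :: "nat => (('v, 'w) path => 'a) => bool" where
 "settles n x \<longleftrightarrow> (\<exists>N. \<exists>u\<in>T Ir 0. \<forall>k\<ge>N. (rho ^^ k) x \<boxminus> u : T UNIV n)"

lemma settles:
 assumes x: "x : carrier P"
 shows "settles n x"
proof (rule filtered_wf_induct[OF _ _ _ x])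
 show "settles n x" if "x : T UNIV n" for x
 proof -
  have "(rho ^^ k) x \<boxminus> \<zero>\<^sub>P : T UNIV n" for k
   using funpow_in[OF that, of rho k] rho_T T_P by (intro T_minus) auto
  then show ?thesis unfolding settles_def by (intro exI[of _ 0] bexI[of _ "\<zero>\<^sub>P"]) auto
 qed
 show "settles n (x \<boxplus> y)" if x: "x : carrier P" and y: "y : carrier P"
  and sx: "settles n x" and sy: "settles n y" for x y
 proof -
  from sx sy obtain N u N' u' where u: "u : T Ir 0" "u' : T Ir 0"
   "!!k. k \<ge> N ==> (rho ^^ k) x \<boxminus> u : T UNIV n" "!!k. k \<ge> N' ==> (rho ^^ k) y \<boxminus> u' : T UNIV n"
   unfolding settles_def by blast
  have "(rho ^^ k) (x \<boxplus> y) \<boxminus> (u \<boxplus> u') : T UNIV n" if "k \<ge> max N N'" for k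
  proof -
   have "(rho ^^ k) (x \<boxplus> y) \<boxminus> (u \<boxplus> u') =
     ((rho ^^ k) x \<boxminus> u) \<boxplus> ((rho ^^ k) y \<boxminus> u')"
    using x y u(1,2) T_P rho_pow_P by (simp add: semilinearD(2)[OF rho_pow_lin] P.minus_add_add)
   then show ?thesis using u(3)[of k] u(4)[of k] that by (simp add: T_add)
  qed
  then show ?thesis unfolding settles_def using T_add[OF u(1,2)] by blast
 qed
 fix c p assume c: "c : carrier B" and p: "p : paths Q"
  and IH: "!!oc. oc : occurrences Q S p ==> settles n (c \<bullet> repl oc)"
 show "settles n (c \<bullet> pe p)"
 proof (cases "p : Ir")
  case True
  have u: "c \<bullet> pe p : T Ir 0" using T_smult[OF T_path_elem[OF p True] c] .
  then have "(rho ^^ k) (c \<bullet> pe p) = c \<bullet> pe p" for k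
   by (induction k) (auto simp: rho_Irr)
  then show ?thesis unfolding settles_def
   using u T_P[OF u] by (intro exI[of _ 0] bexI[OF _ u]) (auto simp: a_minus_def P.r_neg)
 next
  case False
  obtain N u where u: "u : T Ir 0"
   "!!k. k \<ge> N ==> (rho ^^ k) (c \<bullet> repl (rightmost_occurrence Q S p)) \<boxminus> u : T UNIV n"
   using IH[OF rightmost_occurrence[OF p False]] unfolding settles_def by blast
  have *: "c \<bullet> repl (rightmost_occurrence Q S p) = rho (c \<bullet> pe p)"
   using c p False by (simp add: semilinearD(3)[OF rho_lin] rho_path)
  have "(rho ^^ k) (c \<bullet> pe p) \<boxminus> u : T UNIV n" if "k \<ge> Suc N" for k
   using u(2)[of "k - 1"] that unfolding * by (cases k) (simp_all add: funpow_swap1)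
  then show ?thesis unfolding settles_def using u(1) by blast
 qed
qed

definition is_normal_form :: "(('v, 'w) path => 'a) => (('v, 'w) path => 'a) => bool" where
 "is_normal_form x y \<longleftrightarrow> y : T Ir 0 \<and> (\<forall>n. \<exists>N. \<forall>k\<ge>N. (rho ^^ k) x \<boxminus> y : T UNIV n)"

lemma T_Int: "x : T X 0 ==> x : T UNIV n ==> x : T X n"
 by (simp add: fspan_def)

lemma normal_form_exists:
 assumes x: "x : carrier P"
 shows "\<exists>y. is_normal_form x y"
proof -
 have "\<forall>n. \<exists>u. u : T Ir 0 \<and> (\<exists>N. \<forall>k\<ge>N. (rho ^^ k) x \<boxminus> u : T UNIV n)"
  using settles[OF x] unfolding settles_def by blast
 from choice[OF this] obtain u where u0: "\<forall>n. u n : T Ir 0 \<and> (\<exists>N. \<forall>k\<ge>N. (rho ^^ k) x \<boxminus> u n : T UNIV n)" ..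
 then have "\<forall>n. \<exists>N. \<forall>k\<ge>N. (rho ^^ k) x \<boxminus> u n : T UNIV n" by blast
 from choice[OF this] obtain N where N: "!!n k. k \<ge> N n ==> (rho ^^ k) x \<boxminus> u n : T UNIV n" by blast
 have uT: "u n : T Ir 0" for n using u0 by blast
 note uP = T_P[OF uT]
 have "u (Suc n) \<boxminus> u n : T Ir n" for n
 proof (rule T_Int)
  show "u (Suc n) \<boxminus> u n : T Ir 0" using uT by (intro T_minus)
  let ?y = "(rho ^^ max (N n) (N (Suc n))) x"
  have y: "?y : carrier P" using rho_pow_P[OF x] .
  have "(?y \<boxminus> u n) \<boxminus> (?y \<boxminus> u (Suc n)) : T UNIV n"
   by (rule T_minus) (use N[of n] N[of "Suc n"] T_mono[of UNIV UNIV n "Suc n"] in auto)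
  also have "(?y \<boxminus> u n) \<boxminus> (?y \<boxminus> u (Suc n)) = (?y \<boxminus> ?y) \<boxminus> (u n \<boxminus> u (Suc n))"
   using y uP by (intro P.minus_minus_minus) auto
  also have "\<dots> = u (Suc n) \<boxminus> u n"
   using y uP by (simp add: a_minus_def P.r_neg P.minus_add P.a_comm)
  finally show "u (Suc n) \<boxminus> u n : T UNIV n" .
 qed
 then obtain y where y: "y : T Ir 0" "!!n. y \<boxminus> u n : T Ir n" using T_limit[of u Ir] uT by blast
 have "(rho ^^ k) x \<boxminus> y : T UNIV n" if "k \<ge> N n" for k n
 proof -
  have "((rho ^^ k) x \<boxminus> u n) \<boxminus> (y \<boxminus> u n) : T UNIV n"
   by (rule T_minus) (use N[OF that] y(2)[of n] T_mono[of Ir UNIV n n] in auto)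
  also have "((rho ^^ k) x \<boxminus> u n) \<boxminus> (y \<boxminus> u n) = ((rho ^^ k) x \<boxminus> y) \<boxminus> (u n \<boxminus> u n)"
   using rho_pow_P[OF x] uP T_P[OF y(1)] by (intro P.minus_minus_minus) auto
  also have "\<dots> = (rho ^^ k) x \<boxminus> y"
   using rho_pow_P[OF x] uP T_P[OF y(1)] by (simp add: a_minus_def P.r_neg)
  finally show ?thesis .
 qed
 then show ?thesis unfolding is_normal_form_def using y(1) by blast
qed

lemma normal_form_unique:
 assumes x: "x : carrier P" and y: "is_normal_form x y" and y': "is_normal_form x y'"
 shows "y = y'"
proof (rule P_eqI)
 show yP: "y : carrier P" and y'P: "y' : carrier P" using y y' T_P by (auto simp: is_normal_form_def)
 fix n
 obtain N N' where N: "!!k. k \<ge> N ==> (rho ^^ k) x \<boxminus> y : T UNIV n" 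
  "!!k. k \<ge> N' ==> (rho ^^ k) x \<boxminus> y' : T UNIV n"
  using y y' unfolding is_normal_form_def by meson
 let ?z = "(rho ^^ max N N') x"
 have z: "?z : carrier P" using rho_pow_P[OF x] .
 have "(?z \<boxminus> y') \<boxminus> (?z \<boxminus> y) : T UNIV n"
  by (rule T_minus) (use N in auto)
 also have "(?z \<boxminus> y') \<boxminus> (?z \<boxminus> y) = (?z \<boxminus> ?z) \<boxminus> (y' \<boxminus> y)"
  using z yP y'P by (intro P.minus_minus_minus) auto
 also have "\<dots> = y \<boxminus> y'" using z yP y'P by (simp add: a_minus_def P.r_neg P.minus_add P.a_comm)
 finally show "y \<boxminus> y' : T UNIV n" .
qed

definition nf :: "(('v, 'w) path => 'a) => ('v, 'w) path => 'a" where
 "nf x = (THE y. is_normal_form x y)"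

lemma nf: "x : carrier P ==> is_normal_form x (nf x)"
 unfolding nf_def using normal_form_exists normal_form_unique by (metis theI)

lemma nf_eq: "x : carrier P ==> is_normal_form x y ==> nf x = y"
 using nf normal_form_unique by blast

lemma nf_T: "x : carrier P ==> nf x : T Ir 0"
 using nf by (simp add: is_normal_form_def)

lemma nf_P: "x : carrier P ==> nf x : carrier P"
 using nf_T T_P by blast

lemma nf_lin: "lin (carrier P) nf"
proof (rule semilinearI)
 show "nf x : carrier P" if "x : carrier P" for x using nf_P[OF that] .
 show "nf (x \<boxplus> y) = nf x \<boxplus> nf y" if x: "x : carrier P" and y: "y : carrier P" for x y
 proof (rule nf_eq)
  show "is_normal_form (x \<boxplus> y) (nf x \<boxplus> nf y)" unfolding is_normal_form_def
  proof (intro conjI allI)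
   show "nf x \<boxplus> nf y : T Ir 0" using nf_T x y by (intro T_add)
   fix n
   obtain N N' where N: "!!k. k \<ge> N ==> (rho ^^ k) x \<boxminus> nf x : T UNIV n"
    "!!k. k \<ge> N' ==> (rho ^^ k) y \<boxminus> nf y : T UNIV n"
    using nf[OF x] nf[OF y] unfolding is_normal_form_def by meson
   have "(rho ^^ k) (x \<boxplus> y) \<boxminus> (nf x \<boxplus> nf y) : T UNIV n" if "k \<ge> max N N'" for k
   proof -
    have "(rho ^^ k) (x \<boxplus> y) \<boxminus> (nf x \<boxplus> nf y) =
      ((rho ^^ k) x \<boxminus> nf x) \<boxplus> ((rho ^^ k) y \<boxminus> nf y)"
     using x y nf_P rho_pow_P by (simp add: semilinearD(2)[OF rho_pow_lin] P.minus_add_add)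
    then show ?thesis using N(1)[of k] N(2)[of k] that by (simp add: T_add)
   qed
   then show "\<exists>N. \<forall>k\<ge>N. (rho ^^ k) (x \<boxplus> y) \<boxminus> (nf x \<boxplus> nf y) : T UNIV n" by blast
  qed
 qed (use x y in simp)
 show "nf (b \<bullet> x) = b \<bullet> nf x" if b: "b : carrier B" and x: "x : carrier P" for b x
 proof (rule nf_eq)
  show "is_normal_form (b \<bullet> x) (b \<bullet> nf x)" unfolding is_normal_form_def
  proof (intro conjI allI)
   show "b \<bullet> nf x : T Ir 0" using nf_T x b by (intro T_smult)
   fix n
   obtain N where N: "!!k. k \<ge> N ==> (rho ^^ k) x \<boxminus> nf x : T UNIV n"
    using nf[OF x] unfolding is_normal_form_def by meson
   have "(rho ^^ k) (b \<bullet> x) \<boxminus> (b \<bullet> nf x) : T UNIV n" if "k \<ge> N" for k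
   proof -
    have "(rho ^^ k) (b \<bullet> x) \<boxminus> (b \<bullet> nf x) = b \<bullet> ((rho ^^ k) x \<boxminus> nf x)"
     using x b nf_P[OF x] rho_pow_P[OF x]
     by (simp add: semilinearD(3)[OF rho_pow_lin] a_minus_def PM.smult_r_distr PM.smult_r_minus)
    then show ?thesis using N(1)[OF that] b by (simp add: T_smult)
   qed
   then show "\<exists>N. \<forall>k\<ge>N. (rho ^^ k) (b \<bullet> x) \<boxminus> (b \<bullet> nf x) : T UNIV n" by blast
  qed
 qed (use x b in simp)
qed

lemma nf_UNIV_T: "x : T UNIV n ==> nf x : T Ir n"
 using lin_T[of UNIV nf Ir 0 x n] nf_lin nf_T by simp

lemma nf_minus: "x : carrier P ==> y : carrier P ==> nf (x \<boxminus> y) = nf x \<boxminus> nf y"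
 using lin_minus[of UNIV 0 nf] nf_lin by simp

lemma nf_Irr: "u : T Ir 0 ==> nf u = u"
proof (rule nf_eq)
 assume u: "u : T Ir 0"
 have "(rho ^^ k) u = u" for k by (induction k) (auto simp: rho_Irr u)
 then show "is_normal_form u u" unfolding is_normal_form_def using u T_P[OF u] by (simp add: a_minus_def P.r_neg)
qed (rule T_P)

lemma nf_rho: "x : carrier P ==> nf (rho x) = nf x"
proof (rule nf_eq)
 assume x: "x : carrier P"
 then show "rho x : carrier P" by (rule rho_P)
 show "is_normal_form (rho x) (nf x)" unfolding is_normal_form_def
 proof (intro conjI allI)
  show "nf x : T Ir 0" using nf_T[OF x] .
  fix n
  obtain N where N: "!!k. k \<ge> N ==> (rho ^^ k) x \<boxminus> nf x : T UNIV n"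
   using nf[OF x] unfolding is_normal_form_def by meson
  have "(rho ^^ k) (rho x) \<boxminus> nf x : T UNIV n" if "k \<ge> N" for k
   using N[of "Suc k"] that by (simp add: funpow_swap1)
  then show "\<exists>N. \<forall>k\<ge>N. (rho ^^ k) (rho x) \<boxminus> nf x : T UNIV n" by blast
 qed
qed

lemma reds_lin: "\<rho> : reds ==> lin (carrier P) \<rho>"
proof (induction rule: reductions.induct)
 case 1
 show ?case by (rule semilinearI) auto
next
 case (2 \<rho> oc p)
 have "lin (carrier P) (\<lambda>x. breds oc (\<rho> x))"
  by (rule lin_comp[OF 2(3) _ breds_lin[OF 2(2)]]) (rule semilinearD(1)[OF 2(3)])
 then show ?case by (simp add: comp_def)
qed

lemma reds_P: "\<rho> : reds ==> x : carrier P ==> \<rho> x : carrier P"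
 using semilinearD(1)[OF reds_lin] .

lemma reds_T: "\<rho> : reds ==> x : T UNIV n ==> \<rho> x : T UNIV n"
 using lin_T[of UNIV \<rho> UNIV 0 x n] reds_lin reds_P by simp

lemma reds_comp: "\<rho> : reds ==> \<rho>' : reds ==> \<rho> \<circ> \<rho>' : reds"
proof (induction rule: reductions.induct)
 case (2 \<rho> oc p)
 then have "breds oc \<circ> (\<rho> \<circ> \<rho>') : reds" by (intro reductions.intros(2))
 then show ?case by (simp only: comp_assoc)
qed simp

lemma reds_first:
 assumes "\<rho> : reds"
 shows "\<rho> x = x \<or> (\<exists>\<rho>'\<in>reds. \<exists>oc p. oc : occurrences Q S p \<and> breds oc x \<noteq> x \<and> \<rho> x = \<rho>' (breds oc x))"
 using assms
proof (induction rule: reductions.induct)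
 case (2 \<rho> oc p)
 show ?case
 proof (cases "\<rho> x = x")
  case True
  then show ?thesis using 2(2) reductions.intros(1) by (cases "breds oc x = x") (auto intro!: bexI[of _ id])
 next
  case False
  then obtain \<rho>' oc' p' where *: "\<rho>' : reds" "oc' : occurrences Q S p'" "breds oc' x \<noteq> x" "\<rho> x = \<rho>' (breds oc' x)"
   using 2(3) by blast
  have "breds oc \<circ> \<rho>' : reds" using *(1) 2(2) by (rule reductions.intros(2))
  moreover have "(breds oc \<circ> \<rho>) x = (breds oc \<circ> \<rho>') (breds oc' x)" using *(4) by simp
  ultimately show ?thesis using *(2,3) by blast
 qed
qed simp

definition stable :: "nat => (('v, 'w) path => 'a) => bool" where
 "stable n x \<longleftrightarrow> (\<forall>\<sigma>. (\<forall>i. \<sigma> i : reds) \<longrightarrow>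
  (\<exists>N. \<forall>k\<ge>N. rec_nat x \<sigma> k \<boxminus> rec_nat x \<sigma> N : T UNIV n))"

lemma seq_reds:
 assumes "!!i. \<sigma> i : reds"
 shows "\<exists>\<rho>\<in>reds. \<forall>x. rec_nat x \<sigma> k = \<rho> x"
proof (induction k)
 case 0
 show ?case using reductions.intros(1) by (intro bexI[of _ id]) auto
next
 case (Suc k)
 then obtain \<rho> where "\<rho> : reds" "!!x. rec_nat x \<sigma> k = \<rho> x" by blast
 then show ?case using reds_comp[OF assms[of k]] by (intro bexI[of _ "\<sigma> k \<circ> \<rho>"]) auto
qed

lemma stable_step:
 assumes x: "x : carrier P"
  and step: "!!oc p. oc : occurrences Q S p ==> breds oc x \<noteq> x ==> stable n (breds oc x)"
 shows "stable n x"
 unfolding stable_def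
proof (intro allI impI)
 fix \<sigma> :: "nat => (('v, 'w) path => 'a) => ('v, 'w) path => 'a" assume \<sigma>: "\<forall>i. \<sigma> i : reds"
 show "\<exists>N. \<forall>k\<ge>N. rec_nat x \<sigma> k \<boxminus> rec_nat x \<sigma> N : T UNIV n"
 proof (cases "\<forall>i. \<sigma> i x = x")
  case True
  then have "rec_nat x \<sigma> k = x" for k by (induction k) auto
  then show ?thesis using x by (simp add: a_minus_def P.r_neg)
 next
  case False
  define i where "i = (LEAST i. \<sigma> i x \<noteq> x)"
  have i: "\<sigma> i x \<noteq> x" using False LeastI_ex[of "\<lambda>i. \<sigma> i x \<noteq> x"] by (auto simp: i_def)
  have before: "\<sigma> j x = x" if "j < i" for j using not_less_Least that by (auto simp: i_def)
  obtain \<rho>' oc p where *: "\<rho>' : reds" "oc : occurrences Q S p" "breds oc x \<noteq> x" "\<sigma> i x = \<rho>' (breds oc x)"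
   using reds_first[of "\<sigma> i" x] \<sigma> i by blast
  define \<sigma>' where "\<sigma>' j = (if j = 0 then \<rho>' else \<sigma> (i + j))" for j
  have "\<forall>j. \<sigma>' j : reds" using \<sigma> *(1) by (simp add: \<sigma>'_def)
  then obtain N where N: "!!k. k \<ge> N ==>
    rec_nat (breds oc x) \<sigma>' k \<boxminus> rec_nat (breds oc x) \<sigma>' N : T UNIV n"
   using step[OF *(2,3)] unfolding stable_def by blast
  have "j \<le> i ==> rec_nat x \<sigma> j = x" for j by (induction j) (auto simp: before)
  then have start: "rec_nat x \<sigma> (Suc i) = \<rho>' (breds oc x)" using *(4) by simp
  have shift: "rec_nat x \<sigma> (i + Suc j) = rec_nat (breds oc x) \<sigma>' (Suc j)" for j
  proof (induction j)
   case 0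
   show ?case using start by (simp add: \<sigma>'_def)
  next
   case (Suc j)
   have "rec_nat x \<sigma> (i + Suc (Suc j)) = \<sigma> (i + Suc j) (rec_nat x \<sigma> (i + Suc j))" by simp
   also have "\<dots> = \<sigma>' (Suc j) (rec_nat (breds oc x) \<sigma>' (Suc j))" unfolding Suc by (simp add: \<sigma>'_def)
   finally show ?case by simp
  qed
  have "rec_nat x \<sigma> k \<boxminus> rec_nat x \<sigma> (i + Suc N) : T UNIV n" if k: "k \<ge> i + Suc N" for k
  proof -
   obtain j where j: "k = i + Suc j" "j \<ge> N"
    using k by (metis Suc_le_D Suc_le_mono add_Suc_right add_leD1 le_Suc_ex le_add_diff_inverse nat_add_left_cancel_le)
   let ?s = "rec_nat (breds oc x) \<sigma>'"
   obtain \<rho> where \<rho>: "!!k. ?s k : carrier P"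
    using seq_reds[of \<sigma>'] \<open>\<forall>j. \<sigma>' j : reds\<close> reds_P semilinearD(1)[OF breds_lin[OF *(2)] x] by metis
   have "(?s (Suc j) \<boxminus> ?s N) \<boxminus> (?s (Suc N) \<boxminus> ?s N) : T UNIV n"
    by (rule T_minus) (use N[of "Suc j"] N[of "Suc N"] j(2) in auto)
   also have "(?s (Suc j) \<boxminus> ?s N) \<boxminus> (?s (Suc N) \<boxminus> ?s N) =
     (?s (Suc j) \<boxminus> ?s (Suc N)) \<boxminus> (?s N \<boxminus> ?s N)"
    using \<rho> by (intro P.minus_minus_minus)
   also have "\<dots> = ?s (Suc j) \<boxminus> ?s (Suc N)"
    using \<rho>[of "Suc j"] \<rho>[of "Suc N"] \<rho>[of N] by (simp add: a_minus_def P.r_neg del: nat.rec)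
   finally show ?thesis unfolding j(1) shift .
  qed
  then show ?thesis by blast
 qed
qed

lemma stable:
 assumes x: "x : carrier P"
 shows "stable n x"
proof (rule filtered_wf_induct[OF _ _ _ x])
 show "stable n x" if "x : T UNIV n" for x
  unfolding stable_def
 proof (intro allI impI)
  fix \<sigma> :: "nat => (('v, 'w) path => 'a) => ('v, 'w) path => 'a" assume "\<forall>i. \<sigma> i : reds"
  then have "rec_nat x \<sigma> k : T UNIV n" for k using that by (induction k) (auto intro: reds_T)
  then show "\<exists>N. \<forall>k\<ge>N. rec_nat x \<sigma> k \<boxminus> rec_nat x \<sigma> N : T UNIV n" using T_minus by blast
 qed
 show "stable n (x \<boxplus> y)" if x: "x : carrier P" and y: "y : carrier P"
  and sx: "stable n x" and sy: "stable n y" for x y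
  unfolding stable_def
 proof (intro allI impI)
  fix \<sigma> :: "nat => (('v, 'w) path => 'a) => ('v, 'w) path => 'a" assume \<sigma>: "\<forall>i. \<sigma> i : reds"
  have P: "rec_nat x \<sigma> k : carrier P" "rec_nat y \<sigma> k : carrier P" for k
   using seq_reds[of \<sigma> k] \<sigma> reds_P x y by auto
  have add: "rec_nat (x \<boxplus> y) \<sigma> k = rec_nat x \<sigma> k \<boxplus> rec_nat y \<sigma> k" for k
   using seq_reds[of \<sigma> k] \<sigma> semilinearD(2)[OF reds_lin x y] by auto
  obtain N N' where N: "!!k. k \<ge> N ==> rec_nat x \<sigma> k \<boxminus> rec_nat x \<sigma> N : T UNIV n"
   "!!k. k \<ge> N' ==> rec_nat y \<sigma> k \<boxminus> rec_nat y \<sigma> N' : T UNIV n"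
   using sx sy \<sigma> unfolding stable_def by meson
  define M where "M = max N N'"
  have "rec_nat z \<sigma> k \<boxminus> rec_nat z \<sigma> M : T UNIV n"
   if zP: "!!k. rec_nat z \<sigma> k : carrier P" and z: "!!k. k \<ge> N0 ==> rec_nat z \<sigma> k \<boxminus> rec_nat z \<sigma> N0 : T UNIV n"
    and "N0 \<le> M" "k \<ge> M" for z k N0
  proof -
   have "(rec_nat z \<sigma> k \<boxminus> rec_nat z \<sigma> N0) \<boxminus> (rec_nat z \<sigma> M \<boxminus> rec_nat z \<sigma> N0) : T UNIV n"
    by (rule T_minus) (use z[of k] z[of M] that(3,4) in auto)
   also have "(rec_nat z \<sigma> k \<boxminus> rec_nat z \<sigma> N0) \<boxminus> (rec_nat z \<sigma> M \<boxminus> rec_nat z \<sigma> N0) =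
     (rec_nat z \<sigma> k \<boxminus> rec_nat z \<sigma> M) \<boxminus> (rec_nat z \<sigma> N0 \<boxminus> rec_nat z \<sigma> N0)"
    using zP by (intro P.minus_minus_minus)
   also have "\<dots> = rec_nat z \<sigma> k \<boxminus> rec_nat z \<sigma> M"
    using zP[of k] zP[of M] zP[of N0] by (simp add: a_minus_def P.r_neg)
   finally show ?thesis .
  qed
  note x' = this[OF P(1) N(1)] and y' = this[OF P(2) N(2)]
  have "rec_nat (x \<boxplus> y) \<sigma> k \<boxminus> rec_nat (x \<boxplus> y) \<sigma> M : T UNIV n" if "k \<ge> M" for k
   unfolding add using x'[of k] y'[of k] that P by (simp add: P.minus_add_add T_add M_def)
  then show "\<exists>N. \<forall>k\<ge>N. rec_nat (x \<boxplus> y) \<sigma> k \<boxminus> rec_nat (x \<boxplus> y) \<sigma> N : T UNIV n" by blast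
 qed
 fix c p assume c: "c : carrier B" and p: "p : paths Q"
  and IH: "!!oc. oc : occurrences Q S p ==> stable n (c \<bullet> repl oc)"
 show "stable n (c \<bullet> pe p)"
 proof (rule stable_step)
  show x: "c \<bullet> pe p : carrier P" using c p by simp
  fix oc p' assume oc: "oc : occurrences Q S p'"
   and ne: "breds oc (c \<bullet> pe p) \<noteq> c \<bullet> pe p"
  have "p' = p"
  proof (rule ccontr)
   assume "p' \<noteq> p"
   then have "(c \<bullet> pe p) p' = \<zero>" using c by (simp add: P_pointwise path_elem_def)
   then show False using breds_other[OF oc x] ne by simp
  qed
  then show "stable n (breds oc (c \<bullet> pe p))"
   using IH oc breds_path_elem[of oc p c] c by simp
 qed
qed

definition irr_mod :: "nat => (('v, 'w) path => 'a) => bool" where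
 "irr_mod n x \<longleftrightarrow> (\<forall>p. x p \<notin> F n \<longrightarrow> p : Ir)"

lemma irr_mod_nf:
 assumes x: "x : carrier P" and irr: "irr_mod n x"
 shows "x \<boxminus> nf x : T UNIV n"
proof -
 define u where "u = (\<lambda>p. if p : Ir then x p else \<zero>)"
 define z where "z = (\<lambda>p. if p : - Ir then x p else \<zero>)"
 have x': "x : T UNIV 0" using x by simp
 have u: "u : T Ir 0" unfolding u_def using restrict_T[OF x', of Ir] by simp
 have zP: "z : carrier P" unfolding z_def using T_P[OF restrict_T[OF x', of "- Ir"]] by simp
 have xe: "x = u \<boxplus> z" unfolding u_def z_def by (rule split_T[OF x'])
 have "z p : F n" for p using irr by (auto simp: z_def irr_mod_def)
 then have z: "z : T UNIV n" using zP by (intro T_I) auto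
 have "nf x = u \<boxplus> nf z" unfolding xe using semilinearD(2)[OF nf_lin T_P[OF u] zP] nf_Irr[OF u] by simp
 then have "x \<boxminus> nf x = z \<boxminus> nf z"
  unfolding xe using P.minus_add_add[OF T_P[OF u] zP T_P[OF u] nf_P[OF zP]] T_P[OF u] zP nf_P[OF zP]
  by (simp add: a_minus_def P.r_neg)
 then show ?thesis using T_minus[OF z] nf_UNIV_T[OF z] T_mono[of Ir UNIV n n] by auto
qed

text \<open>A reducible path \<open>p\<close> does not occur in its own replacement, so reducing it changes any
 element in which it has a nonzero coefficient; by stabilization, repeated rightmost reduction
 ends in an irreducible element.\<close>

lemma reds_irreducible:
 assumes x: "x : carrier P"
 obtains \<rho> where "\<rho> : reds" "irr_mod n (\<rho> x)" "nf (\<rho> x) = nf x"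
proof -
 define bad where "bad y = (SOME p. y p \<notin> F n \<and> p \<notin> Ir)" for y :: "('v, 'w) path => 'a"
 define nxt where "nxt y = (if irr_mod n y then id else breds (rightmost_occurrence Q S (bad y)))" for y
 define y where "y k = ((\<lambda>z. nxt z z) ^^ k) x" for k
 define \<sigma> where "\<sigma> k = nxt (y k)" for k
 have bad: "z (bad z) \<notin> F n" "bad z \<notin> Ir" "bad z : paths Q" if z: "z : carrier P" "\<not> irr_mod n z" for z
 proof -
  have "\<exists>p. z p \<notin> F n \<and> p \<notin> Ir" using z by (auto simp: irr_mod_def)
  from someI_ex[OF this] show 1: "z (bad z) \<notin> F n" and "bad z \<notin> Ir" by (simp_all add: bad_def)
  show "bad z : paths Q"
  proof (rule ccontr)
   assume "bad z \<notin> paths Q"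
   then have "z (bad z) = \<zero>" using families_not_path[OF P_families[OF z(1)]] by blast
   then show False using 1 by simp
  qed
 qed
 have ro: "rightmost_occurrence Q S (bad z) : occurrences Q S (bad z)" if "z : carrier P" "\<not> irr_mod n z" for z
  using rightmost_occurrence bad[OF that] by blast
 have nxt: "nxt z : reds" "nf (nxt z z) = nf z" if z: "z : carrier P" for z
 proof -
  show "nxt z : reds" using reductions.intros(1)[of B Q S \<chi>] breds_reds[OF ro[OF z]] by (simp add: nxt_def)
  show "nf (nxt z z) = nf z"
  proof (cases "irr_mod n z")
   case False
   note b = bad[OF z False] and r = ro[OF z False]
   let ?w = "repl (rightmost_occurrence Q S (bad z))"
   have "nf ?w = nf (pe (bad z))" using rho_path[OF b(3,2)] nf_rho[of "pe (bad z)"] b by simp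
   then have "nf (?w \<boxminus> pe (bad z)) = nf ?w \<boxminus> nf ?w"
    using b nf_minus[OF repl_P[OF r], of "pe (bad z)"] by simp
   then have "nf (?w \<boxminus> pe (bad z)) = \<zero>\<^sub>P"
    using nf_P[OF repl_P[OF r]] by (simp add: a_minus_def P.r_neg)
   then have "nf (breds (rightmost_occurrence Q S (bad z)) z) = nf z"
    using b repl_P[OF r] z nf_P
    by (simp add: breds_eq[OF r z] semilinearD(2,3)[OF nf_lin])
   then show ?thesis using False by (simp add: nxt_def)
  qed (simp add: nxt_def)
 qed
 have yP: "y k : carrier P" for k
  unfolding y_def by (rule funpow_in[OF x]) (use nxt(1) reds_P in blast)
 have "\<forall>i. \<sigma> i : reds" using nxt(1)[OF yP] by (simp add: \<sigma>_def)
 moreover have y_rec: "rec_nat x \<sigma> k = y k" for k by (induction k) (simp_all add: y_def \<sigma>_def)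
 ultimately obtain N where N: "!!k. k \<ge> N ==> y k \<boxminus> y N : T UNIV n"
  using stable[OF x, of n] unfolding stable_def by metis
 have "irr_mod n (y N)"
 proof (rule ccontr)
  assume irr: "\<not> irr_mod n (y N)"
  note b = bad[OF yP irr] and r = ro[OF yP irr]
  let ?p = "bad (y N)" and ?w = "repl (rightmost_occurrence Q S (bad (y N)))"
  have c: "y N ?p : carrier B" using yP by simp
  have "y (Suc N) = breds (rightmost_occurrence Q S ?p) (y N)"
   using irr by (simp add: y_def nxt_def)
  then have "y (Suc N) \<boxminus> y N = y N ?p \<bullet> (?w \<boxminus> pe ?p)"
   using breds_eq[OF r yP] P.add_minus_cancel[OF yP] c repl_P[OF r] b by simp
  then have "(y N ?p \<bullet> (?w \<boxminus> pe ?p)) ?p : F n"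
   using N[of "Suc N"] T_F[of "y (Suc N) \<boxminus> y N" UNIV n ?p] by simp
  moreover have "(?w \<boxminus> pe ?p) ?p = \<ominus> \<one>"
   unfolding P_minus_apply[OF repl_P[OF r] path_elem_P[OF b(3)]] repl_self[OF r]
   by (simp add: path_elem_def a_minus_def)
  ultimately have "\<ominus> y N ?p : F n"
   using c by (simp add: P_apply r_minus)
  then have "y N ?p : F n" using F_uminus[of "\<ominus> y N ?p" n] c by simp
  then show False using b by simp
 qed
 moreover obtain \<rho> where \<rho>: "\<rho> : reds" "rec_nat x \<sigma> N = \<rho> x" using seq_reds[of \<sigma> N] \<open>\<forall>i. \<sigma> i : reds\<close> by blast
 moreover have "nf (y k) = nf x" for k
  by (induction k) (use nxt(2)[OF yP] in \<open>auto simp: y_def\<close>)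
 from this[of N] have "nf (\<rho> x) = nf x" using \<rho>(2) y_rec[of N] by simp
 ultimately show thesis using that[of \<rho>] y_rec[of N] by simp
qed

text \<open>Confluence modulo all (large) powers of \<open>m\<close> makes the kernel of the normal form an ideal.\<close>

definition confluent :: bool where
 "confluent \<longleftrightarrow> (\<forall>n\<ge>2. \<forall>p\<in>paths Q. \<forall>\<rho>\<in>reds. \<forall>\<rho>'\<in>reds.
  irr_mod n (\<rho> (pe p)) \<and> irr_mod n (\<rho>' (pe p)) \<longrightarrow>
  \<rho> (pe p) \<boxminus> \<rho>' (pe p) : T UNIV n)"

text \<open>Both sides can be reduced to irreducible elements modulo \<open>m^n\<close>, and the reduction of the right-hand side
may begin with the one that replaces \<open>p\<close>; so confluence identifies the results for every \<open>n\<close>.\<close>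

lemma nf_repl:
 assumes conf: confluent and oc: "oc : occurrences Q S p"
 shows "nf (repl oc) = nf (pe p)"
proof (rule P_eqI)
 obtain q s r where oc': "oc = (q, s, r)" by (metis prod_cases3)
 have p: "p : paths Q" using occurrencesD[OF oc[unfolded oc']] by blast
 have pP: "pe p : carrier P" using p by simp
 have w: "repl oc : carrier P" using repl_P[OF oc] .
 show "nf (repl oc) : carrier P" "nf (pe p) : carrier P" using nf_P w pP by auto
 fix n :: nat
 define k :: nat where "k = max n 2"
 obtain \<rho> where \<rho>: "\<rho> : reds" "irr_mod k (\<rho> (pe p))" "nf (\<rho> (pe p)) = nf (pe p)"
  using reds_irreducible[OF pP] by blast
 obtain \<rho>' where \<rho>': "\<rho>' : reds" "irr_mod k (\<rho>' (repl oc))" "nf (\<rho>' (repl oc)) = nf (repl oc)"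
  using reds_irreducible[OF w] by blast
 have "breds oc (pe p) = repl oc" using breds_path_elem[OF oc, of \<one>] pP w by (simp add: PM.smult_one)
 then have eq: "(\<rho>' \<circ> breds oc) (pe p) = \<rho>' (repl oc)" by simp
 have "\<rho>' \<circ> breds oc : reds" using reds_comp[OF \<rho>'(1) breds_reds[OF oc]] .
 then have d: "\<rho>' (repl oc) \<boxminus> \<rho> (pe p) : T UNIV k"
  using conf p \<rho>(1,2) \<rho>'(2) eq unfolding confluent_def k_def by (metis max.cobounded2)
 have "nf (\<rho>' (repl oc) \<boxminus> \<rho> (pe p)) : T Ir k" using nf_UNIV_T[OF d] .
 then show "nf (repl oc) \<boxminus> nf (pe p) : T UNIV n"
  using nf_minus[OF reds_P[OF \<rho>'(1) w] reds_P[OF \<rho>(1) pP]] \<rho>(3) \<rho>'(3) T_mono[of Ir UNIV n k]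
  by (simp add: k_def)
qed

text \<open>Reducing inside a product is a reduction of the product: an occurrence in \<open>p\<close> is also one in \<open>a p\<close>.\<close>

lemma nf_mult_path:
 assumes conf: confluent and a: "a : paths Q" and x: "x : carrier P"
 shows "nf (pe a \<boxtimes> rho x) = nf (pe a \<boxtimes> x)"
  "nf (rho x \<boxtimes> pe a) = nf (x \<boxtimes> pe a)"
proof -
 have aP: "pe a : carrier P" using a by simp
 have xU: "x : T UNIV 0" using x by simp
 note L = lin_comp[OF _ _ nf_lin] lin_mult_left[OF aP] lin_mult_right[OF aP]
 have base: "nf (pe a \<boxtimes> repl (q, s, r)) = nf (pe a \<boxtimes> pe p)"
  "nf (repl (q, s, r) \<boxtimes> pe a) = nf (pe p \<boxtimes> pe a)"
  if oc: "(q, s, r) : occurrences Q S p" for q s r p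
 proof -
  note o = occurrencesD[OF oc]
  have P: "pe q : carrier P" "\<chi> s : carrier P" "pe r : carrier P" "pe s : carrier P"
   using o rule_P by auto
  show "nf (pe a \<boxtimes> repl (q, s, r)) = nf (pe a \<boxtimes> pe p)"
  proof (cases "target Q a = source q")
   case True
   have aq: "pe a \<boxtimes> pe q = pe (path_cat a q)"
    using a o True by (simp add: P_mult conv_path_elems)
   have cat: "path_cat a q : paths Q" "target Q (path_cat a q) = target Q q"
    using a o(1) True paths_append[of "fst a" "snd a" "snd q"] target_append[of Q "fst a" "snd a" "snd q"]
    by (auto simp: path_cat_def source_def)
   have "(path_cat a q, s, r) : occurrences Q S (path_cat a p)"
    using o cat by (simp add: occurrences_def path_cat_def)
   from nf_repl[OF conf this] have "nf (repl (path_cat a q, s, r)) = nf (pe (path_cat a p))" .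
   moreover have "source p = source q" using o by (simp add: source_def)
   then have "pe a \<boxtimes> pe p = pe (path_cat a p)"
    using conv_path_elems[OF a o(5)] True by (simp add: P_mult)
   moreover have "pe a \<boxtimes> repl (q, s, r) = repl (path_cat a q, s, r)"
    unfolding repl_eq aq[symmetric] using P aP by (simp add: P.m_assoc)
   ultimately show ?thesis by simp
  next
   case False
   then have "pe a \<boxtimes> pe q = \<zero>\<^sub>P"
    using a o by (simp add: P_mult conv_path_elems P_zero)
   then have "pe a \<boxtimes> (pe q \<boxtimes> y) = \<zero>\<^sub>P" if "y : carrier P" for y
    using P aP that by (simp flip: P.m_assoc)
   then show ?thesis using P aP by (simp add: o(9) repl_eq P.m_assoc)
  qed
  show "nf (repl (q, s, r) \<boxtimes> pe a) = nf (pe p \<boxtimes> pe a)"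
  proof (cases "target Q r = source a")
   case True
   have ra: "pe r \<boxtimes> pe a = pe (path_cat r a)"
    using a o True by (simp add: P_mult conv_path_elems)
   have cat: "path_cat r a : paths Q" "source (path_cat r a) = source r"
    using a o(4) True paths_append[of "fst r" "snd r" "snd a"]
    by (auto simp: path_cat_def source_def)
   have "(q, s, path_cat r a) : occurrences Q S (path_cat p a)"
    using o cat by (simp add: occurrences_def path_cat_def)
   from nf_repl[OF conf this] have "nf (repl (q, s, path_cat r a)) = nf (pe (path_cat p a))" .
   moreover have "target Q p = target Q r"
    using o(6,7,8) by (simp add: source_def target_append)
   then have "pe p \<boxtimes> pe a = pe (path_cat p a)"
    using conv_path_elems[OF o(5) a] True by (simp add: P_mult)
   moreover have "repl (q, s, r) \<boxtimes> pe a = repl (q, s, path_cat r a)"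
    unfolding repl_eq ra[symmetric] using P aP by (simp add: P.m_assoc)
   ultimately show ?thesis by simp
  next
   case False
   then have ra: "pe r \<boxtimes> pe a = \<zero>\<^sub>P"
    using a o by (simp add: P_mult conv_path_elems P_zero)
   show ?thesis using P aP by (simp add: o(9) repl_eq P.m_assoc ra)
  qed
 qed
 have path: "nf (pe a \<boxtimes> rho (pe p)) = nf (pe a \<boxtimes> pe p)"
  "nf (rho (pe p) \<boxtimes> pe a) = nf (pe p \<boxtimes> pe a)"
  if "p : paths Q" for p
 proof -
  obtain q s r where "rightmost_occurrence Q S p = (q, s, r)" by (metis prod_cases3)
  then show "nf (pe a \<boxtimes> rho (pe p)) = nf (pe a \<boxtimes> pe p)"
   "nf (rho (pe p) \<boxtimes> pe a) = nf (pe p \<boxtimes> pe a)"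
   using base[of q s r p] rightmost_occurrence[OF that] rho_path[OF that] rho_Irr_path
   by (cases "p : Ir"; simp)+
 qed
 show "nf (pe a \<boxtimes> rho x) = nf (pe a \<boxtimes> x)"
 proof (rule lin_eq[OF _ _ _ xU])
  show "lin (T UNIV 0) (\<lambda>x. nf (pe a \<boxtimes> x))"
   using lin_comp[OF lin_mult_left[OF aP] _ nf_lin] aP by simp
  show "lin (T UNIV 0) (\<lambda>x. nf (pe a \<boxtimes> rho x))"
   using lin_comp[OF rho_lin rho_P lin_comp[OF lin_mult_left[OF aP] _ nf_lin]] aP by simp
 qed (rule path)
 show "nf (rho x \<boxtimes> pe a) = nf (x \<boxtimes> pe a)"
 proof (rule lin_eq[OF _ _ _ xU])
  show "lin (T UNIV 0) (\<lambda>x. nf (x \<boxtimes> pe a))"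
   using lin_comp[OF lin_mult_right[OF aP] _ nf_lin] aP by simp
  show "lin (T UNIV 0) (\<lambda>x. nf (rho x \<boxtimes> pe a))"
   using lin_comp[OF rho_lin rho_P lin_comp[OF lin_mult_right[OF aP] _ nf_lin]] aP by simp
 qed (rule path)
qed

definition nf_kernel :: "(('v, 'w) path => 'a) set" where
 "nf_kernel = {x : carrier P. nf x = \<zero>\<^sub>P}"

lemma lin_zero_map: "lin D (\<lambda>x. \<zero>\<^sub>P)"
 by (rule semilinearI) auto

lemma nf_kernel_mult_path:
 assumes conf: confluent and a: "a : paths Q" and x: "x : nf_kernel"
 shows "nf (pe a \<boxtimes> x) = \<zero>\<^sub>P" "nf (x \<boxtimes> pe a) = \<zero>\<^sub>P"
proof -
 have xP: "x : carrier P" and x0: "nf x = \<zero>\<^sub>P" using x by (auto simp: nf_kernel_def)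
 have aP: "pe a : carrier P" using a by simp
 then have aT: "pe a : T UNIV 0" by simp
 have pow: "nf (pe a \<boxtimes> (rho ^^ k) x) = nf (pe a \<boxtimes> x)"
  "nf ((rho ^^ k) x \<boxtimes> pe a) = nf (x \<boxtimes> pe a)" for k
  by (induction k) (auto simp: nf_mult_path[OF conf a rho_pow_P[OF xP]])
 have "nf (pe a \<boxtimes> x) : T UNIV n \<and> nf (x \<boxtimes> pe a) : T UNIV n" for n
 proof -
  obtain k where "(rho ^^ k) x \<boxminus> nf x : T UNIV n"
   using nf[OF xP] unfolding is_normal_form_def by blast
  then have k: "(rho ^^ k) x : T UNIV n" using rho_pow_P[OF xP] by (simp add: x0 a_minus_def)
  have "pe a \<boxtimes> (rho ^^ k) x : T UNIV n" "(rho ^^ k) x \<boxtimes> pe a : T UNIV n"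
   using T_mult[OF aT k] T_mult[OF k aT] by simp_all
  then show ?thesis using nf_UNIV_T T_mono[of Ir UNIV n n] pow[of k] by (metis order.refl subset_UNIV)
 qed
 then show "nf (pe a \<boxtimes> x) = \<zero>\<^sub>P" "nf (x \<boxtimes> pe a) = \<zero>\<^sub>P"
  using P_separated nf_P xP aP by (meson P.m_closed)+
qed

theorem confluent_complement:
 assumes conf: confluent
 shows "complement nf_kernel" "x : carrier P ==> proj nf_kernel x = nf x"
proof -
 have mult: "nf (x \<boxtimes> y) = \<zero>\<^sub>P \<and> nf (y \<boxtimes> x) = \<zero>\<^sub>P" if x: "x : nf_kernel" and y: "y : carrier P" for x y
 proof -
  have xP: "x : carrier P" using x by (simp add: nf_kernel_def)
  have yU: "y : T UNIV 0" using y by simp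
  have "nf (x \<boxtimes> y) = \<zero>\<^sub>P"
  proof (rule lin_eq[where X = UNIV and h = "\<lambda>x. \<zero>\<^sub>P", OF _ lin_zero_map _ yU])
   show "lin (T UNIV 0) (\<lambda>y. nf (x \<boxtimes> y))" using lin_comp[OF lin_mult_left[OF xP] _ nf_lin] xP by simp
  qed (rule nf_kernel_mult_path(2)[OF conf _ x])
  moreover have "nf (y \<boxtimes> x) = \<zero>\<^sub>P"
  proof (rule lin_eq[where X = UNIV and h = "\<lambda>x. \<zero>\<^sub>P", OF _ lin_zero_map _ yU])
   show "lin (T UNIV 0) (\<lambda>y. nf (y \<boxtimes> x))" using lin_comp[OF lin_mult_right[OF xP] _ nf_lin] xP by simp
  qed (rule nf_kernel_mult_path(1)[OF conf _ x])
  ultimately show ?thesis by blast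
 qed
 note * = complementI[OF nf_lin nf_T nf_Irr nf_kernel_def mult]
 show "complement nf_kernel" by (rule *(1))
 show "proj nf_kernel x = nf x" if "x : carrier P" using *(2)[OF _ _ _ _ that] .
qed

text \<open>Conversely, an ideal complementary to the irreducible paths that contains the relations
 forces confluence, and it is the kernel of the normal form.\<close>

lemma reds_congruent:
 assumes J: "complement J" and rel: "!!s. s : S ==> pe s \<boxminus> \<chi> s : J"
 shows "oc : occurrences Q S p ==> proj J (repl oc) = proj J (pe p)"
  "\<rho> : reds ==> x : carrier P ==> proj J (\<rho> x) = proj J x"
proof -
 have 1: "proj J (repl oc) = proj J (pe p)" if oc: "oc : occurrences Q S p" for oc p
 proof -
  obtain q s r where oc': "oc = (q, s, r)" by (metis prod_cases3)
  note o = occurrencesD[OF oc[unfolded oc']]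
  have P: "pe q : carrier P" "\<chi> s : carrier P" "pe r : carrier P" "pe s : carrier P"
   using o rule_P by auto
  have "proj J (pe s) = proj J (\<chi> s)" using proj_eq_iff[OF J P(4,2)] rel[OF o(2)] by simp
  then have "proj J (pe s \<boxtimes> pe r) = proj J (\<chi> s \<boxtimes> pe r)"
   using proj_mult(1)[OF J P(4,3)] proj_mult(1)[OF J P(2,3)] by simp
  then have "proj J (pe q \<boxtimes> (pe s \<boxtimes> pe r)) =
    proj J (pe q \<boxtimes> (\<chi> s \<boxtimes> pe r))"
   using P proj_mult(2)[OF J P(1), of "pe s \<boxtimes> pe r"]
    proj_mult(2)[OF J P(1), of "\<chi> s \<boxtimes> pe r"] by simp
  then show ?thesis unfolding oc' o(9) repl_eq using P by (simp add: P.m_assoc)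
 qed
 then show "oc : occurrences Q S p ==> proj J (repl oc) = proj J (pe p)" .
 have 2: "proj J (breds oc x) = proj J x" if oc: "oc : occurrences Q S p" and x: "x : carrier P" for oc p x
 proof -
  obtain q s r where oc': "oc = (q, s, r)" by (metis prod_cases3)
  have p: "pe p : carrier P" using occurrencesD(5)[OF oc[unfolded oc']] by simp
  have "proj J (repl oc \<boxminus> pe p) = \<zero>\<^sub>P"
   using proj_minus[OF J repl_P[OF oc] p] 1[OF oc] proj_P[OF J p] by (simp add: a_minus_def P.r_neg)
  then show ?thesis
   using x p repl_P[OF oc] proj_P[OF J x]
   by (simp add: breds_eq[OF oc x] semilinearD(2,3)[OF proj_lin[OF J]])
 qed
 show "proj J (\<rho> x) = proj J x" if "\<rho> : reds" "x : carrier P"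
  using that
 proof (induction rule: reductions.induct)
  case (2 \<rho> oc p)
  then show ?case using \<open>!!oc p x. oc : occurrences Q S p ==> x : carrier P ==> proj J (breds oc x) = proj J x\<close>[of oc p "\<rho> x"]
   reds_P by simp
 qed simp
qed

lemma proj_eq_nf:
 assumes J: "complement J" and rel: "!!s. s : S ==> pe s \<boxminus> \<chi> s : J"
  and x: "x : carrier P"
 shows "proj J x = nf x"
proof -
 have "lin (T UNIV 0) (\<lambda>x. proj J (rho x))" using lin_comp[OF rho_lin rho_P proj_lin[OF J]] by simp
 then have rho: "proj J (rho x) = proj J x" if "x : carrier P" for x
 proof (rule lin_eq[of UNIV])
  show "lin (T UNIV 0) (proj J)" using proj_lin[OF J] by simp
  fix p assume p: "p : paths Q"
  show "proj J (rho (pe p)) = proj J (pe p)"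
   using reds_congruent(1)[OF J rel rightmost_occurrence[OF p]] rho_path[OF p] rho_Irr_path
   by (cases "p : Ir") auto
 qed (use that in simp)
 have pow: "proj J ((rho ^^ k) x) = proj J x" for k
  by (induction k) (auto simp: rho[OF rho_pow_P[OF x]])
 show ?thesis
 proof (rule P_eqI[OF proj_P[OF J x] nf_P[OF x]])
  fix n
  obtain k where k: "(rho ^^ k) x \<boxminus> nf x : T UNIV n" using nf[OF x] unfolding is_normal_form_def by blast
  have "proj J ((rho ^^ k) x \<boxminus> nf x) = proj J x \<boxminus> nf x"
   using proj_minus[OF J rho_pow_P[OF x] nf_P[OF x]] pow proj_Irr[OF J nf_T[OF x]] by simp
  then show "proj J x \<boxminus> nf x : T UNIV n" using proj_T[OF J k] T_mono[of Ir UNIV n n] by auto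
 qed
qed

lemma complement_confluent:
 assumes J: "complement J" and rel: "!!s. s : S ==> pe s \<boxminus> \<chi> s : J"
  and \<rho>: "\<rho> : reds" "\<rho>' : reds" and x: "x : carrier P"
  and irr: "irr_mod n (\<rho> x)" "irr_mod n (\<rho>' x)"
 shows "\<rho> x \<boxminus> \<rho>' x : T UNIV n"
proof -
 note P = reds_P[OF \<rho>(1) x] reds_P[OF \<rho>(2) x]
 have "nf (\<rho> x) = nf (\<rho>' x)"
  using reds_congruent(2)[OF J rel \<rho>(1) x] reds_congruent(2)[OF J rel \<rho>(2) x]
   proj_eq_nf[OF J rel P(1)] proj_eq_nf[OF J rel P(2)] by simp
 then have "\<rho> x \<boxminus> \<rho>' x = (\<rho> x \<boxminus> nf (\<rho> x)) \<boxminus> (\<rho>' x \<boxminus> nf (\<rho>' x))"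
  using P.minus_minus_minus[OF P(1) nf_P[OF P(1)] P(2) nf_P[OF P(1)]] P nf_P[OF P(1)]
  by (simp add: a_minus_def P.r_neg)
 then show ?thesis using irr_mod_nf[OF P(1) irr(1)] irr_mod_nf[OF P(2) irr(2)] by (simp add: T_minus)
qed

end

section \<open>Base change of complements\<close>

context adic_quiver
begin

abbreviation mspan where "mspan X \<equiv> module_span B P X"

lemma P_submodule: "submodule (carrier P) B P"
 by (rule PM.submoduleI) auto

lemma mspan_base: "X \<subseteq> mspan X"
 unfolding module_span_def by (rule hull_subset)

lemma mspan_minimal: "X \<subseteq> N ==> submodule N B P ==> mspan X \<subseteq> N"
 unfolding module_span_def by (rule hull_minimal)

lemma mspan_zero: "\<zero>\<^sub>P : mspan X"
 unfolding module_span_def hull_def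
 using submodule.axioms(1) subgroup.one_closed by fastforce

lemma mspan_add: "x : mspan X ==> y : mspan X ==> x \<boxplus> y : mspan X"
 unfolding module_span_def hull_def
 using subgroup.m_closed[OF submodule.axioms(1), of _ B P x y] by auto

lemma mspan_smult: "x : mspan X ==> c : carrier B ==> c \<bullet> x : mspan X"
 unfolding module_span_def hull_def
 using submodule.smult_closed[of _ B P c x] by auto

lemma complement_submodule:
 assumes "ideal J P"
 shows "submodule J B P"
proof -
 interpret J: ideal J P by fact
 show ?thesis
 proof (rule submodule.intro)
  show "subgroup J (add_monoid P)" by (rule J.a_subgroup)
  show "submodule_axioms J B P"
  proof
   fix a x assume "a : carrier B" "x : J"
   then have "(a \<bullet> \<one>\<^sub>P) \<boxtimes> x = a \<bullet> x" "a \<bullet> \<one>\<^sub>P : carrier P"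
    using J.Icarr by (simp_all add: smult_mult)
   then show "a \<bullet> x : J" using J.I_l_closed[of x "a \<bullet> \<one>\<^sub>P"] \<open>x : J\<close> by simp
  qed
 qed
qed

end

context quiver_tips
begin

lemma complement_if_paths:
 assumes g: "lin (carrier P) g" and gT: "!!x. x : carrier P ==> g x : T Ir 0"
  and gI: "!!u. u : T Ir 0 ==> g u = u"
  and mult: "!!a b. a : paths Q ==> b : paths Q ==>
    g (g (path_elem B a) \<boxtimes> path_elem B b) = g (path_elem B a \<boxtimes> path_elem B b)"
   "!!a b. a : paths Q ==> b : paths Q ==>
    g (path_elem B a \<boxtimes> g (path_elem B b)) = g (path_elem B a \<boxtimes> path_elem B b)"
  and J: "J = {x : carrier P. g x = \<zero>\<^sub>P}"
 shows "complement J" "x : carrier P ==> proj J x = g x"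
proof -
 have gP: "g x : carrier P" if "x : carrier P" for x using T_P[OF gT[OF that]] .
 have L: "lin (T UNIV 0) (\<lambda>x. g (x \<boxtimes> c))" "lin (T UNIV 0) (\<lambda>x. g (c \<boxtimes> x))"
  "lin (T UNIV 0) (\<lambda>x. g (g x \<boxtimes> c))" "lin (T UNIV 0) (\<lambda>x. g (c \<boxtimes> g x))" if c: "c : T UNIV 0" for c
 proof -
  have cP: "c : carrier P" using c by simp
  have 1: "lin (carrier P) (\<lambda>x. g (x \<boxtimes> c))" "lin (carrier P) (\<lambda>x. g (c \<boxtimes> x))"
   using lin_comp[OF lin_mult_right[OF cP] _ g] lin_comp[OF lin_mult_left[OF cP] _ g] cP by auto
  show "lin (T UNIV 0) (\<lambda>x. g (x \<boxtimes> c))" "lin (T UNIV 0) (\<lambda>x. g (c \<boxtimes> x))"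
   "lin (T UNIV 0) (\<lambda>x. g (g x \<boxtimes> c))" "lin (T UNIV 0) (\<lambda>x. g (c \<boxtimes> g x))"
   using 1 lin_comp[OF g _ 1(1)] lin_comp[OF g _ 1(2)] gP by simp_all
 qed
 have gU: "g x : T UNIV 0" if "x : T UNIV 0" for x using gP that by simp
 have g0: "g \<zero>\<^sub>P = \<zero>\<^sub>P" using lin_zero[of UNIV 0 g] g by simp
 have "g (x \<boxtimes> y) = \<zero>\<^sub>P \<and> g (y \<boxtimes> x) = \<zero>\<^sub>P" if x: "x : J" and y: "y : carrier P" for x y
 proof -
  have xy: "x : T UNIV 0" "y : T UNIV 0" and gx: "g x = \<zero>\<^sub>P" using x y J by simp_all
  have a: "g (g x \<boxtimes> y) = g (x \<boxtimes> y)"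
   by (rule lin_eq2[where g = "\<lambda>x y. g (g x \<boxtimes> y)" and h = "\<lambda>x y. g (x \<boxtimes> y)", OF L(3) L(1) L(2)[OF gU] L(2) mult(1) xy])
  have b: "g (y \<boxtimes> g x) = g (y \<boxtimes> x)"
   by (rule lin_eq2[where g = "\<lambda>y x. g (y \<boxtimes> g x)" and h = "\<lambda>y x. g (y \<boxtimes> x)", OF L(1)[OF gU] L(1) L(4) L(2) mult(2) xy(2,1)])
  show ?thesis unfolding a[symmetric] b[symmetric] gx using y g0 by simp
 qed
 note * = complementI[OF g gT gI J this]
 show "complement J" by (rule *(1))
 show "proj J x = g x" if "x : carrier P" using that by (rule *(2)[rotated -1])
qed

lemma kernel_is_closure:
 assumes g: "lin (carrier P) g" and J: "J = {x : carrier P. g x = \<zero>\<^sub>P}" "ideal J P" and X: "X \<subseteq> J"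
  and p: "!!p. p : paths Q ==> path_elem B p \<boxminus> g (path_elem B p) : mspan X"
 shows "J = {y : carrier P. \<forall>n. \<exists>x\<in>mspan X. \<forall>p. y p \<ominus> x p : F n}"
proof
 have g': "lin (T UNIV 0) g" and gP: "!!x. x : carrier P ==> g x : carrier P" using g semilinearD(1)[OF g] by simp_all
 have gT: "g x : T UNIV n" if "x : T UNIV n" for x n using lin_T[OF g' _ that, of UNIV 0] gP by simp
 have span: "mspan X \<subseteq> J" by (rule mspan_minimal[OF X complement_submodule[OF J(2)]])
 then have sP: "z : carrier P" "g z = \<zero>\<^sub>P" if "z : mspan X" for z using that J(1) by auto
 show "{y : carrier P. \<forall>n. \<exists>x\<in>mspan X. \<forall>p. y p \<ominus> x p : F n} \<subseteq> J"
 proof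
  fix y assume "y : {y : carrier P. \<forall>n. \<exists>x\<in>mspan X. \<forall>p. y p \<ominus> x p : F n}"
  then have y: "y : carrier P" and ap: "!!n. \<exists>x\<in>mspan X. \<forall>p. y p \<ominus> x p : F n" by auto
  have "g y : T UNIV n" for n
  proof -
   obtain x where x: "x : mspan X" "\<forall>p. y p \<ominus> x p : F n" using ap by blast
   note xP = sP[OF x(1)]
   have "y \<boxminus> x : T UNIV n" using y xP x(2) by (intro T_I) (auto simp: P_minus_apply)
   then show ?thesis using gT[of "y \<boxminus> x" n] lin_minus[OF g', of y x] xP y gP[OF y] by (simp add: a_minus_def)
  qed
  then show "y : J" using y gP[OF y] P_separated J(1) by blast
 qed
 show "J \<subseteq> {y : carrier P. \<forall>n. \<exists>x\<in>mspan X. \<forall>p. y p \<ominus> x p : F n}"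
 proof (intro subsetI CollectI conjI allI)
  fix y n assume y: "y : J"
  define app where "app x \<longleftrightarrow> (\<exists>z\<in>mspan X. (x \<boxminus> g x) \<boxminus> z : T UNIV n)" for x
  have yU: "y : T UNIV 0" using y J(1) by simp
  then show "y : carrier P" by simp
  from yU have "app y"
  proof (induction rule: approx_induct[where n = n])
   case (add x y)
   then obtain z z' where z: "z : mspan X" "(x \<boxminus> g x) \<boxminus> z : T UNIV n"
    "z' : mspan X" "(y \<boxminus> g y) \<boxminus> z' : T UNIV n" unfolding app_def by blast
   have xy: "x : carrier P" "y : carrier P" using add by simp_all
   have "((x \<boxplus> y) \<boxminus> g (x \<boxplus> y)) \<boxminus> (z \<boxplus> z') = ((x \<boxminus> g x) \<boxminus> z) \<boxplus> ((y \<boxminus> g y) \<boxminus> z')"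
    using xy gP sP(1)[OF z(1)] sP(1)[OF z(3)] by (simp add: semilinearD(2)[OF g] P.minus_add_add)
   then show ?case unfolding app_def using T_add[OF z(2,4)] mspan_add[OF z(1,3)]
    by (intro bexI[of _ "z \<boxplus> z'"]) simp_all
  next
   case (path c q)
   have q: "path_elem B q : carrier P" and c: "c : carrier B" using path by simp_all
   have "c \<bullet> path_elem B q \<boxminus> g (c \<bullet> path_elem B q) = c \<bullet> (path_elem B q \<boxminus> g (path_elem B q))"
    using c q gP[OF q] by (simp add: semilinearD(3)[OF g] a_minus_def PM.smult_r_distr PM.smult_r_minus)
   then show ?case unfolding app_def using c q gP[OF q] mspan_smult[OF p[OF path(3)] c]
    by (intro bexI[of _ "c \<bullet> (path_elem B q \<boxminus> g (path_elem B q))"]) (simp_all add: a_minus_def P.r_neg)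
  next
   case (small z)
   have "(z \<boxminus> g z) \<boxminus> \<zero>\<^sub>P : T UNIV n" using small gT[OF small(2)] by (intro T_minus) auto
   then show ?case unfolding app_def using mspan_zero by blast
  qed
  moreover have "y \<boxminus> g y = y" using y J(1) by (simp add: a_minus_def)
  ultimately obtain z where z: "z : mspan X" "y \<boxminus> z : T UNIV n" unfolding app_def by auto
  have "y p \<ominus> z p : F n" for p
   using T_F[OF z(2), of p] yU sP(1)[OF z(1)] by (simp add: P_minus_apply)
  then show "\<exists>x\<in>mspan X. \<forall>p. y p \<ominus> x p : F n" using z(1) by blast
 qed
qed

end

locale tips_hom = adic_hom B m Q B' m' f + src: quiver_tips B m Q S + tgt: quiver_tips B' m' Q S
 for B (structure) and m and Q :: "('v, 'w) pre_digraph" and S and B' (structure) and m' and f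
begin

text \<open>The projection along the base change is the linear extension of \<open>p \<mapsto> f \<circ> proj J p\<close>, and
 the base change is spanned by the images of the differences \<open>p - proj J p\<close>.\<close>

theorem base_change_complement:
 assumes J: "src.complement J"
 shows "tgt.complement (base_change_ideal B' m' Q f J)"
  "x : carrier src.P ==> tgt.proj (base_change_ideal B' m' Q f J) (f \<circ> x) = f \<circ> src.proj J x"
proof -
 let ?S = "src.P" and ?T = "tgt.P"
 have u: "f \<circ> src.proj J (path_elem B p) : tgt.T src.Ir 0" if "p : UNIV" "p : paths Q" for p
  using that by (intro f_T src.proj(1)[OF J]) simp
 obtain g where g0: "tgt.lin (tgt.T UNIV 0) g" "!!x. x : tgt.T UNIV 0 ==> g x : tgt.T src.Ir 0"
  "!!p. p : UNIV ==> p : paths Q ==> g (path_elem B' p) = f \<circ> src.proj J (path_elem B p)"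
  by (rule tgt.linear_extension[of UNIV "\<lambda>p. f \<circ> src.proj J (path_elem B p)", OF u]) (assumption | rule that)+
 have g: "tgt.lin (carrier ?T) g" and gT: "!!x. x : carrier ?T ==> g x : tgt.T src.Ir 0"
  and gp: "!!p. p : paths Q ==> g (path_elem B' p) = f \<circ> src.proj J (path_elem B p)"
  using g0 by simp_all
 have gP: "g x : carrier ?T" if "x : carrier ?T" for x using tgt.T_P[OF gT[OF that]] .
 have gI: "g u = u" if "u : tgt.T src.Ir 0" for u
 proof (rule tgt.lin_eq[OF _ _ _ that])
  show "tgt.lin (tgt.T src.Ir 0) g" using g tgt.T_P by (auto intro: semilinear_subset)
  show "tgt.lin (tgt.T src.Ir 0) (\<lambda>u. u)" by (rule semilinearI) (auto simp: tgt.T_P)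
  show "g (path_elem B' p) = path_elem B' p" if "p : src.Ir" "p : paths Q" for p
   using gp[OF that(2)] src.proj_Irr[OF J src.T_path_elem[OF that(2,1)]] by (simp add: f_path_elem)
 qed
 have gf: "g (f \<circ> x) = f \<circ> src.proj J x" if x: "x : carrier ?S" for x
 proof (rule semilinear_eq[where X = UNIV and g = "\<lambda>x. g (f \<circ> x)" and h = "\<lambda>x. f \<circ> src.proj J x"])
  note pl = semilinearD[OF src.proj_lin[OF J]]
  show "semilinear f B ?S ?T (src.T UNIV 0) (\<lambda>x. g (f \<circ> x))"
   by (rule semilinearI) (auto simp: gP f_P_add f_P_smult semilinearD(2,3)[OF g])
  show "semilinear f B ?S ?T (src.T UNIV 0) (\<lambda>x. f \<circ> src.proj J x)"
   by (rule semilinearI) (auto simp: pl f_P_add f_P_smult)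
  show "g (f \<circ> path_elem B p) = f \<circ> src.proj J (path_elem B p)" if "p : paths Q" for p
   by (simp add: gp[OF that] f_path_elem)
 qed (use x in simp)
 let ?J = "{x : carrier ?T. g x = \<zero>\<^bsub>?T\<^esub>}"
 have mult: "g (g (path_elem B' a) \<otimes>\<^bsub>?T\<^esub> path_elem B' b) = g (path_elem B' a \<otimes>\<^bsub>?T\<^esub> path_elem B' b)"
   "g (path_elem B' a \<otimes>\<^bsub>?T\<^esub> g (path_elem B' b)) = g (path_elem B' a \<otimes>\<^bsub>?T\<^esub> path_elem B' b)"
  if "a : paths Q" "b : paths Q" for a b
 proof -
  have ab: "path_elem B a : carrier ?S" "path_elem B b : carrier ?S" using that by auto
  have pab: "src.proj J (path_elem B a) : carrier ?S" "src.proj J (path_elem B b) : carrier ?S"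
   using src.proj_P[OF J] ab by auto
  have "g ((f \<circ> src.proj J (path_elem B a)) \<otimes>\<^bsub>?T\<^esub> (f \<circ> path_elem B b)) =
    g ((f \<circ> path_elem B a) \<otimes>\<^bsub>?T\<^esub> (f \<circ> path_elem B b))"
   "g ((f \<circ> path_elem B a) \<otimes>\<^bsub>?T\<^esub> (f \<circ> src.proj J (path_elem B b))) =
    g ((f \<circ> path_elem B a) \<otimes>\<^bsub>?T\<^esub> (f \<circ> path_elem B b))"
   using ab pab by (simp_all only: f_P_mult[symmetric] gf src.P.m_closed src.proj_mult[OF J])
  then show "g (g (path_elem B' a) \<otimes>\<^bsub>?T\<^esub> path_elem B' b) = g (path_elem B' a \<otimes>\<^bsub>?T\<^esub> path_elem B' b)"
   "g (path_elem B' a \<otimes>\<^bsub>?T\<^esub> g (path_elem B' b)) = g (path_elem B' a \<otimes>\<^bsub>?T\<^esub> path_elem B' b)"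
   using that by (simp_all add: gp f_path_elem)
 qed
 note compl = tgt.complement_if_paths[OF g gT gI mult refl]
 have X: "(\<lambda>x. f \<circ> x) ` J \<subseteq> ?J"
 proof (clarify, intro conjI)
  fix j assume j: "j : J"
  note jP = src.complement_sub[OF J j]
  show "f \<circ> j : carrier ?T" using jP by simp
  show "g (f \<circ> j) = \<zero>\<^bsub>?T\<^esub>" using gf[OF jP] src.proj_eq_zero[OF J jP] j f_P_zero by simp
 qed
 have diff: "path_elem B' p \<ominus>\<^bsub>?T\<^esub> g (path_elem B' p) : tgt.mspan ((\<lambda>x. f \<circ> x) ` J)" if p: "p : paths Q" for p
 proof -
  have pP: "path_elem B p : carrier ?S" using p by simp
  have "path_elem B' p \<ominus>\<^bsub>?T\<^esub> g (path_elem B' p) = f \<circ> (path_elem B p \<ominus>\<^bsub>?S\<^esub> src.proj J (path_elem B p))"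
   using f_P_minus[OF pP src.proj_P[OF J pP]] gp[OF p] by (simp add: f_path_elem)
  then show ?thesis using subsetD[OF tgt.mspan_base imageI[OF src.proj(2)[OF J pP], of "\<lambda>x. f \<circ> x"]] by simp
 qed
 have eq: "base_change_ideal B' m' Q f J = ?J"
  unfolding base_change_ideal_def
  by (rule sym, rule tgt.kernel_is_closure[OF g refl tgt.complement_ideal[OF compl(1)] X diff])
 show "tgt.complement (base_change_ideal B' m' Q f J)" unfolding eq using compl(1) .
 show "tgt.proj (base_change_ideal B' m' Q f J) (f \<circ> x) = f \<circ> src.proj J x" if "x : carrier ?S"
 proof -
  have "tgt.proj ?J (f \<circ> x) = g (f \<circ> x)" using f_P[OF that] by (rule compl(2)[rotated -1])
  then show ?thesis by (simp only: eq gf[OF that])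
 qed
qed

end

section \<open>Trivially filtered coefficients\<close>

text \<open>A ring \<open>R\<close> is complete for the zero ideal, and its completed path algebra is then
 the path algebra itself. This makes \<open>\<Bbbk>Q\<close> an instance of the theory above.\<close>

lemma (in cring) zero_power: "ideal_power R {\<zero>} (Suc n) = {\<zero>}"
proof -
 interpret M: comm_monoid "ideals_set R" by (rule ideals_set_is_comm_monoid)
 have z: "{\<zero>} : carrier (ideals_set R)" by (simp add: ideals_set_def zeroideal)
 have I: "ideal_power R {\<zero>} n : carrier (ideals_set R)" using M.nat_pow_closed[OF z] .
 have "ideal_power R {\<zero>} (Suc n) = ideal_prod R (ideal_power R {\<zero>} n) {\<zero>}"
  using M.nat_pow_Suc[of "{\<zero>}" n] by (simp add: ideals_set_def)
 also have "\<dots> = {\<zero>}" using I ideal_prod_zero[of "ideal_power R {\<zero>} n"] by (simp add: ideals_set_def)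
 finally show ?thesis .
qed

lemma (in cring) adic_ring_zero: "adic_ring R {\<zero>}"
proof (rule adic_ring.intro[OF is_cring], rule adic_ring_axioms.intro)
 show "ideal {\<zero>} R" by (rule zeroideal)
 have F0: "ideal_power R {\<zero>} 0 = carrier R" by (simp add: nat_pow_def)
 show "complete_filtration R (ideal_power R {\<zero>})"
  unfolding complete_filtration_def
 proof (intro allI impI)
  fix x :: "nat => 'a"
  assume x: "\<forall>n. x n : ideal_power R {\<zero>} 0 \<and> x (Suc n) \<ominus> x n : ideal_power R {\<zero>} n"
  then have xR: "x n : carrier R" for n unfolding F0 by blast
  have step: "x (Suc (Suc n)) = x (Suc n)" for n
   using x[THEN spec, of "Suc n"] zero_power[of n] xR by simp
  have const: "x (Suc n) = x (Suc 0)" for n by (induction n) (auto simp: step)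
  show "\<exists>!y. y : ideal_power R {\<zero>} 0 \<and> (\<forall>n. y \<ominus> x n : ideal_power R {\<zero>} n)"
  proof (rule ex1I[of _ "x (Suc 0)"])
   have "x (Suc 0) \<ominus> x n : ideal_power R {\<zero>} n" for n
   proof (cases n)
    case 0
    then show ?thesis using xR by (simp add: nat_pow_def)
   next
    case (Suc k)
    then show ?thesis using xR const[of k] unfolding Suc zero_power by (simp add: a_minus_def r_neg)
   qed
   then show "x (Suc 0) : ideal_power R {\<zero>} 0 \<and> (\<forall>n. x (Suc 0) \<ominus> x n : ideal_power R {\<zero>} n)"
    unfolding F0 using xR by blast
   fix y assume y: "y : ideal_power R {\<zero>} 0 \<and> (\<forall>n. y \<ominus> x n : ideal_power R {\<zero>} n)"
   then have "y : carrier R" unfolding F0 by blast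
   moreover have "y \<ominus> x (Suc 0) : {\<zero>}" using y zero_power[of 0] by blast
   ultimately show "y = x (Suc 0)" using xR by simp
  qed
 qed
 show "\<exists>G. finite G \<and> G \<subseteq> carrier R \<and> ideal_power R {\<zero>} n = Idl G" for n
 proof (cases n)
  case 0
  then show ?thesis using genideal_one F0 by (intro exI[of _ "{\<one>}"]) simp
 next
  case (Suc k)
  then show ?thesis using genideal_zero zero_power by (intro exI[of _ "{\<zero>}"]) simp
 qed
qed

lemma (in cring) path_algebra_trivially_completed:
 fixes Q :: "('v, 'w) pre_digraph"
 shows "completed_path_algebra R {\<zero>} Q = path_algebra R Q"
proof -
 have F0: "ideal_power R {\<zero>} 0 = carrier R" by (simp add: nat_pow_def)
 have "(\<forall>n. finite {p : paths Q. x p \<notin> ideal_power R {\<zero>} n}) \<longleftrightarrow> finite {p. x p \<noteq> \<zero>}"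
  if x: "\<forall>p\<in>paths Q. x p : carrier R" "\<forall>p. p \<notin> paths Q \<longrightarrow> x p = \<zero>" for x :: "('v, 'w) path => 'a"
 proof -
  have e1: "{p. x p \<noteq> \<zero>} = {p : paths Q. x p \<notin> ideal_power R {\<zero>} (Suc n)}" for n
   unfolding zero_power using x(2) by auto
  have e0: "{p : paths Q. x p \<notin> ideal_power R {\<zero>} 0} = {}" unfolding F0 using x(1) by auto
  show ?thesis
  proof
   show "finite {p. x p \<noteq> \<zero>}" if "\<forall>n. finite {p : paths Q. x p \<notin> ideal_power R {\<zero>} n}"
    unfolding e1[of 0] using that by blast
   show "\<forall>n. finite {p : paths Q. x p \<notin> ideal_power R {\<zero>} n}" if fin: "finite {p. x p \<noteq> \<zero>}"
   proof
    fix n show "finite {p : paths Q. x p \<notin> ideal_power R {\<zero>} n}"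
    proof (cases n)
     case 0
     show ?thesis unfolding 0 e0 by simp
    next
     case (Suc k)
     show ?thesis unfolding Suc e1[of k, symmetric] by (rule fin)
    qed
   qed
  qed
 qed
 then show ?thesis unfolding completed_path_algebra_def path_algebra_def
  by (simp cong: conj_cong)
qed

text \<open>If all sequences of reductions stabilize, there is no infinite chain of paths each of which
 occurs in a replacement of its predecessor. Cancellation is the difficulty. Along a chain without
 repetitions, always reducing the last member present never lets the chain disappear. Otherwise
 there is a finite set of paths, each having a successor in the set; in a minimal such set
 every path has exactly one successor, so reducing moves a single path around the set
 forever.\<close>

context rules
begin

lemma breds_at:
 assumes "oc : occurrences Q S p" "x : carrier P"
 shows "p' \<noteq> p ==> breds oc x p' = x p' \<oplus> x p \<otimes> repl oc p'" "breds oc x p = \<zero>"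
proof -
 obtain q s r where oc: "oc = (q, s, r)" by (metis prod_cases3)
 have pQ: "p : paths Q" using occurrencesD[OF assms(1)[unfolded oc]] by blast
 note c = P_coeff[OF assms(2)] P_coeff[OF repl_P[OF assms(1)]]
 have *: "(repl oc \<boxminus> path_elem B p) p' = repl oc p' \<ominus> path_elem B p p'" for p'
  using P_minus_apply[OF repl_P[OF assms(1)] path_elem_P[OF pQ]] .
 show "breds oc x p' = x p' \<oplus> x p \<otimes> repl oc p'" if "p' \<noteq> p"
  unfolding breds_eq[OF assms] P_apply * using that c by (simp add: path_elem_def a_minus_def)
 show "breds oc x p = \<zero>"
  unfolding breds_eq[OF assms] P_apply * using c[of p] repl_self[OF assms(1)]
  by (simp add: path_elem_def a_minus_def r_minus r_neg)
qed

lemma not_reduction_finite: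
 assumes p: "p : paths Q" and start: "Good (path_elem B p)"
  and step: "!!x. x : carrier P ==> Good x ==>
   \<exists>oc p'. oc : occurrences Q S p' \<and> Good (breds oc x) \<and> breds oc x \<noteq> x"
 shows "\<not> reduction_finite B Q S \<chi> p"
proof
 assume fin: "reduction_finite B Q S \<chi> p"
 have "\<forall>x. \<exists>oc. x : carrier P \<and> Good x \<longrightarrow>
   (\<exists>p'. oc : occurrences Q S p') \<and> Good (breds oc x) \<and> breds oc x \<noteq> x" using step by blast
 from choice[OF this] obtain oc where oc: "!!x. x : carrier P ==> Good x ==>
   (\<exists>p'. oc x : occurrences Q S p') \<and> Good (breds (oc x) x) \<and> breds (oc x) x \<noteq> x" by blast
 define y where "y k = ((\<lambda>x. breds (oc x) x) ^^ k) (path_elem B p)" for k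
 have y: "y k : carrier P \<and> Good (y k)" for k
 proof (induction k)
  case 0
  show ?case using p start by (simp add: y_def)
 next
  case (Suc k)
  then obtain p' where "oc (y k) : occurrences Q S p'" "Good (breds (oc (y k)) (y k))" using oc by blast
  moreover from this have "breds (oc (y k)) (y k) : carrier P" using semilinearD(1)[OF breds_lin] Suc by blast
  ultimately show ?case by (simp add: y_def)
 qed
 have "\<forall>i. breds (oc (y i)) : reds" using oc y breds_reds by blast
 then obtain N where N: "!!n. n \<ge> N ==> rec_nat (path_elem B p) (\<lambda>i. breds (oc (y i))) n =
   rec_nat (path_elem B p) (\<lambda>i. breds (oc (y i))) N"
  using fin unfolding reduction_finite_def by meson
 have "rec_nat (path_elem B p) (\<lambda>i. breds (oc (y i))) k = y k" for k
  by (induction k) (simp_all add: y_def)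
 then have "y (Suc N) = y N" using N[of "Suc N"] by (simp del: nat.rec)
 then show False using oc[of "y N"] y[of N] by (simp add: y_def)
qed

lemma wf_if_reduction_finite:
 assumes dom: "domain B" and m: "m = {\<zero>}"
  and fin: "!!p. p : paths Q ==> reduction_finite B Q S \<chi> p"
 shows "wf {(p', p). \<exists>oc\<in>occurrences Q S p. repl oc p' \<notin> m}" (is "wf ?r")
proof (rule ccontr)
 interpret domain B by fact
 have occ_path: "p : paths Q" if "oc : occurrences Q S p" for oc p
  using occurrencesD(5) that by (metis prod_cases3)
 have nonzero: "a \<otimes> b \<noteq> \<zero>" if "a : carrier B" "b : carrier B" "a \<noteq> \<zero>" "b \<noteq> \<zero>" for a b
  using integral that by blast
 assume "\<not> wf ?r"
 then obtain c where c: "!!i. (c (Suc i), c i) : ?r"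
  unfolding wf_iff_no_infinite_down_chain by blast
 have "\<exists>p\<in>paths Q. \<not> reduction_finite B Q S \<chi> p"
 proof (cases "inj c")
  case True
  define Good where "Good x \<longleftrightarrow> (\<exists>i. x (c i) \<noteq> \<zero>)" for x
  have "\<not> reduction_finite B Q S \<chi> (c 0)"
  proof (rule not_reduction_finite[of _ Good])
   show "c 0 : paths Q" using c[of 0] occ_path by blast
   show "Good (path_elem B (c 0))" by (auto simp: Good_def path_elem_def intro!: exI[of _ 0])
   fix x assume x: "x : carrier P" and "Good x"
   define I where "I = {i. x (c i) \<noteq> \<zero>}"
   have "{p. x p \<notin> F (Suc 0)} = {p. x p \<noteq> \<zero>}" unfolding F_1 using m by auto
   then have "finite {p. x p \<noteq> \<zero>}" using P_finite[OF x, of "Suc 0"] by (simp only:)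
   then have "finite (c -` {p. x p \<noteq> \<zero>})" by (rule finite_vimageI) (rule True)
   then have finI: "finite I" by (simp add: I_def vimage_def)
   have "I \<noteq> {}" using \<open>Good x\<close> by (auto simp: Good_def I_def)
   then have i: "Max I : I" using finI by simp
   define i where "i = Max I"
   have xi: "x (c i) \<noteq> \<zero>" using i by (simp add: I_def i_def)
   have xSi: "x (c (Suc i)) = \<zero>" using Max_ge[OF finI, of "Suc i"] by (auto simp: I_def i_def)
   obtain oc where oc: "oc : occurrences Q S (c i)" "repl oc (c (Suc i)) \<noteq> \<zero>" using c[of i] m by auto
   have ne: "c (Suc i) \<noteq> c i" using injD[OF True, of "Suc i" i] by auto
   have "breds oc x (c (Suc i)) = x (c i) \<otimes> repl oc (c (Suc i))"
    using breds_at(1)[OF oc(1) x ne] xSi x repl_P[OF oc(1)] by simp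
   then have "breds oc x (c (Suc i)) \<noteq> \<zero>" using nonzero xi oc x repl_P[OF oc(1)] by simp
   moreover have "breds oc x \<noteq> x" using breds_at(2)[OF oc(1) x] xi by metis
   ultimately show "\<exists>oc p'. oc : occurrences Q S p' \<and> Good (breds oc x) \<and> breds oc x \<noteq> x"
    using oc(1) unfolding Good_def by blast
  qed
  then show ?thesis using c[of 0] occ_path by blast
 next
  case False
  then obtain i j where ij: "c i = c j" "i < j" by (metis injI linorder_neqE_nat)
  define closed where "closed C \<longleftrightarrow> finite C \<and> C \<noteq> {} \<and> (\<forall>p\<in>C. \<exists>p'\<in>C. (p', p) : ?r)" for C
  have "closed (c ` {i..<j})"
   unfolding closed_def
  proof (intro conjI ballI)
   fix p assume "p : c ` {i..<j}"
   then obtain k where k: "p = c k" "i \<le> k" "k < j" by auto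
   have "c (Suc k) : c ` {i..<j}"
   proof (cases "Suc k = j")
    case True
    then have "c (Suc k) = c i" using ij by simp
    then show ?thesis using ij(2) by auto
   next
    case False
    then show ?thesis using k by auto
   qed
   then show "\<exists>p'\<in>c ` {i..<j}. (p', p) : ?r" using c[of k] unfolding k(1) by blast
  qed (use ij in auto)
  then obtain C where C: "closed C" and min: "!!D. closed D ==> card C \<le> card D"
   using ex_has_least_nat[of closed _ card] by blast
  have finC: "finite C" using C by (simp add: closed_def)
  have "\<forall>p. \<exists>oc. p : C \<longrightarrow> oc : occurrences Q S p \<and> (\<exists>p'\<in>C. repl oc p' \<noteq> \<zero>)"
   using C unfolding closed_def m by blast
  from choice[OF this] obtain oc where
   "\<forall>p. p : C \<longrightarrow> oc p : occurrences Q S p \<and> (\<exists>p'\<in>C. repl (oc p) p' \<noteq> \<zero>)" by blast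
  then have oc: "!!p. p : C ==> oc p : occurrences Q S p"
   and "\<forall>p. \<exists>p'. p : C \<longrightarrow> p' : C \<and> repl (oc p) p' \<noteq> \<zero>" by blast+
  from choice[OF this(2)] obtain nx where nx: "!!p. p : C ==> nx p : C \<and> repl (oc p) (nx p) \<noteq> \<zero>" by blast
  have image: "h ` C = C" if h: "!!p. p : C ==> h p : C \<and> repl (oc p) (h p) \<noteq> \<zero>" for h
  proof -
   have sub: "h ` C \<subseteq> C" using h by auto
   have "closed (h ` C)"
    unfolding closed_def
   proof (intro conjI ballI)
    fix p assume "p : h ` C"
    then have pC: "p : C" using sub by auto
    then have "(h p, p) : ?r" using h[OF pC] oc[OF pC] m by blast
    then show "\<exists>p'\<in>h ` C. (p', p) : ?r" using pC by blast
   qed (use C in \<open>auto simp: closed_def\<close>)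
   from min[OF this] show ?thesis using card_seteq[OF finC sub] by blast
  qed
  have unique: "a = nx p" if p: "p : C" and a: "a : C" "repl (oc p) a \<noteq> \<zero>" for p a
  proof -
   have inj: "inj_on h C" if "h ` C = C" for h :: "('v, 'w) path => ('v, 'w) path"
    using that finC by (simp add: eq_card_imp_inj_on)
   have remove: "h ` (C - {p}) = C - {h p}" if "h ` C = C" for h :: "('v, 'w) path => ('v, 'w) path"
    using inj_on_image_set_diff[OF inj[OF that], of C "{p}"] that p by auto
   let ?h = "nx(p := a)"
   have "?h ` C = C" by (rule image) (use nx p a in auto)
   from remove[OF this] have "?h ` (C - {p}) = C - {a}" by simp
   moreover have "?h ` (C - {p}) = nx ` (C - {p})" by (intro image_cong) auto
   moreover have "nx ` (C - {p}) = C - {nx p}" by (rule remove[OF image]) (rule nx)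
   ultimately show ?thesis using a(1) nx[OF p] by blast
  qed
  have nx_ne: "nx p \<noteq> p" if "p : C" for p using nx[OF that] repl_self[OF oc[OF that]] by metis
  obtain p0 where p0: "p0 : C" using C by (auto simp: closed_def)
  define Good where "Good x \<longleftrightarrow> (\<exists>p\<in>C. {q : C. x q \<noteq> \<zero>} = {p})" for x
  have "\<not> reduction_finite B Q S \<chi> p0"
  proof (rule not_reduction_finite[of _ Good])
   show "p0 : paths Q" using oc[OF p0] occ_path by blast
   show "Good (path_elem B p0)" unfolding Good_def using p0
    by (intro bexI[OF _ p0]) (auto simp: path_elem_def)
   fix x assume x: "x : carrier P" and "Good x"
   then obtain p where p: "p : C" "{q : C. x q \<noteq> \<zero>} = {p}" by (auto simp: Good_def)
   then have xp: "x p \<noteq> \<zero>" by blast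
   have w: "repl (oc p) : carrier P" using repl_P[OF oc[OF p(1)]] .
   have at: "breds (oc p) x q = x p \<otimes> repl (oc p) q" if "q : C" "q \<noteq> p" for q
    using breds_at(1)[OF oc[OF p(1)] x that(2)] p(2) that x w by auto
   have "breds (oc p) x q \<noteq> \<zero> \<longleftrightarrow> q = nx p" if "q : C" for q
   proof (cases "q = p")
    case True
    then show ?thesis using breds_at(2)[OF oc[OF p(1)] x] nx_ne[OF p(1)] by auto
   next
    case False
    have "x p \<otimes> repl (oc p) q \<noteq> \<zero> \<longleftrightarrow> repl (oc p) q \<noteq> \<zero>"
     using nonzero[of "x p" "repl (oc p) q"] xp x w by auto
    then show ?thesis using at[OF that False] unique[OF p(1) that] nx[OF p(1)] by auto
   qed
   then have "{q : C. breds (oc p) x q \<noteq> \<zero>} = {nx p}" using nx[OF p(1)] by blast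
   then have "Good (breds (oc p) x)" unfolding Good_def using nx[OF p(1)] by blast
   moreover have "breds (oc p) x \<noteq> x" using breds_at(2)[OF oc[OF p(1)] x] xp by metis
   ultimately show "\<exists>oc p'. oc : occurrences Q S p' \<and> Good (breds oc x) \<and> breds oc x \<noteq> x"
    using oc[OF p(1)] by blast
  qed
  then show ?thesis using oc[OF p0] occ_path by blast
 qed
 then show False using fin by blast
qed

end

declare nat_pow_Suc [simp del]

section \<open>Reductions modulo powers of the maximal ideal\<close>

text \<open>The same map as \<open>truncation\<close>, for an arbitrary coefficient ring.\<close>

definition trunc :: "('b, 'm) ring_scheme => 'b set => nat => (('v, 'a) path => 'b) => ('v, 'a) path => 'b set" where
 "trunc B m n x = (\<lambda>p. ideal_power B m (Suc n) +>\<^bsub>B\<^esub> x p)"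

lemma truncation_eq: "truncation = trunc"
 by (intro ext) (simp add: truncation_def trunc_def)

context rules
begin

abbreviation BQ where "BQ n \<equiv> B Quot F (Suc n)"
abbreviation tr where "tr n \<equiv> trunc B m n"
abbreviation cls where "cls n \<equiv> (\<lambda>b. F (Suc n) +> b)"

lemma BQ_cring: "cring (BQ n)"
 by (rule ideal.quotient_is_cring[OF F_ideal is_cring])

lemma cls_hom: "cls n : ring_hom B (BQ n)"
 using ideal.rcos_ring_hom[OF F_ideal] .

lemma BQ_quiver: "coeff_quiver (BQ n) Q"
 by (intro coeff_quiver.intro BQ_cring wf_digraph_axioms)

lemma cls_eq:
 assumes "a : carrier B" "b : carrier B"
 shows "cls n a = cls n b \<longleftrightarrow> a \<ominus> b : F (Suc n)"
 using ring.quotient_eq_iff_same_a_r_cos[OF ring_axioms F_ideal assms] by blast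

lemma cls_zero:
 assumes "a : carrier B"
 shows "cls n a = \<zero>\<^bsub>BQ n\<^esub> \<longleftrightarrow> a : F (Suc n)"
 using cls_eq[OF assms zero_closed, of n] assms ring_hom_zero[OF cls_hom ring_axioms cring.axioms(1)[OF BQ_cring]]
 by (simp add: a_minus_def)

lemma tr_comp: "tr n x = cls n \<circ> x"
 by (simp add: trunc_def comp_def)

lemma tr_apply: "tr n x p = cls n (x p)"
 by (simp add: trunc_def)

lemma tr_eq:
 assumes "x : carrier P" "y : carrier P"
 shows "tr n x = tr n y \<longleftrightarrow> x \<boxminus> y : T UNIV (Suc n)"
proof -
 have "tr n x = tr n y \<longleftrightarrow> (\<forall>p. x p \<ominus> y p : F (Suc n))"
  using assms by (simp add: fun_eq_iff tr_apply cls_eq)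
 also have "\<dots> \<longleftrightarrow> x \<boxminus> y : T UNIV (Suc n)"
  using assms by (simp add: fspan_def P_minus_apply)
 finally show ?thesis .
qed

lemma irreducible_tr:
 assumes "x : carrier P"
 shows "irreducible_elem (BQ n) Q S (tr n x) \<longleftrightarrow> (\<forall>p. x p \<notin> F (Suc n) \<longrightarrow> p : Ir)"
 using cls_zero[OF P_coeff[OF assms]] by (simp add: irreducible_elem_def tr_apply)

lemma tr_path_elem: "tr n (pe p) = path_elem (BQ n) p"
 unfolding tr_comp by (rule ring_hom_path_elem[OF cls_hom ring_axioms cring.axioms(1)[OF BQ_cring]])

lemma repl_tr:
 assumes "oc : occurrences Q S p"
 shows "replacement (BQ n) Q (\<lambda>s. tr n (\<chi> s)) oc = tr n (repl oc)"
proof -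
 obtain q s r where oc: "oc = (q, s, r)" by (metis prod_cases3)
 note o = occurrencesD[OF assms[unfolded oc]]
 have chi: "\<chi> s : carrier P" using rule_P o by blast
 note h = ring_hom_conv[OF cls_hom coeff_quiver_axioms BQ_quiver]
 have 1: "tr n (conv B Q (pe q) (\<chi> s)) = conv (BQ n) Q (path_elem (BQ n) q) (tr n (\<chi> s))"
  unfolding tr_path_elem[symmetric] unfolding tr_comp using o chi by (intro h) auto
 have 2: "tr n (conv B Q (conv B Q (pe q) (\<chi> s)) (pe r)) =
   conv (BQ n) Q (tr n (conv B Q (pe q) (\<chi> s))) (path_elem (BQ n) r)"
  unfolding tr_path_elem[symmetric] unfolding tr_comp using o chi by (intro h) auto
 show ?thesis unfolding oc replacement_def by (simp add: 1[symmetric] 2[symmetric])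
qed

lemma breds_tr:
 assumes oc: "oc : occurrences Q S p" and x: "x : carrier P"
 shows "basic_reduction (BQ n) Q (\<lambda>s. tr n (\<chi> s)) oc (tr n x) = tr n (breds oc x)"
proof
 fix p'
 obtain q s r where oc': "oc = (q, s, r)" by (metis prod_cases3)
 have p: "path_cat q (path_cat s r) = p" using oc by (auto simp: occurrences_def oc')
 note c = P_coeff[OF x] P_coeff[OF repl_P[OF oc]]
 have z: "cls n \<zero> = \<zero>\<^bsub>BQ n\<^esub>" using cls_zero[OF zero_closed, of n] by simp
 show "basic_reduction (BQ n) Q (\<lambda>s. tr n (\<chi> s)) oc (tr n x) p' = tr n (breds oc x) p'"
  using repl_tr[OF oc, of n] c[unfolded oc'] ring_hom_mult[OF cls_hom, of "x p" "repl (q, s, r) p'" n]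
   ring_hom_add[OF cls_hom, of "x p'" "x p \<otimes> repl (q, s, r) p'" n]
   ring_hom_add[OF cls_hom, of "\<zero>" "x p \<otimes> repl (q, s, r) p'" n]
  unfolding oc' basic_reduction_def
  by (cases "p' = p") (simp_all add: Let_def p tr_apply z del: l_zero)
qed

lemma reductions_tr:
 assumes "\<rho> : reductions (BQ n) Q S (\<lambda>s. tr n (\<chi> s))"
 shows "\<exists>\<rho>'\<in>reds. \<forall>x\<in>carrier P. \<rho>' x : carrier P \<and> \<rho> (tr n x) = tr n (\<rho>' x)"
 using assms
proof (induction rule: reductions.induct)
 case 1
 show ?case using reductions.intros(1) by (intro bexI[of _ id]) auto
next
 case (2 \<rho> oc p)
 then obtain \<rho>' where \<rho>': "\<rho>' : reds" "!!x. x : carrier P ==> \<rho>' x : carrier P \<and> \<rho> (tr n x) = tr n (\<rho>' x)" by blast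
 have "breds oc \<circ> \<rho>' : reds" using \<rho>'(1) 2(2) by (rule reductions.intros(2))
 then show ?case
  using \<rho>'(2) breds_tr[OF 2(2)] semilinearD(1)[OF breds_lin[OF 2(2)]]
  by (intro bexI[of _ "breds oc \<circ> \<rho>'"]) auto
qed

lemma tr_reductions:
 assumes "\<rho> : reds"
 shows "\<exists>\<rho>'\<in>reductions (BQ n) Q S (\<lambda>s. tr n (\<chi> s)).
  \<forall>x\<in>carrier P. \<rho> x : carrier P \<and> \<rho>' (tr n x) = tr n (\<rho> x)"
 using assms
proof (induction rule: reductions.induct)
 case 1
 show ?case by (intro bexI[OF _ reductions.intros(1)]) auto
next
 case (2 \<rho> oc p)
 then obtain \<rho>' where \<rho>': "\<rho>' : reductions (BQ n) Q S (\<lambda>s. tr n (\<chi> s))"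
  "!!x. x : carrier P ==> \<rho> x : carrier P \<and> \<rho>' (tr n x) = tr n (\<rho> x)" by blast
 show ?case
  using \<rho>'(2) breds_tr[OF 2(2)] semilinearD(1)[OF breds_lin[OF 2(2)]]
  by (intro bexI[OF _ reductions.intros(2)[OF \<rho>'(1) 2(2)]]) auto
qed

end

context rewriting
begin

lemma irr_mod_tr: "x : carrier P ==> irreducible_elem (BQ n) Q S (tr n x) \<longleftrightarrow> irr_mod (Suc n) x"
 unfolding irr_mod_def by (rule irreducible_tr)

text \<open>Confluence over \<open>B\<close> is confluence over all the quotients by powers of \<open>m\<close>. Only powers from the second on
are covered by the hypothesis, which is enough since the conditions for larger powers imply those for
smaller ones.\<close>

lemma confluent_if_reduction_unique:
 assumes uniq: "!!n p. n \<ge> 1 ==> p : paths Q ==>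
  reduction_unique (BQ n) Q S (\<lambda>s. tr n (\<chi> s)) p"
 shows confluent
 unfolding confluent_def
proof (intro allI impI ballI)
 fix k :: nat and p \<rho> \<rho>'
 assume k: "2 \<le> k" and p: "p : paths Q" and \<rho>: "\<rho> : reds" "\<rho>' : reds"
  and irr: "irr_mod k (\<rho> (pe p)) \<and> irr_mod k (\<rho>' (pe p))"
 define n where "n = k - 1"
 have n: "n \<ge> 1" "k = Suc n" using k by (auto simp: n_def)
 have pP: "pe p : carrier P" using p by simp
 obtain r r' where r: "r : reductions (BQ n) Q S (\<lambda>s. tr n (\<chi> s))" "r (tr n (pe p)) = tr n (\<rho> (pe p))"
  "r' : reductions (BQ n) Q S (\<lambda>s. tr n (\<chi> s))" "r' (tr n (pe p)) = tr n (\<rho>' (pe p))"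
  using tr_reductions[OF \<rho>(1), of n] tr_reductions[OF \<rho>(2), of n] pP by blast
 have P: "\<rho> (pe p) : carrier P" "\<rho>' (pe p) : carrier P" using reds_P \<rho> pP by auto
 have U: "r (path_elem (BQ n) p) = r' (path_elem (BQ n) p)"
  if "irreducible_elem (BQ n) Q S (r (path_elem (BQ n) p))" "irreducible_elem (BQ n) Q S (r' (path_elem (BQ n) p))"
  using uniq[OF n(1) p] r(1,3) that unfolding reduction_unique_def by blast
 have "r (path_elem (BQ n) p) = r' (path_elem (BQ n) p)"
 proof (rule U)
  show "irreducible_elem (BQ n) Q S (r (path_elem (BQ n) p))"
   using r(2) irr irr_mod_tr[OF P(1), of n] n(2) by (simp add: tr_path_elem)
  show "irreducible_elem (BQ n) Q S (r' (path_elem (BQ n) p))"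
   using r(4) irr irr_mod_tr[OF P(2), of n] n(2) by (simp add: tr_path_elem)
 qed
 then have "tr n (\<rho> (pe p)) = tr n (\<rho>' (pe p))" using r(2,4) by (simp add: tr_path_elem)
 then show "\<rho> (pe p) \<boxminus> \<rho>' (pe p) : T UNIV k" using tr_eq[OF P] n(2) by simp
qed

text \<open>Reductions do not leave the residue class modulo \<open>J\<close>, and an irreducible element is determined by its
class.\<close>

lemma reduction_unique_if_complement:
 assumes J: "complement J" and rel: "!!s. s : S ==> pe s \<boxminus> \<chi> s : J"
  and p: "p : paths Q"
 shows "reduction_unique (BQ n) Q S (\<lambda>s. tr n (\<chi> s)) p"
 unfolding reduction_unique_def
proof (intro conjI ballI impI)
 let ?R = "reductions (BQ n) Q S (\<lambda>s. tr n (\<chi> s))"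
 have pP: "pe p : carrier P" using p by simp
 show "reduction_finite (BQ n) Q S (\<lambda>s. tr n (\<chi> s)) p"
  unfolding reduction_finite_def
 proof (intro allI impI)
  fix \<rho> :: "nat => (('v, 'w) path => 'a set) => ('v, 'w) path => 'a set" assume "\<forall>i. \<rho> i : ?R"
  then have "\<forall>i. \<exists>\<rho>'. \<rho>' : reds \<and> (\<forall>x\<in>carrier P. \<rho>' x : carrier P \<and> \<rho> i (tr n x) = tr n (\<rho>' x))"
   using reductions_tr by blast
  from choice[OF this] obtain \<sigma> where \<sigma>: "!!i. \<sigma> i : reds"
   "!!i x. x : carrier P ==> \<sigma> i x : carrier P \<and> \<rho> i (tr n x) = tr n (\<sigma> i x)" by blast
  have seq: "rec_nat (pe p) \<sigma> k : carrier P \<and>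
    rec_nat (path_elem (BQ n) p) \<rho> k = tr n (rec_nat (pe p) \<sigma> k)" for k
   by (induction k) (use \<sigma> pP in \<open>auto simp: tr_path_elem\<close>)
  obtain N where N: "!!k. k \<ge> N ==>
    rec_nat (pe p) \<sigma> k \<boxminus> rec_nat (pe p) \<sigma> N : T UNIV (Suc n)"
   using stable[OF pP, of "Suc n"] \<sigma>(1) unfolding stable_def by meson
  have "rec_nat (path_elem (BQ n) p) \<rho> k = rec_nat (path_elem (BQ n) p) \<rho> N" if "k \<ge> N" for k
   using N[OF that] seq[of k] seq[of N] tr_eq[of "rec_nat (pe p) \<sigma> k" "rec_nat (pe p) \<sigma> N" n]
   by simp
  then show "\<exists>N. \<forall>k\<ge>N. rec_nat (path_elem (BQ n) p) \<rho> k = rec_nat (path_elem (BQ n) p) \<rho> N" by blast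
 qed
 fix r r' assume r: "r : ?R" "r' : ?R"
  and irr: "irreducible_elem (BQ n) Q S (r (path_elem (BQ n) p)) \<and> irreducible_elem (BQ n) Q S (r' (path_elem (BQ n) p))"
 obtain \<rho> \<rho>' where \<rho>: "\<rho> : reds" "r (tr n (pe p)) = tr n (\<rho> (pe p))"
  "\<rho>' : reds" "r' (tr n (pe p)) = tr n (\<rho>' (pe p))"
  using reductions_tr[OF r(1)] reductions_tr[OF r(2)] pP by blast
 have P: "\<rho> (pe p) : carrier P" "\<rho>' (pe p) : carrier P" using reds_P \<rho> pP by auto
 have "irr_mod (Suc n) (\<rho> (pe p))" "irr_mod (Suc n) (\<rho>' (pe p))"
  using irr \<rho>(2,4) irr_mod_tr[OF P(1), of n] irr_mod_tr[OF P(2), of n] by (simp_all add: tr_path_elem)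
 then have "\<rho> (pe p) \<boxminus> \<rho>' (pe p) : T UNIV (Suc n)"
  using complement_confluent[OF J rel \<rho>(1,3) pP] by blast
 then show "r (path_elem (BQ n) p) = r' (path_elem (BQ n) p)"
  using tr_eq[OF P, of n] \<rho>(2,4) by (simp add: tr_path_elem)
qed

text \<open>Over the quotient ring rightmost reduction is a sum over the finite support, over \<open>B\<close> it is the
continuous extension of its values on paths. The two sums agree for finite sums of paths, and every element is
one modulo a power of \<open>m\<close>.\<close>

lemma rightmost_reduction_tr:
 assumes x: "x : carrier P"
 shows "rightmost_reduction (BQ n) Q S (\<lambda>s. tr n (\<chi> s)) (tr n x) = tr n (rho x)"
proof
 fix p'
 interpret R: cring "BQ n" by (rule BQ_cring)
 let ?t = "\<lambda>x p. cls n (x p) \<otimes>\<^bsub>BQ n\<^esub> cls n (rho (pe p) p')"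
 have cl: "cls n b : carrier (BQ n)" if "b : carrier B" for b using ring_hom_closed[OF cls_hom that] .
 have wP: "rho (pe p) : carrier P" if "p : paths Q" for p using rho_P that by simp
 have tc: "?t x p : carrier (BQ n)" if "x : carrier P" "p : paths Q" for x p
  using cl[OF P_coeff[OF that(1)]] cl[OF P_coeff[OF wP[OF that(2)]]] by simp
 define E where "E x A0 \<longleftrightarrow> finite A0 \<and> A0 \<subseteq> paths Q \<and>
  (\<forall>A. finite A \<and> A0 \<subseteq> A \<and> A \<subseteq> paths Q \<longrightarrow> finsum (BQ n) (?t x) A = cls n (rho x p'))" for x A0
 define C where "C x \<longleftrightarrow> (\<exists>A0. E x A0)" for x
 have ED: "finite A0" "A0 \<subseteq> paths Q"
  "finite A ==> A0 \<subseteq> A ==> A \<subseteq> paths Q ==> finsum (BQ n) (?t x) A = cls n (rho x p')"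
  if "E x A0" for x A0 A using that unfolding E_def by simp_all
 have CI: "C x" if "finite A0" "A0 \<subseteq> paths Q"
  "!!A. finite A ==> A0 \<subseteq> A ==> A \<subseteq> paths Q ==> finsum (BQ n) (?t x) A = cls n (rho x p')" for x A0
  unfolding C_def E_def using that by (intro exI[of _ A0]) simp
 have "x : T UNIV 0" using x by simp
 then have "C x"
 proof (induction rule: approx_induct[where n = "Suc n"])
  case (add x y)
  have xy: "x : carrier P" "y : carrier P" using add by simp_all
  obtain A0 A1 where A01: "E x A0" "E y A1" using add(3,4) unfolding C_def by (elim exE)
  note A = ED(1,2)[OF A01(1)] ED(1,2)[OF A01(2)] ED(3)[OF A01(1)] ED(3)[OF A01(2)]
  have "finsum (BQ n) (?t (x \<boxplus> y)) A = cls n (rho (x \<boxplus> y) p')"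
   if "finite A" "A0 \<union> A1 \<subseteq> A" "A \<subseteq> paths Q" for A
  proof -
   have "finsum (BQ n) (?t (x \<boxplus> y)) A = finsum (BQ n) (\<lambda>p. ?t x p \<oplus>\<^bsub>BQ n\<^esub> ?t y p) A"
   proof (rule R.finsum_cong'[OF refl])
    show "(\<lambda>p. ?t x p \<oplus>\<^bsub>BQ n\<^esub> ?t y p) : A \<rightarrow> carrier (BQ n)" using tc xy that(3) by auto
    fix p assume "p : A"
    then have "p : paths Q" using that(3) by (rule subsetD[rotated])
    note w = cl[OF P_coeff[OF wP[OF this], of p']]
    show "?t (x \<boxplus> y) p = ?t x p \<oplus>\<^bsub>BQ n\<^esub> ?t y p"
     unfolding P_apply ring_hom_add[OF cls_hom P_coeff[OF xy(1)] P_coeff[OF xy(2)]]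
     using cl[OF P_coeff[OF xy(1)]] cl[OF P_coeff[OF xy(2)]] w by (simp add: R.l_distr)
   qed
   also have "\<dots> = finsum (BQ n) (?t x) A \<oplus>\<^bsub>BQ n\<^esub> finsum (BQ n) (?t y) A"
    using tc xy that(3) by (intro R.finsum_addf) auto
   also have "\<dots> = cls n (rho x p') \<oplus>\<^bsub>BQ n\<^esub> cls n (rho y p')"
    using A(5)[OF that(1) _ that(3)] A(6)[OF that(1) _ that(3)] that(2) by simp
   also have "\<dots> = cls n (rho (x \<boxplus> y) p')"
    unfolding semilinearD(2)[OF rho_lin xy] P_apply
    using ring_hom_add[OF cls_hom P_coeff[OF rho_P[OF xy(1)]] P_coeff[OF rho_P[OF xy(2)]]] by simp
   finally show ?thesis .
  qed
  then show ?case using A(1-4) by (intro CI[of "A0 \<union> A1"]) simp_all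
 next
  case (path c p)
  have c: "c : carrier B" using path by simp
  have pP: "pe p : carrier P" using path by simp
  have "finsum (BQ n) (?t (c \<bullet> pe p)) A = cls n (rho (c \<bullet> pe p) p')"
   if "finite A" "{p} \<subseteq> A" "A \<subseteq> paths Q" for A
  proof -
   have z: "cls n \<zero> = \<zero>\<^bsub>BQ n\<^esub>" using cls_zero[OF zero_closed, of n] by simp
   let ?v = "cls n c \<otimes>\<^bsub>BQ n\<^esub> cls n (rho (pe p) p')"
   have v: "?v : carrier (BQ n)" using cl[OF c] cl[OF P_coeff[OF rho_P[OF pP]]] by simp
   have "finsum (BQ n) (?t (c \<bullet> pe p)) A = finsum (BQ n) (\<lambda>q. if p = q then (\<lambda>_. ?v) q else \<zero>\<^bsub>BQ n\<^esub>) A"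
   proof (rule R.finsum_cong'[OF refl])
    fix q assume q: "q : A"
    then have "q : paths Q" using that(3) by (rule subsetD[rotated])
    from cl[OF P_coeff[OF wP[OF this], of p']] show "?t (c \<bullet> pe p) q = (if p = q then (\<lambda>_. ?v) q else \<zero>\<^bsub>BQ n\<^esub>)"
     using c z by (auto simp: P_apply path_elem_def)
   qed (use v in auto)
   also have "\<dots> = ?v" using R.finsum_singleton[of p A "\<lambda>_. ?v"] that v by simp
   also have "\<dots> = cls n (rho (c \<bullet> pe p) p')"
    unfolding semilinearD(3)[OF rho_lin c pP] P_apply
    using ring_hom_mult[OF cls_hom c P_coeff[OF rho_P[OF pP]]] by simp
   finally show ?thesis .
  qed
  then show ?case using path by (intro CI[of "{p}"]) simp_all
 next
  case (small z)
  have zP: "z : carrier P" using small T_P by blast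
  have "finsum (BQ n) (?t z) A = cls n (rho z p')" if "A \<subseteq> paths Q" for A
  proof -
   have "?t z p = \<zero>\<^bsub>BQ n\<^esub>" if "p : A" for p
   proof -
    have "cls n (z p) = \<zero>\<^bsub>BQ n\<^esub>" using cls_zero[OF P_coeff[OF zP]] T_F[OF small(2)] by blast
    moreover have "p : paths Q" using that \<open>A \<subseteq> paths Q\<close> by (rule subsetD[rotated])
    then have "cls n (rho (pe p) p') : carrier (BQ n)" by (rule cl[OF P_coeff[OF wP]])
    ultimately show ?thesis by simp
   qed
   then have "finsum (BQ n) (?t z) A = \<zero>\<^bsub>BQ n\<^esub>" by (rule R.add.finprod_one_eqI)
   moreover have "cls n (rho z p') = \<zero>\<^bsub>BQ n\<^esub>"
    using cls_zero[OF P_coeff[OF rho_P[OF zP]]] T_F[OF rho_T[OF small(2)]] by blast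
   ultimately show ?thesis by simp
  qed
  then show ?case by (intro CI[of "{}"]) simp_all
 qed
 then obtain A0 where "E x A0" unfolding C_def by (elim exE)
 note A0 = ED[OF this]
 define D where "D = {p. tr n x p \<noteq> \<zero>\<^bsub>BQ n\<^esub>}"
 have D_eq: "D = {p. x p \<notin> F (Suc n)}"
  using cls_zero[OF P_coeff[OF x]] by (auto simp: D_def tr_apply)
 have finD: "finite D" unfolding D_eq by (rule P_finite[OF x])
 have DQ: "D \<subseteq> paths Q"
 proof
  fix p assume "p : D"
  then show "p : paths Q"
   using families_not_path[OF P_families[OF x], of p] F_zero[of "Suc n"] unfolding D_eq
   by (cases "p : paths Q") auto
 qed
 have "rightmost_reduction (BQ n) Q S (\<lambda>s. tr n (\<chi> s)) (tr n x) p' = finsum (BQ n) (?t x) D"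
  unfolding rightmost_reduction_def D_def[symmetric]
 proof (rule R.finsum_cong'[OF refl])
  show "?t x : D \<rightarrow> carrier (BQ n)" using tc[OF x] DQ by auto
  fix p assume "p : D"
  then have p: "p : paths Q" using DQ by auto
  have "(if p : Ir then path_elem (BQ n) p
    else replacement (BQ n) Q (\<lambda>s. tr n (\<chi> s)) (rightmost_occurrence Q S p)) = tr n (rho (pe p))"
   using rho_path[OF p] repl_tr[OF rightmost_occurrence[OF p]] by (simp add: rho_Irr_path tr_path_elem)
  then show "tr n x p \<otimes>\<^bsub>BQ n\<^esub> (if p : Ir then path_elem (BQ n) p
    else replacement (BQ n) Q (\<lambda>s. tr n (\<chi> s)) (rightmost_occurrence Q S p)) p' = ?t x p"
   by (simp add: tr_apply)
 qed
 also have "\<dots> = finsum (BQ n) (?t x) (A0 \<union> D)"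
 proof (rule R.add.finprod_mono_neutral_cong_left)
  show "?t x p = \<zero>\<^bsub>BQ n\<^esub>" if "p : A0 \<union> D - D" for p
  proof -
   have "cls n (x p) = \<zero>\<^bsub>BQ n\<^esub>" using that by (auto simp: D_def tr_apply)
   moreover have "p : paths Q" using that A0(2) by auto
   then have "cls n (rho (pe p) p') : carrier (BQ n)" by (rule cl[OF P_coeff[OF wP]])
   ultimately show ?thesis by simp
  qed
  show "?t x : A0 \<union> D \<rightarrow> carrier (BQ n)" using tc[OF x] DQ A0(2) by auto
 qed (use A0(1) finD in auto)
 also have "\<dots> = cls n (rho x p')" using A0 finD DQ by simp
 finally show "rightmost_reduction (BQ n) Q S (\<lambda>s. tr n (\<chi> s)) (tr n x) p' = tr n (rho x) p'"
  by (simp add: tr_apply)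
qed

lemma rightmost_reduction_pow_tr:
 assumes x: "x : carrier P"
 shows "(rightmost_reduction (BQ n) Q S (\<lambda>s. tr n (\<chi> s)) ^^ k) (tr n x) = tr n ((rho ^^ k) x)"
 by (induction k) (simp_all add: rightmost_reduction_tr[OF rho_pow_P[OF x]])

lemma limit_of_rightmost_reductions:
 assumes x: "x : carrier P"
 shows "(THE y. y : T Ir 0 \<and> (\<forall>n. \<exists>N. \<forall>k\<ge>N.
  (rightmost_reduction (BQ n) Q S (\<lambda>s. tr n (\<chi> s)) ^^ k) (tr n x) = tr n y)) = nf x"
proof -
 have "(y : T Ir 0 \<and> (\<forall>n. \<exists>N. \<forall>k\<ge>N.
   (rightmost_reduction (BQ n) Q S (\<lambda>s. tr n (\<chi> s)) ^^ k) (tr n x) = tr n y)) \<longleftrightarrow> is_normal_form x y" for y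
 proof -
  have "(\<forall>n. \<exists>N. \<forall>k\<ge>N. tr n ((rho ^^ k) x) = tr n y) \<longleftrightarrow>
    (\<forall>n. \<exists>N. \<forall>k\<ge>N. (rho ^^ k) x \<boxminus> y : T UNIV n)" if y: "y : T Ir 0"
  proof -
   have eq: "tr n ((rho ^^ k) x) = tr n y \<longleftrightarrow> (rho ^^ k) x \<boxminus> y : T UNIV (Suc n)" for n k
    by (rule tr_eq[OF rho_pow_P[OF x] T_P[OF y]])
   have mono: "z : T UNIV n" if "z : T UNIV (Suc n)" for z n using T_mono[of UNIV UNIV n "Suc n"] that by simp
   show ?thesis unfolding eq
   proof (intro iffI allI)
    fix n assume *: "\<forall>n. \<exists>N. \<forall>k\<ge>N. (rho ^^ k) x \<boxminus> y : T UNIV (Suc n)"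
    show "\<exists>N. \<forall>k\<ge>N. (rho ^^ k) x \<boxminus> y : T UNIV n" using *[THEN spec, of n] mono by meson
   next
    fix n assume *: "\<forall>n. \<exists>N. \<forall>k\<ge>N. (rho ^^ k) x \<boxminus> y : T UNIV n"
    show "\<exists>N. \<forall>k\<ge>N. (rho ^^ k) x \<boxminus> y : T UNIV (Suc n)" using *[THEN spec, of "Suc n"] .
   qed
  qed
  then show ?thesis unfolding rightmost_reduction_pow_tr[OF x] is_normal_form_def by blast
 qed
 then show ?thesis unfolding nf_def by simp
qed

end

section \<open>Quotients by complements in coordinates\<close>

lemma quotient_algebra_simps [simp]:
 "carrier (quotient_algebra M J) = a_rcosets\<^bsub>M\<^esub> J"
 "X \<oplus>\<^bsub>quotient_algebra M J\<^esub> Y = X <+>\<^bsub>M\<^esub> Y"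
 "X \<otimes>\<^bsub>quotient_algebra M J\<^esub> Y = rcoset_mult M J X Y"
 "\<one>\<^bsub>quotient_algebra M J\<^esub> = J +>\<^bsub>M\<^esub> \<one>\<^bsub>M\<^esub>"
 "b \<odot>\<^bsub>quotient_algebra M J\<^esub> X = (\<Union>x\<in>X. J +>\<^bsub>M\<^esub> (b \<odot>\<^bsub>M\<^esub> x))"
 by (simp_all add: quotient_algebra_def ring.defs module.defs FactRing_def)

context quiver_tips
begin

abbreviation QA where "QA J \<equiv> quotient_algebra P J"
abbreviation N where "N \<equiv> T Ir 0"

lemma coset_eq: "ideal J P ==> x : carrier P ==> y : carrier P ==>
  J +>\<^sub>P x = J +>\<^sub>P y \<longleftrightarrow> x \<boxminus> y : J"
 using ring.quotient_eq_iff_same_a_r_cos[OF P_ring] by blast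

lemma coset_ops:
 assumes J: "ideal J P" and x: "x : carrier P" and y: "y : carrier P" and b: "b : carrier B"
 shows "J +>\<^sub>P x : carrier (QA J)"
  "(J +>\<^sub>P x) \<oplus>\<^bsub>QA J\<^esub> (J +>\<^sub>P y) = J +>\<^sub>P (x \<boxplus> y)"
  "(J +>\<^sub>P x) \<otimes>\<^bsub>QA J\<^esub> (J +>\<^sub>P y) = J +>\<^sub>P (x \<boxtimes> y)"
  "b \<odot>\<^bsub>QA J\<^esub> (J +>\<^sub>P x) = J +>\<^sub>P (b \<bullet> x)"
proof -
 interpret J: ideal J P by fact
 show "J +>\<^sub>P x : carrier (QA J)" using x P.a_rcosetsI[OF J.a_subset] by simp
 show "(J +>\<^sub>P x) \<oplus>\<^bsub>QA J\<^esub> (J +>\<^sub>P y) = J +>\<^sub>P (x \<boxplus> y)" using J.a_rcos_sum x y by simp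
 show "(J +>\<^sub>P x) \<otimes>\<^bsub>QA J\<^esub> (J +>\<^sub>P y) = J +>\<^sub>P (x \<boxtimes> y)" using J.rcoset_mult_add x y by simp
 have "J +>\<^sub>P (b \<bullet> x') = J +>\<^sub>P (b \<bullet> x)" if x': "x' : J +>\<^sub>P x" for x'
 proof -
  obtain h where h: "h : J" "x' = h \<boxplus> x" using x' unfolding a_r_coset_def' by (elim UN_E singletonE)
  have "b \<bullet> x' \<boxminus> b \<bullet> x = b \<bullet> h"
   using h x b J.Icarr P.add_minus_cancel[of "b \<bullet> x" "b \<bullet> h"]
   by (simp add: PM.smult_r_distr P.a_comm)
  moreover have "b \<bullet> h : J" using submodule.smult_closed[OF complement_submodule[OF J] b h(1)] .
  ultimately show ?thesis using coset_eq[OF J] h x b J.Icarr by simp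
 qed
 then have "(\<Union>x'\<in>J +>\<^sub>P x. J +>\<^sub>P (b \<bullet> x')) = J +>\<^sub>P (b \<bullet> x)"
  by (intro UN_constant_eq[OF J.a_rcos_self[OF x]] ballI)
 then show "b \<odot>\<^bsub>QA J\<^esub> (J +>\<^sub>P x) = J +>\<^sub>P (b \<bullet> x)" by simp
qed

lemma coset_cases:
 assumes "X : carrier (QA J)"
 obtains x where "x : carrier P" "X = J +>\<^sub>P x"
 using assms by (auto simp: A_RCOSETS_def')

text \<open>Coordinates of a coset: its representative in \<open>N\<close>.\<close>

definition crd :: "(('v, 'w) path => 'a) set => (('v, 'w) path => 'a) set => ('v, 'w) path => 'a" where
 "crd J X = (THE u. u : N \<and> X = J +>\<^sub>P u)"

lemma coset_proj: "complement J ==> x : carrier P ==> J +>\<^sub>P x = J +>\<^sub>P proj J x"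
 using coset_eq[OF complement_ideal] proj(2) proj_P by blast

lemma coset_inj:
 assumes "complement J" "u : N" "v : N" "J +>\<^sub>P u = J +>\<^sub>P v"
 shows "u = v"
 using proj_eq_iff[OF assms(1) T_P[OF assms(2)] T_P[OF assms(3)]] coset_eq[OF complement_ideal[OF assms(1)]]
  proj_Irr[OF assms(1)] assms T_P by metis

lemma crd_coset: "complement J ==> u : N ==> crd J (J +>\<^sub>P u) = u"
 unfolding crd_def using coset_inj by (intro the_equality) auto

lemma crd:
 assumes J: "complement J" and X: "X : carrier (QA J)"
 shows "crd J X : N" "X = J +>\<^sub>P crd J X"
proof -
 obtain x where "x : carrier P" "X = J +>\<^sub>P x" using coset_cases[OF X] .
 then have "proj J x : N" "X = J +>\<^sub>P proj J x" using coset_proj[OF J] proj(1)[OF J] by auto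
 then show "crd J X : N" "X = J +>\<^sub>P crd J X" using crd_coset[OF J] by auto
qed

lemma N_P: "u : N ==> u : carrier P" by (rule T_P)

lemma coset_N: "complement J ==> u : N ==> J +>\<^sub>P u : carrier (QA J)"
 using coset_ops(1)[OF complement_ideal, of J u "\<zero>\<^sub>P" \<zero>] N_P by simp

lemma module_isoI:
 assumes J: "complement J" "complement J'"
  and \<theta>: "lin N \<theta>" "bij_betw \<theta> N N" and g: "!!u. u : N ==> g (J +>\<^sub>P u) = J' +>\<^sub>P \<theta> u"
 shows "g : module_iso B (QA J) (QA J')"
proof -
 note I = complement_ideal[OF J(1)] complement_ideal[OF J(2)]
 have \<theta>N: "\<theta> u : N" if "u : N" for u using \<theta>(2) that by (auto simp: bij_betw_def)
 have hom: "g (X \<oplus>\<^bsub>QA J\<^esub> Y) = g X \<oplus>\<^bsub>QA J'\<^esub> g Y" if XY: "X : carrier (QA J)" "Y : carrier (QA J)" for X Y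
 proof -
  obtain u v where uv: "u : N" "v : N" "X = J +>\<^sub>P u" "Y = J +>\<^sub>P v"
   by (rule that[OF crd(1)[OF J(1) XY(1)] crd(1)[OF J(1) XY(2)] crd(2)[OF J(1) XY(1)] crd(2)[OF J(1) XY(2)]])
  have "X \<oplus>\<^bsub>QA J\<^esub> Y = J +>\<^sub>P (u \<boxplus> v)" unfolding uv(3,4) using coset_ops(2)[OF I(1) N_P N_P, OF uv(1,2) zero_closed] .
  moreover have "g X \<oplus>\<^bsub>QA J'\<^esub> g Y = J' +>\<^sub>P (\<theta> u \<boxplus> \<theta> v)"
   unfolding uv(3,4) g[OF uv(1)] g[OF uv(2)] using coset_ops(2)[OF I(2) N_P N_P, OF \<theta>N \<theta>N, OF uv(1,2) zero_closed] .
  ultimately show ?thesis using g[OF T_add[OF uv(1,2)]] semilinearD(2)[OF \<theta>(1) uv(1,2)] by simp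
 qed
 have smult: "g (b \<odot>\<^bsub>QA J\<^esub> X) = b \<odot>\<^bsub>QA J'\<^esub> g X" if b: "b : carrier B" and X: "X : carrier (QA J)" for b X
 proof -
  obtain u where u: "u : N" "X = J +>\<^sub>P u" by (rule that[OF crd(1)[OF J(1) X] crd(2)[OF J(1) X]])
  have "b \<odot>\<^bsub>QA J\<^esub> X = J +>\<^sub>P (b \<bullet> u)" unfolding u(2) using coset_ops(4)[OF I(1) N_P N_P, OF u(1,1) b] .
  moreover have "b \<odot>\<^bsub>QA J'\<^esub> g X = J' +>\<^sub>P (b \<bullet> \<theta> u)"
   unfolding u(2) g[OF u(1)] using coset_ops(4)[OF I(2) N_P N_P, OF \<theta>N \<theta>N, OF u(1,1) b] .
  ultimately show ?thesis using g[OF T_smult[OF u(1) b]] semilinearD(3)[OF \<theta>(1) b u(1)] by simp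
 qed
 have car: "g X : carrier (QA J')" if "X : carrier (QA J)" for X
  using crd(2)[OF J(1) that] g[OF crd(1)[OF J(1) that]] coset_N[OF J(2) \<theta>N[OF crd(1)[OF J(1) that]]] by simp
 have "bij_betw g (carrier (QA J)) (carrier (QA J'))"
 proof (rule bij_betw_imageI)
  show "inj_on g (carrier (QA J))"
  proof (rule inj_onI)
   fix X Y assume XY: "X : carrier (QA J)" "Y : carrier (QA J)" "g X = g Y"
   then have "\<theta> (crd J X) = \<theta> (crd J Y)"
    using g crd[OF J(1)] coset_inj[OF J(2)] \<theta>N by metis
   then have "crd J X = crd J Y" using \<theta>(2) crd(1)[OF J(1)] XY by (meson bij_betw_def inj_onD)
   then show "X = Y" using crd(2)[OF J(1)] XY by metis
  qed
  show "g ` carrier (QA J) = carrier (QA J')"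
  proof
   show "g ` carrier (QA J) \<subseteq> carrier (QA J')" using car by auto
   show "carrier (QA J') \<subseteq> g ` carrier (QA J)"
   proof
    fix Y assume Y: "Y : carrier (QA J')"
    have "crd J' Y : \<theta> ` N" using \<theta>(2) crd(1)[OF J(2) Y] by (simp add: bij_betw_def)
    then obtain u where u: "u : N" "\<theta> u = crd J' Y" by (elim imageE) simp
    then have "Y = g (J +>\<^sub>P u)" using g crd(2)[OF J(2) Y] by simp
    then show "Y : g ` carrier (QA J)" using coset_N[OF J(1) u(1)] by blast
   qed
  qed
 qed
 then show ?thesis
  unfolding module_iso_def iso_def hom_def using hom smult car by auto
qed

lemma module_isoD:
 assumes "g : module_iso B M M'"
 shows "X : carrier M ==> g X : carrier M'" "bij_betw g (carrier M) (carrier M')"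
  "X : carrier M ==> Y : carrier M ==> g (X \<oplus>\<^bsub>M\<^esub> Y) = g X \<oplus>\<^bsub>M'\<^esub> g Y"
  "b : carrier B ==> X : carrier M ==> g (b \<odot>\<^bsub>M\<^esub> X) = b \<odot>\<^bsub>M'\<^esub> g X"
 using assms by (auto simp: module_iso_def iso_def hom_def)

text \<open>The inverse of an isomorphism of quotients, in coordinates. It is defined on all of \<open>P\<close> because
\<open>J'\<close> need not have a complement.\<close>

lemma module_iso_coordinates:
 assumes J: "complement J" and J': "ideal J' P" and g: "g : module_iso B (QA J) (QA J')"
 obtains h where "lin (carrier P) h" "!!x. x : carrier P ==> h x : N"
  "!!x. x : carrier P ==> g (J +>\<^sub>P h x) = J' +>\<^sub>P x"
proof -
 define h where "h x = crd J (inv_into (carrier (QA J)) g (J' +>\<^sub>P x))" for x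
 note I = complement_ideal[OF J]
 have h: "h x : N" "g (J +>\<^sub>P h x) = J' +>\<^sub>P x" if x: "x : carrier P" for x
 proof -
  have "J' +>\<^sub>P x : g ` carrier (QA J)"
   using module_isoD(2)[OF g] coset_ops(1)[OF J' x x zero_closed] by (simp add: bij_betw_def)
  then have Y: "inv_into (carrier (QA J)) g (J' +>\<^sub>P x) : carrier (QA J)"
   "g (inv_into (carrier (QA J)) g (J' +>\<^sub>P x)) = J' +>\<^sub>P x"
   by (rule inv_into_into, rule f_inv_into_f)
  show "h x : N" "g (J +>\<^sub>P h x) = J' +>\<^sub>P x"
   using crd[OF J Y(1)] Y(2) by (simp_all add: h_def)
 qed
 have uniq: "h x = u" if "x : carrier P" "u : N" "g (J +>\<^sub>P u) = J' +>\<^sub>P x" for x u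
 proof (rule coset_inj[OF J h(1)[OF that(1)] that(2)])
  have "inj_on g (carrier (QA J))" using module_isoD(2)[OF g] by (simp add: bij_betw_def)
  then show "J +>\<^sub>P h x = J +>\<^sub>P u"
   by (rule inj_onD) (use that(3) h(2)[OF that(1)] coset_N[OF J h(1)[OF that(1)]] coset_N[OF J that(2)] in simp_all)
 qed
 have "lin (carrier P) h"
 proof (rule semilinearI)
  fix x assume x: "x : carrier P"
  note hx = N_P[OF h(1)[OF x]]
  show "h x : carrier P" by (rule hx)
  show "h (x \<boxplus> y) = h x \<boxplus> h y" if y: "y : carrier P" for y
  proof (rule uniq)
   note hy = N_P[OF h(1)[OF y]]
   show "h x \<boxplus> h y : N" using h(1)[OF x] h(1)[OF y] by (rule T_add)
   have "g (J +>\<^sub>P (h x \<boxplus> h y)) = (J' +>\<^sub>P x) \<oplus>\<^bsub>QA J'\<^esub> (J' +>\<^sub>P y)"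
    using module_isoD(3)[OF g coset_N[OF J h(1)[OF x]] coset_N[OF J h(1)[OF y]]]
     coset_ops(2)[OF I hx hy zero_closed] h(2)[OF x] h(2)[OF y] by simp
   then show "g (J +>\<^sub>P (h x \<boxplus> h y)) = J' +>\<^sub>P (x \<boxplus> y)"
    unfolding coset_ops(2)[OF J' x y zero_closed] .
  qed (use x y in simp)
  show "h (b \<bullet> x) = b \<bullet> h x" if b: "b : carrier B" for b
  proof (rule uniq)
   show "b \<bullet> h x : N" using h(1)[OF x] b by (rule T_smult)
   have "g (J +>\<^sub>P (b \<bullet> h x)) = b \<odot>\<^bsub>QA J'\<^esub> (J' +>\<^sub>P x)"
    using module_isoD(4)[OF g b coset_N[OF J h(1)[OF x]]] coset_ops(4)[OF I hx hx b] h(2)[OF x] by simp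
   then show "g (J +>\<^sub>P (b \<bullet> h x)) = J' +>\<^sub>P (b \<bullet> x)"
    unfolding coset_ops(4)[OF J' x x b] .
  qed (use x b in simp)
 qed
 then show thesis using h by (rule that)
qed

lemma idempotent_left_apply:
 assumes x: "x : carrier P" and u: "u : verts Q"
 shows "(pe (u, []) \<boxtimes> x) p = (if source p = u then x p else \<zero>)"
proof (cases "source p = u")
 case True
 then have p: "p = (u, [] @ snd p)" by (simp add: source_def prod_eq_iff)
 show ?thesis
 proof (cases "p : paths Q")
  case True
  then show ?thesis
   using conv_path_elem_left[OF P_families[OF x], of u "[]" "snd p"] p \<open>source p = u\<close> by (simp add: P_mult)
 next
  case False
  then show ?thesis using conv_not_path families_not_path[OF P_families[OF x]] by (simp add: P_mult)
 qed
next
 case False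
 have "conv B Q (pe (u, [])) x p = \<zero>"
 proof (rule ccontr)
  assume "conv B Q (pe (u, [])) x p \<noteq> \<zero>"
  then obtain r where "((u, []), r) : splittings Q p"
   using conv_path_elem_left_nonzero[OF P_families[OF x]] by blast
  then show False using False by (auto simp: splittings_def path_cat_def source_def)
 qed
 then show ?thesis using False by (simp add: P_mult)
qed

lemma idempotent_right_apply:
 assumes x: "x : carrier P" and u: "u : verts Q"
 shows "(x \<boxtimes> pe (u, [])) p = (if target Q p = u then x p else \<zero>)"
proof (cases "p : paths Q")
 case True
 show ?thesis
 proof (cases "target Q p = u")
  case True
  then show ?thesis
   using conv_path_elem_right[OF P_families[OF x], of "fst p" "snd p" "[]"] \<open>p : paths Q\<close> by (simp add: P_mult)
 next
  case False
  have "conv B Q x (pe (u, [])) p = \<zero>"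
  proof (rule ccontr)
   assume "conv B Q x (pe (u, [])) p \<noteq> \<zero>"
   then obtain q where q: "(q, (u, [])) : splittings Q p"
    using conv_path_elem_right_nonzero[OF P_families[OF x]] by blast
   then have "p = q" "target Q q = u" by (auto simp: splittings_def path_cat_def source_def prod_eq_iff)
   then show False using False by simp
  qed
  then show ?thesis using False by (simp add: P_mult)
 qed
next
 case False
 then show ?thesis using conv_not_path families_not_path[OF P_families[OF x]] by (simp add: P_mult)
qed

lemma one_N: "\<one>\<^sub>P : N"
proof (rule T_I)
 show "\<one>\<^sub>P p = \<zero>" if "p \<notin> Ir" for p
  using short_Irr[of p] that by (auto simp: P_one path_algebra_def)
qed auto

lemma arrow_path: "a : arcs Q ==> (tail Q a, [a]) : paths Q"
 by (simp add: paths_Cons head_in_verts)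

lemma arrow_N: "a : arcs Q ==> pe (tail Q a, [a]) : N"
 using arrow_path short_Irr by (intro T_path_elem) auto

lemma vertex_N: "i : verts Q ==> pe (i, []) : N"
 using short_Irr by (intro T_path_elem) auto

end

section \<open>Gauge equivalence of products\<close>

context adic_quiver
begin

lemma lin_path_T:
 assumes g: "lin (T X 0) g" "!!x. x : T X 0 ==> g x : T Y 0"
  and p: "!!p. p : X ==> p : paths Q ==> g (pe p) : T Y n" and x: "x : T X 0"
 shows "g x : T Y n"
 using x
proof (induction rule: approx_induct[where n = n])
 case (add x y)
 then show ?case by (simp add: semilinearD(2)[OF g(1)] T_add)
next
 case (path c q)
 then show ?case using p[OF path(2,3)] by (simp add: semilinearD(3)[OF g(1)] T_path_elem T_smult)
next
 case (small z)
 then show ?case using lin_T[OF g, of z n] by simp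
qed

text \<open>Orthogonal idempotents for the vertices, and elements for the arrows that lie in the corners
 cut out by their end points, are the same as a multiplicative map on the path algebra.\<close>

lemma quiver_representation:
 assumes cl: "!!u v. u : T Y 0 ==> v : T Y 0 ==> mul u v : T Y 0"
  and lin: "!!v. v : T Y 0 ==> lin (T Y 0) (\<lambda>u. mul u v)" "!!u. u : T Y 0 ==> lin (T Y 0) (mul u)"
  and assoc: "!!u v w. u : T Y 0 ==> v : T Y 0 ==> w : T Y 0 ==> mul (mul u v) w = mul u (mul v w)"
  and E: "!!i. i : verts Q ==> E i : T Y 0" and A: "!!a. a : arcs Q ==> A a : T Y 0"
  and EE: "!!i j. i : verts Q ==> j : verts Q ==> mul (E i) (E j) = (if i = j then E i else \<zero>\<^sub>P)"
  and EA: "!!a. a : arcs Q ==> mul (E (tail Q a)) (A a) = A a" "!!a. a : arcs Q ==> mul (A a) (E (head Q a)) = A a"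
 obtains G where "lin (carrier P) G" "!!x. x : carrier P ==> G x : T Y 0"
  "!!x y. x : carrier P ==> y : carrier P ==> G (x \<boxtimes> y) = mul (G x) (G y)"
  "!!i. i : verts Q ==> G (pe (i, [])) = E i"
  "!!a. a : arcs Q ==> G (pe (tail Q a, [a])) = A a"
proof -
 define h where "h = rec_list E (\<lambda>a _ r _. mul (A a) (r (head Q a)))"
 have h_Nil: "h [] u = E u" and h_Cons: "h (a # as) u = mul (A a) (h as (head Q a))" for u a as
  by (simp_all add: h_def)
 have hY: "h as u : T Y 0" if "(u, as) : paths Q" for u as
  using that by (induction as arbitrary: u) (auto simp: h_Nil h_Cons paths_Cons intro!: E A cl)
 have m0: "mul u \<zero>\<^sub>P = \<zero>\<^sub>P" "mul \<zero>\<^sub>P u = \<zero>\<^sub>P" if "u : T Y 0" for u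
  using lin_zero[OF lin(2)[OF that]] lin_zero[OF lin(1)[OF that]] by simp_all
 have Eh: "mul (E i) (h as u) = (if i = u then h as u else \<zero>\<^sub>P)" if p: "(u, as) : paths Q" and i: "i : verts Q" for i u as
 proof -
  have u: "u : verts Q" using source_in_verts[OF p] by simp
  have *: "mul (E u) (h as u) = h as u"
  proof (cases as)
   case Nil
   then show ?thesis using EE[OF u u] by (simp add: h_Nil)
  next
   case (Cons a bs)
   then have a: "a : arcs Q" "tail Q a = u" "(head Q a, bs) : paths Q" using p by (auto simp: paths_Cons)
   show ?thesis using assoc[OF E[OF u] A[OF a(1)] hY[OF a(3)]] EA(1)[OF a(1)] a(2) by (simp add: Cons h_Cons)
  qed
  show ?thesis using assoc[OF E[OF i] E[OF u] hY[OF p]] EE[OF i u] m0(2)[OF hY[OF p]] * by (auto split: if_splits)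
 qed
 have hh: "mul (h as u) (h bs w) = (if target Q (u, as) = w then h (as @ bs) u else \<zero>\<^sub>P)"
  if "(u, as) : paths Q" and q: "(w, bs) : paths Q" for u w as bs
  using that(1)
 proof (induction as arbitrary: u)
  case Nil
  then show ?case using Eh[OF q, of u] by (auto simp: h_Nil)
 next
  case (Cons a as)
  then have a: "a : arcs Q" "(head Q a, as) : paths Q" by (auto simp: paths_Cons)
  show ?case using assoc[OF A[OF a(1)] hY[OF a(2)] hY[OF q]] Cons.IH[OF a(2)] m0(1)[OF A[OF a(1)]]
   by (simp add: h_Cons)
 qed
 obtain G where G0: "lin (T UNIV 0) G" "!!x. x : T UNIV 0 ==> G x : T Y 0"
  "!!p. p : UNIV ==> p : paths Q ==> G (pe p) = h (snd p) (fst p)"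
  by (rule linear_extension[of UNIV "\<lambda>p. h (snd p) (fst p)" Y]) (assumption | rule hY | simp)+
 have G: "lin (carrier P) G" "!!x. x : carrier P ==> G x : T Y 0"
  "!!p. p : paths Q ==> G (pe p) = h (snd p) (fst p)" using G0 by simp_all
 have mult: "G (x \<boxtimes> y) = mul (G x) (G y)" if x: "x : carrier P" and y: "y : carrier P" for x y
 proof (rule lin_eq2[where X = UNIV and Y = UNIV and g = "\<lambda>u v. G (u \<boxtimes> v)" and h = "\<lambda>u v. mul (G u) (G v)"])
  fix v assume "v : T UNIV 0"
  then have v: "v : carrier P" by simp
  show "lin (T UNIV 0) (\<lambda>u. G (u \<boxtimes> v))" using lin_comp[OF lin_mult_right[OF v] _ G(1)] v by simp
  show "lin (T UNIV 0) (\<lambda>u. mul (G u) (G v))" using lin_comp[OF G(1) _ lin(1)[OF G(2)[OF v]]] G(2) by simp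
  show "lin (T UNIV 0) (\<lambda>u. G (v \<boxtimes> u))" using lin_comp[OF lin_mult_left[OF v] _ G(1)] v by simp
  show "lin (T UNIV 0) (\<lambda>u. mul (G v) (G u))" using lin_comp[OF G(1) _ lin(2)[OF G(2)[OF v]]] G(2) by simp
 next
  fix p q assume pq: "p : paths Q" "q : paths Q"
  show "G (pe p \<boxtimes> pe q) = mul (G (pe p)) (G (pe q))"
  proof (cases "target Q p = source q")
   case True
   have "path_cat p q : paths Q"
    using pq True paths_append[of "fst p" "snd p" "snd q"] by (simp add: path_cat_def source_def)
   then show ?thesis using True hh[of "fst p" "snd p" "fst q" "snd q"] pq
    by (simp add: P_mult conv_path_elems[OF pq] G(3) path_cat_def source_def)
  next
   case False
   then show ?thesis using hh[of "fst p" "snd p" "fst q" "snd q"] pq lin_zero[OF G0(1)]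
    by (simp add: P_mult conv_path_elems[OF pq] G(3) source_def P_zero)
  qed
 qed (use x y in simp_all)
 have arrow: "G (pe (tail Q a, [a])) = A a" if "a : arcs Q" for a
  using G(3)[of "(tail Q a, [a])"] that EA(2)[OF that] by (simp add: paths_Cons h_Cons h_Nil)
 have vertex: "G (pe (i, [])) = E i" if "i : verts Q" for i
  using G(3)[of "(i, [])"] that by (simp add: h_Nil)
 show thesis by (rule that[OF G(1,2) mult vertex arrow])
qed

end

context quiver_tips
begin

lemma T_inter: "x : T X 0 ==> x : T UNIV n ==> x : T X n"
 by (simp add: fspan_def)

lemma T_UNIV: "x : T X n ==> x : T UNIV n"
 by (simp add: fspan_def)

text \<open>The automorphisms that reduce to the identity modulo \<open>m\<close>.\<close>

definition near :: "((('v, 'w) path => 'a) => ('v, 'w) path => 'a) => bool" where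
 "near \<theta> \<longleftrightarrow> lin N \<theta> \<and> (\<forall>u\<in>N. \<theta> u : N \<and> \<theta> u \<boxminus> u : T Ir 1)"

lemma nearI:
 assumes "lin N \<theta>" and c: "!!u. u : N ==> \<theta> u : N" and n: "!!u. u : N ==> \<theta> u \<boxminus> u : T UNIV 1"
 shows "near \<theta>"
 unfolding near_def
proof (intro conjI ballI assms(1))
 fix u assume u: "u : N"
 show "\<theta> u : N" by (rule c[OF u])
 show "\<theta> u \<boxminus> u : T Ir 1" by (rule T_inter[OF T_minus[OF c[OF u] u] n[OF u]])
qed

lemma near_if_paths:
 assumes h: "lin N h" "!!u. u : N ==> h u : N"
  and p: "!!p. p : Ir ==> p : paths Q ==> h (pe p) \<boxminus> pe p : T UNIV 1"
 shows "near h"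
proof (rule nearI[OF h])
 fix w assume w: "w : N"
 show "h w \<boxminus> w : T UNIV 1"
 proof (rule lin_path_T[where g = "\<lambda>w. h w \<boxminus> w" and X = Ir and Y = UNIV and n = 1, OF _ _ _ w])
  show "lin N (\<lambda>w. h w \<boxminus> w)"
   using semilinearD[OF h(1)] N_P
   by (intro semilinearI) (auto simp: P.minus_add_add a_minus_def PM.smult_r_distr PM.smult_r_minus P.minus_add P.a_ac)
  show "h x \<boxminus> x : T UNIV 0" if "x : N" for x using N_P[OF h(2)[OF that]] N_P[OF that] by simp
  show "h (pe q) \<boxminus> pe q : T UNIV 1" if "q : Ir" "q : paths Q" for q by (rule p[OF that])
 qed
qed

lemma nearD:
 assumes "near \<theta>"
 shows "lin N \<theta>" "u : N ==> \<theta> u : N" "u : N ==> \<theta> u \<boxminus> u : T Ir 1" "bij_betw \<theta> N N"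
 using assms near_identity_bij[of Ir \<theta>] unfolding near_def by blast+

lemma near_id: "near (\<lambda>u. u)"
proof (rule nearI)
 show "lin N (\<lambda>u. u)" using N_P by (intro semilinearI) simp_all
 show "u \<boxminus> u : T UNIV 1" if "u : N" for u using N_P[OF that] by (simp add: a_minus_def P.r_neg)
qed

lemma near_comp:
 assumes "near \<theta>" "near \<theta>'"
 shows "near (\<lambda>u. \<theta>' (\<theta> u))"
proof (rule nearI)
 show "lin N (\<lambda>u. \<theta>' (\<theta> u))"
  by (rule lin_comp[OF nearD(1)[OF assms(1)] nearD(2)[OF assms(1)] nearD(1)[OF assms(2)]])
 fix u assume u: "u : N"
 note c = nearD(2)[OF assms(1) u] nearD(2)[OF assms(2) nearD(2)[OF assms(1) u]]
 show "\<theta>' (\<theta> u) : N" by (rule c(2))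
 have "\<theta>' (\<theta> u) \<boxminus> u = (\<theta>' (\<theta> u) \<boxminus> \<theta> u) \<boxplus> (\<theta> u \<boxminus> u)"
  using P.minus_telescope[OF N_P N_P N_P, OF c(2) c(1) u] by simp
 also have "\<dots> : T Ir 1" using nearD(3)[OF assms(2) c(1)] nearD(3)[OF assms(1) u] by (rule T_add)
 finally show "\<theta>' (\<theta> u) \<boxminus> u : T UNIV 1" by (rule T_UNIV)
qed

lemma near_inv:
 assumes "near \<theta>"
 obtains \<theta>' where "near \<theta>'" "!!u. u : N ==> \<theta> (\<theta>' u) = u" "!!u. u : N ==> \<theta>' (\<theta> u) = u"
proof (rule that[of "inv_into N \<theta>"])
 note \<theta> = nearD[OF assms]
 show r: "\<theta> (inv_into N \<theta> u) = u" if "u : N" for u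
  using \<theta>(4) that by (simp add: bij_betw_def f_inv_into_f)
 show "inv_into N \<theta> (\<theta> u) = u" if "u : N" for u
  using \<theta>(4) that by (simp add: bij_betw_def)
 have cl: "inv_into N \<theta> u : N" if "u : N" for u
  using \<theta>(4) that by (simp add: bij_betw_def inv_into_into)
 show "near (inv_into N \<theta>)"
 proof (rule nearI[OF lin_inv[OF \<theta>(1) \<theta>(4)] cl])
  fix u assume u: "u : N"
  note c = N_P[OF u] N_P[OF cl[OF u]]
  have "inv_into N \<theta> u \<boxminus> u = \<boxminus> (\<theta> (inv_into N \<theta> u) \<boxminus> inv_into N \<theta> u)"
   using c unfolding r[OF u] by (simp add: a_minus_def P.minus_add P.a_comm)
  then show "inv_into N \<theta> u \<boxminus> u : T UNIV 1"
   using T_UNIV[OF T_uminus[OF \<theta>(3)[OF cl[OF u]]]] by simp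
 qed
qed

definition bilin :: "((('v, 'w) path => 'a) => (('v, 'w) path => 'a) => ('v, 'w) path => 'a) => bool" where
 "bilin \<mu> \<longleftrightarrow> (\<forall>u\<in>N. \<forall>v\<in>N. \<mu> u v : N) \<and> (\<forall>v\<in>N. lin N (\<lambda>u. \<mu> u v)) \<and> (\<forall>u\<in>N. lin N (\<mu> u))"

lemma bilinD:
 assumes "bilin \<mu>"
 shows "u : N ==> v : N ==> \<mu> u v : N" "v : N ==> lin N (\<lambda>u. \<mu> u v)" "u : N ==> lin N (\<mu> u)"
 using assms unfolding bilin_def by blast+

text \<open>Equivalence of two products on \<open>N\<close>; the common form of the three notions of equivalence.\<close>

definition gauge :: "((('v, 'w) path => 'a) => (('v, 'w) path => 'a) => ('v, 'w) path => 'a) =>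
  ((('v, 'w) path => 'a) => (('v, 'w) path => 'a) => ('v, 'w) path => 'a) => bool" where
 "gauge \<mu> \<mu>' \<longleftrightarrow> (\<exists>\<theta>. near \<theta> \<and> (\<forall>u\<in>N. \<forall>v\<in>N. \<theta> (\<mu> u v) = \<mu>' (\<theta> u) (\<theta> v)))"

lemma gaugeI: "near \<theta> ==> (!!u v. u : N ==> v : N ==> \<theta> (\<mu> u v) = \<mu>' (\<theta> u) (\<theta> v)) ==> gauge \<mu> \<mu>'"
 unfolding gauge_def by blast

lemma gaugeE:
 assumes "gauge \<mu> \<mu>'"
 obtains \<theta> where "near \<theta>" "!!u v. u : N ==> v : N ==> \<theta> (\<mu> u v) = \<mu>' (\<theta> u) (\<theta> v)"
proof -
 obtain \<theta> where \<theta>: "near \<theta>" "\<forall>u\<in>N. \<forall>v\<in>N. \<theta> (\<mu> u v) = \<mu>' (\<theta> u) (\<theta> v)"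
  using assms unfolding gauge_def by (elim exE conjE)
 show thesis by (rule that[OF \<theta>(1) bspec[OF bspec[OF \<theta>(2)]]])
qed

lemma gauge_cong: "(!!u v. u : N ==> v : N ==> \<mu> u v = \<mu>' u v) ==> gauge \<mu> \<mu>'"
 by (rule gaugeI[OF near_id])

lemma gauge_trans:
 assumes "gauge \<mu> \<mu>'" "gauge \<mu>' \<mu>''"
 shows "gauge \<mu> \<mu>''"
proof -
 obtain \<theta> where \<theta>: "near \<theta>" "!!u v. u : N ==> v : N ==> \<theta> (\<mu> u v) = \<mu>' (\<theta> u) (\<theta> v)"
  by (rule gaugeE[OF assms(1)], rule that)
 obtain \<theta>' where \<theta>': "near \<theta>'" "!!u v. u : N ==> v : N ==> \<theta>' (\<mu>' u v) = \<mu>'' (\<theta>' u) (\<theta>' v)"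
  by (rule gaugeE[OF assms(2)], rule that)
 show ?thesis
  by (rule gaugeI[OF near_comp[OF \<theta>(1) \<theta>'(1)]]) (simp add: \<theta>(2) \<theta>'(2) nearD(2)[OF \<theta>(1)])
qed

lemma gauge_sym:
 assumes \<mu>: "bilin \<mu>" and g: "gauge \<mu> \<mu>'"
 shows "gauge \<mu>' \<mu>"
proof -
 obtain \<theta> where \<theta>: "near \<theta>" "!!u v. u : N ==> v : N ==> \<theta> (\<mu> u v) = \<mu>' (\<theta> u) (\<theta> v)"
  by (rule gaugeE[OF g], rule that)
 obtain i where i: "near i" "!!u. u : N ==> \<theta> (i u) = u" "!!u. u : N ==> i (\<theta> u) = u"
  using near_inv[OF \<theta>(1)] by metis
 show ?thesis
 proof (rule gaugeI[OF i(1)])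
  fix u v assume uv: "u : N" "v : N"
  note c = nearD(2)[OF i(1) uv(1)] nearD(2)[OF i(1) uv(2)]
  have "\<mu>' u v = \<theta> (\<mu> (i u) (i v))" using \<theta>(2)[OF c] i(2) uv by simp
  then show "i (\<mu>' u v) = \<mu> (i u) (i v)" using i(3)[OF bilinD(1)[OF \<mu> c]] by simp
 qed
qed

text \<open>The product of the quotient by \<open>J\<close>, in the coordinates given by the irreducible paths.\<close>

definition nprod :: "(('v, 'w) path => 'a) set => (('v, 'w) path => 'a) => (('v, 'w) path => 'a) => ('v, 'w) path => 'a" where
 "nprod J u v = proj J (u \<boxtimes> v)"

lemma bilin_nprod:
 assumes J: "complement J"
 shows "bilin (nprod J)"
 unfolding bilin_def nprod_def
proof (intro conjI ballI)
 fix u v assume uv: "u : N" "v : N"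
 then show "proj J (u \<boxtimes> v) : N" using N_P by (intro proj(1)[OF J]) simp
next
 fix v assume v: "v : N"
 have "lin (carrier P) (\<lambda>u. proj J (u \<boxtimes> v))" "lin (carrier P) (\<lambda>u. proj J (v \<boxtimes> u))"
  using lin_comp[OF lin_mult_right[OF N_P[OF v]] _ proj_lin[OF J]]
   lin_comp[OF lin_mult_left[OF N_P[OF v]] _ proj_lin[OF J]] N_P[OF v] by simp_all
 then show "lin N (\<lambda>u. proj J (u \<boxtimes> v))" "lin N (\<lambda>u. proj J (v \<boxtimes> u))"
  using N_P by (auto intro: semilinear_subset)
qed

lemma complement_eqI:
 assumes J: "complement J" "complement J'"
  and eq: "!!p. p : paths Q ==> proj J (pe p) = proj J' (pe p)"
 shows "J = J'"
proof -
 have "proj J x = proj J' x" if "x : carrier P" for x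
  using lin_eq[of UNIV "proj J" "proj J'" x] proj_lin[OF J(1)] proj_lin[OF J(2)] eq that by simp
 then show ?thesis
  using proj_eq_zero[OF J(1)] proj_eq_zero[OF J(2)] complement_sub[OF J(1)] complement_sub[OF J(2)] by (metis subsetI subset_antisym)
qed

end

text \<open>The gauge transformation over \<open>B'\<close> is the linear extension of the one over \<open>B\<close>; its multiplicativity
needs to be checked on paths only, which come from \<open>B\<close>.\<close>

lemma (in tips_hom) gauge_base_change:
 assumes bil: "src.bilin \<mu>" "src.bilin \<nu>" "tgt.bilin \<mu>'" "tgt.bilin \<nu>'"
  and \<mu>: "!!u v. u : src.N ==> v : src.N ==> f \<circ> \<mu> u v = \<mu>' (f \<circ> u) (f \<circ> v)"
  and \<nu>: "!!u v. u : src.N ==> v : src.N ==> f \<circ> \<nu> u v = \<nu>' (f \<circ> u) (f \<circ> v)"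
  and g: "src.gauge \<mu> \<nu>"
 shows "tgt.gauge \<mu>' \<nu>'"
proof -
 obtain \<theta> where \<theta>: "src.near \<theta>" "!!u v. u : src.N ==> v : src.N ==> \<theta> (\<mu> u v) = \<nu> (\<theta> u) (\<theta> v)"
  by (rule src.gaugeE[OF g], rule that)
 note \<theta>' = src.nearD[OF \<theta>(1)]
 have e: "path_elem B p : src.N" if "p : src.Ir" "p : paths Q" for p using that by (intro src.T_path_elem)
 have u: "f \<circ> \<theta> (path_elem B p) : tgt.T src.Ir 0" if "p : src.Ir" "p : paths Q" for p
  by (rule f_T[OF \<theta>'(2)[OF e[OF that]]])
 obtain h where h: "tgt.lin (tgt.T src.Ir 0) h" "!!x. x : tgt.T src.Ir 0 ==> h x : tgt.T src.Ir 0"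
  "!!p. p : src.Ir ==> p : paths Q ==> h (path_elem B' p) = f \<circ> \<theta> (path_elem B p)"
  by (rule tgt.linear_extension[of src.Ir "\<lambda>p. f \<circ> \<theta> (path_elem B p)", OF u]) (assumption | rule that)+
 have hf: "h (f \<circ> u) = f \<circ> \<theta> u" if "u : src.N" for u
 proof (rule semilinear_eq[OF _ _ _ that])
  show "semilinear f B src.P tgt.P src.N (\<lambda>u. h (f \<circ> u))"
   using semilinearD[OF h(1)] src.N_P by (intro semilinearI) (auto simp: f_P_add f_P_smult f_T)
  show "semilinear f B src.P tgt.P src.N (\<lambda>u. f \<circ> \<theta> u)"
   using semilinearD[OF \<theta>'(1)] by (intro semilinearI) (auto simp: f_P_add f_P_smult)
 qed (simp add: f_path_elem h(3))
 have near: "tgt.near h"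
 proof (rule tgt.near_if_paths[OF h(1,2)])
  fix p assume p: "p : src.Ir" "p : paths Q"
  have "h (path_elem B' p) \<ominus>\<^bsub>tgt.P\<^esub> path_elem B' p = f \<circ> (\<theta> (path_elem B p) \<ominus>\<^bsub>src.P\<^esub> path_elem B p)"
   using f_P_minus[OF src.N_P[OF \<theta>'(2)[OF e[OF p]]] src.N_P[OF e[OF p]]] by (simp add: h(3)[OF p] f_path_elem)
  then show "h (path_elem B' p) \<ominus>\<^bsub>tgt.P\<^esub> path_elem B' p : tgt.T UNIV 1"
   using tgt.T_UNIV[OF f_T[OF \<theta>'(3)[OF e[OF p]]]] by simp
 qed
 show ?thesis
 proof (rule tgt.gaugeI[OF near])
  fix u v assume uv: "u : tgt.N" "v : tgt.N"
  show "h (\<mu>' u v) = \<nu>' (h u) (h v)"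
  proof (rule tgt.lin_eq2[where g = "\<lambda>u v. h (\<mu>' u v)" and h = "\<lambda>u v. \<nu>' (h u) (h v)", OF _ _ _ _ _ uv])
   fix v assume v: "v : tgt.N"
   show "tgt.lin tgt.N (\<lambda>u. h (\<mu>' u v))" "tgt.lin tgt.N (\<lambda>u. h (\<mu>' v u))"
    by (rule tgt.lin_comp[OF tgt.bilinD(2)[OF bil(3) v] tgt.bilinD(1)[OF bil(3) _ v] h(1)], assumption,
     rule tgt.lin_comp[OF tgt.bilinD(3)[OF bil(3) v] tgt.bilinD(1)[OF bil(3) v] h(1)])
   show "tgt.lin tgt.N (\<lambda>u. \<nu>' (h u) (h v))" "tgt.lin tgt.N (\<lambda>u. \<nu>' (h v) (h u))"
    using tgt.lin_comp[OF h(1,2) tgt.bilinD(2)[OF bil(4) h(2)[OF v]]]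
     tgt.lin_comp[OF h(1,2) tgt.bilinD(3)[OF bil(4) h(2)[OF v]]] by simp_all
  next
   fix p q assume pq: "p : src.Ir" "p : paths Q" "q : src.Ir" "q : paths Q"
   note e = e[OF pq(1,2)] e[OF pq(3,4)]
   have "h (\<mu>' (f \<circ> path_elem B p) (f \<circ> path_elem B q)) = f \<circ> \<nu> (\<theta> (path_elem B p)) (\<theta> (path_elem B q))"
    unfolding \<mu>[OF e, symmetric] hf[OF src.bilinD(1)[OF bil(1) e]] \<theta>(2)[OF e] by simp
   also have "\<dots> = \<nu>' (h (f \<circ> path_elem B p)) (h (f \<circ> path_elem B q))"
    unfolding hf[OF e(1)] hf[OF e(2)] by (rule \<nu>[OF \<theta>'(2)[OF e(1)] \<theta>'(2)[OF e(2)]])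
   finally show "h (\<mu>' (path_elem B' p) (path_elem B' q)) = \<nu>' (h (path_elem B' p)) (h (path_elem B' q))"
    by (simp add: f_path_elem)
  qed
 qed
qed

context rewriting
begin

text \<open>The path \<open>s\<close> occurs in itself, with trivial left and right remainder.\<close>

lemma rule_in_nf_kernel:
 assumes conf: confluent and s: "s : S"
 shows "pe s \<boxminus> \<chi> s : nf_kernel"
proof -
 have p: "s : paths Q" using s S_paths by auto
 have v: "fst s : verts Q" "target Q s : verts Q" using source_in_verts[OF p] target_in_verts[OF p] by auto
 have oc: "((fst s, []), s, (target Q s, [])) : occurrences Q S s"
  using s p v by (simp add: occurrences_def source_def path_cat_def)
 have \<chi>: "\<chi> s : carrier P" using rule_P[OF s] .
 have "repl ((fst s, []), s, (target Q s, [])) = \<chi> s"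
 proof
  fix q
  have P: "pe (fst s, []) \<boxtimes> \<chi> s : carrier P" using \<chi> v by simp
  have "\<chi> s q = \<zero> \<or> (source q = fst s \<and> target Q q = target Q s)"
   using rule_parallel[OF s, of q] by (auto simp: parallel_def source_def)
  then show "repl ((fst s, []), s, (target Q s, [])) q = \<chi> s q"
   unfolding repl_eq idempotent_right_apply[OF P v(2)] idempotent_left_apply[OF \<chi> v(1)] by auto
 qed
 then have "nf (\<chi> s) = nf (pe s)" using nf_repl[OF conf oc] by simp
 then show ?thesis using \<chi> p nf_minus[of "pe s" "\<chi> s"] nf_P[of "pe s"]
  by (simp add: nf_kernel_def a_minus_def P.r_neg)
qed

end

section \<open>The undeformed algebra\<close>

locale diamond =
 fixes K :: "'k ring" and Q :: "('v, 'a) pre_digraph" and I :: "(('v, 'a) path => 'k) set"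
  and S :: "('v, 'a) path set" and \<phi> :: "('v, 'a) path => ('v, 'a) path => 'k"
 assumes K_field: "field K" and Q_fin: "fin_digraph Q" and I_ideal: "ideal I (path_algebra K Q)"
  and redsys: "reduction_system K Q S \<phi>" and diam: "satisfies_diamond K Q S \<phi> I"
begin

lemma K_cring: "cring K"
 using K_field by (simp add: field_def domain_def)

lemma K_domain: "domain K"
 using K_field by (simp add: field_def)

lemma kP: "completed_path_algebra K {\<zero>\<^bsub>K\<^esub>} Q = path_algebra K Q"
 by (rule cring.path_algebra_trivially_completed[OF K_cring])

lemma k_adic_quiver: "adic_quiver K {\<zero>\<^bsub>K\<^esub>} Q"
 by (intro adic_quiver.intro cring.adic_ring_zero K_cring Q_fin)

lemma tips:
 assumes "adic_quiver B m Q"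
 shows "quiver_tips B m Q S"
proof (intro quiver_tips.intro quiver_tips_axioms.intro assms)
 show "S \<subseteq> paths Q" "!!s. s : S ==> 2 \<le> length (snd s)"
  "!!s s'. s : S ==> s' : S ==> s \<noteq> s' ==> occurrences Q {s} s' = {}"
  using redsys unfolding reduction_system_def by blast+
qed

lemma \<phi>_props:
 assumes "s : S"
 shows "\<phi> s : carrier (path_algebra K Q)" "\<phi> s p \<noteq> \<zero>\<^bsub>K\<^esub> ==> p : Irr Q S" "\<phi> s p \<noteq> \<zero>\<^bsub>K\<^esub> ==> parallel Q p s"
 using redsys assms unfolding reduction_system_def by blast+

lemma k_rules: "rules K {\<zero>\<^bsub>K\<^esub>} Q S \<phi>"
proof -
 interpret k: quiver_tips K "{\<zero>\<^bsub>K\<^esub>}" Q S by (rule tips[OF k_adic_quiver])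
 show ?thesis
 proof
  show "\<phi> s : k.T k.Ir 0" if "s : S" for s
   using \<phi>_props[OF that] kP by (intro k.T_I) auto
  show "parallel Q p s" if "s : S" "\<phi> s p \<noteq> \<zero>\<^bsub>K\<^esub>" for s p using \<phi>_props(3)[OF that] .
 qed
qed

lemma k_rewriting: "rewriting K {\<zero>\<^bsub>K\<^esub>} Q S \<phi>"
proof -
 interpret k: rules K "{\<zero>\<^bsub>K\<^esub>}" Q S \<phi> by (rule k_rules)
 show ?thesis
 proof (intro rewriting.intro k_rules rewriting_axioms.intro k.wf_if_reduction_finite[OF K_domain refl])
  fix p assume "p : paths Q"
  then have "reduction_unique K Q S \<phi> p" using diam unfolding satisfies_diamond_def by (elim conjE) (rule bspec)
  then show "reduction_finite K Q S \<phi> p" unfolding reduction_unique_def by (rule conjunct1)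
 qed
qed

end

sublocale diamond \<subseteq> k: rewriting K "{\<zero>\<^bsub>K\<^esub>}" Q S \<phi> by (rule k_rewriting)

context diamond
begin

lemma k_F: "k.F (Suc n) = {\<zero>\<^bsub>K\<^esub>}"
 by (rule k.zero_power)

lemma k_T: "x : k.T X (Suc n) \<longleftrightarrow> x = \<zero>\<^bsub>k.P\<^esub>"
proof
 assume "x : k.T X (Suc n)"
 then have "x p : k.F (Suc n)" for p by (rule k.T_F)
 then show "x = \<zero>\<^bsub>k.P\<^esub>" unfolding k_F by (intro ext) (simp add: k.P_apply)
qed simp

lemma k_confluent: k.confluent
 unfolding k.confluent_def
proof (intro allI impI ballI)
 fix n :: nat and p \<rho> \<rho>'
 assume n: "2 \<le> n" and p: "p : paths Q" and \<rho>: "\<rho> : k.reds" "\<rho>' : k.reds"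
  and irr: "k.irr_mod n (\<rho> (path_elem K p)) \<and> k.irr_mod n (\<rho>' (path_elem K p))"
 obtain j where j: "n = Suc j" using n by (cases n) auto
 have "\<rho> (path_elem K p) = \<rho>' (path_elem K p)"
  using diam p \<rho> irr unfolding satisfies_diamond_def reduction_unique_def irreducible_elem_def k.irr_mod_def j k_F
  by blast
 moreover have "\<rho>' (path_elem K p) : carrier k.P" using k.reds_P[OF \<rho>(2)] p by simp
 ultimately show "\<rho> (path_elem K p) \<ominus>\<^bsub>k.P\<^esub> \<rho>' (path_elem K p) : k.T UNIV n"
  by (simp add: a_minus_def k.P.r_neg)
qed

text \<open>The ideal generated by the relations contains \<open>x - rho x\<close> for all \<open>x\<close>, hence \<open>x - nf x\<close> since over a
field with the zero ideal the iteration stops after finitely many steps.\<close>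

lemma I_eq_nf_kernel: "I = k.nf_kernel"
proof
 have I': "ideal I k.P" using I_ideal by (simp add: kP)
 interpret J: ideal I k.P by (rule I')
 have gens: "I = Idl\<^bsub>k.P\<^esub> ((\<lambda>s. path_elem K s \<ominus>\<^bsub>k.P\<^esub> \<phi> s) ` S)"
  using diam by (simp add: satisfies_diamond_def kP)
 note c = k.confluent_complement[OF k_confluent]
 show "I \<subseteq> k.nf_kernel"
  unfolding gens
  using k.rule_in_nf_kernel[OF k_confluent] by (intro k.P.genideal_minimal[OF k.complement_ideal[OF c(1)]]) blast
 show "k.nf_kernel \<subseteq> I"
 proof
  fix x assume x: "x : k.nf_kernel"
  then have xP: "x : carrier k.P" "k.nf x = \<zero>\<^bsub>k.P\<^esub>" by (auto simp: k.nf_kernel_def)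
  have gen: "path_elem K s \<ominus>\<^bsub>k.P\<^esub> \<phi> s : I" if s: "s : S" for s
  proof -
   have "(\<lambda>s. path_elem K s \<ominus>\<^bsub>k.P\<^esub> \<phi> s) ` S \<subseteq> carrier k.P" using k.S_paths k.rule_P by auto
   then have "(\<lambda>s. path_elem K s \<ominus>\<^bsub>k.P\<^esub> \<phi> s) ` S \<subseteq> I"
    unfolding gens by (rule k.P.genideal_self)
   then show ?thesis using s by blast
  qed
  have step: "y \<ominus>\<^bsub>k.P\<^esub> k.rho y : I" if "y : carrier k.P" for y
  proof -
   have "y : k.T UNIV 0" using that by simp
   then show ?thesis
   proof (induction rule: k.approx_induct[where n = "Suc 0"])
    case (add x y)
    then have P: "x : carrier k.P" "y : carrier k.P" by simp_all
    have "(x \<oplus>\<^bsub>k.P\<^esub> y) \<ominus>\<^bsub>k.P\<^esub> k.rho (x \<oplus>\<^bsub>k.P\<^esub> y) = (x \<ominus>\<^bsub>k.P\<^esub> k.rho x) \<oplus>\<^bsub>k.P\<^esub> (y \<ominus>\<^bsub>k.P\<^esub> k.rho y)"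
     using P k.rho_P by (simp add: semilinearD(2)[OF k.rho_lin] k.P.minus_add_add)
    then show ?case using add by simp
   next
    case (path c p)
    have p: "path_elem K p : carrier k.P" and c: "c : carrier K" using path by simp_all
    have "path_elem K p \<ominus>\<^bsub>k.P\<^esub> k.rho (path_elem K p) : I"
    proof (cases "p : k.Ir")
     case True
     then show ?thesis using p by (simp add: k.rho_Irr_path a_minus_def k.P.r_neg)
    next
     case False
     obtain q s r where qsr: "k.rho (path_elem K p) = k.repl (q, s, r)" "(q, s, r) : occurrences Q S p"
      using k.rho_path[OF path(3) False] k.rightmost_occurrence[OF path(3) False] by (metis prod_cases3)
     note o = k.occurrencesD[OF qsr(2)]
     have P: "path_elem K q : carrier k.P" "\<phi> s : carrier k.P" "path_elem K r : carrier k.P" "path_elem K s : carrier k.P"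
      using o k.rule_P by auto
     have "path_elem K p \<ominus>\<^bsub>k.P\<^esub> k.rho (path_elem K p) =
       path_elem K q \<otimes>\<^bsub>k.P\<^esub> ((path_elem K s \<ominus>\<^bsub>k.P\<^esub> \<phi> s) \<otimes>\<^bsub>k.P\<^esub> path_elem K r)"
      unfolding qsr(1) k.repl_eq unfolding o(9) using P
      by (simp add: a_minus_def k.P.l_distr k.P.r_distr k.P.l_minus k.P.r_minus k.P.m_assoc)
     moreover have "(path_elem K s \<ominus>\<^bsub>k.P\<^esub> \<phi> s) \<otimes>\<^bsub>k.P\<^esub> path_elem K r : I"
      using J.I_r_closed[OF gen[OF o(2)] P(3)] .
     ultimately show ?thesis using J.I_l_closed[OF _ P(1)] by simp
    qed
    then have "c \<odot>\<^bsub>k.P\<^esub> (path_elem K p \<ominus>\<^bsub>k.P\<^esub> k.rho (path_elem K p)) : I"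
     using submodule.smult_closed[OF k.complement_submodule[OF I'] c] by blast
    then show ?case using c p k.rho_P[OF p]
     by (simp add: semilinearD(3)[OF k.rho_lin] a_minus_def k.PM.smult_r_distr k.PM.smult_r_minus)
   next
    case (small z)
    then have "z = \<zero>\<^bsub>k.P\<^esub>" by (simp only: k_T)
    moreover have "k.rho \<zero>\<^bsub>k.P\<^esub> = \<zero>\<^bsub>k.P\<^esub>" using k.lin_zero[of UNIV 0 k.rho] k.rho_lin by simp
    ultimately show ?case by (simp add: a_minus_def)
   qed
  qed
  have pow: "x \<ominus>\<^bsub>k.P\<^esub> (k.rho ^^ j) x : I" for j
  proof (induction j)
   case 0
   show ?case using xP by (simp add: a_minus_def k.P.r_neg)
  next
   case (Suc j)
   have "(x \<ominus>\<^bsub>k.P\<^esub> (k.rho ^^ j) x) \<oplus>\<^bsub>k.P\<^esub> ((k.rho ^^ j) x \<ominus>\<^bsub>k.P\<^esub> k.rho ((k.rho ^^ j) x)) : I"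
    using J.a_closed[OF Suc step[OF k.rho_pow_P[OF xP(1)]]] .
   then show ?case using k.P.minus_telescope[OF xP(1) k.rho_pow_P[OF xP(1)] k.rho_P[OF k.rho_pow_P[OF xP(1)]]] by simp
  qed
  obtain j where "(k.rho ^^ j) x \<ominus>\<^bsub>k.P\<^esub> k.nf x : k.T UNIV (Suc 0)"
   using k.nf[OF xP(1)] unfolding k.is_normal_form_def by blast
  then have "(k.rho ^^ j) x = \<zero>\<^bsub>k.P\<^esub>"
   unfolding k_T xP(2) using k.rho_pow_P[OF xP(1)] by (simp add: a_minus_def)
  then show "x : I" using pow[of j] xP(1) by (simp add: a_minus_def)
 qed
qed

lemma I_complement: "k.complement I"
 unfolding I_eq_nf_kernel by (rule k.confluent_complement[OF k_confluent])

lemma proj_I: "x : carrier k.P ==> k.proj I x = k.nf x"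
 unfolding I_eq_nf_kernel by (rule k.confluent_complement(2)[OF k_confluent])

end

section \<open>Deformations over a coefficient algebra\<close>

locale coeff_point = diamond K Q I S \<phi>
 for K :: "'k ring" and Q :: "('v, 'a) pre_digraph" and I and S and \<phi> +
 fixes B :: "('k, 'b) module" and m
 assumes BM: "(B, m) : coeff_algebras K"
begin

lemma B_algebra: "algebra K B" and B_noetherian: "noetherian_ring B" and m_maximal: "maximalideal m B"
 and B_complete: "complete_filtration B (ideal_power B m)"
 and residue_bij: "bij_betw (\<lambda>c. m +>\<^bsub>B\<^esub> structure_map B c) (carrier K) (carrier (B Quot m))"
 using BM by (simp_all add: coeff_algebras_def)

lemma B_cring: "cring B"
 by (rule algebra.axioms(2)[OF B_algebra])

lemma B_adic: "adic_ring B m"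
proof (intro adic_ring.intro adic_ring_axioms.intro B_cring B_complete)
 interpret cring B by (rule B_cring)
 interpret M: comm_monoid "ideals_set B" by (rule ideals_set_is_comm_monoid)
 show m: "ideal m B" using m_maximal by (rule maximalideal.axioms)
 fix n
 have "ideal_power B m n : carrier (ideals_set B)"
  using m by (intro M.nat_pow_closed) (simp add: ideals_set_def)
 then have "ideal (ideal_power B m n) B" by (simp add: ideals_set_def)
 from noetherian_ring.finetely_gen[OF B_noetherian this]
 show "\<exists>G. finite G \<and> G \<subseteq> carrier B \<and> ideal_power B m n = Idl\<^bsub>B\<^esub> G"
  by (elim exE conjE) (intro exI conjI)
qed

lemma B_adic_quiver: "adic_quiver B m Q"
 by (intro adic_quiver.intro B_adic Q_fin)

end

sublocale coeff_point \<subseteq> quiver_tips B m Q S by (rule tips[OF B_adic_quiver])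

context coeff_point
begin

abbreviation emb where "emb \<equiv> structure_map B"
abbreviation rs where "rs \<equiv> residue K B m"

lemma emb_hom: "emb : ring_hom K B"
proof -
 interpret A: algebra K B by (rule B_algebra)
 show ?thesis
  unfolding structure_map_def
  by (rule ring_hom_memI) (simp_all add: A.smult_l_distr A.smult_assoc2 A.smult_assoc1)
qed

lemma emb_closed: "c : carrier K ==> emb c : carrier B"
 using ring_hom_closed[OF emb_hom] .

lemma residue_ex1:
 assumes b: "b : carrier B"
 shows "\<exists>!c. c : carrier K \<and> b \<ominus>\<^bsub>B\<^esub> emb c : m"
proof -
 have eq: "m +>\<^bsub>B\<^esub> emb c = m +>\<^bsub>B\<^esub> b \<longleftrightarrow> b \<ominus>\<^bsub>B\<^esub> emb c : m" if "c : carrier K" for c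
  using quotient_eq_iff_same_a_r_cos[OF m_ideal b emb_closed[OF that]] by auto
 have "m +>\<^bsub>B\<^esub> b : carrier (B Quot m)"
  using b a_rcosetsI[OF additive_subgroup.a_subset[OF ideal.axioms(1)[OF m_ideal]]] by (simp add: FactRing_def)
 then have "\<exists>!c. c : carrier K \<and> m +>\<^bsub>B\<^esub> emb c = m +>\<^bsub>B\<^esub> b"
  using residue_bij unfolding bij_betw_iff_bijections by metis
 then show ?thesis using eq by auto
qed

lemma residue: "b : carrier B ==> rs b : carrier K" "b : carrier B ==> b \<ominus>\<^bsub>B\<^esub> emb (rs b) : m"
 using theI'[OF residue_ex1, of b] by (simp_all add: residue_def)

lemma residue_eq: "b : carrier B ==> c : carrier K ==> b \<ominus>\<^bsub>B\<^esub> emb c : m ==> rs b = c"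
 using residue_ex1[of b] residue[of b] by blast

lemma m_closed': "a : m ==> b : m ==> a \<oplus>\<^bsub>B\<^esub> b : m" "a : m ==> b : carrier B ==> a \<otimes>\<^bsub>B\<^esub> b : m"
  "a : m ==> b : carrier B ==> b \<otimes>\<^bsub>B\<^esub> a : m" "\<zero>\<^bsub>B\<^esub> : m" "a : m ==> a : carrier B"
 using additive_subgroup.a_closed[OF ideal.axioms(1)[OF m_ideal]] ideal.I_r_closed[OF m_ideal]
  ideal.I_l_closed[OF m_ideal] additive_subgroup.zero_closed[OF ideal.axioms(1)[OF m_ideal]] ideal.Icarr[OF m_ideal]
 by simp_all

lemma residue_emb: "c : carrier K ==> rs (emb c) = c"
 by (rule residue_eq) (simp_all add: emb_closed a_minus_def r_neg m_closed')

lemma residue_hom: "rs : ring_hom B K"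
proof (rule ring_hom_memI)
 note e = ring_hom_add[OF emb_hom] ring_hom_mult[OF emb_hom] ring_hom_one[OF emb_hom] emb_closed
 show "rs b : carrier K" if "b : carrier B" for b using residue(1)[OF that] .
 show "rs \<one>\<^bsub>B\<^esub> = \<one>\<^bsub>K\<^esub>"
  using residue_emb[of "\<one>\<^bsub>K\<^esub>"] ring_hom_one[OF emb_hom] k.one_closed by simp
 fix a b assume ab: "a : carrier B" "b : carrier B"
 let ?a = "emb (rs a)" and ?b = "emb (rs b)"
 note r = residue[OF ab(1)] residue[OF ab(2)]
 note c = e(4)[OF r(1)] e(4)[OF r(3)]
 show "rs (a \<oplus>\<^bsub>B\<^esub> b) = rs a \<oplus>\<^bsub>K\<^esub> rs b"
 proof (rule residue_eq)
  have "(a \<oplus>\<^bsub>B\<^esub> b) \<ominus>\<^bsub>B\<^esub> emb (rs a \<oplus>\<^bsub>K\<^esub> rs b) = (a \<ominus>\<^bsub>B\<^esub> ?a) \<oplus>\<^bsub>B\<^esub> (b \<ominus>\<^bsub>B\<^esub> ?b)"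
   unfolding e(1)[OF r(1) r(3)] using ab c by (rule minus_add_add)
  then show "(a \<oplus>\<^bsub>B\<^esub> b) \<ominus>\<^bsub>B\<^esub> emb (rs a \<oplus>\<^bsub>K\<^esub> rs b) : m" using r m_closed'(1) by simp
 qed (use ab r in auto)
 show "rs (a \<otimes>\<^bsub>B\<^esub> b) = rs a \<otimes>\<^bsub>K\<^esub> rs b"
 proof (rule residue_eq)
  have "(a \<otimes>\<^bsub>B\<^esub> b) \<ominus>\<^bsub>B\<^esub> emb (rs a \<otimes>\<^bsub>K\<^esub> rs b) = (a \<otimes>\<^bsub>B\<^esub> b \<ominus>\<^bsub>B\<^esub> a \<otimes>\<^bsub>B\<^esub> ?b) \<oplus>\<^bsub>B\<^esub> (a \<otimes>\<^bsub>B\<^esub> ?b \<ominus>\<^bsub>B\<^esub> ?a \<otimes>\<^bsub>B\<^esub> ?b)"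
   unfolding e(2)[OF r(1) r(3)] using ab c by (intro minus_telescope[symmetric]) auto
  also have "\<dots> = a \<otimes>\<^bsub>B\<^esub> (b \<ominus>\<^bsub>B\<^esub> ?b) \<oplus>\<^bsub>B\<^esub> (a \<ominus>\<^bsub>B\<^esub> ?a) \<otimes>\<^bsub>B\<^esub> ?b"
   using ab c by (simp add: a_minus_def l_distr r_distr l_minus r_minus)
  also have "\<dots> : m" using r ab c m_closed' by simp
  finally show "(a \<otimes>\<^bsub>B\<^esub> b) \<ominus>\<^bsub>B\<^esub> emb (rs a \<otimes>\<^bsub>K\<^esub> rs b) : m" .
 qed (use ab r in auto)
qed

lemma emb_zero: "emb \<zero>\<^bsub>K\<^esub> = \<zero>\<^bsub>B\<^esub>"
 using ring_hom_zero[OF emb_hom] K_cring ring_axioms by (simp add: cring_def)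

lemma residue_zero_iff:
 assumes b: "b : carrier B"
 shows "rs b = \<zero>\<^bsub>K\<^esub> \<longleftrightarrow> b : m"
proof -
 have "b \<ominus>\<^bsub>B\<^esub> emb \<zero>\<^bsub>K\<^esub> = b" using b by (simp add: emb_zero a_minus_def)
 moreover have "\<zero>\<^bsub>K\<^esub> : carrier K" by (rule k.zero_closed)
 ultimately show ?thesis using residue(2)[OF b] residue_eq[OF b] by metis
qed

end

sublocale coeff_point \<subseteq> res: tips_hom B m Q S K "{\<zero>\<^bsub>K\<^esub>}" "residue K B m"
proof (intro tips_hom.intro adic_hom.intro adic_hom_axioms.intro)
 show "rs ` m \<subseteq> {\<zero>\<^bsub>K\<^esub>}" using residue_zero_iff m_closed'(5) by auto
qed (rule residue_hom B_adic_quiver k_adic_quiver quiver_tips_axioms k.quiver_tips_axioms)+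

sublocale coeff_point \<subseteq> emb: tips_hom K "{\<zero>\<^bsub>K\<^esub>}" Q S B m "structure_map B"
proof (intro tips_hom.intro adic_hom.intro adic_hom_axioms.intro)
 show "emb ` {\<zero>\<^bsub>K\<^esub>} \<subseteq> m" using m_closed'(4) by (simp add: emb_zero)
qed (rule emb_hom B_adic_quiver k_adic_quiver quiver_tips_axioms k.quiver_tips_axioms)+

context coeff_point
begin

lemma res_zero_iff: "x : carrier P ==> rs \<circ> x = \<zero>\<^bsub>k.P\<^esub> \<longleftrightarrow> x : T UNIV 1"
proof
 assume x: "x : carrier P" and 0: "rs \<circ> x = \<zero>\<^bsub>k.P\<^esub>"
 show "x : T UNIV 1"
 proof (rule T_I[OF x])
  fix p
  have "(rs \<circ> x) p = \<zero>\<^bsub>K\<^esub>" unfolding 0 by (simp add: k.P_apply)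
  then show "x p : F 1" using residue_zero_iff[OF P_coeff[OF x, of p]] by simp
 qed simp
next
 assume "x : T UNIV 1"
 then have "rs \<circ> x : k.T UNIV (Suc 0)" using res.f_T[of x UNIV 1] by simp
 then show "rs \<circ> x = \<zero>\<^bsub>k.P\<^esub>" unfolding k_T .
qed

lemma res_eq_iff:
 assumes "x : carrier P" "y : carrier P"
 shows "rs \<circ> x = rs \<circ> y \<longleftrightarrow> x \<boxminus> y : T UNIV 1"
 using res_zero_iff[of "x \<boxminus> y"] assms res.f_P_minus[OF assms]
  k.P.r_right_minus_eq[OF res.f_P[OF assms(1)] res.f_P[OF assms(2)]] by simp

lemma res_emb: "x : carrier k.P ==> rs \<circ> (emb \<circ> x) = x"
 by (rule ext) (simp add: residue_emb)

text \<open>The ideals \<open>J\<close> that deform \<open>I\<close>: those with the same complement that reduce into \<open>I\<close>.\<close>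

definition good :: "(('v, 'a) path => 'b) set => bool" where
 "good J \<longleftrightarrow> complement J \<and> (\<forall>x\<in>J. rs \<circ> x : I)"

lemma goodD: "good J ==> complement J" "good J ==> ideal J P" "good J ==> x : J ==> rs \<circ> x : I"
 by (auto simp: good_def complement_def)

lemma res_proj:
 assumes J: "good J" and x: "x : carrier P"
 shows "rs \<circ> proj J x = k.proj I (rs \<circ> x)"
proof (rule k.proj_unique[OF I_complement, symmetric])
 note p = proj[OF goodD(1)[OF J] x]
 show "rs \<circ> proj J x : k.N" using res.f_T[OF p(1)] .
 show "(rs \<circ> x) \<ominus>\<^bsub>k.P\<^esub> (rs \<circ> proj J x) : I"
  using goodD(3)[OF J p(2)] res.f_P_minus[OF x N_P[OF p(1)]] by simp
qed (use x in simp)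

text \<open>Whether \<open>J\<close> reduces into \<open>I\<close> is visible on the projections of the paths.\<close>

lemma goodI:
 assumes J: "complement J"
  and p: "!!p. p : paths Q ==> rs \<circ> proj J (pe p) = k.proj I (path_elem K p)"
 shows "good J"
 unfolding good_def
proof (intro conjI ballI J)
 fix x assume xJ: "x : J"
 then have x: "x : carrier P" using complement_sub[OF J] by blast
 note pr = semilinearD[OF proj_lin[OF J]] and kpr = semilinearD[OF k.proj_lin[OF I_complement]]
 have "rs \<circ> proj J x = k.proj I (rs \<circ> x)"
 proof (rule res.semilinear_eq[of UNIV])
  show "semilinear rs B P k.P (T UNIV 0) (\<lambda>x. rs \<circ> proj J x)"
   using pr by (intro semilinearI) (simp_all add: res.f_P_add res.f_P_smult)
  show "semilinear rs B P k.P (T UNIV 0) (\<lambda>x. k.proj I (rs \<circ> x))"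
   using kpr by (intro semilinearI) (simp_all add: res.f_P_add res.f_P_smult)
 qed (simp_all add: p res.f_path_elem x)
 moreover have "proj J x = \<zero>\<^sub>P" using proj_eq_zero[OF J x] xJ by simp
 ultimately show "rs \<circ> x : I"
  using k.proj_eq_zero[OF I_complement res.f_P[OF x]] by (simp add: res.f_P_zero)
qed

abbreviation Ihat where "Ihat \<equiv> base_change_ideal B m Q emb I"
abbreviation red where "red \<equiv> reduce_mod K B m Q I"

lemma completed_quotient_eq: "completed_quotient B m Q I = QA Ihat"
 by (simp add: completed_quotient_def)

lemma good_Ihat: "good Ihat"
proof (rule goodI)
 note bc = emb.base_change_complement[OF I_complement]
 show "complement Ihat" by (rule bc(1))
 fix p assume p: "p : paths Q"
 then have P: "path_elem K p : carrier k.P" by simp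
 have "proj Ihat (pe p) = emb \<circ> k.proj I (path_elem K p)"
  using bc(2)[OF P] by (simp add: emb.f_path_elem)
 then show "rs \<circ> proj Ihat (pe p) = k.proj I (path_elem K p)"
  using res_emb[OF k.proj_P[OF I_complement P]] by simp
qed

lemmas Ihat = goodD(1,2)[OF good_Ihat]

lemma red_coset:
 assumes J: "ideal J P" "!!x. x : J ==> rs \<circ> x : I" and x: "x : carrier P"
 shows "red (J +>\<^sub>P x) = I +>\<^bsub>k.P\<^esub> (rs \<circ> x)"
proof -
 interpret J: ideal J P by (rule J)
 have "I +>\<^bsub>k.P\<^esub> (rs \<circ> y) = I +>\<^bsub>k.P\<^esub> (rs \<circ> x)" if y: "y : J +>\<^sub>P x" for y
 proof -
  obtain h where h: "h : J" "y = h \<boxplus> x" using y unfolding a_r_coset_def' by (elim UN_E singletonE)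
  have hP: "h : carrier P" using h(1) by (rule J.Icarr)
  have "(rs \<circ> y) \<ominus>\<^bsub>k.P\<^esub> (rs \<circ> x) = rs \<circ> h"
   unfolding h(2) res.f_P_add[OF hP x]
   using k.P.add_minus_cancel[of "rs \<circ> x" "rs \<circ> h"] hP x by (simp add: k.P.a_comm)
  then show ?thesis
   using k.coset_eq[OF k.complement_ideal[OF I_complement] res.f_P res.f_P, of y x] J(2)[OF h(1)] hP x h(2) by simp
 qed
 then have "(\<Union>y\<in>J +>\<^sub>P x. I +>\<^bsub>k.P\<^esub> (rs \<circ> y)) = I +>\<^bsub>k.P\<^esub> (rs \<circ> x)"
  by (intro UN_constant_eq[OF J.a_rcos_self[OF x]] ballI)
 then show ?thesis unfolding reduce_mod_def quotient_map_def kP[symmetric] .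
qed

lemma red_good: "good J ==> x : carrier P ==> red (J +>\<^sub>P x) = I +>\<^bsub>k.P\<^esub> (rs \<circ> x)"
 by (rule red_coset[OF goodD(2) goodD(3)])

lemma red_eq_near:
 assumes "u : N" "v : N"
 shows "I +>\<^bsub>k.P\<^esub> (rs \<circ> u) = I +>\<^bsub>k.P\<^esub> (rs \<circ> v) \<longleftrightarrow> u \<boxminus> v : T UNIV 1"
 using k.coset_inj[OF I_complement res.f_T[OF assms(1)] res.f_T[OF assms(2)]]
  res_eq_iff[OF N_P[OF assms(1)] N_P[OF assms(2)]] by auto

lemma near_coordinates:
 assumes J: "good J" and J': "ideal J' P" "!!x. x : J' ==> rs \<circ> x : I" and g: "g : module_iso B (QA J) (QA J')"
  and rd: "!!X. X : carrier (QA J) ==> red (g X) = red X"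
 obtains h where "lin (carrier P) h" "!!x. x : carrier P ==> h x : N"
  "!!x. x : carrier P ==> g (J +>\<^sub>P h x) = J' +>\<^sub>P x" "near h"
proof -
 obtain h where h: "lin (carrier P) h" "!!x. x : carrier P ==> h x : N"
  "!!x. x : carrier P ==> g (J +>\<^sub>P h x) = J' +>\<^sub>P x"
  by (rule module_iso_coordinates[OF goodD(1)[OF J] J'(1) g], rule that)
 have near: "near h"
 proof (rule nearI)
  show "lin N h" using h(1) N_P by (auto intro: semilinear_subset)
  fix u assume u: "u : N"
  show c: "h u : N" using h(2)[OF N_P[OF u]] .
  have "I +>\<^bsub>k.P\<^esub> (rs \<circ> h u) = I +>\<^bsub>k.P\<^esub> (rs \<circ> u)"
   using rd[OF coset_N[OF goodD(1)[OF J] c]] h(3)[OF N_P[OF u]] red_good[OF J N_P[OF c]] red_coset[OF J' N_P[OF u]] by simp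
  then show "h u \<boxminus> u : T UNIV 1" using red_eq_near[OF c u] by simp
 qed
 show thesis by (rule that[OF h near])
qed

lemma near_iso:
 assumes \<theta>: "near \<theta>"
 defines "L \<equiv> \<lambda>X. Ihat +>\<^sub>P \<theta> (crd Ihat X)"
 shows "L : module_iso B (QA Ihat) (QA Ihat)" "X : carrier (QA Ihat) ==> red (L X) = red X"
proof -
 note \<theta>' = nearD[OF \<theta>]
 show "L : module_iso B (QA Ihat) (QA Ihat)"
  by (rule module_isoI[OF Ihat(1) Ihat(1) \<theta>'(1,4)]) (simp add: L_def crd_coset[OF Ihat(1)])
 show "red (L X) = red X" if X: "X : carrier (QA Ihat)"
 proof -
  note x = crd[OF Ihat(1) X]
  have "red (L X) = red (Ihat +>\<^sub>P crd Ihat X)"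
   using red_good[OF good_Ihat N_P] \<theta>'(2)[OF x(1)] x(1) red_eq_near[OF \<theta>'(2)[OF x(1)] x(1)]
    T_UNIV[OF \<theta>'(3)[OF x(1)]] by (simp add: L_def)
  then show ?thesis using x(2) by simp
 qed
qed

end

section \<open>Deformations of the ideal\<close>

context coeff_point
begin

text \<open>As \<open>x\<close> depends linearly on its coefficients, so does \<open>x - proj J x\<close>; so the elements of \<open>J\<close> with
coefficients in \<open>m^n\<close> are combinations of elements of \<open>J\<close> with these coefficients. This is the flatness of
the quotient by \<open>J\<close>.\<close>

lemma ideal_smult_complement:
 assumes J: "complement J"
 shows "ideal_smult B P (F n) J = J \<inter> T UNIV n"
proof
 let ?X = "{b \<bullet> x | b x. b : F n \<and> x : J}"
 have "?X \<subseteq> J \<inter> T UNIV n"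
 proof (clarify, rule IntI)
  fix b x assume bx: "b : F n" "x : J"
  show "b \<bullet> x : J" by (rule complement_closed(7)[OF J bx(2) F_carrier[OF bx(1)]])
  have "x : T UNIV 0" using complement_sub[OF J bx(2)] by simp
  then show "b \<bullet> x : T UNIV n" using T_smult_F[of x UNIV 0 b n] bx(1) by simp
 qed
 moreover have "submodule (J \<inter> T UNIV n) B P"
  by (rule PM.submoduleI)
   (auto simp: T_P complement_closed[OF J] intro: T_uminus T_add T_smult)
 ultimately show "ideal_smult B P (F n) J \<subseteq> J \<inter> T UNIV n"
  unfolding ideal_smult_def by (rule mspan_minimal)
 show "J \<inter> T UNIV n \<subseteq> ideal_smult B P (F n) J"
 proof
  fix x assume x: "x : J \<inter> T UNIV n"
  then have "x : T UNIV n" by blast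
  then have "x \<boxminus> proj J x : mspan ?X"
  proof (induction rule: T_induct)
   case (smult b y)
   have y: "y : carrier P" using smult(2) by simp
   have "b \<bullet> y \<boxminus> proj J (b \<bullet> y) = b \<bullet> (y \<boxminus> proj J y)"
    using y F_carrier[OF smult(1)] proj_P[OF J y]
    by (simp add: semilinearD(3)[OF proj_lin[OF J]] a_minus_def PM.smult_r_distr PM.smult_r_minus)
   moreover have "b \<bullet> (y \<boxminus> proj J y) : ?X" using smult(1) proj(2)[OF J y] by blast
   then have "b \<bullet> (y \<boxminus> proj J y) : mspan ?X" by (rule subsetD[OF mspan_base])
   ultimately show ?case by simp
  next
   case (add y z)
   then have yz: "y : carrier P" "z : carrier P" using T_P by blast+
   have "(y \<boxplus> z) \<boxminus> proj J (y \<boxplus> z) = (y \<boxminus> proj J y) \<boxplus> (z \<boxminus> proj J z)"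
    unfolding semilinearD(2)[OF proj_lin[OF J] yz]
    by (rule P.minus_add_add[OF yz proj_P[OF J yz(1)] proj_P[OF J yz(2)]])
   then show ?case using mspan_add[OF add(3,4)] by simp
  qed
  moreover have "proj J x = \<zero>\<^sub>P" "x : carrier P"
   using x proj_eq_zero[OF J] complement_sub[OF J] by auto
  ultimately show "x : ideal_smult B P (F n) J" unfolding ideal_smult_def by (simp add: a_minus_def)
 qed
qed

lemma complement_complete:
 assumes J: "complement J"
 shows "complete_filtration P (\<lambda>n. ideal_smult B P (F n) J)"
 unfolding complete_filtration_def ideal_smult_complement[OF J]
proof (intro allI impI)
 fix x :: "nat => ('v, 'a) path => 'b"
 assume x: "\<forall>n. x n : J \<inter> T UNIV 0 \<and> x (Suc n) \<boxminus> x n : J \<inter> T UNIV n"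
 have xJ: "x n : J" "x n : T UNIV 0" "x (Suc n) \<boxminus> x n : T UNIV n" for n using x by simp_all
 have xP: "x n : carrier P" for n using xJ(2)[of n] by simp
 obtain y where y: "y : T UNIV 0" "!!n. y \<boxminus> x n : T UNIV n"
  by (rule T_limit[of x, OF xJ(2,3)], rule that)
 have yP: "y : carrier P" using y by simp
 have "proj J y = \<zero>\<^sub>P"
 proof (rule P_separated[OF proj_P[OF J yP]])
  fix n
  have "proj J (x n) = \<zero>\<^sub>P" using proj_eq_zero[OF J xP] xJ(1) by simp
  then have "proj J (y \<boxminus> x n) = proj J y"
   using proj_minus[OF J yP xP[of n]] proj_P[OF J yP] by (simp add: a_minus_def)
  then show "proj J y : T UNIV n" using T_UNIV[OF proj_T[OF J y(2)[of n]]] by simp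
 qed
 then have yJ: "y : J" using proj_eq_zero[OF J yP] by simp
 show "\<exists>!y. y : J \<inter> T UNIV 0 \<and> (\<forall>n. y \<boxminus> x n : J \<inter> T UNIV n)"
 proof (rule ex1I[of _ y])
  show "y : J \<inter> T UNIV 0 \<and> (\<forall>n. y \<boxminus> x n : J \<inter> T UNIV n)"
   using yJ yP y(2) complement_closed(2)[OF J yJ xJ(1)] by simp
  fix z assume z: "z : J \<inter> T UNIV 0 \<and> (\<forall>n. z \<boxminus> x n : J \<inter> T UNIV n)"
  then have zP: "z : carrier P" and zn: "z \<boxminus> x n : T UNIV n" for n by simp_all
  show "z = y"
  proof (rule P_eqI[OF zP yP])
   fix n
   have "z \<boxminus> y = (z \<boxminus> x n) \<boxminus> (y \<boxminus> x n)"
    using P.minus_minus_minus[OF zP xP yP xP, of n n] zP yP xP[of n] by (simp add: a_minus_def P.r_neg)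
   then show "z \<boxminus> y : T UNIV n" using T_minus[OF zn[of n] y(2)[of n]] by simp
  qed
 qed
qed

lemma identity_coordinates:
 assumes J: "complement J" "complement J'"
 defines "g \<equiv> \<lambda>X. J' +>\<^sub>P crd J X"
 shows "g : module_iso B (QA J) (QA J')" "!!u. u : N ==> g (J +>\<^sub>P u) = J' +>\<^sub>P u"
proof -
 show g: "g (J +>\<^sub>P u) = J' +>\<^sub>P u" if "u : N" for u using crd_coset[OF J(1) that] by (simp add: g_def)
 show "g : module_iso B (QA J) (QA J')"
  by (rule module_isoI[OF J nearD(1)[OF near_id] nearD(4)[OF near_id] g])
qed

lemma trivializations_eq: "trivializations K Q I (B, m) J =
  {\<Phi> : module_iso B (QA Ihat) (QA J). \<forall>X\<in>carrier (QA Ihat). red (\<Phi> X) = red X}"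
 by (simp add: trivializations_def completed_quotient_eq Let_def)

lemma trivialization:
 assumes J: "good J"
 shows "(\<lambda>X. J +>\<^sub>P crd Ihat X) : trivializations K Q I (B, m) J"
 unfolding trivializations_eq
proof (intro CollectI conjI ballI identity_coordinates(1) Ihat goodD(1)[OF J])
 fix X assume X: "X : carrier (QA Ihat)"
 note c = crd[OF Ihat(1) X]
 show "red (J +>\<^sub>P crd Ihat X) = red X"
  using red_good[OF J N_P[OF c(1)]] red_good[OF good_Ihat N_P[OF c(1)]] c(2) by simp
qed

text \<open>For a deformation \<open>J\<close> the trivialization gives a linear map \<open>h\<close> from \<open>P\<close> to \<open>N\<close> with kernel \<open>J\<close>. On \<open>N\<close> it is
the identity modulo \<open>m\<close>, hence bijective, so that \<open>N\<close> is a complement of \<open>J\<close>.\<close>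

lemma ideal_deformations_eq: "ideal_deformations K Q I (B, m) = {J. good J}"
proof (rule equalityI; rule subsetI)
 fix J assume "J : {J. good J}"
 then have J: "good J" by simp
 note c = goodD(1)[OF J]
 show "J : ideal_deformations K Q I (B, m)"
  unfolding ideal_deformations_def Let_def prod.case mem_Collect_eq kP[symmetric]
 proof (intro conjI ballI impI goodD(2)[OF J] complement_complete[OF c])
  show "(\<lambda>x. rs \<circ> x) ` J = I"
  proof
   show "(\<lambda>x. rs \<circ> x) ` J \<subseteq> I" using goodD(3)[OF J] by auto
   show "I \<subseteq> (\<lambda>x. rs \<circ> x) ` J"
   proof
    fix z assume zI: "z : I"
    then have z: "z : carrier k.P" using k.complement_sub[OF I_complement] by blast
    define x where "x = emb \<circ> z"
    have x: "x : carrier P" "rs \<circ> x = z" using z res_emb[OF z] by (simp_all add: x_def)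
    have "rs \<circ> proj J x = \<zero>\<^bsub>k.P\<^esub>"
     using res_proj[OF J x(1)] k.proj_eq_zero[OF I_complement z] zI x(2) by simp
    then have "rs \<circ> (x \<boxminus> proj J x) = z"
     using res.f_P_minus[OF x(1) proj_P[OF c x(1)]] x(2) z by (simp add: a_minus_def)
    then show "z : (\<lambda>x. rs \<circ> x) ` J" using proj(2)[OF c x(1)] by blast
   qed
  qed
  show "x : ideal_smult B P m J" if x: "x : J" "rs \<circ> x = \<zero>\<^bsub>k.P\<^esub>" for x
   using ideal_smult_complement[OF c, of "Suc 0"] res_zero_iff[OF complement_sub[OF c x(1)]] x by simp
  show "trivializations K Q I (B, m) J \<noteq> {}" using trivialization[OF J] by blast
 qed
next
 fix J assume "J : ideal_deformations K Q I (B, m)"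
 then have J: "ideal J P" "(\<lambda>x. rs \<circ> x) ` J = I" and "trivializations K Q I (B, m) J \<noteq> {}"
  unfolding ideal_deformations_def Let_def prod.case by (simp_all add: kP)
 then obtain \<Phi> where \<Phi>: "\<Phi> : module_iso B (QA Ihat) (QA J)" "!!X. X : carrier (QA Ihat) ==> red (\<Phi> X) = red X"
  unfolding trivializations_eq by blast
 have JI: "rs \<circ> x : I" if "x : J" for x using J(2) that by blast
 obtain h where h: "lin (carrier P) h" "!!x. x : carrier P ==> h x : N"
  "!!x. x : carrier P ==> \<Phi> (Ihat +>\<^sub>P h x) = J +>\<^sub>P x" and near: "near h"
  by (rule near_coordinates[OF good_Ihat J(1) JI \<Phi>], assumption+, rule that)
 have ker: "h x = h y \<longleftrightarrow> x \<boxminus> y : J" if "x : carrier P" "y : carrier P" for x y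
 proof -
  have "inj_on \<Phi> (carrier (QA Ihat))" using module_isoD(2)[OF \<Phi>(1)] by (simp add: bij_betw_def)
  then have "h x = h y \<longleftrightarrow> J +>\<^sub>P x = J +>\<^sub>P y"
   using h(3)[OF that(1)] h(3)[OF that(2)] coset_inj[OF Ihat(1) h(2)[OF that(1)] h(2)[OF that(2)]]
    inj_onD[OF _ _ coset_N[OF Ihat(1) h(2)[OF that(1)]] coset_N[OF Ihat(1) h(2)[OF that(2)]], of \<Phi>] by metis
  then show ?thesis using coset_eq[OF J(1) that] by simp
 qed
 have "\<exists>!u. u : N \<and> x \<boxminus> u : J" if x: "x : carrier P" for x
 proof -
  have "h x : h ` N" using nearD(4)[OF near] h(2)[OF x] by (simp add: bij_betw_def)
  then obtain u where u: "u : N" "h x = h u" by (elim imageE)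
  have "inj_on h N" using nearD(4)[OF near] by (simp add: bij_betw_def)
  then have "v = u" if "v : N" "h x = h v" for v using u that by (simp add: inj_on_def)
  then have uniq: "v = u" if "v : N" "x \<boxminus> v : J" for v using ker[OF x N_P] that by simp
  show ?thesis
  proof (rule ex1I[of _ u])
   show "u : N \<and> x \<boxminus> u : J" using u ker[OF x N_P[OF u(1)]] by simp
   show "v = u" if "v : N \<and> x \<boxminus> v : J" for v using uniq that by simp
  qed
 qed
 then have "good J" unfolding good_def complement_def using J(1) JI by blast
 then show "J : {J. good J}" by simp
qed

text \<open>Since all trivializations of \<open>J\<close> are allowed, those given by the coordinates \<open>N\<close> can be used; the isomorphism
of quotients is then a gauge transformation. It preserves the unit because it is surjective.\<close>

lemma ideal_equiv_eq:
 "ideal_equiv K Q I (B, m) = {(J, J'). good J \<and> good J' \<and> gauge (nprod J) (nprod J')}"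
proof (rule equalityI; rule subrelI)
 fix J J' assume "(J, J') : ideal_equiv K Q I (B, m)"
 then obtain \<Phi> \<Phi>' L where J: "good J" "good J'"
  and \<Phi>: "\<Phi> : module_iso B (QA Ihat) (QA J)" "!!X. X : carrier (QA Ihat) ==> red (\<Phi> X) = red X"
  and \<Phi>': "\<Phi>' : module_iso B (QA Ihat) (QA J')" "!!X. X : carrier (QA Ihat) ==> red (\<Phi>' X) = red X"
  and L: "L : module_iso B (QA Ihat) (QA Ihat)" "!!X. X : carrier (QA Ihat) ==> red (L X) = red X"
  and g: "\<Phi>' \<circ> L \<circ> inv_into (carrier (QA Ihat)) \<Phi> : module_iso B (QA J) (QA J')"
   "\<Phi>' \<circ> L \<circ> inv_into (carrier (QA Ihat)) \<Phi> : ring_iso (QA J) (QA J')"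
  unfolding ideal_equiv_def Let_def prod.case trivializations_eq completed_quotient_eq ideal_deformations_eq
  by blast
 define g where "g = \<Phi>' \<circ> L \<circ> inv_into (carrier (QA Ihat)) \<Phi>"
 note g = g[folded g_def]
 note c = goodD(1)[OF J(1)] goodD(1)[OF J(2)] and i = goodD(2)[OF J(1)] goodD(2)[OF J(2)]
 have red_g: "red (g X) = red X" if X: "X : carrier (QA J)" for X
 proof -
  let ?Y = "inv_into (carrier (QA Ihat)) \<Phi> X"
  have "X : \<Phi> ` carrier (QA Ihat)" using module_isoD(2)[OF \<Phi>(1)] X by (simp add: bij_betw_def)
  then have Y: "?Y : carrier (QA Ihat)" "\<Phi> ?Y = X" by (rule inv_into_into, rule f_inv_into_f)
  then show ?thesis using \<Phi>(2)[OF Y(1)] L(2)[OF Y(1)] \<Phi>'(2)[OF module_isoD(1)[OF L(1) Y(1)]] by (simp add: g_def)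
 qed
 obtain h where h: "lin (carrier P) h" "!!x. x : carrier P ==> h x : N"
  "!!x. x : carrier P ==> g (J +>\<^sub>P h x) = J' +>\<^sub>P x" and near: "near h"
  by (rule near_coordinates[OF J(1) i(2) goodD(3)[OF J(2)] g(1) red_g], assumption+, rule that)
 have "gauge (nprod J') (nprod J)"
 proof (rule gaugeI[OF near])
  fix u v assume uv: "u : N" "v : N"
  note P = N_P[OF uv(1)] N_P[OF uv(2)] and hN = h(2)[OF N_P[OF uv(1)]] h(2)[OF N_P[OF uv(2)]]
  have uvP: "u \<boxtimes> v : carrier P" "h u \<boxtimes> h v : carrier P" using P N_P[OF hN(1)] N_P[OF hN(2)] by simp_all
  note pN = proj(1)[OF c(2) uvP(1)] proj(1)[OF c(1) uvP(2)]
  have "g (J +>\<^sub>P proj J (h u \<boxtimes> h v)) = g ((J +>\<^sub>P h u) \<otimes>\<^bsub>QA J\<^esub> (J +>\<^sub>P h v))"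
   using coset_ops(3)[OF i(1) N_P N_P, OF hN zero_closed] coset_proj[OF c(1) uvP(2)] by simp
  also have "\<dots> = (J' +>\<^sub>P u) \<otimes>\<^bsub>QA J'\<^esub> (J' +>\<^sub>P v)"
   using ring_hom_mult[of g "QA J" "QA J'"] g(2) coset_N[OF c(1) hN(1)] coset_N[OF c(1) hN(2)] h(3)[OF P(1)] h(3)[OF P(2)]
   by (simp add: ring_iso_def del: quotient_algebra_simps)
  also have "\<dots> = J' +>\<^sub>P proj J' (u \<boxtimes> v)"
   using coset_ops(3)[OF i(2) P zero_closed] coset_proj[OF c(2) uvP(1)] by simp
  also have "\<dots> = g (J +>\<^sub>P h (proj J' (u \<boxtimes> v)))" using h(3)[OF N_P[OF pN(1)]] by simp
  finally have "J +>\<^sub>P proj J (h u \<boxtimes> h v) = J +>\<^sub>P h (proj J' (u \<boxtimes> v))"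
   using module_isoD(2)[OF g(1)] coset_N[OF c(1) pN(2)] coset_N[OF c(1) h(2)[OF N_P[OF pN(1)]]]
   by (auto simp: bij_betw_def dest: inj_onD simp del: quotient_algebra_simps)
  then show "h (nprod J' u v) = nprod J (h u) (h v)"
   unfolding nprod_def using coset_inj[OF c(1) pN(2) h(2)[OF N_P[OF pN(1)]]] by simp
 qed
 then have "gauge (nprod J) (nprod J')" by (rule gauge_sym[OF bilin_nprod[OF c(2)]])
 then show "(J, J') : {(J, J'). good J \<and> good J' \<and> gauge (nprod J) (nprod J')}" using J by simp
next
 fix J J' assume "(J, J') : {(J, J'). good J \<and> good J' \<and> gauge (nprod J) (nprod J')}"
 then have J: "good J" "good J'" and g: "gauge (nprod J) (nprod J')" by simp_all
 obtain \<theta> where \<theta>: "near \<theta>" "!!u v. u : N ==> v : N ==>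
   \<theta> (nprod J u v) = nprod J' (\<theta> u) (\<theta> v)" by (rule gaugeE[OF g], rule that)
 note c = goodD(1)[OF J(1)] goodD(1)[OF J(2)] and i = goodD(2)[OF J(1)] goodD(2)[OF J(2)]
 note \<theta>' = nearD[OF \<theta>(1)]
 let ?\<Phi> = "\<lambda>X. J +>\<^sub>P crd Ihat X" and ?\<Phi>' = "\<lambda>X. J' +>\<^sub>P crd Ihat X" and ?L = "\<lambda>X. Ihat +>\<^sub>P \<theta> (crd Ihat X)"
 define g where "g = ?\<Phi>' \<circ> ?L \<circ> inv_into (carrier (QA Ihat)) ?\<Phi>"
 note L = near_iso(1)[OF \<theta>(1)] and L_red = near_iso(2)[OF \<theta>(1)]
 have g: "g (J +>\<^sub>P u) = J' +>\<^sub>P \<theta> u" if u: "u : N" for u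
 proof -
  note iso = identity_coordinates[OF Ihat(1) c(1)]
  have "inv_into (carrier (QA Ihat)) ?\<Phi> (J +>\<^sub>P u) = Ihat +>\<^sub>P u"
   using module_isoD(2)[OF iso(1)] coset_N[OF Ihat(1) u] iso(2)[OF u]
   by (metis (no_types, lifting) bij_betw_def inv_into_f_f)
  then show ?thesis using crd_coset[OF Ihat(1)] u \<theta>'(2)[OF u] by (simp add: g_def)
 qed
 have iso: "g : module_iso B (QA J) (QA J')" by (rule module_isoI[OF c \<theta>'(1,4) g])
 have mult: "g (X \<otimes>\<^bsub>QA J\<^esub> Y) = g X \<otimes>\<^bsub>QA J'\<^esub> g Y" if XY: "X : carrier (QA J)" "Y : carrier (QA J)" for X Y
 proof -
  obtain u v where uv: "u : N" "v : N" "X = J +>\<^sub>P u" "Y = J +>\<^sub>P v"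
   by (rule that[OF crd(1)[OF c(1) XY(1)] crd(1)[OF c(1) XY(2)] crd(2)[OF c(1) XY(1)] crd(2)[OF c(1) XY(2)]])
  note P = N_P[OF uv(1)] N_P[OF uv(2)] and \<theta>P = N_P[OF \<theta>'(2)[OF uv(1)]] N_P[OF \<theta>'(2)[OF uv(2)]]
  have uvP: "u \<boxtimes> v : carrier P" "\<theta> u \<boxtimes> \<theta> v : carrier P" using P \<theta>P by simp_all
  have "g (X \<otimes>\<^bsub>QA J\<^esub> Y) = g (J +>\<^sub>P proj J (u \<boxtimes> v))"
   unfolding uv(3,4) using coset_ops(3)[OF i(1) P zero_closed] coset_proj[OF c(1) uvP(1)] by simp
  also have "\<dots> = J' +>\<^sub>P proj J' (\<theta> u \<boxtimes> \<theta> v)"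
   using g[OF proj(1)[OF c(1) uvP(1)]] \<theta>(2)[OF uv(1,2)] by (simp add: nprod_def)
  also have "\<dots> = g X \<otimes>\<^bsub>QA J'\<^esub> g Y"
   unfolding uv(3,4) g[OF uv(1)] g[OF uv(2)]
   using coset_ops(3)[OF i(2) \<theta>P zero_closed] coset_proj[OF c(2) uvP(2)] by simp
  finally show ?thesis .
 qed
 have "\<theta> \<one>\<^sub>P = \<one>\<^sub>P"
 proof -
  have "\<one>\<^sub>P : \<theta> ` N" using \<theta>'(4) one_N by (simp add: bij_betw_def)
  then obtain v where v: "v : N" "\<theta> v = \<one>\<^sub>P" by (elim imageE) simp
  have "\<theta> (nprod J \<one>\<^sub>P v) = \<theta> v" using v proj_Irr[OF c(1) v(1)] N_P by (simp add: nprod_def)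
  then have "nprod J' (\<theta> \<one>\<^sub>P) \<one>\<^sub>P = \<one>\<^sub>P" using \<theta>(2)[OF one_N v(1)] v(2) by simp
  then show ?thesis using proj_Irr[OF c(2) \<theta>'(2)[OF one_N]] N_P[OF \<theta>'(2)[OF one_N]] by (simp add: nprod_def)
 qed
 then have "g \<one>\<^bsub>QA J\<^esub> = \<one>\<^bsub>QA J'\<^esub>" using g[OF one_N] by simp
 then have riso: "g : ring_iso (QA J) (QA J')"
  unfolding ring_iso_def using module_isoD[OF iso] mult
  by (intro CollectI conjI ring_hom_memI) (simp_all del: quotient_algebra_simps)
 show "(J, J') : ideal_equiv K Q I (B, m)"
  unfolding ideal_equiv_def Let_def prod.case ideal_deformations_eq completed_quotient_eq
  by (rule CollectI, rule case_prodI,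
    intro conjI bexI[where x = ?\<Phi>] bexI[where x = ?\<Phi>'] bexI[where x = ?L] IntI ballI CollectI)
   (simp_all only: J trivialization[OF J(1)] trivialization[OF J(2)] L L_red g_def[symmetric]
    iso riso)
qed

end

section \<open>Deformations of the reduction system\<close>

context quiver_tips
begin

lemma path_elem_Cons:
 assumes "(u, a # as) : paths Q"
 shows "pe (u, a # as) = pe (tail Q a, [a]) \<boxtimes> pe (head Q a, as)"
proof -
 have a: "a : arcs Q" "tail Q a = u" "(head Q a, as) : paths Q" using assms by (auto simp: paths_Cons)
 show ?thesis using conv_path_elems[OF arrow_path[OF a(1)] a(3)] a(2) by (simp add: P_mult source_def path_cat_def)
qed

lemma vertex_mult:
 assumes "i : verts Q" "j : verts Q"
 shows "pe (i, []) \<boxtimes> pe (j, []) = (if i = j then pe (i, []) else \<zero>\<^sub>P)"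
 using conv_path_elems[of "(i, [])" "(j, [])"] assms by (simp add: P_mult P_zero source_def path_cat_def)

lemma source_mult:
 assumes "p : paths Q"
 shows "pe (fst p, []) \<boxtimes> pe p = pe p"
 using conv_path_elems[of "(fst p, [])" p] assms source_in_verts[OF assms] by (simp add: P_mult source_def path_cat_def)

lemma target_mult:
 assumes "p : paths Q"
 shows "pe p \<boxtimes> pe (target Q p, []) = pe p"
 using conv_path_elems[of p "(target Q p, [])"] assms target_in_verts[OF assms] by (simp add: P_mult source_def path_cat_def)

lemma idempotent_N:
 assumes u: "u : N" and i: "i : verts Q"
 shows "pe (i, []) \<boxtimes> u : N" "u \<boxtimes> pe (i, []) : N"
proof -
 have e: "pe (i, []) : carrier P" using i by simp
 note 0 = T_supp[OF u]
 show "pe (i, []) \<boxtimes> u : N"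
  using 0 by (intro T_I) (simp_all add: idempotent_left_apply[OF N_P[OF u] i] N_P[OF u] e)
 show "u \<boxtimes> pe (i, []) : N"
  using 0 by (intro T_I) (simp_all add: idempotent_right_apply[OF N_P[OF u] i] N_P[OF u] e)
qed

lemma proj_idempotent:
 assumes J: "complement J" and x: "x : carrier P" and i: "i : verts Q"
 shows "proj J (pe (i, []) \<boxtimes> x) = pe (i, []) \<boxtimes> proj J x"
  "proj J (x \<boxtimes> pe (i, [])) = proj J x \<boxtimes> pe (i, [])"
proof -
 have e: "pe (i, []) : carrier P" using i by simp
 note p = proj[OF J x] and pP = proj_P[OF J x]
 show "proj J (pe (i, []) \<boxtimes> x) = pe (i, []) \<boxtimes> proj J x"
 proof (rule proj_unique[OF J _ idempotent_N(1)[OF p(1) i]])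
  show "pe (i, []) \<boxtimes> x \<boxminus> pe (i, []) \<boxtimes> proj J x : J"
   using complement_closed(6)[OF J p(2) e] e x pP by (simp add: a_minus_def P.r_distr P.r_minus)
 qed (use e x in simp)
 show "proj J (x \<boxtimes> pe (i, [])) = proj J x \<boxtimes> pe (i, [])"
 proof (rule proj_unique[OF J _ idempotent_N(2)[OF p(1) i]])
  show "x \<boxtimes> pe (i, []) \<boxminus> proj J x \<boxtimes> pe (i, []) : J"
   using complement_closed(5)[OF J p(2) e] e x pP by (simp add: a_minus_def P.l_distr P.l_minus)
 qed (use e x in simp)
qed

lemma nprod_assoc:
 assumes J: "complement J" and N: "u : N" "v : N" "w : N"
 shows "nprod J (nprod J u v) w = nprod J u (nprod J v w)"
 using proj_mult(1)[OF J _ N_P[OF N(3)], of "u \<boxtimes> v"] proj_mult(2)[OF J N_P[OF N(1)], of "v \<boxtimes> w"]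
  N_P[OF N(1)] N_P[OF N(2)] N_P[OF N(3)] by (simp add: nprod_def P.m_assoc)

lemma nprod_one:
 assumes J: "complement J" and u: "u : N"
 shows "nprod J \<one>\<^sub>P u = u" "nprod J u \<one>\<^sub>P = u"
 using proj_Irr[OF J u] N_P[OF u] by (simp_all add: nprod_def)

lemma bilin_cong:
 assumes \<mu>: "bilin \<mu>" and u: "u : N" "u' : N" and v: "v : N" "v' : N"
  and d: "u \<boxminus> u' : T UNIV n" "v \<boxminus> v' : T UNIV n"
 shows "\<mu> u v \<boxminus> \<mu> u' v' : T UNIV n"
proof -
 note m = bilinD[OF \<mu>]
 have dN: "u \<boxminus> u' : T Ir n" "v \<boxminus> v' : T Ir n"
  using d T_minus[OF u] T_minus[OF v] by (simp_all add: T_inter)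
 have "\<mu> u v \<boxminus> \<mu> u' v : T Ir n"
  using lin_T[OF m(2)[OF v(1)] m(1)[OF _ v(1)] dN(1)] lin_minus[OF m(2)[OF v(1)] u] by simp
 moreover have "\<mu> u' v \<boxminus> \<mu> u' v' : T Ir n"
  using lin_T[OF m(3)[OF u(2)] m(1)[OF u(2)] dN(2)] lin_minus[OF m(3)[OF u(2)] v] by simp
 ultimately have "(\<mu> u v \<boxminus> \<mu> u' v) \<boxplus> (\<mu> u' v \<boxminus> \<mu> u' v') : T Ir n" by (rule T_add)
 then show ?thesis
  using P.minus_telescope[OF N_P N_P N_P, OF m(1)[OF u(1) v(1)] m(1)[OF u(2) v(1)] m(1)[OF u(2) v(2)]] T_UNIV by simp
qed

text \<open>Any gauge equivalence \<open>\<theta>\<close> can be conjugated so as to fix the vertices. The conjugating element is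
 the sum of the products \<open>\<theta>(e\<^sub>i) e\<^sub>i\<close>; only left multiplication by it appears, as the map \<open>W\<close> with
 \<open>W y = \<theta>(e\<^sub>i) y\<close> on elements \<open>y\<close> with source \<open>i\<close>, which is bijective since it is near the identity.\<close>

lemma gauge_fixing_vertices:
 assumes J: "complement J" and J': "complement J'" and g: "gauge (nprod J') (nprod J)"
 obtains L where "near L" "!!u v. u : N ==> v : N ==> L (nprod J' u v) = nprod J (L u) (L v)"
  "!!i. i : verts Q ==> L (pe (i, [])) = pe (i, [])"
proof -
 let ?m = "nprod J" and ?e = "\<lambda>i. pe (i, [])"
 obtain \<theta> where \<theta>: "near \<theta>" "!!u v. u : N ==> v : N ==> \<theta> (nprod J' u v) = ?m (\<theta> u) (\<theta> v)"
  by (rule gaugeE[OF g], rule that)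
 note \<theta>N = nearD(2)[OF \<theta>(1)]
 note m = bilinD[OF bilin_nprod[OF J]] and assoc = nprod_assoc[OF J]
 have eN: "?e i : N" "\<theta> (?e i) : N" if "i : verts Q" for i using vertex_N[OF that] \<theta>N by simp_all
 have pN: "pe p : N" if "p : Ir" "p : paths Q" for p using that by (intro T_path_elem)
 have eT: "\<theta> (?e i) \<boxminus> ?e i : T UNIV 1" if "i : verts Q" for i
  using T_UNIV[OF nearD(3)[OF \<theta>(1) vertex_N[OF that]]] .
 have \<theta>\<theta>: "?m (\<theta> (?e i)) (\<theta> (?e j)) = (if i = j then \<theta> (?e i) else \<zero>\<^sub>P)" if ij: "i : verts Q" "j : verts Q" for i j
 proof -
  have "nprod J' (?e i) (?e j) = (if i = j then ?e i else \<zero>\<^sub>P)"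
   using vertex_mult[OF ij] proj_Irr[OF J' eN(1)[OF ij(1)]] proj_Irr[OF J' eN(1)[OF ij(2)]] proj_Irr[OF J', of "\<zero>\<^sub>P"] by (simp add: nprod_def)
  then show ?thesis using \<theta>(2)[OF eN(1)[OF ij(1)] eN(1)[OF ij(2)]] lin_zero[OF nearD(1)[OF \<theta>(1)]] by (auto split: if_splits)
 qed
 have src: "fst p : verts Q" if "p : paths Q" for p using source_in_verts[OF that] .
 obtain W where W: "lin N W" "!!x. x : N ==> W x : N"
  "!!p. p : Ir ==> p : paths Q ==> W (pe p) = ?m (\<theta> (?e (fst p))) (pe p)"
  by (rule linear_extension[of Ir "\<lambda>p. ?m (\<theta> (?e (fst p))) (pe p)" Ir])
   (assumption | rule m(1) eN src pN that)+
 have emp: "?m (?e (fst p)) (pe p) = pe p" if "p : Ir" "p : paths Q" for p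
  using source_mult[OF that(2)] proj_Irr[OF J pN[OF that]] by (simp add: nprod_def)
 have nearW: "near W"
 proof (rule near_if_paths[OF W(1,2)])
  fix p assume p: "p : Ir" "p : paths Q"
  have "?m (\<theta> (?e (fst p))) (pe p) \<boxminus> ?m (?e (fst p)) (pe p) : T UNIV 1"
   using pN[OF p] N_P[OF pN[OF p]] eN[OF src[OF p(2)]] eT[OF src[OF p(2)]]
   by (intro bilin_cong[OF bilin_nprod[OF J]]) (simp_all add: a_minus_def P.r_neg)
  then show "W (pe p) \<boxminus> pe p : T UNIV 1" unfolding W(3)[OF p] emp[OF p] .
 qed
 have Wsrc: "W y = ?m (\<theta> (?e i)) y" if i: "i : verts Q" and y: "y : N" "!!p. y p \<noteq> \<zero> ==> source p = i" for i y
 proof (rule lin_eq[where X = "{p : Ir. fst p = i}" and g = W and h = "?m (\<theta> (?e i))"])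
  have sub: "T {p : Ir. fst p = i} 0 \<subseteq> N" using T_mono[of "{p : Ir. fst p = i}" Ir 0 0] by auto
  show "lin (T {p : Ir. fst p = i} 0) W" "lin (T {p : Ir. fst p = i} 0) (?m (\<theta> (?e i)))"
   using semilinear_subset[OF W(1) sub] semilinear_subset[OF m(3)[OF eN(2)[OF i]] sub] by simp_all
  show "W (pe p) = ?m (\<theta> (?e i)) (pe p)" if "p : {p : Ir. fst p = i}" "p : paths Q" for p
   using W(3)[of p] that by simp
  show "y : T {p : Ir. fst p = i} 0"
  proof (rule T_I[OF N_P[OF y(1)]])
   show "y p = \<zero>" if "p \<notin> {p : Ir. fst p = i}" for p
    using T_supp[OF y(1), of p] y(2)[of p] that by (auto simp: source_def)
   show "y p : F 0" for p using N_P[OF y(1)] by simp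
  qed
 qed
 have psrc: "source q = fst p" if p: "p : Ir" "p : paths Q" and v: "v : N" and q: "?m (pe p) v q \<noteq> \<zero>" for p q v
 proof -
  have P: "pe p \<boxtimes> v : carrier P" "?e (fst p) : carrier P" using p N_P[OF v] src by simp_all
  have "?e (fst p) \<boxtimes> ?m (pe p) v = ?m (pe p) v"
   using proj_idempotent(1)[OF J P(1) src[OF p(2)]] source_mult[OF p(2)] P.m_assoc[OF P(2) _ N_P[OF v], of "pe p"] p
   by (simp add: nprod_def)
  then show ?thesis
   using idempotent_left_apply[OF N_P[OF m(1)[OF pN[OF p] v]] src[OF p(2)], of q] q by (auto split: if_splits)
 qed
 have Wm: "W (?m u v) = ?m (W u) v" if uv: "u : N" "v : N" for u v
 proof (rule lin_eq[where g = "\<lambda>u. W (?m u v)" and h = "\<lambda>u. ?m (W u) v", OF _ _ _ uv(1)])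
  show "lin N (\<lambda>u. W (?m u v))" by (rule lin_comp[OF m(2)[OF uv(2)] m(1)[OF _ uv(2)] W(1)])
  show "lin N (\<lambda>u. ?m (W u) v)" by (rule lin_comp[OF W(1) W(2) m(2)[OF uv(2)]])
  fix p assume p: "p : Ir" "p : paths Q"
  have "W (?m (pe p) v) = ?m (\<theta> (?e (fst p))) (?m (pe p) v)"
   by (rule Wsrc[OF src[OF p(2)] m(1)[OF pN[OF p] uv(2)] psrc[OF p uv(2)]])
  then show "W (?m (pe p) v) = ?m (W (pe p)) v"
   unfolding W(3)[OF p] using assoc[OF eN(2)[OF src[OF p(2)]] pN[OF p] uv(2)] by simp
 qed
 have We: "W (?e i) = ?m (\<theta> (?e i)) (W \<one>\<^sub>P)" if i: "i : verts Q" for i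
 proof -
  have "W (?m (?e i) y) = ?m (\<theta> (?e i)) (W y)" if y: "y : N" for y
  proof (rule lin_eq[where g = "\<lambda>y. W (?m (?e i) y)" and h = "\<lambda>y. ?m (\<theta> (?e i)) (W y)", OF _ _ _ y])
   show "lin N (\<lambda>y. W (?m (?e i) y))" by (rule lin_comp[OF m(3)[OF eN(1)[OF i]] m(1)[OF eN(1)[OF i]] W(1)])
   show "lin N (\<lambda>y. ?m (\<theta> (?e i)) (W y))" by (rule lin_comp[OF W(1) W(2) m(3)[OF eN(2)[OF i]]])
   fix p assume p: "p : Ir" "p : paths Q"
   have i0: "\<zero>\<^sub>P : N" by simp
   have "?m (?e i) (pe p) = (if i = fst p then pe p else \<zero>\<^sub>P)"
    using conv_path_elems[of "(i, [])" p] i p proj_Irr[OF J pN[OF p]] proj_Irr[OF J i0]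
    by (simp add: nprod_def P_mult source_def path_cat_def P_zero)
   moreover have "?m (\<theta> (?e i)) (W (pe p)) = (if i = fst p then W (pe p) else \<zero>\<^sub>P)"
    using assoc[OF eN(2)[OF i] eN(2)[OF src[OF p(2)]] pN[OF p]] \<theta>\<theta>[OF i src[OF p(2)]]
     lin_zero[OF m(2)[OF pN[OF p]]] by (cases "i = fst p") (simp_all add: W(3)[OF p])
   ultimately show "W (?m (?e i) (pe p)) = ?m (\<theta> (?e i)) (W (pe p))"
    using lin_zero[OF W(1)] by simp
  qed
  from this[OF one_N] show ?thesis using nprod_one(2)[OF J eN(1)[OF i]] by simp
 qed
 \<comment> \<open>\<open>V\<close> is left multiplication by the inverse of the conjugating element \<open>W 1\<close>.\<close>
 obtain V where V: "near V" "!!u. u : N ==> W (V u) = u" "!!u. u : N ==> V (W u) = u"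
  by (rule near_inv[OF nearW], rule that)
 let ?c = "W \<one>\<^sub>P"
 have cN: "?c : N" using W(2)[OF one_N] .
 have R: "near (\<lambda>y. ?m y ?c)"
 proof (rule nearI[OF m(2)[OF cN] m(1)[OF _ cN]])
  fix u assume u: "u : N"
  have "?m u ?c \<boxminus> ?m u \<one>\<^sub>P : T UNIV 1"
   using u N_P[OF u] cN one_N T_UNIV[OF nearD(3)[OF nearW one_N]]
   by (intro bilin_cong[OF bilin_nprod[OF J]]) (simp_all add: a_minus_def P.r_neg)
  then show "?m u ?c \<boxminus> u : T UNIV 1" unfolding nprod_one(2)[OF J u] .
 qed
 let ?L = "\<lambda>x. V (?m (\<theta> x) ?c)"
 have nearL: "near ?L" by (rule near_comp[OF near_comp[OF \<theta>(1) R] V(1)])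
 have WL: "W (?L x) = ?m (\<theta> x) ?c" if "x : N" for x using V(2)[OF m(1)[OF \<theta>N[OF that] cN]] .
 show thesis
 proof (rule that[OF nearL])
  fix u v assume uv: "u : N" "v : N"
  note LN = nearD(2)[OF nearL uv(1)] nearD(2)[OF nearL uv(2)]
  have n': "nprod J' u v : N" using bilinD(1)[OF bilin_nprod[OF J'] uv] .
  have "W (?m (?L u) (?L v)) = ?m (?m (\<theta> u) ?c) (?L v)" using Wm[OF LN] WL[OF uv(1)] by simp
  also have "\<dots> = ?m (\<theta> u) (W (?m \<one>\<^sub>P (?L v)))" using assoc[OF \<theta>N[OF uv(1)] cN LN(2)] Wm[OF one_N LN(2)] by simp
  also have "\<dots> = ?m (\<theta> u) (?m (\<theta> v) ?c)" using nprod_one(1)[OF J LN(2)] WL[OF uv(2)] by simp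
  also have "\<dots> = W (?L (nprod J' u v))"
   using assoc[OF \<theta>N[OF uv(1)] \<theta>N[OF uv(2)] cN] \<theta>(2)[OF uv] WL[OF n'] by simp
  finally have "V (W (?m (?L u) (?L v))) = V (W (?L (nprod J' u v)))" by simp
  then show "?L (nprod J' u v) = ?m (?L u) (?L v)"
   using V(3)[OF m(1)[OF LN]] V(3)[OF nearD(2)[OF nearL n']] by simp
 next
  fix i assume i: "i : verts Q"
  show "?L (?e i) = ?e i" using We[OF i] V(3)[OF eN(1)[OF i]] by simp
 qed
qed

lemma completed_Irr_simps [simp]:
 "carrier (completed_Irr B m Q S) = N"
 "x \<oplus>\<^bsub>completed_Irr B m Q S\<^esub> y = x \<boxplus> y" "b \<odot>\<^bsub>completed_Irr B m Q S\<^esub> x = b \<bullet> x"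
proof -
 have "carrier (completed_Irr B m Q S) = {x : carrier P. \<forall>p. x p \<noteq> \<zero> \<longrightarrow> p : Ir}"
  unfolding completed_Irr_def by simp
 also have "\<dots> = N"
  by (intro equalityI subsetI) (auto intro!: T_I dest: T_supp simp: N_P)
 finally show "carrier (completed_Irr B m Q S) = N" .
qed (simp_all add: completed_Irr_def)

lemma near_module_iso: "near L ==> L : module_iso B (completed_Irr B m Q S) (completed_Irr B m Q S)"
 unfolding module_iso_def iso_def hom_def using nearD[of L] semilinearD(2,3)[OF nearD(1)[of L]] by simp

lemma module_iso_lin:
 assumes "L : module_iso B (completed_Irr B m Q S) (completed_Irr B m Q S)"
 shows "lin N L" "u : N ==> L u : N"
proof -
 note L = module_isoD[OF assms, simplified]
 show "L u : N" if "u : N" for u by (rule L(1)[OF that])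
 show "lin N L" by (rule semilinearI) (use L N_P in simp_all)
qed

lemma arrow_extension:
 assumes A: "!!a. a : arcs Q ==> A a : carrier P"
  "!!a. a : arcs Q ==> pe (tail Q a, []) \<boxtimes> A a = A a"
  "!!a. a : arcs Q ==> A a \<boxtimes> pe (head Q a, []) = A a"
 obtains G where "lin (carrier P) G" "!!x. x : carrier P ==> G x : carrier P"
  "!!x y. x : carrier P ==> y : carrier P ==> G (x \<boxtimes> y) = G x \<boxtimes> G y"
  "!!i. i : verts Q ==> G (pe (i, [])) = pe (i, [])"
  "!!a. a : arcs Q ==> G (pe (tail Q a, [a])) = A a"
  "!!u as. (u, as) : paths Q ==> as \<noteq> [] ==>
   G (pe (u, as)) = foldr (\<lambda>a y. A a \<boxtimes> y) as \<one>\<^sub>P"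
proof -
 obtain G where G: "lin (carrier P) G" "!!x. x : carrier P ==> G x : T UNIV 0"
  "!!x y. x : carrier P ==> y : carrier P ==> G (x \<boxtimes> y) = G x \<boxtimes> G y"
  "!!i. i : verts Q ==> G (pe (i, [])) = pe (i, [])"
  "!!a. a : arcs Q ==> G (pe (tail Q a, [a])) = A a"
 proof (rule quiver_representation[of UNIV "\<lambda>x y. x \<boxtimes> y" "\<lambda>i. pe (i, [])" A])
  show "lin (T UNIV 0) (\<lambda>u. u \<boxtimes> v)" if "v : T UNIV 0" for v using lin_mult_right[of v] that by simp
  show "lin (T UNIV 0) ((\<boxtimes>) u)" if "u : T UNIV 0" for u using lin_mult_left[of u] that by simp
 qed (simp_all add: A P.m_assoc vertex_mult)
 have fold: "G (pe (u, as)) = foldr (\<lambda>a y. A a \<boxtimes> y) as \<one>\<^sub>P" if "(u, as) : paths Q" "as \<noteq> []" for u as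
  using that
 proof (induction as arbitrary: u)
  case (Cons a as)
  then have a: "a : arcs Q" "tail Q a = u" "(head Q a, as) : paths Q" by (auto simp: paths_Cons)
  show ?case
  proof (cases "as = []")
   case True
   then show ?thesis using G(5)[OF a(1)] a(2) A(1)[OF a(1)] by simp
  next
   case False
   then show ?thesis
    using path_elem_Cons[OF Cons.prems(1)] G(3)[of "pe (tail Q a, [a])" "pe (head Q a, as)"]
     G(5)[OF a(1)] Cons.IH[OF a(3) False] arrow_path[OF a(1)] a(3) by simp
  qed
 qed simp
 have GP: "G x : carrier P" if "x : carrier P" for x using G(2)[OF that] by simp
 show thesis by (rule that[OF G(1) GP G(3,4,5) fold])
qed

end

context coeff_point
begin

abbreviation rl where "rl \<equiv> deformed_rule B \<phi>"

text \<open>The families \<open>\<psi>\<close> over which deformations of the reduction system range, before uniqueness is imposed.\<close>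

definition admissible :: "(('v, 'a) path => ('v, 'a) path => 'b) => bool" where
 "admissible \<psi> \<longleftrightarrow> \<psi> : (\<Pi>\<^sub>E s\<in>S. {x : N. \<forall>p. x p : m \<and> (x p \<noteq> \<zero>\<^bsub>B\<^esub> \<longrightarrow> parallel Q p s)})"

lemma admissibleD:
 assumes "admissible \<psi>" "s : S"
 shows "\<psi> s : N" "\<psi> s p : m" "\<psi> s p \<noteq> \<zero>\<^bsub>B\<^esub> ==> parallel Q p s"
 using PiE_mem[OF assms(1)[unfolded admissible_def] assms(2)] by simp_all

lemma red_deformations_eq: "\<psi> : red_deformations Q S \<phi> (B, m) \<longleftrightarrow> admissible \<psi> \<and>
  (\<forall>n\<ge>1. \<forall>p\<in>paths Q. reduction_unique (B Quot F (Suc n)) Q S (\<lambda>s. trunc B m n (rl \<psi> s)) p)"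
 by (simp add: red_deformations_def admissible_def truncation_eq)

lemma rl_eq: "s : S ==> rl \<psi> s = (emb \<circ> \<phi> s) \<boxplus> \<psi> s"
 by (rule ext) (simp add: deformed_rule_def P_apply)

lemma emb_rule_N: "s : S ==> emb \<circ> \<phi> s : N"
 by (rule emb.f_T[OF k.rule_T])

lemma res_rl:
 assumes "admissible \<psi>" and s: "s : S"
 shows "rs \<circ> rl \<psi> s = \<phi> s"
proof -
 note \<psi> = admissibleD[OF assms]
 have "\<psi> s : T UNIV 1" using \<psi>(2) N_P[OF \<psi>(1)] by (intro T_I) simp_all
 then have "rs \<circ> \<psi> s = \<zero>\<^bsub>k.P\<^esub>" using res_zero_iff[OF N_P[OF \<psi>(1)]] by simp
 then show ?thesis
  unfolding rl_eq[OF s] res.f_P_add[OF N_P[OF emb_rule_N[OF s]] N_P[OF \<psi>(1)]] res_emb[OF k.rule_P[OF s]]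
  using k.rule_P[OF s] by simp
qed

lemma rl_rules:
 assumes \<psi>: "admissible \<psi>"
 shows "rules B m Q S (rl \<psi>)"
proof (intro rules.intro rules_axioms.intro quiver_tips_axioms)
 fix s assume s: "s : S"
 show "rl \<psi> s : N" unfolding rl_eq[OF s] using emb_rule_N[OF s] admissibleD(1)[OF \<psi> s] by (rule T_add)
 fix p assume "rl \<psi> s p \<noteq> \<zero>\<^bsub>B\<^esub>"
 then have "\<phi> s p \<noteq> \<zero>\<^bsub>K\<^esub> \<or> \<psi> s p \<noteq> \<zero>\<^bsub>B\<^esub>" by (auto simp: deformed_rule_def emb_zero)
 then show "parallel Q p s" using k.rule_parallel[OF s] admissibleD(3)[OF \<psi> s] by blast
qed

lemma res_replacement:
 assumes \<psi>: "admissible \<psi>" and oc: "oc : occurrences Q S p"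
 shows "rs \<circ> replacement B Q (rl \<psi>) oc = k.repl oc"
proof -
 interpret R: rules B m Q S "rl \<psi>" by (rule rl_rules[OF \<psi>])
 obtain q s r where qsr: "oc = (q, s, r)" by (metis prod_cases3)
 note o = occurrencesD[OF oc[unfolded qsr]]
 have P: "pe q : carrier P" "rl \<psi> s : carrier P" "pe r : carrier P"
  using o R.rule_P by simp_all
 then show ?thesis
  unfolding qsr R.repl_eq k.repl_eq by (simp add: res.f_P_mult res.f_path_elem res_rl[OF \<psi> o(2)])
qed

text \<open>Modulo \<open>m\<close> the replacements are those over \<open>\<Bbbk>\<close>, so termination is inherited.\<close>

lemma rl_rewriting:
 assumes \<psi>: "admissible \<psi>"
 shows "rewriting B m Q S (rl \<psi>)"
proof (intro rewriting.intro rewriting_axioms.intro rl_rules[OF \<psi>] wf_subset[OF k.terminating] subrelI CollectI case_prodI)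
 interpret R: rules B m Q S "rl \<psi>" by (rule rl_rules[OF \<psi>])
 fix p' p assume "(p', p) : {(p', p). \<exists>oc\<in>occurrences Q S p. replacement B Q (rl \<psi>) oc p' \<notin> m}"
 then obtain oc where oc: "oc : occurrences Q S p" "replacement B Q (rl \<psi>) oc p' \<notin> m" by blast
 have "rs (replacement B Q (rl \<psi>) oc p') \<noteq> \<zero>\<^bsub>K\<^esub>"
  using residue_zero_iff[OF P_coeff[OF R.repl_P[OF oc(1)], of p']] oc(2) by simp
 then have "k.repl oc p' \<notin> {\<zero>\<^bsub>K\<^esub>}" unfolding res_replacement[OF \<psi> oc(1), symmetric] by simp
 then show "\<exists>oc\<in>occurrences Q S p. k.repl oc p' \<notin> {\<zero>\<^bsub>K\<^esub>}" using oc(1) by blast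
qed

text \<open>The deformed rule must replace \<open>s\<close> by its projection along \<open>J\<close>.\<close>

definition rule_of :: "(('v, 'a) path => 'b) set => ('v, 'a) path => ('v, 'a) path => 'b" where
 "rule_of J = restrict (\<lambda>s. proj J (pe s) \<boxminus> (emb \<circ> \<phi> s)) S"

lemma rl_rule_of:
 assumes J: "good J" and s: "s : S"
 shows "rl (rule_of J) s = proj J (pe s)"
proof -
 have P: "proj J (pe s) : carrier P" "emb \<circ> \<phi> s : carrier P"
  using proj_P[OF goodD(1)[OF J]] S_paths s emb_rule_N[OF s] N_P by auto
 then show ?thesis unfolding rl_eq[OF s] rule_of_def using s
  P.minus_add_cancel[OF P] by (simp add: P.a_comm)
qed

text \<open>The projection of \<open>s\<close> is parallel to \<open>s\<close> because \<open>proj J\<close> commutes with multiplication by the vertices.\<close>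

lemma admissible_rule_of:
 assumes J: "good J"
 shows "admissible (rule_of J)"
 unfolding admissible_def rule_of_def
proof (intro PiE_I CollectI conjI allI impI)
 fix s p assume s: "s : S"
 let ?x = "proj J (pe s) \<boxminus> (emb \<circ> \<phi> s)"
 note c = goodD(1)[OF J]
 have sp: "s : paths Q" using s S_paths by auto
 have v: "fst s : verts Q" "target Q s : verts Q" using k.source_in_verts[OF sp] k.target_in_verts[OF sp] by auto
 have sP: "pe s : carrier P" "path_elem K s : carrier k.P" using sp by simp_all
 note p = proj(1)[OF c sP(1)] and e = emb_rule_N[OF s]
 have x: "?x : N" using p e by (rule T_minus)
 then show "restrict (\<lambda>s. proj J (pe s) \<boxminus> (emb \<circ> \<phi> s)) S s : N" using s by simp
 have "path_elem K s \<ominus>\<^bsub>k.P\<^esub> \<phi> s : I" unfolding I_eq_nf_kernel by (rule k.rule_in_nf_kernel[OF k_confluent s])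
 then have "k.proj I (path_elem K s) = \<phi> s" by (rule k.proj_unique[OF I_complement sP(2) k.rule_T[OF s]])
 then have "rs \<circ> proj J (pe s) = rs \<circ> (emb \<circ> \<phi> s)"
  using res_proj[OF J sP(1)] res_emb[OF k.rule_P[OF s]] by (simp add: res.f_path_elem)
 then have "?x : T UNIV 1" using res_eq_iff[OF N_P[OF p] N_P[OF e]] by simp
 then have "?x p : F 1" by (rule T_F)
 then show "restrict (\<lambda>s. proj J (pe s) \<boxminus> (emb \<circ> \<phi> s)) S s p : m" using s by simp
 assume "restrict (\<lambda>s. proj J (pe s) \<boxminus> (emb \<circ> \<phi> s)) S s p \<noteq> \<zero>\<^bsub>B\<^esub>"
 then have "proj J (pe s) p \<ominus>\<^bsub>B\<^esub> emb (\<phi> s p) \<noteq> \<zero>\<^bsub>B\<^esub>"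
  using s N_P[OF p] N_P[OF e] by (simp add: P_minus_apply)
 then have or: "proj J (pe s) p \<noteq> \<zero>\<^bsub>B\<^esub> \<or> \<phi> s p \<noteq> \<zero>\<^bsub>K\<^esub>"
  by (auto simp: emb_zero a_minus_def)
 have l: "pe (fst s, []) \<boxtimes> proj J (pe s) = proj J (pe s)"
  using proj_idempotent(1)[OF c sP(1) v(1)] source_mult[OF sp] by simp
 have r: "proj J (pe s) \<boxtimes> pe (target Q s, []) = proj J (pe s)"
  using proj_idempotent(2)[OF c sP(1) v(2)] target_mult[OF sp] by simp
 have "source p = fst s \<and> target Q p = target Q s" if "proj J (pe s) p \<noteq> \<zero>\<^bsub>B\<^esub>"
  using idempotent_left_apply[OF N_P[OF p] v(1), of p] idempotent_right_apply[OF N_P[OF p] v(2), of p] that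
  unfolding l r by (auto split: if_splits)
 then show "parallel Q p s" using or k.rule_parallel[OF s, of p] by (auto simp: parallel_def source_def)
qed auto

lemma rule_of:
 assumes J: "good J"
 shows "rule_of J : red_deformations Q S \<phi> (B, m)"
  "x : carrier P ==> red_inf Q S \<phi> (B, m) (rule_of J) x = proj J x"
proof -
 interpret R: rewriting B m Q S "rl (rule_of J)" by (rule rl_rewriting[OF admissible_rule_of[OF J]])
 note c = goodD(1)[OF J]
 have rel: "pe s \<boxminus> rl (rule_of J) s : J" if "s : S" for s
  unfolding rl_rule_of[OF J that] using proj(2)[OF c] S_paths that by auto
 show "rule_of J : red_deformations Q S \<phi> (B, m)"
  unfolding red_deformations_eq
  by (intro conjI allI impI ballI admissible_rule_of[OF J] R.reduction_unique_if_complement[OF c rel])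
 show "red_inf Q S \<phi> (B, m) (rule_of J) x = proj J x" if x: "x : carrier P"
  using R.limit_of_rightmost_reductions[OF x] R.proj_eq_nf[OF c rel x]
  unfolding red_inf_def truncation_eq prod.case completed_Irr_simps(1) by simp
qed

text \<open>The kernel of the normal form map is a good ideal, as forming normal forms commutes with reduction
modulo \<open>m\<close>.\<close>

lemma red_deformation_cases:
 assumes \<psi>: "\<psi> : red_deformations Q S \<phi> (B, m)"
 obtains J where "good J" "\<psi> = rule_of J"
proof -
 have a: "admissible \<psi>" using \<psi> by (simp add: red_deformations_eq)
 interpret R: rewriting B m Q S "rl \<psi>" by (rule rl_rewriting[OF a])
 have conf: R.confluent
  using \<psi> by (intro R.confluent_if_reduction_unique) (simp add: red_deformations_eq)
 note J = R.confluent_complement[OF conf]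
 have rho: "rs \<circ> R.rho x = k.rho (rs \<circ> x)" if "x : carrier P" for x
 proof (rule res.semilinear_eq[of UNIV])
  show "semilinear rs B P k.P (T UNIV 0) (\<lambda>x. rs \<circ> R.rho x)"
   using semilinearD[OF R.rho_lin] by (intro semilinearI) (simp_all add: res.f_P_add res.f_P_smult)
  show "semilinear rs B P k.P (T UNIV 0) (\<lambda>x. k.rho (rs \<circ> x))"
   using semilinearD[OF k.rho_lin] by (intro semilinearI) (simp_all add: res.f_P_add res.f_P_smult)
  fix p assume p: "p : paths Q"
  show "rs \<circ> R.rho (pe p) = k.rho (rs \<circ> pe p)"
   unfolding res.f_path_elem
   using R.rho_path[OF p] k.rho_path[OF p] res_replacement[OF a rightmost_occurrence[OF p]]
   by (cases "p : Ir") (simp_all add: R.rho_Irr_path k.rho_Irr_path res.f_path_elem)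
 qed (use that in simp)
 have pow: "rs \<circ> (R.rho ^^ j) x = (k.rho ^^ j) (rs \<circ> x)" if "x : carrier P" for x j
 proof (induction j)
  case (Suc j)
  have "rs \<circ> R.rho ((R.rho ^^ j) x) = k.rho ((k.rho ^^ j) (rs \<circ> x))"
   unfolding rho[OF R.rho_pow_P[OF that]] Suc ..
  then show ?case by (simp only: funpow.simps(2) comp_def)
 qed simp
 have res_nf: "rs \<circ> R.nf x = k.nf (rs \<circ> x)" if x: "x : carrier P" for x
 proof -
  obtain j where j: "(R.rho ^^ j) x \<boxminus> R.nf x : T UNIV 1"
   using R.nf[OF x] unfolding R.is_normal_form_def by blast
  have eq: "rs \<circ> R.nf x = (k.rho ^^ j) (rs \<circ> x)"
   unfolding pow[OF x, symmetric] using iffD2[OF res_eq_iff[OF R.rho_pow_P[OF x] R.nf_P[OF x]] j] by (rule sym)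
  have "k.nf ((k.rho ^^ j) (rs \<circ> x)) = k.nf (rs \<circ> x)"
   using k.nf_rho k.rho_pow_P[OF res.f_P[OF x]] by (induction j) simp_all
  then show ?thesis using k.nf_Irr[OF res.f_T[OF R.nf_T[OF x]]] eq by simp
 qed
 have good: "good R.nf_kernel"
 proof (rule goodI[OF J(1)])
  fix p assume p: "p : paths Q"
  then have P: "pe p : carrier P" "path_elem K p : carrier k.P" by simp_all
  show "rs \<circ> proj R.nf_kernel (pe p) = k.proj I (path_elem K p)"
   unfolding J(2)[OF P(1)] res_nf[OF P(1)] proj_I[OF P(2)] res.f_path_elem ..
 qed
 have "\<psi> = rule_of R.nf_kernel"
 proof (rule extensionalityI[of _ S])
  show "\<psi> : extensional S" using a by (auto simp: admissible_def PiE_def)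
  show "rule_of R.nf_kernel : extensional S" by (simp add: rule_of_def)
  fix s assume s: "s : S"
  have P: "\<psi> s : carrier P" "emb \<circ> \<phi> s : carrier P" "pe s : carrier P"
   using admissibleD(1)[OF a s] emb_rule_N[OF s] N_P S_paths s by auto
  have "proj R.nf_kernel (pe s) = rl \<psi> s"
   by (rule proj_unique[OF J(1) P(3) R.rule_T[OF s] R.rule_in_nf_kernel[OF conf s]])
  then show "\<psi> s = rule_of R.nf_kernel s"
   using P.add_minus_cancel[OF P(2,1)] s by (simp add: rule_of_def rl_eq)
 qed
 then show thesis using good by (rule that[rotated])
qed

text \<open>For a complement the last condition in the definition of equivalence says that \<open>L\<close> is
 multiplicative.\<close>

lemma red_equiv_iff_gauge:
 assumes J: "good J" and J': "good J'"
 shows "(rule_of J, rule_of J') : red_equiv K Q S \<phi> (B, m) \<longleftrightarrow> gauge (nprod J) (nprod J')"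
proof
 note c = goodD(1)[OF J] and c' = goodD(1)[OF J']
 let ?e = "\<lambda>i. pe (i, [])" and ?A = "\<lambda>a. pe (tail Q a, [a])"
 assume "(rule_of J, rule_of J') : red_equiv K Q S \<phi> (B, m)"
 then obtain L where L: "L : module_iso B (completed_Irr B m Q S) (completed_Irr B m Q S)"
  and bim: "\<forall>i\<in>verts Q. \<forall>x\<in>N. L (?e i \<boxtimes> x) = ?e i \<boxtimes> L x \<and> L (x \<boxtimes> ?e i) = L x \<boxtimes> ?e i"
  and res: "\<forall>x\<in>N. rs \<circ> L x = rs \<circ> x" and Le: "\<forall>i\<in>verts Q. L (?e i) = ?e i"
  and Lp: "\<forall>(u, as)\<in>paths Q. as \<noteq> [] \<longrightarrow> L (red_inf Q S \<phi> (B, m) (rule_of J') (pe (u, as))) =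
   red_inf Q S \<phi> (B, m) (rule_of J) (foldr (\<lambda>a y. L (?A a) \<boxtimes> y) as \<one>\<^sub>P)"
  unfolding red_equiv_def Let_def prod.case completed_Irr_simps(1) by (elim CollectE case_prodE conjE bexE Pair_inject) simp
 note LN = module_iso_lin[OF L]
 have near: "near L"
 proof (rule nearI[OF LN])
  show "L u \<boxminus> u : T UNIV 1" if "u : N" for u
   using res_eq_iff[OF N_P[OF LN(2)[OF that]] N_P[OF that]] res that by simp
 qed
 have bim1: "L (?e i \<boxtimes> x) = ?e i \<boxtimes> L x" "L (x \<boxtimes> ?e i) = L x \<boxtimes> ?e i" if "i : verts Q" "x : N" for i x
  using bim that by simp_all
 have LA: "L (?A a) : carrier P" "?e (tail Q a) \<boxtimes> L (?A a) = L (?A a)" "L (?A a) \<boxtimes> ?e (head Q a) = L (?A a)"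
  if a: "a : arcs Q" for a
  using bim1(1)[OF k.tail_in_verts[OF a] arrow_N[OF a]] bim1(2)[OF k.head_in_verts[OF a] arrow_N[OF a]]
   source_mult[OF arrow_path[OF a]] target_mult[OF arrow_path[OF a]] N_P[OF LN(2)[OF arrow_N[OF a]]] by simp_all
 obtain G where G: "lin (carrier P) G" "!!x. x : carrier P ==> G x : carrier P"
  "!!x y. x : carrier P ==> y : carrier P ==> G (x \<boxtimes> y) = G x \<boxtimes> G y"
  "!!i. i : verts Q ==> G (?e i) = ?e i" "!!a. a : arcs Q ==> G (?A a) = L (?A a)"
  "!!u as. (u, as) : paths Q ==> as \<noteq> [] ==> G (pe (u, as)) = foldr (\<lambda>a y. L (?A a) \<boxtimes> y) as \<one>\<^sub>P"
  by (rule arrow_extension[of "\<lambda>a. L (?A a)", OF LA], assumption+, rule that)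
 have LG: "L (proj J' x) = proj J (G x)" if x: "x : carrier P" for x
 proof (rule lin_eq[where X = UNIV and g = "\<lambda>x. L (proj J' x)" and h = "\<lambda>x. proj J (G x)"])
  show "lin (T UNIV 0) (\<lambda>x. L (proj J' x))" using lin_comp[OF proj_lin[OF c'] proj(1)[OF c'] LN(1)] by simp
  show "lin (T UNIV 0) (\<lambda>x. proj J (G x))" using lin_comp[OF G(1,2) proj_lin[OF c]] by simp
  fix p assume p: "p : paths Q"
  obtain u as where ua: "p = (u, as)" by (cases p)
  have pP: "pe p : carrier P" using p by simp
  show "L (proj J' (pe p)) = proj J (G (pe p))"
  proof (cases "as = []")
   case True
   then have u: "u : verts Q" using p ua by simp
   then show ?thesis using True ua Le G(4)[OF u] proj_Irr[OF c vertex_N[OF u]] proj_Irr[OF c' vertex_N[OF u]] by simp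
  next
   case False
   have "L (red_inf Q S \<phi> (B, m) (rule_of J') (pe (u, as))) = red_inf Q S \<phi> (B, m) (rule_of J) (G (pe (u, as)))"
    using bspec[OF Lp p] False G(6)[of u as] p ua by simp
   then show ?thesis using rule_of(2)[OF J' pP] rule_of(2)[OF J G(2)[OF pP]] ua by simp
  qed
 qed (use x in simp)
 have "gauge (nprod J') (nprod J)"
 proof (rule gaugeI[OF near])
  fix u v assume uv: "u : N" "v : N"
  note P = N_P[OF uv(1)] N_P[OF uv(2)]
  have Lu: "L w = proj J (G w)" if "w : N" for w using LG[OF N_P[OF that]] proj_Irr[OF c' that] by simp
  show "L (nprod J' u v) = nprod J (L u) (L v)"
   unfolding nprod_def Lu[OF uv(1)] Lu[OF uv(2)]
   using LG[of "u \<boxtimes> v"] G(3)[OF P] P G(2)[OF P(1)] G(2)[OF P(2)] proj_P[OF c G(2)[OF P(2)]]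
    proj_mult(1)[OF c G(2)[OF P(1)] proj_P[OF c G(2)[OF P(2)]]] proj_mult(2)[OF c G(2)[OF P(1)] G(2)[OF P(2)]] by simp
 qed
 then show "gauge (nprod J) (nprod J')" by (rule gauge_sym[OF bilin_nprod[OF c']])
next
 note c = goodD(1)[OF J] and c' = goodD(1)[OF J']
 let ?e = "\<lambda>i. pe (i, [])" and ?A = "\<lambda>a. pe (tail Q a, [a])"
 assume "gauge (nprod J) (nprod J')"
 then have g: "gauge (nprod J') (nprod J)" by (rule gauge_sym[OF bilin_nprod[OF c]])
 obtain L where L: "near L" "!!u v. u : N ==> v : N ==> L (nprod J' u v) = nprod J (L u) (L v)"
  "!!i. i : verts Q ==> L (?e i) = ?e i"
  by (rule gauge_fixing_vertices[OF c c' g], rule that)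
 note LN = nearD(2)[OF L(1)]
 have bim: "L (?e i \<boxtimes> x) = ?e i \<boxtimes> L x" "L (x \<boxtimes> ?e i) = L x \<boxtimes> ?e i" if i: "i : verts Q" and x: "x : N" for i x
  using L(2)[OF vertex_N[OF i] x] L(2)[OF x vertex_N[OF i]] L(3)[OF i]
   proj_Irr[OF c' idempotent_N(1)[OF x i]] proj_Irr[OF c' idempotent_N(2)[OF x i]]
   proj_Irr[OF c idempotent_N(1)[OF LN[OF x] i]] proj_Irr[OF c idempotent_N(2)[OF LN[OF x] i]]
  by (simp_all add: nprod_def)
 have LA: "L (?A a) : carrier P" "?e (tail Q a) \<boxtimes> L (?A a) = L (?A a)" "L (?A a) \<boxtimes> ?e (head Q a) = L (?A a)"
  if a: "a : arcs Q" for a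
  using bim(1)[OF k.tail_in_verts[OF a] arrow_N[OF a]] bim(2)[OF k.head_in_verts[OF a] arrow_N[OF a]]
   source_mult[OF arrow_path[OF a]] target_mult[OF arrow_path[OF a]] N_P[OF LN[OF arrow_N[OF a]]] by simp_all
 obtain G where G: "lin (carrier P) G" "!!x. x : carrier P ==> G x : carrier P"
  "!!x y. x : carrier P ==> y : carrier P ==> G (x \<boxtimes> y) = G x \<boxtimes> G y"
  "!!i. i : verts Q ==> G (?e i) = ?e i" "!!a. a : arcs Q ==> G (?A a) = L (?A a)"
  "!!u as. (u, as) : paths Q ==> as \<noteq> [] ==> G (pe (u, as)) = foldr (\<lambda>a y. L (?A a) \<boxtimes> y) as \<one>\<^sub>P"
  by (rule arrow_extension[of "\<lambda>a. L (?A a)", OF LA], assumption+, rule that)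
 have LG: "L (proj J' (pe (u, as))) = proj J (G (pe (u, as)))" if "(u, as) : paths Q" for u as
  using that
 proof (induction as arbitrary: u)
  case Nil
  then have u: "u : verts Q" by simp
  then show ?case using L(3)[OF u] G(4)[OF u] proj_Irr[OF c vertex_N[OF u]] proj_Irr[OF c' vertex_N[OF u]] by simp
 next
  case (Cons a as)
  then have a: "a : arcs Q" "(head Q a, as) : paths Q" by (auto simp: k.paths_Cons)
  let ?q = "pe (head Q a, as)"
  have P: "?A a : carrier P" "?q : carrier P" using arrow_path[OF a(1)] a(2) by simp_all
  have "L (proj J' (?A a \<boxtimes> ?q)) = L (nprod J' (?A a) (proj J' ?q))"
   unfolding nprod_def using proj_mult(2)[OF c' P] by simp
  also have "\<dots> = proj J (L (?A a) \<boxtimes> proj J (G ?q))"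
   using L(2)[OF arrow_N[OF a(1)] proj(1)[OF c' P(2)]] Cons.IH[OF a(2)] by (simp add: nprod_def)
  also have "\<dots> = proj J (G (?A a \<boxtimes> ?q))"
   using proj_mult(2)[OF c LA(1)[OF a(1)] G(2)[OF P(2)]] G(3)[OF P] G(5)[OF a(1)] by simp
  finally show ?case using path_elem_Cons[OF Cons.prems] by simp
 qed
 have Lp: "L (red_inf Q S \<phi> (B, m) (rule_of J') (pe (u, as))) =
   red_inf Q S \<phi> (B, m) (rule_of J) (foldr (\<lambda>a y. L (?A a) \<boxtimes> y) as \<one>\<^sub>P)"
  if p: "(u, as) : paths Q" "as \<noteq> []" for u as
 proof -
  have pP: "pe (u, as) : carrier P" using p by simp
  show ?thesis unfolding G(6)[OF p, symmetric] rule_of(2)[OF J' pP] rule_of(2)[OF J G(2)[OF pP]] by (rule LG[OF p(1)])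
 qed
 have res: "rs \<circ> L x = rs \<circ> x" if "x : N" for x
  using res_eq_iff[OF N_P[OF LN[OF that]] N_P[OF that]] T_UNIV[OF nearD(3)[OF L(1) that]] by simp
 show "(rule_of J, rule_of J') : red_equiv K Q S \<phi> (B, m)"
  unfolding red_equiv_def Let_def prod.case completed_Irr_simps(1)
  by (rule CollectI, rule case_prodI, intro conjI bexI[where x = L] ballI rule_of(1)[OF J] rule_of(1)[OF J'] near_module_iso[OF L(1)])
   (use bim res L(3) Lp in \<open>auto simp del: foldr.simps\<close>)
qed

end

section \<open>Lifting idempotents\<close>

text \<open>The Newton step for the equation \<open>x\<^sup>2 = x\<close>: with \<open>d = x\<^sup>2 - x\<close> and \<open>h = d - 2 x d\<close> one has
 \<open>(x + h)\<^sup>2 - (x + h) = h\<^sup>2 - 4 d\<^sup>2\<close>. No unit is required.\<close>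

lemma (in ring) newton_step_sum:
 assumes "x : carrier R" "d : carrier R" "w : carrier R" "q : carrier R" "hh : carrier R"
  and xh: "xh = w \<ominus> ((w \<oplus> q) \<oplus> (w \<oplus> q))"
 shows "((x \<oplus> d) \<oplus> xh) \<oplus> (xh \<oplus> hh) \<ominus> (x \<oplus> (d \<ominus> (w \<oplus> w))) = hh \<ominus> ((q \<oplus> q) \<oplus> (q \<oplus> q))"
 unfolding xh using assms(1-5) by algebra

text \<open>An associative product on \<open>N\<close>, possibly without a unit.\<close>

locale assoc_product = quiver_tips B m Q S
 for B (structure) and m and Q :: "('v, 'w) pre_digraph" and S +
 fixes mul :: "(('v, 'w) path => 'a) => (('v, 'w) path => 'a) => ('v, 'w) path => 'a" (infixl "\<star>" 72)
 assumes mul_bilin: "bilin mul"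
  and mul_assoc: "u : N ==> v : N ==> w : N ==> (u \<star> v) \<star> w = u \<star> (v \<star> w)"
begin

lemmas mul_N [simp] = bilinD(1)[OF mul_bilin]

lemma mul_add: "u : N ==> v : N ==> w : N ==> (u \<boxplus> v) \<star> w = u \<star> w \<boxplus> v \<star> w"
 "u : N ==> v : N ==> w : N ==> w \<star> (u \<boxplus> v) = w \<star> u \<boxplus> w \<star> v"
 by (rule semilinearD(2)[OF bilinD(2)[OF mul_bilin]] semilinearD(2)[OF bilinD(3)[OF mul_bilin]]; assumption)+

lemma mul_minus: "u : N ==> v : N ==> w : N ==> (u \<boxminus> v) \<star> w = u \<star> w \<boxminus> v \<star> w"
 "u : N ==> v : N ==> w : N ==> w \<star> (u \<boxminus> v) = w \<star> u \<boxminus> w \<star> v"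
 by (rule lin_minus[OF bilinD(2)[OF mul_bilin]] lin_minus[OF bilinD(3)[OF mul_bilin]]; assumption)+

lemma mul_zero: "u : N ==> u \<star> \<zero>\<^sub>P = \<zero>\<^sub>P" "u : N ==> \<zero>\<^sub>P \<star> u = \<zero>\<^sub>P"
 by (rule lin_zero[OF bilinD(3)[OF mul_bilin]] lin_zero[OF bilinD(2)[OF mul_bilin]]; assumption)+

lemma N_T: "u : T Ir n ==> u : N"
 using T_mono[of Ir Ir 0 n u] by simp

lemma mul_T:
 assumes u: "u : T Ir n" and v: "v : T Ir j"
 shows "u \<star> v : T Ir (n + j)"
proof -
 have uN: "u : N" using u by (rule N_T)
 have "u \<star> w : T Ir n" if "w : N" for w
  using lin_T[OF bilinD(2)[OF mul_bilin that] bilinD(1)[OF mul_bilin _ that] u] by simp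
 from lin_T[OF bilinD(3)[OF mul_bilin uN] this v] show ?thesis by (simp add: add.commute)
qed

definition newton where
 "newton x = x \<boxplus> ((x \<star> x \<boxminus> x) \<boxminus> (x \<star> (x \<star> x \<boxminus> x) \<boxplus> x \<star> (x \<star> x \<boxminus> x)))"

lemma newton_N: "x : N ==> newton x : N"
 unfolding newton_def by (intro T_add T_minus mul_N)

lemma newton_zero:
 assumes x: "x : N" and z: "z : N"
 shows "z \<star> x = \<zero>\<^sub>P ==> z \<star> newton x = \<zero>\<^sub>P" "x \<star> z = \<zero>\<^sub>P ==> newton x \<star> z = \<zero>\<^sub>P"
proof -
 let ?d = "x \<star> x \<boxminus> x"
 note xx = mul_N[OF x x]
 note d = T_minus[OF xx x]
 note xd = mul_N[OF x d]
 note N = xx d xd T_add[OF xd xd] T_minus[OF d T_add[OF xd xd]]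
 have 0: "\<zero>\<^sub>P \<boxminus> \<zero>\<^sub>P = \<zero>\<^sub>P" by (simp add: a_minus_def)
 show "z \<star> newton x = \<zero>\<^sub>P" if a: "z \<star> x = \<zero>\<^sub>P"
 proof -
  have "z \<star> (x \<star> y) = \<zero>\<^sub>P" if "y : N" for y using mul_assoc[OF z x that] mul_zero(2)[OF that] a by simp
  then show ?thesis unfolding newton_def using N x z a by (simp add: mul_add mul_minus 0)
 qed
 show "newton x \<star> z = \<zero>\<^sub>P" if a: "x \<star> z = \<zero>\<^sub>P"
 proof -
  have *: "(x \<star> x) \<star> z = \<zero>\<^sub>P" using mul_assoc[OF x x z] a mul_zero(1)[OF x] by simp
  then have d: "?d \<star> z = \<zero>\<^sub>P" using N x z a by (simp add: mul_minus 0)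
  then have "(x \<star> ?d) \<star> z = \<zero>\<^sub>P" using mul_assoc[OF x N(2) z] mul_zero(1)[OF x] by simp
  then show ?thesis unfolding newton_def mul_add(1)[OF x N(5) z] mul_minus(1)[OF N(2,4) z] mul_add(1)[OF N(3,3) z]
   using d a by (simp add: 0)
 qed
qed

lemma newton_T:
 assumes x: "x : N" and d: "x \<star> x \<boxminus> x : T Ir (Suc n)"
 shows "newton x \<boxminus> x : T Ir (Suc n)" "newton x \<star> newton x \<boxminus> newton x : T Ir (Suc (Suc n))"
proof -
 define d where "d = x \<star> x \<boxminus> x"
 define w where "w = x \<star> d"
 define h where "h = d \<boxminus> (w \<boxplus> w)"
 have new: "newton x = x \<boxplus> h" by (simp add: newton_def h_def w_def d_def)
 have dT: "d : T Ir (Suc n)" using d by (simp add: d_def)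
 have wT: "w : T Ir (Suc n)" unfolding w_def using mul_T[OF x dT] by simp
 have hT: "h : T Ir (Suc n)" unfolding h_def using dT wT by (intro T_minus T_add)
 note N = N_T[OF dT] N_T[OF wT] N_T[OF hT]
 note P = N_P[OF x] N_P[OF N(1)] N_P[OF N(2)] N_P[OF N(3)]
 show "newton x \<boxminus> x : T Ir (Suc n)" unfolding new P.add_minus_cancel[OF P(1,4)] by (rule hT)
 have xx: "x \<star> x = x \<boxplus> d"
  using P.minus_add_cancel[OF N_P[OF mul_N[OF x x]] P(1)] P by (simp add: d_def P.a_comm N_P[OF mul_N[OF x x]])
 have dx: "d \<star> x = w" unfolding w_def d_def using x by (simp add: mul_minus mul_assoc)
 have xw: "x \<star> w = w \<boxplus> d \<star> d"
  unfolding w_def mul_assoc[OF x x N(1), symmetric] xx mul_add(1)[OF x N(1,1)] ..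
 have wx: "w \<star> x = x \<star> w" unfolding w_def mul_assoc[OF x N(1) x] dx unfolding w_def ..
 have xh: "x \<star> h = w \<boxminus> ((w \<boxplus> d \<star> d) \<boxplus> (w \<boxplus> d \<star> d))"
  unfolding h_def mul_minus(2)[OF N(1) T_add[OF N(2,2)] x] mul_add(2)[OF N(2,2) x] xw w_def[symmetric] ..
 have hx: "h \<star> x = x \<star> h"
  unfolding h_def mul_minus(2)[OF N(1) T_add[OF N(2,2)] x] mul_add(2)[OF N(2,2) x]
   mul_minus(1)[OF N(1) T_add[OF N(2,2)] x] mul_add(1)[OF N(2,2) x] wx dx w_def[symmetric] ..
 have "newton x \<star> newton x = ((x \<boxplus> d) \<boxplus> x \<star> h) \<boxplus> (x \<star> h \<boxplus> h \<star> h)"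
  unfolding new mul_add(1)[OF x N(3) T_add[OF x N(3)]] mul_add(2)[OF x N(3) x] mul_add(2)[OF x N(3) N(3)] hx xx ..
 then have "newton x \<star> newton x \<boxminus> newton x =
   h \<star> h \<boxminus> ((d \<star> d \<boxplus> d \<star> d) \<boxplus> (d \<star> d \<boxplus> d \<star> d))"
  unfolding new h_def[symmetric]
  using P.newton_step_sum[OF P(1,2,3) N_P[OF mul_N[OF N(1,1)]] N_P[OF mul_N[OF N(3,3)]] xh] by (simp add: h_def)
 moreover have "y : T Ir (Suc (Suc n))" if "y : T Ir (Suc n + Suc n)" for y
  by (rule T_mono[OF subset_refl _ that]) simp
 note T2 = this[OF mul_T[OF dT dT]] this[OF mul_T[OF hT hT]]
 ultimately show "newton x \<star> newton x \<boxminus> newton x : T Ir (Suc (Suc n))"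
  using T2 by (simp add: T_minus T_add)
qed

text \<open>The error \<open>x\<^sup>2 - x\<close> gains at least one power of \<open>m\<close> in every Newton step. Each step is a polynomial in \<open>x\<close>
without constant term, so elements annihilated by \<open>x\<close> are annihilated by the limit.\<close>

lemma lift_idempotent:
 assumes x: "x : N" and d: "x \<star> x \<boxminus> x : T UNIV 1"
 obtains e where "e : N" "e \<star> e = e" "e \<boxminus> x : T UNIV 1"
  "!!z. z : N ==> z \<star> x = \<zero>\<^sub>P ==> z \<star> e = \<zero>\<^sub>P" "!!z. z : N ==> x \<star> z = \<zero>\<^sub>P ==> e \<star> z = \<zero>\<^sub>P"
proof -
 define s where "s n = (newton ^^ n) x" for n
 have s0: "s 0 = x" and sS: "s (Suc n) = newton (s n)" for n by (simp_all add: s_def)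
 have s: "s n : N \<and> s n \<star> s n \<boxminus> s n : T Ir (Suc n)" for n
 proof (induction n)
  case 0
  show ?case using x T_inter[OF T_minus[OF mul_N[OF x x] x] d] by (simp add: s0)
 next
  case (Suc n)
  then show ?case unfolding sS using newton_N newton_T(2) by blast
 qed
 then have sN: "s n : N" and sd: "s n \<star> s n \<boxminus> s n : T Ir (Suc n)" for n by simp_all
 have step: "s (Suc n) \<boxminus> s n : T Ir (Suc n)" for n unfolding sS by (rule newton_T(1)[OF sN sd])
 have step': "s (Suc n) \<boxminus> s n : T Ir n" for n by (rule T_mono[OF subset_refl _ step]) simp
 obtain e where e: "e : N" "!!n. e \<boxminus> s n : T Ir n"
  by (rule T_limit[of s, OF sN step'], rule that)
 have ann: "z \<star> s n = \<zero>\<^sub>P" if "z : N" "z \<star> x = \<zero>\<^sub>P" for z n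
  by (induction n) (simp_all add: s0 sS that newton_zero(1)[OF sN])
 have ann': "s n \<star> z = \<zero>\<^sub>P" if "z : N" "x \<star> z = \<zero>\<^sub>P" for z n
  by (induction n) (simp_all add: s0 sS that newton_zero(2)[OF sN])
 have eP: "e : carrier P" and sP: "s n : carrier P" for n using e(1) sN N_P by blast+
 show thesis
 proof (rule that[OF e(1)])
  show "e \<star> e = e"
  proof (rule P_eqI[OF N_P[OF mul_N[OF e(1,1)]] eP])
   fix n
   have 1: "e \<star> e \<boxminus> s n \<star> s n : T UNIV n"
    by (rule bilin_cong[OF mul_bilin e(1) sN e(1) sN T_UNIV[OF e(2)] T_UNIV[OF e(2)]])
   have 2: "s n \<star> s n \<boxminus> s n : T UNIV n" by (rule T_mono[OF subset_UNIV _ sd]) simp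
   have 3: "s n \<boxminus> e : T UNIV n"
    using T_uminus[OF T_UNIV[OF e(2)[of n]]] eP sP[of n] by (simp add: a_minus_def P.minus_add P.a_comm)
   show "e \<star> e \<boxminus> e : T UNIV n"
    using T_add[OF T_add[OF 1 2] 3] P.minus_telescope[OF N_P[OF mul_N[OF e(1,1)]] N_P[OF mul_N[OF sN sN]] sP[of n]]
     P.minus_telescope[OF N_P[OF mul_N[OF e(1,1)]] sP[of n] eP] by simp
  qed
  have "(e \<boxminus> s 1) \<boxplus> (s 1 \<boxminus> s 0) : T Ir 1" using e(2)[of 1] step[of 0] by (intro T_add) simp_all
  then show "e \<boxminus> x : T UNIV 1" using P.minus_telescope[OF eP sP[of 1] sP[of 0]] T_UNIV by (simp add: s0)
  show "z \<star> e = \<zero>\<^sub>P" if z: "z : N" "z \<star> x = \<zero>\<^sub>P" for z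
  proof (rule P_separated[OF N_P[OF mul_N[OF z(1) e(1)]]])
   show "z \<star> e : T UNIV n" for n
    using mul_T[OF z(1) e(2)[of n]] mul_minus(2)[OF e(1) sN[of n] z(1)] ann[OF z, of n] N_P[OF mul_N[OF z(1) e(1)]] T_UNIV
    by (simp add: a_minus_def)
  qed
  show "e \<star> z = \<zero>\<^sub>P" if z: "z : N" "x \<star> z = \<zero>\<^sub>P" for z
  proof (rule P_separated[OF N_P[OF mul_N[OF e(1) z(1)]]])
   show "e \<star> z : T UNIV n" for n
    using mul_T[OF e(2)[of n] z(1)] mul_minus(1)[OF e(1) sN[of n] z(1)] ann'[OF z, of n] N_P[OF mul_N[OF e(1) z(1)]] T_UNIV
    by (simp add: a_minus_def)
  qed
 qed
qed

lemma cong_trans: "x : N ==> y : N ==> z : N ==> x \<boxminus> y : T UNIV n ==> y \<boxminus> z : T UNIV n ==>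
  x \<boxminus> z : T UNIV n"
 using P.minus_telescope[OF N_P N_P N_P, of x y z] T_add[of "x \<boxminus> y" UNIV n "y \<boxminus> z"] by simp

text \<open>Idempotents for the vertices are lifted one after the other, the next one in the corner cut out by
 the sum \<open>e\<close> of those already found.\<close>

lemma orthogonal_idempotents:
 assumes "finite V" and fN: "!!i. i : V ==> f i : N"
  and ff: "!!i j. i : V ==> j : V ==> f i \<star> f j \<boxminus> (if i = j then f i else \<zero>\<^sub>P) : T UNIV 1"
 shows "\<exists>E. \<forall>i\<in>V. E i : N \<and> E i \<boxminus> f i : T UNIV 1 \<and> (\<forall>j\<in>V. E i \<star> E j = (if i = j then E i else \<zero>\<^sub>P))"
proof -
 have "\<exists>E e. e : N \<and> e \<star> e = e \<and> (\<forall>i\<in>U. E i : N \<and> E i \<boxminus> f i : T UNIV 1 \<and> e \<star> E i = E i \<and> E i \<star> e = E i \<and>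
   (\<forall>j\<in>U. E i \<star> E j = (if i = j then E i else \<zero>\<^sub>P))) \<and> (\<forall>j\<in>V - U. e \<star> f j : T UNIV 1 \<and> f j \<star> e : T UNIV 1)"
  if "finite U" "U \<subseteq> V" for U
  using that
 proof (induction U rule: finite_induct)
  case empty
  show ?case by (intro exI[of _ f] exI[of _ "\<zero>\<^sub>P"]) (simp add: mul_zero fN)
 next
  case (insert v U)
  then have "U \<subseteq> V" by simp
  from insert.IH[OF this] obtain E e where e: "e : N" "e \<star> e = e" and E: "\<forall>i\<in>U. E i : N \<and> E i \<boxminus> f i : T UNIV 1 \<and>
    e \<star> E i = E i \<and> E i \<star> e = E i \<and> (\<forall>j\<in>U. E i \<star> E j = (if i = j then E i else \<zero>\<^sub>P))"
   and ef: "\<forall>j\<in>V - U. e \<star> f j : T UNIV 1 \<and> f j \<star> e : T UNIV 1" by (elim exE conjE) (rule that)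
  have v: "v : V" "v \<notin> U" "f v : N" using insert fN by auto
  have EU: "E i : N" "E i \<boxminus> f i : T UNIV 1" "e \<star> E i = E i" "E i \<star> e = E i" if "i : U" for i
   using E that by simp_all
  \<comment> \<open>\<open>?x = (1 - e) (f v) (1 - e)\<close>, written without a unit.\<close>
  let ?ef = "e \<star> f v" let ?g = "f v \<boxminus> ?ef" let ?x = "?g \<boxminus> ?g \<star> e"
  note efN = mul_N[OF e(1) v(3)]
  note gN = T_minus[OF v(3) efN]
  note N = efN gN mul_N[OF gN e(1)] T_minus[OF gN mul_N[OF gN e(1)]]
  have eg: "e \<star> ?g = \<zero>\<^sub>P"
   using mul_minus(2)[OF v(3) N(1) e(1)] mul_assoc[OF e(1,1) v(3)] e(2) N_P[OF N(1)] by (simp add: a_minus_def P.r_neg)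
  have ege: "e \<star> (?g \<star> e) = \<zero>\<^sub>P"
   using mul_assoc[OF e(1) N(2) e(1)] unfolding eg mul_zero(2)[OF e(1)] by (rule sym)
  have ex: "e \<star> ?x = \<zero>\<^sub>P" unfolding mul_minus(2)[OF N(2,3) e(1)] eg ege by (simp add: a_minus_def)
  have xe: "?x \<star> e = \<zero>\<^sub>P"
   unfolding mul_minus(1)[OF N(2,3) e(1)] mul_assoc[OF N(2) e(1,1)] e(2) using N_P[OF N(3)] by simp
  have efv: "?ef : T Ir 1" "f v \<star> e : T Ir 1" using ef v(1,2) N(1) mul_N[OF v(3) e(1)] by (auto intro: T_inter)
  have "(?ef) \<star> e : T Ir 1" using mul_T[OF efv(1) e(1)] by simp
  then have ge: "?g \<star> e : T Ir 1" using mul_minus(1)[OF v(3) N(1) e(1)] efv(2) by (simp add: T_minus)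
  have "?x \<boxminus> ?g = \<boxminus> (?g \<star> e)" "?g \<boxminus> f v = \<boxminus> ?ef"
   using P.add_minus_cancel[OF N_P[OF N(2)] P.a_inv_closed[OF N_P[OF N(3)]]]
    P.add_minus_cancel[OF N_P[OF v(3)] P.a_inv_closed[OF N_P[OF N(1)]]] by (simp_all add: a_minus_def)
  then have xf: "?x \<boxminus> f v : T UNIV 1"
   using cong_trans[OF N(4,2) v(3)] T_UNIV[OF T_uminus[OF ge]] T_UNIV[OF T_uminus[OF efv(1)]] by simp
  have fx: "f v \<boxminus> ?x : T UNIV 1"
   using T_uminus[OF xf] N_P[OF N(4)] N_P[OF v(3)] by (simp add: a_minus_def P.minus_add P.a_comm)
  have xx: "?x \<star> ?x \<boxminus> ?x : T UNIV 1"
   using cong_trans[OF mul_N[OF N(4,4)] mul_N[OF v(3,3)] N(4) bilin_cong[OF mul_bilin N(4) v(3) N(4) v(3) xf xf]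
    cong_trans[OF mul_N[OF v(3,3)] v(3) N(4) _ fx]] ff[OF v(1,1)] by simp
  obtain h where h: "h : N" "h \<star> h = h" "h \<boxminus> ?x : T UNIV 1"
   "!!z. z : N ==> z \<star> ?x = \<zero>\<^sub>P ==> z \<star> h = \<zero>\<^sub>P" "!!z. z : N ==> ?x \<star> z = \<zero>\<^sub>P ==> h \<star> z = \<zero>\<^sub>P"
   by (rule lift_idempotent[OF N(4) xx], rule that)
  note eh = h(4)[OF e(1) ex] and he = h(5)[OF e(1) xe]
  have hf: "h \<boxminus> f v : T UNIV 1" by (rule cong_trans[OF h(1) N(4) v(3) h(3) xf])
  have Eh: "E i \<star> h = \<zero>\<^sub>P" "h \<star> E i = \<zero>\<^sub>P" if i: "i : U" for i
   using mul_assoc[OF EU(1)[OF i] e(1) h(1)] mul_assoc[OF h(1) e(1) EU(1)[OF i]] eh he EU(3,4)[OF i]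
    mul_zero[OF EU(1)[OF i]] by simp_all
  have e': "e \<boxplus> h : N" using e(1) h(1) by (rule T_add)
  have hf0: "h \<star> f j : T UNIV 1" "f j \<star> h : T UNIV 1" if j: "j : V - insert v U" for j
  proof -
   have jN: "f j : N" and j': "j : V" "j \<noteq> v" using fN j by auto
   have jj: "f j \<boxminus> f j : T UNIV 1" using N_P[OF jN] by (simp add: a_minus_def P.r_neg)
   have *: "y : T UNIV 1" if "y : N" "z : N" "y \<boxminus> z : T UNIV 1" "z \<boxminus> \<zero>\<^sub>P : T UNIV 1" for y z
    using cong_trans[OF that(1,2) _ that(3,4)] N_P[OF that(1)] by (simp add: a_minus_def)
   show "h \<star> f j : T UNIV 1" "f j \<star> h : T UNIV 1"
    using *[OF mul_N[OF h(1) jN] mul_N[OF v(3) jN] bilin_cong[OF mul_bilin h(1) v(3) jN jN hf jj]] ff[OF v(1) j'(1)]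
     *[OF mul_N[OF jN h(1)] mul_N[OF jN v(3)] bilin_cong[OF mul_bilin jN jN h(1) v(3) jj hf]] ff[OF j'(1) v(1)] j'(2)
    by auto
  qed
  show ?case
  proof (intro exI[of _ "E(v := h)"] exI[of _ "e \<boxplus> h"] conjI ballI)
   show "e \<boxplus> h : N" by (rule e')
   show "(e \<boxplus> h) \<star> (e \<boxplus> h) = e \<boxplus> h"
    using mul_add(1)[OF e(1) h(1) e'] mul_add(2)[OF e(1) h(1) e(1)] mul_add(2)[OF e(1) h(1) h(1)]
     e(2) h(2) eh he N_P[OF e(1)] N_P[OF h(1)] by simp
  next
   fix i assume i: "i : insert v U"
   show "(E(v := h)) i : N" "(E(v := h)) i \<boxminus> f i : T UNIV 1" using i h(1) hf EU(1,2) by auto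
   show "(e \<boxplus> h) \<star> (E(v := h)) i = (E(v := h)) i" "(E(v := h)) i \<star> (e \<boxplus> h) = (E(v := h)) i"
    using i mul_add(1)[OF e(1) h(1), of "(E(v := h)) i"] mul_add(2)[OF e(1) h(1), of "(E(v := h)) i"]
     h(1,2) eh he EU[of i] Eh[of i] N_P[OF h(1)] N_P[of "E i"] by (cases "i = v"; simp)+
   fix j assume "j : insert v U"
   then show "(E(v := h)) i \<star> (E(v := h)) j = (if i = j then (E(v := h)) i else \<zero>\<^sub>P)"
    using i E Eh h(2) by auto
  next
   fix j assume j: "j : V - insert v U"
   then have jN: "f j : N" and j': "j : V - U" using fN by auto
   show "(e \<boxplus> h) \<star> f j : T UNIV 1" "f j \<star> (e \<boxplus> h) : T UNIV 1"
    unfolding mul_add(1)[OF e(1) h(1) jN] mul_add(2)[OF e(1) h(1) jN] using ef j' hf0[OF j] by (auto intro: T_add)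
  qed
 qed
 from this[OF assms(1) subset_refl] obtain E e where "\<forall>i\<in>V. E i : N \<and> E i \<boxminus> f i : T UNIV 1 \<and>
   e \<star> E i = E i \<and> E i \<star> e = E i \<and> (\<forall>j\<in>V. E i \<star> E j = (if i = j then E i else \<zero>\<^sub>P))"
  by (elim exE conjE) (rule that)
 then show ?thesis by (intro exI[of _ E]) simp
qed

end

section \<open>Deformations of the algebra\<close>

context coeff_point
begin

text \<open>Every associative product on the free module on the irreducible paths is the product of a
 quotient of the path algebra: the vertices and arrows lift to a representation \<open>G\<close> of the quiver
 in it, and the kernel of \<open>G\<close> is the ideal.\<close>

lemma product_from_ideal:
 assumes \<mu>: "bilin \<mu>" and assoc: "!!u v w. u : N ==> v : N ==> w : N ==> \<mu> (\<mu> u v) w = \<mu> u (\<mu> v w)"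
  and res: "!!u v. u : N ==> v : N ==> rs \<circ> \<mu> u v = k.proj I ((rs \<circ> u) \<otimes>\<^bsub>k.P\<^esub> (rs \<circ> v))"
 obtains J where "good J" "gauge (nprod J) \<mu>"
proof -
 interpret A: assoc_product B m Q S \<mu>
  by (intro assoc_product.intro assoc_product_axioms.intro quiver_tips_axioms \<mu> assoc)
 note m = bilinD[OF \<mu>]
 let ?e = "\<lambda>i. pe (i, [])" and ?a = "\<lambda>a. pe (tail Q a, [a])"
 let ?ek = "\<lambda>i. path_elem K (i, [])" and ?ak = "\<lambda>a. path_elem K (tail Q a, [a])"
 have kIrr: "k.proj I x = x" if "x : k.N" for x using k.proj_Irr[OF I_complement that] .
 have ff: "\<mu> (?e i) (?e j) \<boxminus> (if i = j then ?e i else \<zero>\<^sub>P) : T UNIV 1" if ij: "i : verts Q" "j : verts Q" for i j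
 proof -
  have N: "?e i : N" "?e j : N" using ij vertex_N by simp_all
  have "rs \<circ> \<mu> (?e i) (?e j) = rs \<circ> (if i = j then ?e i else \<zero>\<^sub>P)"
   unfolding res[OF N] using k.vertex_mult[OF ij] kIrr[OF k.vertex_N[OF ij(1)]] kIrr[OF k.vertex_N[OF ij(2)]] kIrr[of "\<zero>\<^bsub>k.P\<^esub>"]
   by (simp add: res.f_path_elem res.f_P_zero)
  then show ?thesis using N_P[OF m(1)[OF N]] N_P[OF N(1)] N_P[OF N(2)] by (subst res_eq_iff[symmetric]) simp_all
 qed
 have "\<exists>E. \<forall>i\<in>verts Q. E i : N \<and> E i \<boxminus> ?e i : T UNIV 1 \<and>
   (\<forall>j\<in>verts Q. \<mu> (E i) (E j) = (if i = j then E i else \<zero>\<^sub>P))"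
  by (rule A.orthogonal_idempotents[OF _ vertex_N ff]) (simp_all add: fin_digraph.finite_verts[OF Q_fin])
 then obtain E where E: "!!i. i : verts Q ==> E i : N" "!!i. i : verts Q ==> E i \<boxminus> ?e i : T UNIV 1"
  "!!i j. i : verts Q ==> j : verts Q ==> \<mu> (E i) (E j) = (if i = j then E i else \<zero>\<^sub>P)" by auto
 have resE: "rs \<circ> E i = ?ek i" if "i : verts Q" for i
  using iffD2[OF res_eq_iff[OF N_P[OF E(1)] N_P[OF vertex_N]] E(2)] that by (simp add: res.f_path_elem)
 \<comment> \<open>The arrows are moved into the corners cut out by the idempotents of their end points.\<close>
 define Ar where "Ar a = \<mu> (E (tail Q a)) (\<mu> (?a a) (E (head Q a)))" for a
 have ArN: "Ar a : N" and inner: "\<mu> (?a a) (E (head Q a)) : N" if a: "a : arcs Q" for a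
  unfolding Ar_def using E(1)[OF k.tail_in_verts[OF a]] E(1)[OF k.head_in_verts[OF a]] arrow_N[OF a] by simp_all
 have resA: "rs \<circ> Ar a = ?ak a" if a: "a : arcs Q" for a
 proof -
  note t = k.tail_in_verts[OF a] and h = k.head_in_verts[OF a]
  have "?ak a \<otimes>\<^bsub>k.P\<^esub> ?ek (head Q a) = ?ak a" "?ek (tail Q a) \<otimes>\<^bsub>k.P\<^esub> ?ak a = ?ak a"
   using k.target_mult[OF k.arrow_path[OF a]] k.source_mult[OF k.arrow_path[OF a]] by simp_all
  then show ?thesis
   unfolding Ar_def res[OF E(1)[OF t] inner[OF a]] res[OF arrow_N[OF a] E(1)[OF h]] resE[OF t] resE[OF h] res.f_path_elem
   using kIrr[OF k.arrow_N[OF a]] by simp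
 qed
 have EA: "\<mu> (E (tail Q a)) (Ar a) = Ar a" "\<mu> (Ar a) (E (head Q a)) = Ar a" if a: "a : arcs Q" for a
 proof -
  note t = k.tail_in_verts[OF a] and h = k.head_in_verts[OF a]
  show "\<mu> (E (tail Q a)) (Ar a) = Ar a"
   unfolding Ar_def assoc[OF E(1)[OF t] E(1)[OF t] inner[OF a], symmetric] using E(3)[OF t t] by simp
  show "\<mu> (Ar a) (E (head Q a)) = Ar a"
   unfolding Ar_def assoc[OF E(1)[OF t] inner[OF a] E(1)[OF h]] assoc[OF arrow_N[OF a] E(1)[OF h] E(1)[OF h]]
   using E(3)[OF h h] by simp
 qed
 obtain G where G: "lin (carrier P) G" "!!x. x : carrier P ==> G x : N"
  "!!x y. x : carrier P ==> y : carrier P ==> G (x \<boxtimes> y) = \<mu> (G x) (G y)"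
  "!!i. i : verts Q ==> G (?e i) = E i" "!!a. a : arcs Q ==> G (?a a) = Ar a"
  by (rule quiver_representation[of Ir \<mu> E Ar, OF m assoc E(1) ArN E(3) EA], assumption+, rule that)
 have resG: "rs \<circ> G (pe (u, as)) = k.proj I (path_elem K (u, as))" if "(u, as) : paths Q" for u as
  using that
 proof (induction as arbitrary: u)
  case Nil
  then have u: "u : verts Q" by simp
  show ?case using G(4)[OF u] resE[OF u] kIrr[OF k.vertex_N[OF u]] by simp
 next
  case (Cons a as)
  then have a: "a : arcs Q" "(head Q a, as) : paths Q" by (auto simp: k.paths_Cons)
  let ?q = "pe (head Q a, as)" and ?qk = "path_elem K (head Q a, as)"
  have P: "?a a : carrier P" "?q : carrier P" "?ak a : carrier k.P" "?qk : carrier k.P"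
   using arrow_path[OF a(1)] a(2) by simp_all
  have "rs \<circ> G (?a a \<boxtimes> ?q) = k.proj I (?ak a \<otimes>\<^bsub>k.P\<^esub> ?qk)"
   unfolding G(3)[OF P(1,2)] res[OF G(2)[OF P(1)] G(2)[OF P(2)]]
   unfolding G(5)[OF a(1)] resA[OF a(1)] Cons.IH[OF a(2)]
   by (rule k.proj_mult(2)[OF I_complement P(3,4)])
  then show ?case using path_elem_Cons[OF Cons.prems] k.path_elem_Cons[OF Cons.prems] by simp
 qed
 have resG': "rs \<circ> G x = k.proj I (rs \<circ> x)" if x: "x : carrier P" for x
 proof (rule res.semilinear_eq[where X = UNIV and g = "\<lambda>x. rs \<circ> G x" and h = "\<lambda>x. k.proj I (rs \<circ> x)"])
  show "semilinear rs B P k.P (T UNIV 0) (\<lambda>x. rs \<circ> G x)"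
   using semilinearD[OF G(1)] by (intro semilinearI) (simp_all add: res.f_P_add res.f_P_smult)
  show "semilinear rs B P k.P (T UNIV 0) (\<lambda>x. k.proj I (rs \<circ> x))"
   using semilinearD[OF k.proj_lin[OF I_complement]] by (intro semilinearI) (simp_all add: res.f_P_add res.f_P_smult)
  show "rs \<circ> G (pe p) = k.proj I (rs \<circ> pe p)" if "p : paths Q" for p
   using resG[of "fst p" "snd p"] that by (simp add: res.f_path_elem)
 qed (use x in simp)
 have nearG: "near G"
 proof (rule nearI)
  show "lin N G" using G(1) N_P by (auto intro: semilinear_subset)
  fix u assume u: "u : N"
  show c: "G u : N" using G(2)[OF N_P[OF u]] .
  have "rs \<circ> G u = rs \<circ> u" using resG'[OF N_P[OF u]] kIrr[OF res.f_T[OF u]] by simp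
  then show "G u \<boxminus> u : T UNIV 1" using res_eq_iff[OF N_P[OF c] N_P[OF u]] by simp
 qed
 obtain V where V: "near V" "!!u. u : N ==> G (V u) = u" "!!u. u : N ==> V (G u) = u"
  by (rule near_inv[OF nearG], rule that)
 define J where "J = {x : carrier P. V (G x) = \<zero>\<^sub>P}"
 have G0: "G x = \<zero>\<^sub>P" if "x : J" for x
  using that V(2)[OF G(2)[of x]] lin_zero[OF nearD(1)[OF nearG]] by (simp add: J_def)
 have "complement J \<and> (\<forall>x\<in>carrier P. proj J x = V (G x))"
 proof (intro conjI ballI)
  have a: "lin (carrier P) (\<lambda>x. V (G x))" by (rule lin_comp[OF G(1,2) nearD(1)[OF V(1)]])
  have b: "V (G x) : N" if "x : carrier P" for x using nearD(2)[OF V(1) G(2)[OF that]] .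
  have c: "V (G (x \<boxtimes> y)) = \<zero>\<^sub>P \<and> V (G (y \<boxtimes> x)) = \<zero>\<^sub>P" if x: "x : J" and y: "y : carrier P" for x y
  proof -
   have xP: "x : carrier P" using x by (simp add: J_def)
   show ?thesis unfolding G(3)[OF xP y] G(3)[OF y xP] G0[OF x]
    using A.mul_zero[OF G(2)[OF y]] lin_zero[OF nearD(1)[OF V(1)]] by simp
  qed
  show "complement J" by (rule complementI(1)[OF a b V(3) J_def c])
  show "proj J x = V (G x)" if "x : carrier P" for x by (rule complementI(2)[OF a b V(3) J_def c that])
 qed
 then have J: "complement J" and projJ: "!!x. x : carrier P ==> proj J x = V (G x)" by simp_all
 have "good J"
 proof (rule goodI[OF J])
  fix p assume p: "p : paths Q"
  then have pP: "pe p : carrier P" by simp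
  note GN = G(2)[OF pP]
  have "rs \<circ> V (G (pe p)) = rs \<circ> G (pe p)"
   using iffD2[OF res_eq_iff[OF N_P[OF nearD(2)[OF V(1) GN]] N_P[OF GN]] T_UNIV[OF nearD(3)[OF V(1) GN]]] .
  then show "rs \<circ> proj J (pe p) = k.proj I (path_elem K p)"
   using projJ[OF pP] resG'[OF pP] by (simp add: res.f_path_elem)
 qed
 moreover have "gauge (nprod J) \<mu>"
 proof (rule gaugeI[OF nearG])
  fix u v assume uv: "u : N" "v : N"
  note P = N_P[OF uv(1)] N_P[OF uv(2)]
  have uvP: "u \<boxtimes> v : carrier P" using P by simp
  show "G (nprod J u v) = \<mu> (G u) (G v)"
   unfolding nprod_def projJ[OF uvP] V(2)[OF G(2)[OF uvP]] by (rule G(3)[OF P])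
 qed
 ultimately show thesis by (rule that)
qed

abbreviation kap where "kap u \<equiv> Ihat +>\<^sub>P u"

lemma alg_deformations_iff: "star : alg_deformations K Q I (B, m) \<longleftrightarrow>
  star : carrier (QA Ihat) \<rightarrow>\<^sub>E carrier (QA Ihat) \<rightarrow>\<^sub>E carrier (QA Ihat) \<and>
  (\<forall>x\<in>carrier (QA Ihat). \<forall>y\<in>carrier (QA Ihat). \<forall>z\<in>carrier (QA Ihat).
   star (x \<oplus>\<^bsub>QA Ihat\<^esub> y) z = star x z \<oplus>\<^bsub>QA Ihat\<^esub> star y z \<and>
   star x (y \<oplus>\<^bsub>QA Ihat\<^esub> z) = star x y \<oplus>\<^bsub>QA Ihat\<^esub> star x z \<and>
   star (star x y) z = star x (star y z)) \<and>
  (\<forall>b\<in>carrier B. \<forall>x\<in>carrier (QA Ihat). \<forall>y\<in>carrier (QA Ihat).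
   star (b \<odot>\<^bsub>QA Ihat\<^esub> x) y = b \<odot>\<^bsub>QA Ihat\<^esub> star x y \<and> star x (b \<odot>\<^bsub>QA Ihat\<^esub> y) = b \<odot>\<^bsub>QA Ihat\<^esub> star x y) \<and>
  (\<forall>x\<in>carrier (QA Ihat). \<forall>y\<in>carrier (QA Ihat). red (star x y) = red x \<otimes>\<^bsub>k.QA I\<^esub> red y)"
proof -
 have A: "X \<otimes>\<^bsub>path_algebra K Q Quot I\<^esub> Y = X \<otimes>\<^bsub>k.QA I\<^esub> Y" for X Y
  by (simp add: FactRing_def kP)
 show ?thesis
  by (simp only: alg_deformations_def Let_def prod.case mem_Collect_eq completed_quotient_eq A)
qed

text \<open>A product on the completion of \<open>A \<otimes> B\<close>, transported to \<open>N\<close> along the splitting by irreducible paths.\<close>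

definition coord_product where "coord_product star u v = crd Ihat (star (kap u) (kap v))"

lemmas kap_N = coset_N[OF Ihat(1)]
lemmas kap_add = coset_ops(2)[OF Ihat(2) N_P N_P zero_closed]
lemmas kap_smult = coset_ops(4)[OF Ihat(2) N_P N_P]

lemma alg_deformation:
 assumes star: "star : alg_deformations K Q I (B, m)"
 shows "u : N ==> v : N ==> star (kap u) (kap v) = kap (coord_product star u v)"
  "bilin (coord_product star)"
  "u : N ==> v : N ==> w : N ==>
   coord_product star (coord_product star u v) w = coord_product star u (coord_product star v w)"
  "u : N ==> v : N ==> rs \<circ> coord_product star u v = k.proj I ((rs \<circ> u) \<otimes>\<^bsub>k.P\<^esub> (rs \<circ> v))"
proof -
 let ?M = "carrier (QA Ihat)" and ?\<mu> = "coord_product star"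
 note s = star[unfolded alg_deformations_iff]
 have cl: "star X Y : ?M" if "X : ?M" "Y : ?M" for X Y
  using PiE_mem[OF PiE_mem[OF conjunct1[OF s] that(1)] that(2)] .
 have ax: "star (X \<oplus>\<^bsub>QA Ihat\<^esub> Y) Z = star X Z \<oplus>\<^bsub>QA Ihat\<^esub> star Y Z"
  "star X (Y \<oplus>\<^bsub>QA Ihat\<^esub> Z) = star X Y \<oplus>\<^bsub>QA Ihat\<^esub> star X Z" "star (star X Y) Z = star X (star Y Z)"
  if "X : ?M" "Y : ?M" "Z : ?M" for X Y Z using s that by blast+
 have bx: "star (b \<odot>\<^bsub>QA Ihat\<^esub> X) Y = b \<odot>\<^bsub>QA Ihat\<^esub> star X Y" "star X (b \<odot>\<^bsub>QA Ihat\<^esub> Y) = b \<odot>\<^bsub>QA Ihat\<^esub> star X Y"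
  if "b : carrier B" "X : ?M" "Y : ?M" for b X Y using s that by blast+
 have rx: "red (star X Y) = red X \<otimes>\<^bsub>k.QA I\<^esub> red Y" if "X : ?M" "Y : ?M" for X Y using s that by blast
 have sN: "?\<mu> u v : N" and sk: "star (kap u) (kap v) = kap (?\<mu> u v)" if "u : N" "v : N" for u v
  using crd[OF Ihat(1) cl[OF kap_N[OF that(1)] kap_N[OF that(2)]]] by (simp_all add: coord_product_def)
 show "star (kap u) (kap v) = kap (?\<mu> u v)" if "u : N" "v : N" by (rule sk[OF that])
 note inj = coset_inj[OF Ihat(1)]
 have l: "lin N (\<lambda>u. ?\<mu> u v)" and r: "lin N (?\<mu> v)" if v: "v : N" for v
 proof -
  show "lin N (\<lambda>u. ?\<mu> u v)"
  proof (rule semilinearI)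
   show "?\<mu> u v : carrier P" if "u : N" for u using N_P[OF sN[OF that v]] .
   show "?\<mu> (u \<boxplus> u') v = ?\<mu> u v \<boxplus> ?\<mu> u' v" if u: "u : N" "u' : N" for u u'
    by (rule inj[OF sN[OF T_add[OF u] v] T_add[OF sN[OF u(1) v] sN[OF u(2) v]]])
     (use sk[OF T_add[OF u] v] ax(1)[OF kap_N[OF u(1)] kap_N[OF u(2)] kap_N[OF v]] sk[OF u(1) v] sk[OF u(2) v]
      kap_add[OF u] kap_add[OF sN[OF u(1) v] sN[OF u(2) v]] in simp)
   show "?\<mu> (b \<bullet> u) v = b \<bullet> ?\<mu> u v" if b: "b : carrier B" and u: "u : N" for b u
    by (rule inj[OF sN[OF T_smult[OF u b] v] T_smult[OF sN[OF u v] b]])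
     (use sk[OF T_smult[OF u b] v] bx(1)[OF b kap_N[OF u] kap_N[OF v]] sk[OF u v]
      kap_smult[OF u u b] kap_smult[OF sN[OF u v] sN[OF u v] b] in simp)
  qed
  show "lin N (?\<mu> v)"
  proof (rule semilinearI)
   show "?\<mu> v u : carrier P" if "u : N" for u using N_P[OF sN[OF v that]] .
   show "?\<mu> v (u \<boxplus> u') = ?\<mu> v u \<boxplus> ?\<mu> v u'" if u: "u : N" "u' : N" for u u'
    by (rule inj[OF sN[OF v T_add[OF u]] T_add[OF sN[OF v u(1)] sN[OF v u(2)]]])
     (use sk[OF v T_add[OF u]] ax(2)[OF kap_N[OF v] kap_N[OF u(1)] kap_N[OF u(2)]] sk[OF v u(1)] sk[OF v u(2)]
      kap_add[OF u] kap_add[OF sN[OF v u(1)] sN[OF v u(2)]] in simp)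
   show "?\<mu> v (b \<bullet> u) = b \<bullet> ?\<mu> v u" if b: "b : carrier B" and u: "u : N" for b u
    by (rule inj[OF sN[OF v T_smult[OF u b]] T_smult[OF sN[OF v u] b]])
     (use sk[OF v T_smult[OF u b]] bx(2)[OF b kap_N[OF v] kap_N[OF u]] sk[OF v u]
      kap_smult[OF u u b] kap_smult[OF sN[OF v u] sN[OF v u] b] in simp)
  qed
 qed
 show "bilin ?\<mu>" unfolding bilin_def using sN l r by blast
 show "?\<mu> (?\<mu> u v) w = ?\<mu> u (?\<mu> v w)" if n: "u : N" "v : N" "w : N"
 proof (rule inj[OF sN[OF sN[OF n(1,2)] n(3)] sN[OF n(1) sN[OF n(2,3)]]])
  show "kap (?\<mu> (?\<mu> u v) w) = kap (?\<mu> u (?\<mu> v w))"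
   unfolding sk[OF sN[OF n(1,2)] n(3), symmetric] sk[OF n(1) sN[OF n(2,3)], symmetric]
    sk[OF n(1,2), symmetric] sk[OF n(2,3), symmetric] by (rule ax(3)[OF kap_N[OF n(1)] kap_N[OF n(2)] kap_N[OF n(3)]])
 qed
 show "rs \<circ> ?\<mu> u v = k.proj I ((rs \<circ> u) \<otimes>\<^bsub>k.P\<^esub> (rs \<circ> v))" if uv: "u : N" "v : N"
 proof -
  note P = res.f_P[OF N_P[OF uv(1)]] res.f_P[OF N_P[OF uv(2)]]
  have PP: "(rs \<circ> u) \<otimes>\<^bsub>k.P\<^esub> (rs \<circ> v) : carrier k.P" using P by simp
  have "I +>\<^bsub>k.P\<^esub> (rs \<circ> ?\<mu> u v) = (I +>\<^bsub>k.P\<^esub> (rs \<circ> u)) \<otimes>\<^bsub>k.QA I\<^esub> (I +>\<^bsub>k.P\<^esub> (rs \<circ> v))"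
   using rx[OF kap_N[OF uv(1)] kap_N[OF uv(2)]] sk[OF uv] red_good[OF good_Ihat N_P[OF sN[OF uv]]]
    red_good[OF good_Ihat N_P[OF uv(1)]] red_good[OF good_Ihat N_P[OF uv(2)]] by simp
  also have "\<dots> = I +>\<^bsub>k.P\<^esub> ((rs \<circ> u) \<otimes>\<^bsub>k.P\<^esub> (rs \<circ> v))"
   using k.coset_ops(3)[OF k.complement_ideal[OF I_complement] P k.zero_closed] .
  also have "\<dots> = I +>\<^bsub>k.P\<^esub> k.proj I ((rs \<circ> u) \<otimes>\<^bsub>k.P\<^esub> (rs \<circ> v))" by (rule k.coset_proj[OF I_complement PP])
  finally show ?thesis
   by (rule k.coset_inj[OF I_complement res.f_T[OF sN[OF uv]] k.proj(1)[OF I_complement PP]])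
 qed
qed

text \<open>The restrictions make the product a member of the extensional function space in which deformations
are counted.\<close>

definition star_of where
 "star_of J = (\<lambda>X\<in>carrier (QA Ihat). \<lambda>Y\<in>carrier (QA Ihat). kap (nprod J (crd Ihat X) (crd Ihat Y)))"

lemma kap_cases:
 assumes "X : carrier (QA Ihat)"
 obtains u where "u : N" "X = kap u"
 using crd[OF Ihat(1) assms] by (rule that)

lemma star_of:
 assumes J: "good J"
 shows "star_of J : alg_deformations K Q I (B, m)"
  "u : N ==> v : N ==> star_of J (kap u) (kap v) = kap (nprod J u v)"
  "u : N ==> v : N ==> coord_product (star_of J) u v = nprod J u v"
proof -
 let ?M = "carrier (QA Ihat)" and ?m = "nprod J"
 note c = goodD(1)[OF J]
 note m = bilinD[OF bilin_nprod[OF c]]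
 have sk: "star_of J (kap u) (kap v) = kap (?m u v)" if "u : N" "v : N" for u v
  using kap_N[OF that(1)] kap_N[OF that(2)] crd_coset[OF Ihat(1) that(1)] crd_coset[OF Ihat(1) that(2)]
  by (simp add: star_of_def)
 then show "u : N ==> v : N ==> star_of J (kap u) (kap v) = kap (?m u v)" .
 show "coord_product (star_of J) u v = ?m u v" if "u : N" "v : N"
  unfolding coord_product_def sk[OF that] by (rule crd_coset[OF Ihat(1) m(1)[OF that]])
 show "star_of J : alg_deformations K Q I (B, m)"
  unfolding alg_deformations_iff
 proof (intro conjI ballI)
  show "star_of J : ?M \<rightarrow>\<^sub>E ?M \<rightarrow>\<^sub>E ?M"
   unfolding star_of_def
   by (intro restrict_PiE_iff[THEN iffD2] ballI kap_N m(1) crd(1)[OF Ihat(1)])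
 next
  fix X Y Z assume XYZ: "X : ?M" "Y : ?M" "Z : ?M"
  obtain x where x: "x : N" "X = kap x" by (rule kap_cases[OF XYZ(1)], rule that)
  obtain y where y: "y : N" "Y = kap y" by (rule kap_cases[OF XYZ(2)], rule that)
  obtain z where z: "z : N" "Z = kap z" by (rule kap_cases[OF XYZ(3)], rule that)
  show "star_of J (X \<oplus>\<^bsub>QA Ihat\<^esub> Y) Z = star_of J X Z \<oplus>\<^bsub>QA Ihat\<^esub> star_of J Y Z"
   unfolding x(2) y(2) z(2) kap_add[OF x(1) y(1)] sk[OF T_add[OF x(1) y(1)] z(1)] sk[OF x(1) z(1)] sk[OF y(1) z(1)]
    kap_add[OF m(1)[OF x(1) z(1)] m(1)[OF y(1) z(1)]] semilinearD(2)[OF m(2)[OF z(1)] x(1) y(1)] ..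
  show "star_of J X (Y \<oplus>\<^bsub>QA Ihat\<^esub> Z) = star_of J X Y \<oplus>\<^bsub>QA Ihat\<^esub> star_of J X Z"
   unfolding x(2) y(2) z(2) kap_add[OF y(1) z(1)] sk[OF x(1) T_add[OF y(1) z(1)]] sk[OF x(1) z(1)] sk[OF x(1) y(1)]
    kap_add[OF m(1)[OF x(1) y(1)] m(1)[OF x(1) z(1)]] semilinearD(2)[OF m(3)[OF x(1)] y(1) z(1)] ..
  show "star_of J (star_of J X Y) Z = star_of J X (star_of J Y Z)"
   unfolding x(2) y(2) z(2) sk[OF x(1) y(1)] sk[OF y(1) z(1)] sk[OF m(1)[OF x(1) y(1)] z(1)] sk[OF x(1) m(1)[OF y(1) z(1)]]
    nprod_assoc[OF c x(1) y(1) z(1)] ..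
 next
  fix b X Y assume b: "b : carrier B" and XY: "X : ?M" "Y : ?M"
  obtain x where x: "x : N" "X = kap x" by (rule kap_cases[OF XY(1)], rule that)
  obtain y where y: "y : N" "Y = kap y" by (rule kap_cases[OF XY(2)], rule that)
  note xy = m(1)[OF x(1) y(1)]
  show "star_of J (b \<odot>\<^bsub>QA Ihat\<^esub> X) Y = b \<odot>\<^bsub>QA Ihat\<^esub> star_of J X Y"
   unfolding x(2) y(2) kap_smult[OF x(1,1) b] sk[OF T_smult[OF x(1) b] y(1)] sk[OF x(1) y(1)]
    kap_smult[OF xy xy b] semilinearD(3)[OF m(2)[OF y(1)] b x(1)] ..
  show "star_of J X (b \<odot>\<^bsub>QA Ihat\<^esub> Y) = b \<odot>\<^bsub>QA Ihat\<^esub> star_of J X Y"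
   unfolding x(2) y(2) kap_smult[OF y(1,1) b] sk[OF x(1) T_smult[OF y(1) b]] sk[OF x(1) y(1)]
    kap_smult[OF xy xy b] semilinearD(3)[OF m(3)[OF x(1)] b y(1)] ..
 next
  fix X Y assume XY: "X : ?M" "Y : ?M"
  obtain x where x: "x : N" "X = kap x" by (rule kap_cases[OF XY(1)], rule that)
  obtain y where y: "y : N" "Y = kap y" by (rule kap_cases[OF XY(2)], rule that)
  note P = N_P[OF x(1)] N_P[OF y(1)]
  have PP: "x \<boxtimes> y : carrier P" using P by simp
  have "red (kap (?m x y)) = I +>\<^bsub>k.P\<^esub> k.proj I ((rs \<circ> x) \<otimes>\<^bsub>k.P\<^esub> (rs \<circ> y))"
   unfolding red_good[OF good_Ihat N_P[OF m(1)[OF x(1) y(1)]]] unfolding nprod_def res_proj[OF J PP] res.f_P_mult[OF P] ..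
  also have "\<dots> = (I +>\<^bsub>k.P\<^esub> (rs \<circ> x)) \<otimes>\<^bsub>k.QA I\<^esub> (I +>\<^bsub>k.P\<^esub> (rs \<circ> y))"
   using k.coset_proj[OF I_complement, of "(rs \<circ> x) \<otimes>\<^bsub>k.P\<^esub> (rs \<circ> y)"] P
    k.coset_ops(3)[OF k.complement_ideal[OF I_complement] res.f_P[OF P(1)] res.f_P[OF P(2)] k.zero_closed] by simp
  finally show "red (star_of J X Y) = red X \<otimes>\<^bsub>k.QA I\<^esub> red Y"
   unfolding x(2) y(2) sk[OF x(1) y(1)] red_good[OF good_Ihat P(1)] red_good[OF good_Ihat P(2)] .
 qed
qed

lemma alg_equiv_eq: "alg_equiv K Q I (B, m) = {(star, star'). star : alg_deformations K Q I (B, m) \<and>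
  star' : alg_deformations K Q I (B, m) \<and> gauge (coord_product star) (coord_product star')}"
proof (rule equalityI; rule subrelI)
 let ?M = "carrier (QA Ihat)"
 fix star star' assume "(star, star') : alg_equiv K Q I (B, m)"
 then obtain L where s: "star : alg_deformations K Q I (B, m)" "star' : alg_deformations K Q I (B, m)"
  and L: "L : module_iso B (QA Ihat) (QA Ihat)" and rd: "\<forall>X\<in>?M. red (L X) = red X"
  and mult: "\<forall>X\<in>?M. \<forall>Y\<in>?M. L (star X Y) = star' (L X) (L Y)"
  unfolding alg_equiv_def Let_def prod.case completed_quotient_eq by (elim CollectE case_prodE conjE bexE Pair_inject) simp
 obtain h where h: "lin (carrier P) h" "!!x. x : carrier P ==> h x : N" "!!x. x : carrier P ==> L (kap (h x)) = kap x"
  and near: "near h"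
  by (rule near_coordinates[OF good_Ihat Ihat(2) goodD(3)[OF good_Ihat] L bspec[OF rd]], assumption+, rule that)
 note hN = h(2)[OF N_P] and hk = h(3)[OF N_P]
 note \<mu> = bilinD(1)[OF alg_deformation(2)[OF s(1)]] and \<mu>' = bilinD(1)[OF alg_deformation(2)[OF s(2)]]
 have "gauge (coord_product star') (coord_product star)"
 proof (rule gaugeI[OF near])
  fix u v assume uv: "u : N" "v : N"
  note hu = hN[OF uv(1)] hN[OF uv(2)]
  have "L (kap (coord_product star (h u) (h v))) = star' (L (kap (h u))) (L (kap (h v)))"
   using bspec[OF bspec[OF mult kap_N[OF hu(1)]] kap_N[OF hu(2)]] alg_deformation(1)[OF s(1) hu] by simp
  also have "\<dots> = L (kap (h (coord_product star' u v)))"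
   unfolding hk[OF uv(1)] hk[OF uv(2)] alg_deformation(1)[OF s(2) uv] hk[OF \<mu>'[OF uv]] ..
  finally have "kap (coord_product star (h u) (h v)) = kap (h (coord_product star' u v))"
   using module_isoD(2)[OF L] kap_N[OF \<mu>[OF hu]] kap_N[OF hN[OF \<mu>'[OF uv]]] by (meson bij_betw_def inj_onD)
  then show "h (coord_product star' u v) = coord_product star (h u) (h v)"
   using coset_inj[OF Ihat(1) \<mu>[OF hu] hN[OF \<mu>'[OF uv]]] by simp
 qed
 then have "gauge (coord_product star) (coord_product star')" by (rule gauge_sym[OF alg_deformation(2)[OF s(2)]])
 then show "(star, star') : {(star, star'). star : alg_deformations K Q I (B, m) \<and>
  star' : alg_deformations K Q I (B, m) \<and> gauge (coord_product star) (coord_product star')}" using s by simp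
next
 let ?M = "carrier (QA Ihat)"
 fix star star' assume "(star, star') : {(star, star'). star : alg_deformations K Q I (B, m) \<and>
  star' : alg_deformations K Q I (B, m) \<and> gauge (coord_product star) (coord_product star')}"
 then have s: "star : alg_deformations K Q I (B, m)" "star' : alg_deformations K Q I (B, m)"
  and g: "gauge (coord_product star) (coord_product star')" by simp_all
 obtain \<theta> where \<theta>: "near \<theta>" "!!u v. u : N ==> v : N ==> \<theta> (coord_product star u v) = coord_product star' (\<theta> u) (\<theta> v)"
  by (rule gaugeE[OF g], rule that)
 note \<theta>' = nearD[OF \<theta>(1)]
 let ?L = "\<lambda>X. kap (\<theta> (crd Ihat X))"
 have Lk: "?L (kap u) = kap (\<theta> u)" if "u : N" for u using crd_coset[OF Ihat(1) that] by simp
 note L = near_iso(1)[OF \<theta>(1)] and rd = near_iso(2)[OF \<theta>(1)]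
 have mult: "?L (star X Y) = star' (?L X) (?L Y)" if XY: "X : ?M" "Y : ?M" for X Y
 proof -
  obtain u where u: "u : N" "X = kap u" by (rule kap_cases[OF XY(1)], rule that)
  obtain v where v: "v : N" "Y = kap v" by (rule kap_cases[OF XY(2)], rule that)
  show ?thesis unfolding u(2) v(2) alg_deformation(1)[OF s(1) u(1) v(1)] Lk[OF u(1)] Lk[OF v(1)]
   Lk[OF bilinD(1)[OF alg_deformation(2)[OF s(1)] u(1) v(1)]]
   alg_deformation(1)[OF s(2) \<theta>'(2)[OF u(1)] \<theta>'(2)[OF v(1)]] \<theta>(2)[OF u(1) v(1)] ..
 qed
 show "(star, star') : alg_equiv K Q I (B, m)"
  unfolding alg_equiv_def Let_def prod.case completed_quotient_eq
  by (rule CollectI, rule case_prodI, intro conjI bexI[where x = ?L] ballI s L rd mult; assumption)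
qed

end

section \<open>Base change of deformations\<close>

locale coeff_map = X: coeff_point K Q I S \<phi> B m + Y: coeff_point K Q I S \<phi> B' m'
 for K :: "'k ring" and Q :: "('v, 'a) pre_digraph" and I and S and \<phi>
  and B :: "('k, 'b) module" and m and B' :: "('k, 'b) module" and m' +
 fixes f
 assumes f_coeff: "f : coeff_homs K (B, m) (B', m')"
begin

lemma f: "f : ring_hom B B'" "f ` m \<subseteq> m'"
 "c : carrier K ==> b : carrier B ==> f (c \<odot>\<^bsub>B\<^esub> b) = c \<odot>\<^bsub>B'\<^esub> f b"
 using f_coeff by (auto simp: coeff_homs_def)

end

sublocale coeff_map \<subseteq> bc: tips_hom B m Q S B' m' f
 by (intro tips_hom.intro adic_hom.intro adic_hom_axioms.intro X.B_adic_quiver Y.B_adic_quiver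
  X.quiver_tips_axioms Y.quiver_tips_axioms f)

context coeff_map
begin

lemma f_emb: "c : carrier K ==> f (X.emb c) = Y.emb c"
 using f(3)[of c "\<one>\<^bsub>B\<^esub>"] ring_hom_one[OF f(1)] by (simp add: structure_map_def)

lemma residue_f:
 assumes b: "b : carrier B"
 shows "Y.rs (f b) = X.rs b"
proof (rule Y.residue_eq)
 note r = X.residue[OF b]
 have "f (b \<ominus>\<^bsub>B\<^esub> X.emb (X.rs b)) : m'" using f(2) r(2) by blast
 then show "f b \<ominus>\<^bsub>B'\<^esub> Y.emb (X.rs b) : m'"
  using bc.f_minus[OF b X.emb_closed[OF r(1)]] f_emb[OF r(1)] by simp
 show "f b : carrier B'" using b by simp
 show "X.rs b : carrier K" by (rule r(1))
qed

lemma residue_comp: "x : carrier X.P ==> Y.rs \<circ> (f \<circ> x) = X.rs \<circ> x"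
 by (rule ext) (simp add: residue_f)

abbreviation bci where "bci J \<equiv> base_change_ideal B' m' Q f J"

lemma good_base_change:
 assumes J: "X.good J"
 shows "Y.good (bci J)"
proof (rule Y.goodI)
 note b = bc.base_change_complement[OF X.goodD(1)[OF J]]
 show "Y.complement (bci J)" by (rule b(1))
 fix p assume p: "p : paths Q"
 then have P: "path_elem B p : carrier X.P" by simp
 have "Y.proj (bci J) (path_elem B' p) = f \<circ> X.proj J (path_elem B p)"
  using b(2)[OF P] by (simp add: bc.f_path_elem)
 then show "Y.rs \<circ> Y.proj (bci J) (path_elem B' p) = X.k.proj I (path_elem K p)"
  using residue_comp[OF X.proj_P[OF X.goodD(1)[OF J] P]] X.res_proj[OF J P] by (simp add: X.res.f_path_elem)
qed

lemma nprod_base_change: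
 assumes J: "X.good J" and uv: "u : X.N" "v : X.N"
 shows "f \<circ> X.nprod J u v = Y.nprod (bci J) (f \<circ> u) (f \<circ> v)"
 using bc.base_change_complement(2)[OF X.goodD(1)[OF J], of "u \<otimes>\<^bsub>X.P\<^esub> v"] X.N_P[OF uv(1)] X.N_P[OF uv(2)]
 by (simp add: X.nprod_def Y.nprod_def bc.f_P_mult)

lemma rule_of_base_change:
 assumes J: "X.good J"
 shows "restrict (\<lambda>s. f \<circ> X.rule_of J s) S = Y.rule_of (bci J)"
proof (rule extensionalityI[of _ S])
 fix s assume s: "s : S"
 have sp: "path_elem B s : carrier X.P" using s X.S_paths by auto
 note P = X.proj_P[OF X.goodD(1)[OF J] sp] X.N_P[OF X.emb_rule_N[OF s]]
 have e: "f \<circ> (X.emb \<circ> \<phi> s) = Y.emb \<circ> \<phi> s"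
  by (rule ext) (simp add: f_emb X.k.P_coeff[OF X.k.rule_P[OF s]])
 show "restrict (\<lambda>s. f \<circ> X.rule_of J s) S s = Y.rule_of (bci J) s"
  using s bc.f_P_minus[OF P] e bc.base_change_complement(2)[OF X.goodD(1)[OF J] sp]
  by (simp add: X.rule_of_def Y.rule_of_def bc.f_path_elem)
qed (simp_all add: Y.rule_of_def)

abbreviation fq where "fq \<equiv> quotient_map Y.P Y.Ihat f"

text \<open>The completed base change of \<open>I\<close> to \<open>B'\<close> agrees with the base change from \<open>B\<close>, since the projections
along both have the same values on paths.\<close>

lemma quotient_map_coset:
 assumes x: "x : carrier X.P"
 shows "fq (X.kap x) = Y.kap (f \<circ> x)"
proof -
 have "bci X.Ihat = Y.Ihat"
 proof (rule Y.complement_eqI)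
  note g = good_base_change[OF X.good_Ihat]
  show "Y.complement (bci X.Ihat)" "Y.complement Y.Ihat" using Y.goodD(1)[OF g] Y.Ihat(1) by simp_all
  fix p assume p: "p : paths Q"
  then have P: "path_elem B p : carrier X.P" "path_elem K p : carrier X.k.P" by simp_all
  have pr: "X.k.proj I (path_elem K p) : carrier X.k.P" by (rule X.k.proj_P[OF X.I_complement P(2)])
  have "f \<circ> (X.emb \<circ> X.k.proj I (path_elem K p)) = Y.emb \<circ> X.k.proj I (path_elem K p)"
   by (rule ext) (simp add: f_emb X.k.P_coeff[OF pr])
  then show "Y.proj (bci X.Ihat) (path_elem B' p) = Y.proj Y.Ihat (path_elem B' p)"
   using bc.base_change_complement(2)[OF X.Ihat(1) P(1)] X.emb.base_change_complement(2)[OF X.I_complement P(2)]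
    Y.emb.base_change_complement(2)[OF X.I_complement P(2)]
   by (simp add: bc.f_path_elem X.emb.f_path_elem Y.emb.f_path_elem)
 qed
 then have I: "f \<circ> h : Y.Ihat" if h: "h : X.Ihat" for h
 proof -
  have hP: "h : carrier X.P" using X.complement_sub[OF X.Ihat(1) h] .
  have "Y.proj (bci X.Ihat) (f \<circ> h) = \<zero>\<^bsub>Y.P\<^esub>"
   using bc.base_change_complement(2)[OF X.Ihat(1) hP] X.proj_eq_zero[OF X.Ihat(1) hP] h bc.f_P_zero by simp
  then show ?thesis using Y.proj_eq_zero[OF Y.Ihat(1) bc.f_P[OF hP]] \<open>bci X.Ihat = Y.Ihat\<close> by simp
 qed
 interpret J: ideal X.Ihat X.P by (rule X.Ihat)
 have "Y.kap (f \<circ> y) = Y.kap (f \<circ> x)" if y: "y : X.kap x" for y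
 proof -
  obtain h where h: "h : X.Ihat" "y = h \<oplus>\<^bsub>X.P\<^esub> x" using y unfolding a_r_coset_def' by (elim UN_E singletonE)
  have hP: "h : carrier X.P" using h(1) by (rule J.Icarr)
  have "(f \<circ> y) \<ominus>\<^bsub>Y.P\<^esub> (f \<circ> x) = f \<circ> h"
   unfolding h(2) bc.f_P_add[OF hP x] using Y.P.add_minus_cancel[of "f \<circ> x" "f \<circ> h"] hP x by (simp add: Y.P.a_comm)
  then show ?thesis using Y.coset_eq[OF Y.Ihat(2) bc.f_P bc.f_P, of y x] I[OF h(1)] hP x h(2) by simp
 qed
 then show ?thesis
  unfolding quotient_map_def by (intro UN_constant_eq[OF J.a_rcos_self[OF x]] ballI)
qed

lemma alg_base_change_product:
 assumes s: "(star, star') : alg_base_change K Q I (B, m) (B', m') f" and uv: "u : X.N" "v : X.N"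
 shows "f \<circ> X.coord_product star u v = Y.coord_product star' (f \<circ> u) (f \<circ> v)"
proof -
 have s': "star : alg_deformations K Q I (B, m)" "star' : alg_deformations K Q I (B', m')"
  "!!X Y. X : carrier (X.QA X.Ihat) ==> Y : carrier (X.QA X.Ihat) ==> fq (star X Y) = star' (fq X) (fq Y)"
  using s unfolding alg_base_change_def Let_def prod.case X.completed_quotient_eq by blast+
 note a = X.alg_deformation[OF s'(1)] and a' = Y.alg_deformation[OF s'(2)]
 note N = bc.f_T[OF uv(1)] bc.f_T[OF uv(2)]
 note c = X.bilinD(1)[OF a(2) uv] and c' = Y.bilinD(1)[OF a'(2) N]
 have "Y.kap (f \<circ> X.coord_product star u v) = Y.kap (Y.coord_product star' (f \<circ> u) (f \<circ> v))"
  using s'(3)[OF X.kap_N[OF uv(1)] X.kap_N[OF uv(2)]]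
  unfolding a(1)[OF uv] quotient_map_coset[OF X.N_P[OF c]] quotient_map_coset[OF X.N_P[OF uv(1)]]
   quotient_map_coset[OF X.N_P[OF uv(2)]] a'(1)[OF N] .
 then show ?thesis by (rule Y.coset_inj[OF Y.Ihat(1) bc.f_T[OF c] c'])
qed

lemma star_of_base_change:
 assumes J: "X.good J"
 shows "(X.star_of J, Y.star_of (bci J)) : alg_base_change K Q I (B, m) (B', m') f"
proof -
 note J' = good_base_change[OF J]
 have "fq (X.star_of J X Y) = Y.star_of (bci J) (fq X) (fq Y)"
  if XY: "X : carrier (X.QA X.Ihat)" "Y : carrier (X.QA X.Ihat)" for X Y
 proof -
  obtain u where u: "u : X.N" "X = X.kap u" by (rule X.kap_cases[OF XY(1)], rule that)
  obtain v where v: "v : X.N" "Y = X.kap v" by (rule X.kap_cases[OF XY(2)], rule that)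
  note N = X.bilinD(1)[OF X.bilin_nprod[OF X.goodD(1)[OF J]] u(1) v(1)]
  show ?thesis
   unfolding u(2) v(2) X.star_of(2)[OF J u(1) v(1)] quotient_map_coset[OF X.N_P[OF N]]
    quotient_map_coset[OF X.N_P[OF u(1)]] quotient_map_coset[OF X.N_P[OF v(1)]]
    Y.star_of(2)[OF J' bc.f_T[OF u(1)] bc.f_T[OF v(1)]] nprod_base_change[OF J u(1) v(1)] ..
 qed
 then show ?thesis
  unfolding alg_base_change_def Let_def prod.case X.completed_quotient_eq
  by (intro CollectI case_prodI conjI ballI X.star_of(1)[OF J] Y.star_of(1)[OF J'])
qed

end

section \<open>Presentations of deformation functors\<close>

text \<open>A deformation problem whose objects, up to gauge equivalence of the products \<open>\<mu>\<close> that they define,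
 are the elements of \<open>E\<close>. All functors presented by the same \<open>E\<close> are isomorphic.\<close>

locale gauge_problem =
 fixes Ob :: "'o set" and Hom :: "'o => 'o => ('b => 'b) set"
  and E :: "'o => 'e set" and e :: "'o => 'o => ('b => 'b) => 'e => 'e" and M :: "'o => 'e => 'p"
  and V :: "'o => 'p set" and G :: "'o => 'p => 'p => bool"
  and R :: "'o => 'o => ('b => 'b) => 'p => 'p => bool"
 assumes id_Hom: "X : Ob ==> id : Hom X X"
  and comp_Hom: "X : Ob ==> Y : Ob ==> Z : Ob ==> f : Hom X Y ==> g : Hom Y Z ==> g \<circ> f : Hom X Z"
  and e_closed: "X : Ob ==> Y : Ob ==> f : Hom X Y ==> J : E X ==> e X Y f J : E Y"
  and e_id: "X : Ob ==> J : E X ==> e X X id J = J"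
  and e_comp: "X : Ob ==> Y : Ob ==> Z : Ob ==> f : Hom X Y ==> g : Hom Y Z ==> J : E X ==>
   e X Z (g \<circ> f) J = e Y Z g (e X Y f J)"
  and M_V: "X : Ob ==> J : E X ==> M X J : V X"
  and G_refl: "X : Ob ==> a : V X ==> G X a a"
  and G_sym: "X : Ob ==> a : V X ==> b : V X ==> G X a b ==> G X b a"
  and G_trans: "X : Ob ==> a : V X ==> b : V X ==> c : V X ==> G X a b ==> G X b c ==> G X a c"
  and R_M: "X : Ob ==> Y : Ob ==> f : Hom X Y ==> J : E X ==> R X Y f (M X J) (M Y (e X Y f J))"
  and R_G: "X : Ob ==> Y : Ob ==> f : Hom X Y ==> a : V X ==> b : V X ==> a' : V Y ==> b' : V Y ==>
   R X Y f a a' ==> R X Y f b b' ==> G X a b ==> G Y a' b'"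

text \<open>A functor whose objects \<open>A\<close> define products \<open>\<mu>\<close>, are identified by the relation \<open>r\<close> when these are gauge
equivalent, and are all equivalent to objects \<open>s J\<close>. The functor acts on classes by the relation \<open>b\<close>, which
may relate an object to several others, or to none unless it has the form \<open>s J\<close>.\<close>

locale presented_functor = gauge_problem Ob Hom E e M V G R
 for Ob :: "'o set" and Hom :: "'o => 'o => ('b => 'b) set" and E :: "'o => 'e set" and e
  and M :: "'o => 'e => 'p" and V G R +
 fixes A :: "'o => 'd set" and r :: "'o => 'd rel" and b :: "'o => 'o => ('b => 'b) => 'd rel"
  and \<mu> :: "'o => 'd => 'p" and s :: "'o => 'e => 'd"
  and D :: "'o => 'd set set" and Dmap :: "'o => 'o => ('b => 'b) => 'd set => 'd set"
 assumes D_eq: "X : Ob ==> D X = A X // r X" and Dmap_eq: "X : Ob ==> Y : Ob ==> Dmap X Y f C = r Y `` (b X Y f `` C)"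
  and r_iff: "X : Ob ==> (x, y) : r X \<longleftrightarrow> x : A X \<and> y : A X \<and> G X (\<mu> X x) (\<mu> X y)"
  and \<mu>_V: "X : Ob ==> x : A X ==> \<mu> X x : V X"
  and s_A: "X : Ob ==> J : E X ==> s X J : A X" and s_M: "X : Ob ==> J : E X ==> G X (\<mu> X (s X J)) (M X J)"
  and s_surj: "X : Ob ==> x : A X ==> \<exists>J\<in>E X. G X (M X J) (\<mu> X x)"
  and b_R: "X : Ob ==> Y : Ob ==> f : Hom X Y ==> x : A X ==> (x, y) : b X Y f ==>
   y : A Y \<and> R X Y f (\<mu> X x) (\<mu> Y y)"
  and b_s: "X : Ob ==> Y : Ob ==> f : Hom X Y ==> J : E X ==> \<exists>y. (s X J, y) : b X Y f"
begin

definition cl :: "'o => 'e => 'd set" where "cl X J = r X `` {s X J}"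

lemma mem_cl:
 assumes X: "X : Ob" and J: "J : E X"
 shows "x : cl X J \<longleftrightarrow> x : A X \<and> G X (M X J) (\<mu> X x)"
proof -
 note v = \<mu>_V[OF X s_A[OF X J]] M_V[OF X J]
 note s = s_M[OF X J] G_sym[OF X v s_M[OF X J]]
 show ?thesis
  unfolding cl_def Image_singleton_iff r_iff[OF X]
  using s_A[OF X J] G_trans[OF X v(2,1) \<mu>_V[OF X] s(2)] G_trans[OF X v \<mu>_V[OF X] s(1)] by blast
qed

lemma cl_eq_iff:
 assumes X: "X : Ob" and J: "J : E X" "J' : E X"
 shows "cl X J = cl X J' \<longleftrightarrow> G X (M X J) (M X J')"
proof
 note v = M_V[OF X J(1)] M_V[OF X J(2)]
 assume "cl X J = cl X J'"
 then have "s X J' : cl X J"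
  using mem_cl[OF X J(2)] s_A[OF X J(2)] G_sym[OF X \<mu>_V[OF X s_A[OF X J(2)]] v(2) s_M[OF X J(2)]] by simp
 then have "G X (M X J) (\<mu> X (s X J'))" using mem_cl[OF X J(1)] by simp
 then show "G X (M X J) (M X J')" using G_trans[OF X v(1) \<mu>_V[OF X s_A[OF X J(2)]] v(2) _ s_M[OF X J(2)]] by simp
next
 note v = M_V[OF X J(1)] M_V[OF X J(2)]
 assume g: "G X (M X J) (M X J')"
 show "cl X J = cl X J'"
  using mem_cl[OF X J(1)] mem_cl[OF X J(2)] G_trans[OF X v \<mu>_V[OF X] g] G_trans[OF X v(2,1) \<mu>_V[OF X] G_sym[OF X v g]]
  by blast
qed

lemma D_cl: "X : Ob ==> D X = cl X ` E X"
proof -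
 assume X: "X : Ob"
 have "r X `` {x} : cl X ` E X" if x: "x : A X" for x
 proof -
  obtain J where J: "J : E X" "G X (M X J) (\<mu> X x)" using s_surj[OF X x] by blast
  note v = M_V[OF X J(1)] \<mu>_V[OF X x]
  have "r X `` {x} = cl X J"
   using mem_cl[OF X J(1)] r_iff[OF X] x G_trans[OF X v \<mu>_V[OF X] J(2)]
    G_trans[OF X v(2,1) \<mu>_V[OF X] G_sym[OF X v J(2)]] by blast
  then show ?thesis using J(1) by blast
 qed
 then show "D X = cl X ` E X"
  unfolding D_eq[OF X] quotient_def cl_def using s_A[OF X] by blast
qed

lemma Dmap_cl:
 assumes X: "X : Ob" "Y : Ob" and f: "f : Hom X Y" and J: "J : E X"
 shows "Dmap X Y f (cl X J) = cl Y (e X Y f J)"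
proof -
 let ?J = "e X Y f J"
 note J' = e_closed[OF X f J]
 have *: "y : A Y \<and> G Y (M Y ?J) (\<mu> Y y)" if "x : cl X J" "(x, y) : b X Y f" for x y
 proof -
  have x: "x : A X" "G X (M X J) (\<mu> X x)" using mem_cl[OF X(1) J] that by simp_all
  have y: "y : A Y" "R X Y f (\<mu> X x) (\<mu> Y y)" using b_R[OF X f x(1) that(2)] by simp_all
  show ?thesis
   using y(1) R_G[OF X f M_V[OF X(1) J] \<mu>_V[OF X(1) x(1)] M_V[OF X(2) J'] \<mu>_V[OF X(2) y(1)] R_M[OF X f J] y(2) x(2)] by simp
 qed
 obtain y where y: "(s X J, y) : b X Y f" using b_s[OF X f J] by blast
 have sJ: "s X J : cl X J"
  using mem_cl[OF X(1) J] s_A[OF X(1) J]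
   G_sym[OF X(1) \<mu>_V[OF X(1) s_A[OF X(1) J]] M_V[OF X(1) J] s_M[OF X(1) J]] by simp
 have eq: "r Y `` {z} = cl Y ?J" if z: "z : A Y \<and> G Y (M Y ?J) (\<mu> Y z)" for z
 proof -
  note v = M_V[OF X(2) J'] \<mu>_V[OF X(2) conjunct1[OF z]]
  show ?thesis
   using mem_cl[OF X(2) J'] r_iff[OF X(2)] z G_trans[OF X(2) v \<mu>_V[OF X(2)] conjunct2[OF z]]
    G_trans[OF X(2) v(2,1) \<mu>_V[OF X(2)] G_sym[OF X(2) v conjunct2[OF z]]] by blast
 qed
 have "r Y `` (b X Y f `` cl X J) = (\<Union>z\<in>b X Y f `` cl X J. r Y `` {z})" by blast
 also have "\<dots> = cl Y ?J"
  by (rule UN_constant_eq[of y]) (use y sJ * eq in blast)+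
 finally show ?thesis unfolding Dmap_eq[OF X] .
qed

lemma set_functor: "set_functor Ob Hom D Dmap"
 unfolding set_functor_def
proof (intro conjI ballI)
 show "Dmap X Y f : D X \<rightarrow> D Y" if X: "X : Ob" "Y : Ob" and f: "f : Hom X Y" for X Y f
  using D_cl[OF X(1)] D_cl[OF X(2)] Dmap_cl[OF X f] e_closed[OF X f] by auto
 show "Dmap X X id C = C" if X: "X : Ob" and C: "C : D X" for X C
 proof -
  obtain J where J: "J : E X" "C = cl X J" using C unfolding D_cl[OF X] by blast
  show ?thesis unfolding J(2) Dmap_cl[OF X X id_Hom[OF X] J(1)] e_id[OF X J(1)] ..
 qed
 show "Dmap X Z (g \<circ> f) C = Dmap Y Z g (Dmap X Y f C)"
  if X: "X : Ob" "Y : Ob" "Z : Ob" and f: "f : Hom X Y" "g : Hom Y Z" and C: "C : D X" for X Y Z f g C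
 proof -
  obtain J where J: "J : E X" "C = cl X J" using C unfolding D_cl[OF X(1)] by blast
  show ?thesis
   unfolding J(2) Dmap_cl[OF X(1,3) comp_Hom[OF X f] J(1)] Dmap_cl[OF X(1,2) f(1) J(1)]
    Dmap_cl[OF X(2,3) f(2) e_closed[OF X(1,2) f(1) J(1)]] e_comp[OF X f J(1)] ..
 qed
qed

end

text \<open>Both functors are quotients of \<open>E\<close> by the same relation.\<close>

lemma isomorphic_if_presented:
 assumes 1: "presented_functor Ob Hom E e M V G R A r b \<mu> s D Dmap"
  and 2: "presented_functor Ob Hom E e M V G R A' r' b' \<mu>' s' D' Dmap'"
 shows "isomorphic_functors Ob Hom D Dmap D' Dmap'"
proof -
 interpret F: presented_functor Ob Hom E e M V G R A r b \<mu> s D Dmap by (rule 1)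
 interpret F': presented_functor Ob Hom E e M V G R A' r' b' \<mu>' s' D' Dmap' by (rule 2)
 define \<eta> where "\<eta> X C = F'.cl X (SOME J. J : E X \<and> F.cl X J = C)" for X C
 have \<eta>: "\<eta> X (F.cl X J) = F'.cl X J" if X: "X : Ob" and J: "J : E X" for X J
 proof -
  define J' where "J' = (SOME J'. J' : E X \<and> F.cl X J' = F.cl X J)"
  have "J' : E X \<and> F.cl X J' = F.cl X J" unfolding J'_def by (rule someI[of _ J]) (simp add: J)
  then show ?thesis
   using F.cl_eq_iff[OF X _ J] F'.cl_eq_iff[OF X _ J] unfolding \<eta>_def J'_def[symmetric] by blast
 qed
 have "natural_iso Ob Hom D Dmap D' Dmap' \<eta>"
  unfolding natural_iso_def
 proof (intro conjI ballI)
  fix X assume X: "X : Ob"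
  show "bij_betw (\<eta> X) (D X) (D' X)"
   unfolding bij_betw_def F.D_cl[OF X] F'.D_cl[OF X]
  proof
   show "inj_on (\<eta> X) (F.cl X ` E X)"
   proof (rule inj_onI)
    fix C C' assume C: "C : F.cl X ` E X" "C' : F.cl X ` E X" and eq: "\<eta> X C = \<eta> X C'"
    obtain J where J: "J : E X" "C = F.cl X J" using C(1) by blast
    obtain J' where J': "J' : E X" "C' = F.cl X J'" using C(2) by blast
    show "C = C'"
     using eq unfolding J(2) J'(2) \<eta>[OF X J(1)] \<eta>[OF X J'(1)] F.cl_eq_iff[OF X J(1) J'(1)] F'.cl_eq_iff[OF X J(1) J'(1)] .
   qed
   show "\<eta> X ` (F.cl X ` E X) = F'.cl X ` E X"
    using \<eta>[OF X] by (auto simp: image_image)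
  qed
  fix Y f C assume Y: "Y : Ob" and f: "f : Hom X Y" and C: "C : D X"
  obtain J where J: "J : E X" "C = F.cl X J" using C unfolding F.D_cl[OF X] by blast
  show "\<eta> Y (Dmap X Y f C) = Dmap' X Y f (\<eta> X C)"
   unfolding J(2) F.Dmap_cl[OF X Y f J(1)] \<eta>[OF X J(1)] F'.Dmap_cl[OF X Y f J(1)]
   by (rule \<eta>[OF Y F.e_closed[OF X Y f J(1)]])
 qed
 then show ?thesis unfolding isomorphic_functors_def using F.set_functor F'.set_functor by blast
qed

section \<open>The three deformation functors\<close>

lemma (in coeff_point) rule_of_inj:
 assumes J: "good J" "good J'" and eq: "rule_of J = rule_of J'"
 shows "J = J'"
proof (rule complement_eqI[OF goodD(1)[OF J(1)] goodD(1)[OF J(2)]])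
 fix p assume "p : paths Q"
 then have p: "path_elem B p : carrier P" by simp
 show "proj J (path_elem B p) = proj J' (path_elem B p)"
  using rule_of(2)[OF J(1) p] rule_of(2)[OF J(2) p] eq by simp
qed

context diamond
begin

lemma point: "X : coeff_algebras K ==> coeff_point K Q I S \<phi> (fst X) (snd X)"
 by (intro coeff_point.intro diamond_axioms coeff_point_axioms.intro) simp

lemma coeff_map: "X : coeff_algebras K ==> Y : coeff_algebras K ==> f : coeff_homs K X Y ==>
  coeff_map K Q I S \<phi> (fst X) (snd X) (fst Y) (snd Y) f"
 by (intro coeff_map.intro point coeff_map_axioms.intro) simp_all

definition complements :: "('k, 'b) coeff => (('v, 'a) path => 'b) set set" where
 "complements X = {J. coeff_point.good K Q I S (fst X) (snd X) J}"

definition base_change where "base_change X Y f J = base_change_ideal (fst Y) (snd Y) Q f J"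

definition product_of where "product_of X = quiver_tips.nprod (fst X) (snd X) Q S"

definition products where "products X = {\<mu>. quiver_tips.bilin (fst X) (snd X) Q S \<mu>}"

definition gauge_eq where "gauge_eq X = quiver_tips.gauge (fst X) (snd X) Q S"

text \<open>The product \<open>\<mu>'\<close> extends \<open>\<mu>\<close> along \<open>f\<close>.\<close>

definition compatible where "compatible X Y f \<mu> \<mu>' \<longleftrightarrow> (\<forall>u\<in>fspan (fst X) (snd X) Q (Irr Q S) 0.
  \<forall>v\<in>fspan (fst X) (snd X) Q (Irr Q S) 0. f \<circ> \<mu> u v = \<mu>' (f \<circ> u) (f \<circ> v))"

lemma gauge_problem: "gauge_problem (coeff_algebras K :: ('k, 'b) coeff set) (coeff_homs K) complements base_change
  product_of products gauge_eq compatible"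
proof
 fix X Y Z :: "('k, 'b) coeff" and f g
 assume X: "X : coeff_algebras K"
 interpret X: coeff_point K Q I S \<phi> "fst X" "snd X" by (rule point[OF X])
 show id: "id : coeff_homs K X X"
  by (cases X) (simp add: coeff_homs_def ring_hom_def)
 show "product_of X J : products X" if "J : complements X" for J
  using that X.bilin_nprod[OF X.goodD(1)] by (simp add: complements_def product_of_def products_def)
 show "gauge_eq X a a" if "a : products X" for a
  unfolding gauge_eq_def by (rule X.gauge_cong) (rule refl)
 show "gauge_eq X b a" if "a : products X" "b : products X" "gauge_eq X a b" for a b
  using that X.gauge_sym unfolding gauge_eq_def products_def by simp
 show "gauge_eq X a c"
  if "a : products X" "b : products X" "c : products X" "gauge_eq X a b" "gauge_eq X b c" for a b c
  using that X.gauge_trans unfolding gauge_eq_def by simp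
 show "base_change X X id J = J" if J: "J : complements X" for J
 proof -
  interpret F: coeff_map K Q I S \<phi> "fst X" "snd X" "fst X" "snd X" id by (rule coeff_map[OF X X id])
  have J': "X.good J" using J by (simp add: complements_def)
  note c = X.goodD(1)[OF J'] X.goodD(1)[OF F.good_base_change[OF J']]
  show ?thesis
   unfolding base_change_def
  proof (rule X.complement_eqI[OF c(2,1)])
   fix p assume "p : paths Q"
   then have p: "path_elem (fst X) p : carrier X.P" by simp
   show "X.proj (F.bci J) (path_elem (fst X) p) = X.proj J (path_elem (fst X) p)"
    using F.bc.base_change_complement(2)[OF c(1) p] by simp
  qed
 qed
 assume Y: "Y : coeff_algebras K"
 show "base_change X Y f J : complements Y" if f: "f : coeff_homs K X Y" and J: "J : complements X" for f J
 proof -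
  interpret F: coeff_map K Q I S \<phi> "fst X" "snd X" "fst Y" "snd Y" f by (rule coeff_map[OF X Y f])
  show ?thesis using J F.good_base_change by (simp add: complements_def base_change_def)
 qed
 show "compatible X Y f (product_of X J) (product_of Y (base_change X Y f J))"
  if f: "f : coeff_homs K X Y" and J: "J : complements X" for f J
 proof -
  interpret F: coeff_map K Q I S \<phi> "fst X" "snd X" "fst Y" "snd Y" f by (rule coeff_map[OF X Y f])
  have J': "X.good J" using J by (simp add: complements_def)
  show ?thesis unfolding compatible_def product_of_def base_change_def
   by (intro ballI F.nprod_base_change[OF J'])
 qed
 show "gauge_eq Y a' b'"
  if f: "f : coeff_homs K X Y" and p: "a : products X" "b : products X" "a' : products Y" "b' : products Y"
   and c: "compatible X Y f a a'" "compatible X Y f b b'" and g: "gauge_eq X a b" for f a b a' b'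
 proof -
  interpret F: coeff_map K Q I S \<phi> "fst X" "snd X" "fst Y" "snd Y" f by (rule coeff_map[OF X Y f])
  note p' = p[unfolded products_def mem_Collect_eq]
  note c' = c[unfolded compatible_def]
  show ?thesis
   unfolding gauge_eq_def
   by (rule F.bc.gauge_base_change[OF p' bspec[OF bspec[OF c'(1)]] bspec[OF bspec[OF c'(2)]] g[unfolded gauge_eq_def]])
 qed
 assume Z: "Z : coeff_algebras K" and f: "f : coeff_homs K X Y" and g: "g : coeff_homs K Y Z"
 interpret F: coeff_map K Q I S \<phi> "fst X" "snd X" "fst Y" "snd Y" f by (rule coeff_map[OF X Y f])
 interpret G: coeff_map K Q I S \<phi> "fst Y" "snd Y" "fst Z" "snd Z" g by (rule coeff_map[OF Y Z g])
 show gf: "g \<circ> f : coeff_homs K X Z"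
  using ring_hom_trans[OF F.f(1) G.f(1)] F.f G.f ring_hom_closed[OF F.f(1)]
  by (cases X; cases Y; cases Z) (auto simp: coeff_homs_def image_subset_iff)
 interpret H: coeff_map K Q I S \<phi> "fst X" "snd X" "fst Z" "snd Z" "g \<circ> f" by (rule coeff_map[OF X Z gf])
 show "base_change X Z (g \<circ> f) J = base_change Y Z g (base_change X Y f J)" if J: "J : complements X" for J
 proof -
  have J': "X.good J" using J by (simp add: complements_def)
  note JY = F.good_base_change[OF J']
  note c = X.goodD(1)[OF J'] F.Y.goodD(1)[OF JY] G.Y.goodD(1)[OF G.good_base_change[OF JY]]
   G.Y.goodD(1)[OF H.good_base_change[OF J']]
  show ?thesis
   unfolding base_change_def
  proof (rule G.Y.complement_eqI[OF c(4,3)])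
   fix p assume p: "p : paths Q"
   then have P: "path_elem (fst X) p : carrier X.P" "path_elem (fst Y) p : carrier F.Y.P" by simp_all
   have "G.Y.proj (H.bci J) (path_elem (fst Z) p) = (g \<circ> f) \<circ> X.proj J (path_elem (fst X) p)"
    using H.bc.base_change_complement(2)[OF c(1) P(1)] unfolding H.bc.f_path_elem .
   also have "\<dots> = g \<circ> F.Y.proj (F.bci J) (path_elem (fst Y) p)"
    using F.bc.base_change_complement(2)[OF c(1) P(1)] unfolding F.bc.f_path_elem by (simp add: comp_assoc)
   also have "\<dots> = G.Y.proj (G.bci (F.bci J)) (path_elem (fst Z) p)"
    using G.bc.base_change_complement(2)[OF c(2) P(2)] unfolding G.bc.f_path_elem by (rule sym)
   finally show "G.Y.proj (H.bci J) (path_elem (fst Z) p) = G.Y.proj (G.bci (F.bci J)) (path_elem (fst Z) p)" .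
  qed
 qed
qed

lemma alg_functor_presented:
 "presented_functor (coeff_algebras K :: ('k, 'b) coeff set) (coeff_homs K) complements base_change
  product_of products gauge_eq compatible (alg_deformations K Q I) (alg_equiv K Q I) (alg_base_change K Q I)
  (\<lambda>X. coeff_point.coord_product Q I S (fst X) (snd X)) (\<lambda>X. coeff_point.star_of Q I S (fst X) (snd X))
  (alg_functor K Q I) (alg_functor_map K Q I)"
proof (intro presented_functor.intro presented_functor_axioms.intro gauge_problem)
 fix X Y :: "('k, 'b) coeff" and C
 assume X: "X : coeff_algebras K"
 interpret X: coeff_point K Q I S \<phi> "fst X" "snd X" by (rule point[OF X])
 show "alg_functor K Q I X = alg_deformations K Q I X // alg_equiv K Q I X" by (rule alg_functor_def)
 show "(x, y) : alg_equiv K Q I X \<longleftrightarrow> x : alg_deformations K Q I X \<and> y : alg_deformations K Q I X \<and>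
   gauge_eq X (X.coord_product x) (X.coord_product y)" for x y
  using X.alg_equiv_eq by (simp add: gauge_eq_def)
 show "X.coord_product x : products X" if "x : alg_deformations K Q I X" for x
  using X.alg_deformation(2)[of x] that by (simp add: products_def)
 show "X.star_of J : alg_deformations K Q I X" if "J : complements X" for J
  using X.star_of(1)[of J] that by (simp add: complements_def)
 show "gauge_eq X (X.coord_product (X.star_of J)) (product_of X J)" if "J : complements X" for J
  unfolding gauge_eq_def product_of_def using X.star_of(3)[of J] that
  by (intro X.gauge_cong) (simp add: complements_def)
 show "\<exists>J\<in>complements X. gauge_eq X (product_of X J) (X.coord_product x)"
  if "x : alg_deformations K Q I X" for x
 proof -
  have x: "x : alg_deformations K Q I (fst X, snd X)" using that by simp
  show ?thesis
  proof (rule X.product_from_ideal[where \<mu> = "X.coord_product x"])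
   show "X.bilin (X.coord_product x)" by (rule X.alg_deformation(2)[OF x])
   show "X.coord_product x (X.coord_product x u v) w = X.coord_product x u (X.coord_product x v w)"
    if "u : X.N" "v : X.N" "w : X.N" for u v w by (rule X.alg_deformation(3)[OF x that])
   show "X.rs \<circ> X.coord_product x u v = k.proj I ((X.rs \<circ> u) \<otimes>\<^bsub>k.P\<^esub> (X.rs \<circ> v))"
    if "u : X.N" "v : X.N" for u v by (rule X.alg_deformation(4)[OF x that])
  next
   fix J assume "X.good J" "X.gauge (X.nprod J) (X.coord_product x)"
   then show ?thesis unfolding gauge_eq_def product_of_def complements_def by blast
  qed
 qed
 assume Y: "Y : coeff_algebras K"
 show "alg_functor_map K Q I X Y f C = alg_equiv K Q I Y `` (alg_base_change K Q I X Y f `` C)" for f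
  by (rule alg_functor_map_def)
 fix f assume f: "f : coeff_homs K X Y"
 interpret F: coeff_map K Q I S \<phi> "fst X" "snd X" "fst Y" "snd Y" f by (rule coeff_map[OF X Y f])
 show "y : alg_deformations K Q I Y \<and> compatible X Y f (X.coord_product x) (F.Y.coord_product y)"
  if "(x, y) : alg_base_change K Q I X Y f" for x y
 proof
  have xy: "(x, y) : alg_base_change K Q I (fst X, snd X) (fst Y, snd Y) f" using that by simp
  then show "y : alg_deformations K Q I Y" unfolding alg_base_change_def Let_def prod.case by simp
  show "compatible X Y f (X.coord_product x) (F.Y.coord_product y)"
   unfolding compatible_def by (intro ballI F.alg_base_change_product[OF xy])
 qed
 show "\<exists>y. (X.star_of J, y) : alg_base_change K Q I X Y f" if "J : complements X" for J
  using F.star_of_base_change[of J] that by (auto simp: complements_def)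
qed

text \<open>The ideal is unique (\<open>rule_of_inj\<close>), so the choice is harmless.\<close>

definition red_product where
 "red_product X \<psi> = product_of X (SOME J. J : complements X \<and> \<psi> = coeff_point.rule_of Q S \<phi> (fst X) (snd X) J)"

lemma red_functor_presented:
 "presented_functor (coeff_algebras K :: ('k, 'b) coeff set) (coeff_homs K) complements base_change
  product_of products gauge_eq compatible (red_deformations Q S \<phi>) (red_equiv K Q S \<phi>)
  (\<lambda>X Y f. {(\<psi>, \<psi>'). \<psi>' = restrict (\<lambda>s. f \<circ> \<psi> s) S}) red_product
  (\<lambda>X. coeff_point.rule_of Q S \<phi> (fst X) (snd X)) (red_functor K Q S \<phi>) (red_functor_map K Q S \<phi>)"
proof (intro presented_functor.intro presented_functor_axioms.intro gauge_problem)
 fix X Y :: "('k, 'b) coeff" and C :: "(('v, 'a) path => ('v, 'a) path => 'b) set"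
 assume X: "X : coeff_algebras K"
 interpret G: gauge_problem "coeff_algebras K :: ('k, 'b) coeff set" "coeff_homs K" complements base_change
  product_of products gauge_eq compatible by (rule gauge_problem)
 interpret X: coeff_point K Q I S \<phi> "fst X" "snd X" by (rule point[OF X])
 have prod: "red_product X (X.rule_of J) = product_of X J" if J: "J : complements X" for J
 proof -
  have "(SOME J'. J' : complements X \<and> X.rule_of J = X.rule_of J') = J"
   using J X.rule_of_inj by (intro some_equality) (auto simp: complements_def)
  then show ?thesis by (simp add: red_product_def)
 qed
 have rule: "X.rule_of J : red_deformations Q S \<phi> X" if "J : complements X" for J
  using X.rule_of(1)[of J] that by (simp add: complements_def)
 then show "X.rule_of J : red_deformations Q S \<phi> X" if "J : complements X" for J using that .
 have cases: "\<exists>J\<in>complements X. x = X.rule_of J" if "x : red_deformations Q S \<phi> X" for x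
 proof -
  have "x : red_deformations Q S \<phi> (fst X, snd X)" using that by simp
  then show ?thesis using X.red_deformation_cases[of x] unfolding complements_def by blast
 qed
 show "red_functor K Q S \<phi> X = red_deformations Q S \<phi> X // red_equiv K Q S \<phi> X" by (rule red_functor_def)
 show "(x, y) : red_equiv K Q S \<phi> X \<longleftrightarrow> x : red_deformations Q S \<phi> X \<and> y : red_deformations Q S \<phi> X \<and>
   gauge_eq X (red_product X x) (red_product X y)" for x y
 proof -
  have "x : red_deformations Q S \<phi> X \<and> y : red_deformations Q S \<phi> X" if "(x, y) : red_equiv K Q S \<phi> X"
   using that by (cases X) (simp add: red_equiv_def Let_def)
  moreover have "(x, y) : red_equiv K Q S \<phi> X \<longleftrightarrow> gauge_eq X (red_product X x) (red_product X y)"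
   if xy: "x : red_deformations Q S \<phi> X" "y : red_deformations Q S \<phi> X"
  proof -
   obtain J where J: "J : complements X" "x = X.rule_of J" using cases[OF xy(1)] by blast
   obtain J' where J': "J' : complements X" "y = X.rule_of J'" using cases[OF xy(2)] by blast
   have "X.good J" "X.good J'" using J J' by (simp_all add: complements_def)
   from X.red_equiv_iff_gauge[OF this] show ?thesis
    unfolding J(2) J'(2) prod[OF J(1)] prod[OF J'(1)] by (simp add: gauge_eq_def product_of_def)
  qed
  ultimately show ?thesis by blast
 qed
 show "red_product X x : products X" if "x : red_deformations Q S \<phi> X" for x
  using cases[OF that] prod G.M_V[OF X] by auto
 show "gauge_eq X (red_product X (X.rule_of J)) (product_of X J)" if "J : complements X" for J
  unfolding prod[OF that] by (rule G.G_refl[OF X G.M_V[OF X that]])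
 show "\<exists>J\<in>complements X. gauge_eq X (product_of X J) (red_product X x)"
  if x: "x : red_deformations Q S \<phi> X" for x
 proof -
  obtain J where J: "J : complements X" "x = X.rule_of J" using cases[OF x] by blast
  then show ?thesis using G.G_refl[OF X G.M_V[OF X J(1)]] prod[OF J(1)] by auto
 qed
 assume Y: "Y : coeff_algebras K"
 have "{(\<psi>, \<psi>'). \<psi>' = restrict (\<lambda>s. f \<circ> \<psi> s) S} `` C = (\<lambda>\<psi>. restrict (\<lambda>s. f \<circ> \<psi> s) S) ` C" for f :: "'b => 'b"
  by (auto simp: Image_def image_def)
 then show "red_functor_map K Q S \<phi> X Y f C =
   red_equiv K Q S \<phi> Y `` ({(\<psi>, \<psi>'). \<psi>' = restrict (\<lambda>s. f \<circ> \<psi> s) S} `` C)" for f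
  unfolding red_functor_map_def by simp
 fix f assume f: "f : coeff_homs K X Y"
 interpret F: coeff_map K Q I S \<phi> "fst X" "snd X" "fst Y" "snd Y" f by (rule coeff_map[OF X Y f])
 show "\<exists>y. (X.rule_of J, y) : {(\<psi>, \<psi>'). \<psi>' = restrict (\<lambda>s. f \<circ> \<psi> s) S}" for J by simp
 show "y : red_deformations Q S \<phi> Y \<and> compatible X Y f (red_product X x) (red_product Y y)"
  if x: "x : red_deformations Q S \<phi> X" and xy: "(x, y) : {(\<psi>, \<psi>'). \<psi>' = restrict (\<lambda>s. f \<circ> \<psi> s) S}" for x y
 proof -
  obtain J where J: "J : complements X" "x = X.rule_of J" using cases[OF x] by blast
  have good: "X.good J" using J(1) by (simp add: complements_def)
  have J': "base_change X Y f J : complements Y" by (rule G.e_closed[OF X Y f J(1)])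
  have y: "y = F.Y.rule_of (base_change X Y f J)"
   using xy F.rule_of_base_change[OF good] by (simp add: J(2) base_change_def)
  have "(SOME J'. J' : complements Y \<and> y = F.Y.rule_of J') = base_change X Y f J"
   using J' F.Y.rule_of_inj unfolding y by (intro some_equality) (auto simp: complements_def)
  then have "red_product Y y = product_of Y (base_change X Y f J)" by (simp add: red_product_def)
  moreover have "y : red_deformations Q S \<phi> Y"
   using F.Y.rule_of(1)[of "base_change X Y f J"] J' unfolding y by (simp add: complements_def)
  ultimately show ?thesis using G.R_M[OF X Y f J(1)] prod[OF J(1)] J(2) by simp
 qed
qed

lemma ideal_functor_presented:
 "presented_functor (coeff_algebras K :: ('k, 'b) coeff set) (coeff_homs K) complements base_change
  product_of products gauge_eq compatible (ideal_deformations K Q I) (ideal_equiv K Q I)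
  (\<lambda>X Y f. {(J, J'). J' = base_change X Y f J}) product_of (\<lambda>X J. J) (ideal_functor K Q I) (ideal_functor_map K Q I)"
proof (intro presented_functor.intro presented_functor_axioms.intro gauge_problem)
 interpret G: gauge_problem "coeff_algebras K :: ('k, 'b) coeff set" "coeff_homs K" complements base_change
  product_of products gauge_eq compatible by (rule gauge_problem)
 fix X Y :: "('k, 'b) coeff" and C
 assume X: "X : coeff_algebras K"
 interpret X: coeff_point K Q I S \<phi> "fst X" "snd X" by (rule point[OF X])
 have A: "ideal_deformations K Q I X = complements X"
  using X.ideal_deformations_eq by (simp add: complements_def)
 show "ideal_functor K Q I X = ideal_deformations K Q I X // ideal_equiv K Q I X" by (rule ideal_functor_def)
 show "(x, y) : ideal_equiv K Q I X \<longleftrightarrow> x : ideal_deformations K Q I X \<and> y : ideal_deformations K Q I X \<and>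
   gauge_eq X (product_of X x) (product_of X y)" for x y
  unfolding A using X.ideal_equiv_eq by (simp add: gauge_eq_def product_of_def complements_def)
 show "product_of X x : products X" if "x : ideal_deformations K Q I X" for x
  using that unfolding A by (rule G.M_V[OF X])
 show "J : ideal_deformations K Q I X" if "J : complements X" for J using that A by simp
 show "gauge_eq X (product_of X J) (product_of X J)" if "J : complements X" for J
  by (rule G.G_refl[OF X G.M_V[OF X that]])
 show "\<exists>J\<in>complements X. gauge_eq X (product_of X J) (product_of X x)"
  if "x : ideal_deformations K Q I X" for x
  using that G.G_refl[OF X G.M_V[OF X]] unfolding A by blast
 assume Y: "Y : coeff_algebras K"
 have "{(J, J'). J' = base_change X Y f J} `` C = base_change_ideal (fst Y) (snd Y) Q f ` C" for f :: "'b => 'b"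
  by (auto simp: Image_def image_def base_change_def)
 then show "ideal_functor_map K Q I X Y f C = ideal_equiv K Q I Y `` ({(J, J'). J' = base_change X Y f J} `` C)" for f
  unfolding ideal_functor_map_def by simp
 fix f assume f: "f : coeff_homs K X Y"
 interpret Y: coeff_point K Q I S \<phi> "fst Y" "snd Y" by (rule point[OF Y])
 show "y : ideal_deformations K Q I Y \<and> compatible X Y f (product_of X x) (product_of Y y)"
  if x: "x : ideal_deformations K Q I X" and xy: "(x, y) : {(J, J'). J' = base_change X Y f J}" for x y
  using x xy G.e_closed[OF X Y f] G.R_M[OF X Y f] Y.ideal_deformations_eq unfolding A by (simp add: complements_def)
 show "\<exists>y. (J, y) : {(J, J'). J' = base_change X Y f J}" for J by simp
qed

end

theorem theorem1p1:
  fixes K :: "'k ring" and Q :: "('v, 'a) pre_digraph"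
    and I :: "(('v, 'a) path \<Rightarrow> 'k) set"
    and S :: "('v, 'a) path set" and \<phi> :: "('v, 'a) path \<Rightarrow> ('v, 'a) path \<Rightarrow> 'k"
  assumes "field K" and "\<And>n::nat. n > 0 \<Longrightarrow> [n] \<cdot>\<^bsub>K\<^esub> \<one>\<^bsub>K\<^esub> \<noteq> \<zero>\<^bsub>K\<^esub>"
    and "fin_digraph Q"
    and "ideal I (path_algebra K Q)"
    and "reduction_system K Q S \<phi>" and "satisfies_diamond K Q S \<phi> I"
  shows "isomorphic_functors (coeff_algebras K :: ('k, 'b) coeff set) (coeff_homs K)
           (alg_functor K Q I) (alg_functor_map K Q I)
           (red_functor K Q S \<phi>) (red_functor_map K Q S \<phi>) \<and>
         isomorphic_functors (coeff_algebras K :: ('k, 'b) coeff set) (coeff_homs K)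
           (red_functor K Q S \<phi>) (red_functor_map K Q S \<phi>)
           (ideal_functor K Q I) (ideal_functor_map K Q I)"
proof -
  interpret diamond K Q I S \<phi> by (intro diamond.intro assms(1,3,4,5,6))
  show ?thesis
    by (intro conjI isomorphic_if_presented[OF alg_functor_presented red_functor_presented]
      isomorphic_if_presented[OF red_functor_presented ideal_functor_presented])
qed

end
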